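(* Let $k\ge1$ be an integer and $\rho,\varepsilon_0>0$. (i) There exist constants $C_1,C_2>0$, independent of the mesh (i.e. of the polygon $F$ and of its size), such that for every polygon $F$ satisfying the mesh regularity assumption (M) with parameter $\rho$, $$C_1\|\mathbf v_h\|_F^2\le h_F\sum_{e\subseteq\partial F}\|\mathbf v_h\cdot\mathbf n_e\|_e^2+h_F^2\|\mathrm{div}_F\mathbf v_h\|_F^2+\|\mathbf\Pi^{0,F}_{k+1}\mathbf v_h\|_F^2\le C_2\|\mathbf v_h\|_F^2\qquad\forall\mathbf v_h\in\mathbf V^f_k(F).$$ (ii) There exist constants $C_1,C_2>0$, independent of the mesh, such that for every polygon $F$ satisfying (M) with parameter $\rho$ and the uniform convexity condition (MC) with parameter $\varepsilon_0$, $$C_1\|\mathbf v_h\|_F^2\le h_F\sum_{e\subseteq\partial F}\|\mathbf v_h\cdot\mathbf n_e\|_e^2+h_F^2\|\mathrm{div}_F\mathbf v_h\|_F^2+\|\mathbf\Pi^f_S\mathbf v_h\|_F^2\le C_2\|\mathbf v_h\|_F^2\qquad\forall\mathbf v_h\in\mathbf{SV}^f_k(F).$$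
   Context: (M): $F\subset\mathbb R^2$ is a polygon with diameter $h_F$ and barycenter $\mathbf b_F$; $F$ is star-shaped with respect to a disk of radius $\ge\rho h_F$, and every edge $e$ has length $h_e\ge\rho h_F$. (MC): $F$ is convex and each internal angle $\theta$ of $F$ satisfies $\varepsilon_0\le\theta\le\pi-\varepsilon_0$. $\|\cdot\|_D$ is the $L^2(D)$ norm. $\mathbf n_e$ is the unit outer normal on $e$, $\mathbf n_{\partial F}|_e=\mathbf n_e$. $\mathrm{rot}_F\mathbf v=\partial_{x_1}v_2-\partial_{x_2}v_1$, $\mathrm{div}_F\mathbf v=\partial_{x_1}v_1+\partial_{x_2}v_2$, $\mathbf{curl}_F\phi=[\partial_{x_2}\phi,-\partial_{x_1}\phi]^T$; $\mathbf x_F:=\mathbf x-\mathbf b_F$ and $\mathbf x_F^\perp$ is its rotation by $\pi/2$. $\mathbb P_k(D)$: polynomials of degree at most $k$, $\mathbb P_{-\ell}(D)=\{0\}$ for $\ell\ge1$; $\mathbb P^0_{k}(F)$: those with zero average on either $F$ or $\partial F$. $\mathbf\Pi^{0,F}_{k+1}$ is the $\mathbf L^2(F)$-orthogonal projection onto $(\mathbb P_{k+1}(F))^2$. $\mathbf V^f_k(F)=\{\mathbf v_h\in\mathbf L^2(F):\mathrm{div}_F\mathbf v_h\in\mathbb P_{k-1}(F),\ \mathrm{rot}_F\mathbf v_h\in\mathbb P_k(F),\ \mathbf v_h\cdot\mathbf n_e\in\mathbb P_k(e)\ \forall e\subseteq\partial F\}$. $\eta_F$ is the minimum number of straight lines necessary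 to cover $\partial F$, and $\beta_F:=k+1-\eta_F$. The (well defined) projection $\mathbf\Pi^f_S:\mathbf V^f_k(F)\to(\mathbb P_k(F))^2$ is given by (a) $\int_{\partial F}[(\mathbf v_h-\mathbf\Pi^f_S\mathbf v_h)\cdot\mathbf n_{\partial F}][\mathbf{curl}_Fp_{k+1}\cdot\mathbf n_{\partial F}]=0$ for all $p_{k+1}\in\mathbb P_{k+1}(F)$; (b) $\int_{\partial F}(\mathbf v_h-\mathbf\Pi^f_S\mathbf v_h)\cdot\mathbf n_{\partial F}=0$; (c) $\int_F\mathrm{div}_F(\mathbf v_h-\mathbf\Pi^f_S\mathbf v_h)p^0_{k-1}=0$ for all $p^0_{k-1}\in\mathbb P^0_{k-1}(F)$ (only for $k>1$); (d) $\int_F(\mathbf v_h-\mathbf\Pi^f_S\mathbf v_h)\cdot\mathbf x_F^\perp p_{\beta_F}=0$ for all $p_{\beta_F}\in\mathbb P_{\beta_F}(F)$ (only for $\beta_F\ge0$). $\mathbf{SV}^f_k(F)=\{\mathbf v_h\in\mathbf V^f_k(F):\int_F(\mathbf v_h-\mathbf\Pi^f_S\mathbf v_h)\cdot\mathbf x_F^\perp p=0\ \forall p\in\mathbb P_{\beta_F|k}(F)\}$, where $\mathbb P_{\beta_F|k}(F)$ is a chosen space with $\mathbb P_k(F)=\mathbb P_{\beta_F}(F)\oplus\mathbb P_{\beta_F|k}(F)$. *)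

theory Defs
  imports "HOL-Analysis.Analysis"
begin

text \<open>
  A polygon is given by the cyclic list of its vertices, so that collinear consecutive edges
  (hanging nodes) are possible.  The polygonal domain itself is the open set enclosed by the
  boundary (Jordan domain).
\<close>

type_synonym plane = "real ^ 2"

definition vertex :: "plane list \<Rightarrow> nat \<Rightarrow> plane" where
  "vertex vs i = vs ! (i mod length vs)"

definition edge :: "plane list \<Rightarrow> nat \<Rightarrow> plane set" where
  "edge vs i = closed_segment (vertex vs i) (vertex vs (Suc i))"

definition boundary :: "plane list \<Rightarrow> plane set" where
  "boundary vs = (\<Union>i<length vs. edge vs i)"

definition domain :: "plane list \<Rightarrow> plane set" where
  "domain vs = inside (boundary vs)"

text \<open>Distinct edges meet exactly in their common end points, so the boundary is a simple
  closed curve.\<close>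

definition polygon :: "plane list \<Rightarrow> bool" where
  "polygon vs \<longleftrightarrow> 3 \<le> length vs \<and> distinct vs \<and>
     (\<forall>i<length vs. \<forall>j<length vs. i \<noteq> j \<longrightarrow>
        edge vs i \<inter> edge vs j =
        {vertex vs i, vertex vs (Suc i)} \<inter> {vertex vs j, vertex vs (Suc j)})"

definition edge_length :: "plane list \<Rightarrow> nat \<Rightarrow> real" where
  "edge_length vs i = dist (vertex vs i) (vertex vs (Suc i))"

definition edge_integral :: "plane list \<Rightarrow> nat \<Rightarrow> (plane \<Rightarrow> real) \<Rightarrow> real" where
  "edge_integral vs i f = edge_length vs i *
     (LINT t|lebesgue_on {0..1}. f (linepath (vertex vs i) (vertex vs (Suc i)) t))"

definition outer_normal :: "plane list \<Rightarrow> nat \<Rightarrow> plane" where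
  "outer_normal vs i = (THE n. norm n = 1 \<and> n \<bullet> (vertex vs (Suc i) - vertex vs i) = 0 \<and>
     (\<forall>x\<in>open_segment (vertex vs i) (vertex vs (Suc i)).
        \<forall>\<^sub>F t in at_right 0. x + t *\<^sub>R n \<notin> domain vs))"

definition barycenter :: "plane set \<Rightarrow> plane" where
  "barycenter F = (1 / measure lebesgue F) *\<^sub>R (LINT x|lebesgue_on F. x)"

definition star_shaped_wrt :: "plane set \<Rightarrow> plane set \<Rightarrow> bool" where
  "star_shaped_wrt F B \<longleftrightarrow> B \<subseteq> F \<and> (\<forall>y\<in>B. \<forall>x\<in>F. closed_segment y x \<subseteq> F)"

definition mesh_regular :: "real \<Rightarrow> plane list \<Rightarrow> bool" where
  "mesh_regular \<rho> vs \<longleftrightarrow> polygon vs \<and>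
     (\<exists>c r. r \<ge> \<rho> * diameter (domain vs) \<and> star_shaped_wrt (domain vs) (ball c r)) \<and>
     (\<forall>i<length vs. edge_length vs i \<ge> \<rho> * diameter (domain vs))"

text \<open>The angle in \<open>[0, \<pi>]\<close> spanned by the two edges at a vertex; for a convex polygon this
  is the internal angle (it is only used for convex polygons).\<close>

definition corner_angle :: "plane list \<Rightarrow> nat \<Rightarrow> real" where
  "corner_angle vs i =
     (let a = vertex vs i - vertex vs (Suc i); b = vertex vs (Suc (Suc i)) - vertex vs (Suc i)
      in arccos ((a \<bullet> b) / (norm a * norm b)))"

definition uniformly_convex :: "real \<Rightarrow> plane list \<Rightarrow> bool" where
  "uniformly_convex \<epsilon> vs \<longleftrightarrow> convex (domain vs) \<and>
     (\<forall>i<length vs. \<epsilon> \<le> corner_angle vs i \<and> corner_angle vs i \<le> pi - \<epsilon>)"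

definition is_line :: "plane set \<Rightarrow> bool" where
  "is_line L \<longleftrightarrow> affine L \<and> aff_dim L = 1"

definition eta :: "plane list \<Rightarrow> nat" where
  "eta vs = (LEAST n. \<exists>\<L>. finite \<L> \<and> card \<L> = n \<and> (\<forall>L\<in>\<L>. is_line L) \<and> boundary vs \<subseteq> \<Union>\<L>)"

definition beta :: "nat \<Rightarrow> plane list \<Rightarrow> int" where
  "beta k vs = int k + 1 - int (eta vs)"

text \<open>Polynomials are kept as functions on the whole plane.  The degree bound is an integer;
  for a negative bound the sum is empty and the space is \<open>{0}\<close>.\<close>

definition polys :: "int \<Rightarrow> (plane \<Rightarrow> real) set" where
  "polys k = {p. \<exists>c. p = (\<lambda>x. \<Sum>(i, j) | int i + int j \<le> k. c i j * (x $ 1) ^ i * (x $ 2) ^ j)}"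

lemma polys_negative: "k < 0 \<Longrightarrow> polys k = {\<lambda>x. 0}"
proof -
  assume "k < 0"
  then have "{(i, j). int i + int j \<le> k} = {}" by auto
  then show ?thesis by (simp add: polys_def)
qed

definition vec_polys :: "int \<Rightarrow> (plane \<Rightarrow> plane) set" where
  "vec_polys k = {q. \<forall>i. (\<lambda>x. q x $ i) \<in> polys k}"

definition partial :: "2 \<Rightarrow> (plane \<Rightarrow> real) \<Rightarrow> plane \<Rightarrow> real" where
  "partial i f x = frechet_derivative f (at x) (axis i 1)"

definition grad :: "(plane \<Rightarrow> real) \<Rightarrow> plane \<Rightarrow> plane" where
  "grad f x = vector [partial 1 f x, partial 2 f x]"

definition curl :: "(plane \<Rightarrow> real) \<Rightarrow> plane \<Rightarrow> plane" where
  "curl f x = vector [partial 2 f x, - partial 1 f x]"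

definition perp :: "plane \<Rightarrow> plane" where
  "perp x = vector [- (x $ 2), x $ 1]"

definition square_integrable :: "plane set \<Rightarrow> (plane \<Rightarrow> 'b::euclidean_space) \<Rightarrow> bool" where
  "square_integrable F v \<longleftrightarrow> v \<in> borel_measurable (lebesgue_on F) \<and>
     integrable (lebesgue_on F) (\<lambda>x. (norm (v x))\<^sup>2)"

definition L2_norm_on :: "plane set \<Rightarrow> (plane \<Rightarrow> 'b::euclidean_space) \<Rightarrow> real" where
  "L2_norm_on F v = sqrt (LINT x|lebesgue_on F. (norm (v x))\<^sup>2)"

definition square_integrable_edge :: "plane list \<Rightarrow> nat \<Rightarrow> (plane \<Rightarrow> real) \<Rightarrow> bool" where
  "square_integrable_edge vs i g \<longleftrightarrow>
     (let \<gamma> = linepath (vertex vs i) (vertex vs (Suc i))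
      in (\<lambda>t. g (\<gamma> t)) \<in> borel_measurable (lebesgue_on {0..1}) \<and>
         integrable (lebesgue_on {0..1}) (\<lambda>t. (g (\<gamma> t))\<^sup>2))"

definition L2_norm_edge :: "plane list \<Rightarrow> nat \<Rightarrow> (plane \<Rightarrow> real) \<Rightarrow> real" where
  "L2_norm_edge vs i g = sqrt (edge_integral vs i (\<lambda>x. (g x)\<^sup>2))"

text \<open>
  Divergence, rotation and normal trace of \<open>L\<^sup>2\<close> fields are understood in the weak sense, with
  continuously differentiable test functions (for \<open>L\<^sup>2\<close> data this is the same as testing with
  smooth ones, by mollification).  The square integrability requirements on the derivatives and
  traces are essential, since the Bochner integral of a non-integrable function is \<open>0\<close>.
\<close>

definition C1 :: "(plane \<Rightarrow> real) \<Rightarrow> bool" where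
  "C1 \<phi> \<longleftrightarrow> (\<forall>x. \<phi> differentiable (at x)) \<and> (\<forall>i. continuous_on UNIV (partial i \<phi>))"

definition C1_compact_support :: "plane set \<Rightarrow> (plane \<Rightarrow> real) \<Rightarrow> bool" where
  "C1_compact_support F \<phi> \<longleftrightarrow> C1 \<phi> \<and> (\<exists>K. compact K \<and> K \<subseteq> F \<and> (\<forall>x. x \<notin> K \<longrightarrow> \<phi> x = 0))"

definition has_weak_div :: "plane set \<Rightarrow> (plane \<Rightarrow> plane) \<Rightarrow> (plane \<Rightarrow> real) \<Rightarrow> bool" where
  "has_weak_div F v d \<longleftrightarrow> square_integrable F d \<and>
     (\<forall>\<phi>. C1_compact_support F \<phi> \<longrightarrow>
        (LINT x|lebesgue_on F. d x * \<phi> x) = - (LINT x|lebesgue_on F. v x \<bullet> grad \<phi> x))"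

definition has_weak_rot :: "plane set \<Rightarrow> (plane \<Rightarrow> plane) \<Rightarrow> (plane \<Rightarrow> real) \<Rightarrow> bool" where
  "has_weak_rot F v r \<longleftrightarrow> square_integrable F r \<and>
     (\<forall>\<phi>. C1_compact_support F \<phi> \<longrightarrow>
        (LINT x|lebesgue_on F. r x * \<phi> x) = (LINT x|lebesgue_on F. v x \<bullet> curl \<phi> x))"

text \<open>Unique up to null sets.\<close>

definition weak_div :: "plane set \<Rightarrow> (plane \<Rightarrow> plane) \<Rightarrow> plane \<Rightarrow> real" where
  "weak_div F v = (SOME d. has_weak_div F v d)"

text \<open>\<open>g i\<close> is \<open>v \<bullet> n\<close> (outer normal) on the \<open>i\<close>-th edge.  As usual for fields with square
  integrable divergence, the trace is defined by Green's formula.\<close>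

definition has_normal_trace ::
  "plane list \<Rightarrow> (plane \<Rightarrow> plane) \<Rightarrow> (nat \<Rightarrow> plane \<Rightarrow> real) \<Rightarrow> bool" where
  "has_normal_trace vs v g \<longleftrightarrow> (\<forall>i<length vs. square_integrable_edge vs i (g i)) \<and>
     (\<forall>\<phi>. C1 \<phi> \<longrightarrow>
        (LINT x|lebesgue_on (domain vs). v x \<bullet> grad \<phi> x) +
        (LINT x|lebesgue_on (domain vs). weak_div (domain vs) v x * \<phi> x) =
        (\<Sum>i<length vs. edge_integral vs i (\<lambda>x. g i x * \<phi> x)))"

definition normal_trace :: "plane list \<Rightarrow> (plane \<Rightarrow> plane) \<Rightarrow> nat \<Rightarrow> plane \<Rightarrow> real" where
  "normal_trace vs v = (SOME g. has_normal_trace vs v g)"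

definition face_space :: "nat \<Rightarrow> plane list \<Rightarrow> (plane \<Rightarrow> plane) set" where
  "face_space k vs = {v. square_integrable (domain vs) v \<and>
     (\<exists>d\<in>polys (int k - 1). has_weak_div (domain vs) v d) \<and>
     (\<exists>r\<in>polys (int k). has_weak_rot (domain vs) v r) \<and>
     (\<exists>g. has_normal_trace vs v g \<and> (\<forall>i<length vs. g i \<in> polys (int k)))}"

definition L2_projection :: "nat \<Rightarrow> plane set \<Rightarrow> (plane \<Rightarrow> plane) \<Rightarrow> plane \<Rightarrow> plane" where
  "L2_projection m F v = (THE q. q \<in> vec_polys (int m) \<and>
     (\<forall>p\<in>vec_polys (int m). (LINT x|lebesgue_on F. (v x - q x) \<bullet> p x) = 0))"

text \<open>The flag selects one of the two admissible normalisations: zero average on the boundary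
  (\<open>True\<close>) or on the domain (\<open>False\<close>).\<close>

definition zero_mean_polys :: "bool \<Rightarrow> plane list \<Rightarrow> int \<Rightarrow> (plane \<Rightarrow> real) set" where
  "zero_mean_polys bd vs m = {p \<in> polys m.
     if bd then (\<Sum>i<length vs. edge_integral vs i p) = 0
     else (LINT x|lebesgue_on (domain vs). p x) = 0}"

definition x_perp :: "plane list \<Rightarrow> plane \<Rightarrow> plane" where
  "x_perp vs x = perp (x - barycenter (domain vs))"

definition is_serendipity_projection ::
  "nat \<Rightarrow> bool \<Rightarrow> plane list \<Rightarrow> (plane \<Rightarrow> plane) \<Rightarrow> (plane \<Rightarrow> plane) \<Rightarrow> bool" where
  "is_serendipity_projection k bd vs v q \<longleftrightarrow>
     (let F = domain vs; w = (\<lambda>x. v x - q x) in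
      q \<in> vec_polys (int k) \<and>
      (\<forall>p\<in>polys (int k + 1).
         (\<Sum>i<length vs. edge_integral vs i
            (\<lambda>x. normal_trace vs w i x * (curl p x \<bullet> outer_normal vs i))) = 0) \<and>
      (\<Sum>i<length vs. edge_integral vs i (normal_trace vs w i)) = 0 \<and>
      (k > 1 \<longrightarrow> (\<forall>p\<in>zero_mean_polys bd vs (int k - 1).
         (LINT x|lebesgue_on F. weak_div F w x * p x) = 0)) \<and>
      (beta k vs \<ge> 0 \<longrightarrow> (\<forall>p\<in>polys (beta k vs).
         (LINT x|lebesgue_on F. (w x \<bullet> x_perp vs x) * p x) = 0)))"

definition serendipity_projection ::
  "nat \<Rightarrow> bool \<Rightarrow> plane list \<Rightarrow> (plane \<Rightarrow> plane) \<Rightarrow> plane \<Rightarrow> plane" where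
  "serendipity_projection k bd vs v = (THE q. is_serendipity_projection k bd vs v q)"

definition linear_complement ::
  "(plane \<Rightarrow> real) set \<Rightarrow> (plane \<Rightarrow> real) set \<Rightarrow> (plane \<Rightarrow> real) set \<Rightarrow> bool" where
  "linear_complement U A W \<longleftrightarrow> W \<subseteq> U \<and> (\<lambda>x. 0) \<in> W \<and>
     (\<forall>p\<in>W. \<forall>q\<in>W. (\<lambda>x. p x + q x) \<in> W) \<and> (\<forall>c. \<forall>p\<in>W. (\<lambda>x. c * p x) \<in> W) \<and>
     (\<forall>p\<in>U. \<exists>!(a, w). a \<in> A \<and> w \<in> W \<and> p = (\<lambda>x. a x + w x))"

definition serendipity_space ::
  "nat \<Rightarrow> bool \<Rightarrow> (plane \<Rightarrow> real) set \<Rightarrow> plane list \<Rightarrow> (plane \<Rightarrow> plane) set" where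
  "serendipity_space k bd W vs = {v \<in> face_space k vs.
     \<forall>p\<in>W. (LINT x|lebesgue_on (domain vs).
        ((v x - serendipity_projection k bd vs v x) \<bullet> x_perp vs x) * p x) = 0}"

definition boundary_div_terms :: "plane list \<Rightarrow> (plane \<Rightarrow> plane) \<Rightarrow> real" where
  "boundary_div_terms vs v =
     diameter (domain vs) * (\<Sum>i<length vs. (L2_norm_edge vs i (normal_trace vs v i))\<^sup>2) +
     (diameter (domain vs))\<^sup>2 * (L2_norm_on (domain vs) (weak_div (domain vs) v))\<^sup>2"

end

theory Submission
  imports Defs
begin

text \<open>
  A polygon that is star-shaped with respect to a disc is the almost disjoint union of the
  triangles spanned by the centre and its edges.  Integrating along rays from the centre gives the
  divergence theorem and a trace inequality, averaging over pairs of points gives a Poincare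
  inequality, and averaging \<open>w((1 - e) x + e y)\<close> over \<open>y\<close> in the disc smooths a field without
  leaving the polygon, so that weakly curl-free fields are limits of gradients.

  Lower bounds: if \<open>2 q + (x - b) \<bullet> grad q = rot v\<close> then \<open>w = v - q (x - b)^perp\<close> is curl-free, so \<open>v \<bullet> w\<close>
  is controlled by Green's formula through divergence and normal traces, and \<open>v \<bullet> q (x - b)^perp\<close> only
  sees the projection of \<open>v\<close>.  Upper bounds: inverse estimates, testing with bubble functions on
  the disc and, for the normal traces, on the cone over an edge.

  The serendipity projection of \<open>v\<close> is \<open>dt (x - b) + curl p\<close>, where the first summand matches the
  divergence.  In a uniformly convex polygon \<open>p\<close> is divided successively by the edge functions; the
  remainder is determined by boundary values, and the quotient by the moments against
  \<open>(x - b)^perp\<close>, which integration by parts turns into a weighted scalar product.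
\<close>

text \<open>The constants must not depend on the polygon, and no compactness over admissible shapes
  is used. Norm equivalences for polynomials are proved only on fixed reference sets, a disc and the
  middle half of the unit interval, and transported by scaling; the rest is explicit in
  \<open>\<rho>\<close>, \<open>\<sigma>\<close>, the degree and the bounded number of edges. Fields
  of the face space have only weak derivatives and traces, so a rotation-free field must be
  regularised up to the boundary; star-shapedness about a disc, not just a point, makes this
  possible. As \<open>weak_div\<close> and \<open>normal_trace\<close> are arbitrary choices, their
  uniqueness up to null sets precedes any estimate of them. The operator
  \<open>2 * q + (x - b) \<bullet> grad q\<close> plays two roles: it is the rotation of
  \<open>q\<close> times the rotated \<open>x - b\<close>, and the divergence of \<open>q\<close>
  times \<open>x - b\<close>. Its inverse is explicit, on monomials as well as along rays, and the
  second form bounds it in the sup norm. In the serendipity part convexity acts through heights over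
  the edge lines: they are positive inside, and the angle bounds keep them away from zero on the
  middle of every other edge, which makes division by them stable.\<close>

abbreviation leb :: "'a::euclidean_space set => 'a measure" where "leb \<equiv> lebesgue_on"
abbreviation cont :: "('a::topological_space => 'b::topological_space) => bool" where "cont \<equiv> continuous_on UNIV"

lemmas LINT_add = Bochner_Integration.integral_add
 and LINT_diff = Bochner_Integration.integral_diff
 and LINT_cong = Bochner_Integration.integral_cong
 and LINT_nonneg = Bochner_Integration.integral_nonneg
 and cont_borel = borel_measurable_continuous_onI

section \<open>Star-shaped polygons\<close>

lemma vertex_eq_iff:
 assumes "distinct vs" "vs \<noteq> []"
 shows "vertex vs i = vertex vs j \<longleftrightarrow> i mod length vs = j mod length vs"
 using assms by (simp add: vertex_def nth_eq_iff_index_eq)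

lemma vertex_mod [simp]: "vertex vs (i mod length vs) = vertex vs i" by (simp add: vertex_def)

lemma edge_mod [simp]: "edge vs (i mod length vs) = edge vs i" by (simp add: edge_def vertex_def mod_Suc_eq)

lemma polygon_edge_inter:
 assumes "polygon vs" "i < length vs" "j < length vs" "i \<noteq> j"
 shows "edge vs i \<inter> edge vs j =
 {vertex vs i, vertex vs (Suc i)} \<inter> {vertex vs j, vertex vs (Suc j)}"
 using assms by (simp add: polygon_def)

lemma vertex_Suc_neq:
 assumes "polygon vs"
 shows "vertex vs i \<noteq> vertex vs (Suc i)"
proof
 assume a: "vertex vs i = vertex vs (Suc i)"
 have n: "3 \<le> length vs" "distinct vs" using assms by (auto simp: polygon_def)
 then have "i mod length vs = Suc i mod length vs" using a vertex_eq_iff[of vs i "Suc i"] by force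
 then show False using n by (auto simp: mod_Suc split: if_splits)
qed

text \<open>The edges are joined one at a time: two edges share only end points, and as the vertices
  are distinct the next edge shares only its start with the chain. Stopping before the closing edge,
  \<open>m < length vs\<close>, keeps the chain an arc.\<close>

lemma chain_arc:
 assumes "polygon vs" "1 \<le> m" "m < length vs"
 shows "\<exists>g. arc g \<and> pathstart g = vertex vs 0 \<and> pathfinish g = vertex vs m \<and>
 path_image g = (\<Union>i<m. edge vs i)"
 using assms(2,3)
proof (induction m rule: dec_induct)
 case base
 show ?case using vertex_Suc_neq[OF assms(1), of 0] by (intro exI[of _ "linepath (vertex vs 0) (vertex vs (Suc 0))"])
  (auto simp: arc_linepath edge_def)
next
 case (step m)
 then obtain g where g: "arc g" "pathstart g = vertex vs 0" "pathfinish g = vertex vs m"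
  "path_image g = (\<Union>i<m. edge vs i)" by auto
 have n: "3 \<le> length vs" "distinct vs" "vs \<noteq> []" using assms by (auto simp: polygon_def)
 let ?l = "linepath (vertex vs m) (vertex vs (Suc m))"
 have "path_image g \<inter> path_image ?l \<subseteq> {pathstart ?l}"
 proof
  fix x assume "x \<in> path_image g \<inter> path_image ?l"
  then obtain i where i: "i < m" "x \<in> edge vs i \<inter> edge vs m" using g by (auto simp: edge_def)
  then have "x \<in> {vertex vs i, vertex vs (Suc i)} \<inter> {vertex vs m, vertex vs (Suc m)}"
   using polygon_edge_inter[OF assms(1), of i m] step by auto
  then show "x \<in> {pathstart ?l}" using n i step by (auto simp: vertex_eq_iff)
 qed
 then have "arc (g +++ ?l)" using g vertex_Suc_neq[OF assms(1), of m] by (intro arc_join) (auto simp: arc_linepath)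
 moreover have "path_image (g +++ ?l) = (\<Union>i<Suc m. edge vs i)" using g by (simp add: path_image_join lessThan_Suc edge_def Un_commute)
 ultimately show ?case using g by (intro exI[of _ "g +++ ?l"]) auto
qed

lemma boundary_simple_loop:
 assumes "polygon vs"
 shows "\<exists>g. simple_path g \<and> pathfinish g = pathstart g \<and> path_image g = boundary vs"
proof -
 define n where "n = length vs"
 have n: "3 \<le> n" "distinct vs" "vs \<noteq> []" using assms by (auto simp: polygon_def n_def)
 obtain g where g: "arc g" "pathstart g = vertex vs 0" "pathfinish g = vertex vs (n-1)"
  "path_image g = (\<Union>i<n-1. edge vs i)"
  using chain_arc[OF assms, of "n-1"] n(1) unfolding n_def by fastforce
 let ?l = "linepath (vertex vs (n-1)) (vertex vs (Suc (n-1)))"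
 have v0: "vertex vs (Suc (n-1)) = vertex vs 0" using n by (simp add: vertex_def n_def)
 have "path_image g \<inter> path_image ?l \<subseteq> {pathstart g, pathstart ?l}"
 proof
  fix x assume "x \<in> path_image g \<inter> path_image ?l"
  then obtain i where i: "i < n-1" "x \<in> edge vs i \<inter> edge vs (n-1)" using g by (auto simp: edge_def)
  then have "x \<in> {vertex vs i, vertex vs (Suc i)} \<inter> {vertex vs (n-1), vertex vs (Suc (n-1))}"
   using polygon_edge_inter[OF assms(1), of i "n-1"] n(1) unfolding n_def by fastforce
  then show "x \<in> {pathstart g, pathstart ?l}" using g v0 by auto
 qed
 then have "simple_path (g +++ ?l)" using g v0 vertex_Suc_neq[OF assms(1), of "n-1"] by (intro simple_path_join_loop) (auto simp: arc_linepath)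
 moreover have "path_image (g +++ ?l) = (\<Union>i<Suc (n-1). edge vs i)"
  using g by (simp add: path_image_join lessThan_Suc edge_def Un_commute del: Suc_pred)
 moreover have "Suc (n-1) = length vs" using n by (simp add: n_def)
 ultimately show ?thesis using g v0 by (intro exI[of _ "g +++ ?l"]) (auto simp: boundary_def)
qed

lemma boundary_homeomorphic_sphere:
 assumes "polygon vs"
 shows "boundary vs homeomorphic sphere (0::plane) 1"
proof -
 obtain g where "simple_path g" "pathfinish g = pathstart g" "path_image g = boundary vs" using boundary_simple_loop[OF assms] by blast
 then have "boundary vs homeomorphic sphere (0::complex) 1" using homeomorphic_simple_path_image_circle[of g 1 0] by simp
 moreover have "sphere (0::complex) 1 homeomorphic sphere (0::plane) 1" by (rule homeomorphic_spheres_gen) auto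
 ultimately show ?thesis by (rule homeomorphic_trans)
qed

lemma compact_boundary: "compact (boundary vs)" by (auto simp: boundary_def edge_def)

lemma open_domain: "open (domain vs)"
 unfolding domain_def by (rule open_inside) (simp add: compact_boundary compact_imp_closed)

lemma bounded_domain: "bounded (domain vs)"
 unfolding domain_def by (rule bounded_inside) (auto simp: compact_boundary compact_imp_bounded)

text \<open>A connected enclosed region is a whole component of the complement, and by the
  Jordan-Brouwer theorem every such component has the entire curve as its frontier. Connectedness
  will come from star-shapedness.\<close>

lemma frontier_domain:
 assumes "polygon vs" "connected (domain vs)" "domain vs \<noteq> {}"
 shows "frontier (domain vs) = boundary vs"
proof -
 let ?F = "domain vs" and ?G = "boundary vs"
 obtain x where x: "x \<in> ?F" using assms by blast
 then have nx: "x \<notin> ?G" by (auto simp: domain_def inside_def)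
 have "?F = connected_component_set (- ?G) x"
 proof
  have "?F \<subseteq> - ?G" by (auto simp: domain_def inside_def)
  then show "?F \<subseteq> connected_component_set (- ?G) x" using x assms by (simp add: connected_component_maximal)
  show "connected_component_set (- ?G) x \<subseteq> ?F" using x by (auto simp: domain_def intro: inside_same_component)
 qed
 then have "?F \<in> components (- ?G)" using nx by (auto simp: components_def)
 then show ?thesis by (rule Jordan_Brouwer_frontier[OF boundary_homeomorphic_sphere[OF assms(1)]]) simp
qed

text \<open>The planar cross product, that is the oriented area of the parallelogram spanned by
  \<open>a\<close> and \<open>b\<close>.\<close>

definition wedge :: "plane => plane => real" where
 "wedge a b = a $ 1 * b $ 2 - a $ 2 * b $ 1"

lemma plane_inner: "(a::plane) \<bullet> b = a $ 1 * b $ 1 + a $ 2 * b $ 2" by (simp add: inner_vec_def sum_2)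

lemma plane_norm_sq: "(norm (a::plane))^2 = (a $ 1)^2 + (a $ 2)^2"
 unfolding power2_norm_eq_inner plane_inner by (simp add: power2_eq_square)

lemma plane_eq_iff: "(a::plane) = b \<longleftrightarrow> a $ 1 = b $ 1 \<and> a $ 2 = b $ 2"
 by (simp add: vec_eq_iff forall_2)

lemma perp_nth [simp]: "perp a $ 1 = - a $ 2" "perp a $ 2 = a $ 1" by (simp_all add: perp_def)

lemma wedge_perp: "wedge a b = perp a \<bullet> b" by (simp add: wedge_def plane_inner)

lemma norm_perp [simp]: "norm (perp a) = norm a"
proof -
 have "(norm (perp a))^2 = (norm a)^2" by (simp add: plane_norm_sq)
 then show ?thesis by simp
qed

lemma abs_wedge_le: "\<bar>wedge a b\<bar> \<le> norm a * norm b"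
 using Cauchy_Schwarz_ineq2[of "perp a" b] by (simp add: wedge_perp)

lemma lagrange_plane: "(wedge a b)^2 + (a \<bullet> b)^2 = (norm a)^2 * (norm b)^2"
 unfolding plane_norm_sq by (simp add: wedge_def plane_inner power2_eq_square algebra_simps)

text \<open>Cramer's rule with the determinant cleared, so that no independence of \<open>a\<close>
  and \<open>b\<close> has to be assumed.\<close>

lemma wedge_decomp:
 "wedge a b *\<^sub>R x = wedge x b *\<^sub>R a + wedge a x *\<^sub>R b"
 by (simp add: wedge_def plane_eq_iff algebra_simps)

lemma wedge_linear [simp]:
 "wedge (a + a') b = wedge a b + wedge a' b" "wedge (a - a') b = wedge a b - wedge a' b"
 "wedge a (b + b') = wedge a b + wedge a b'" "wedge a (b - b') = wedge a b - wedge a b'"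
 "wedge (s *\<^sub>R a) b = s * wedge a b" "wedge a (s *\<^sub>R b) = s * wedge a b"
 "wedge a a = 0" "wedge (- a) b = - wedge a b" "wedge a (- b) = - wedge a b"
 "wedge 0 b = 0" "wedge a 0 = 0"
 by (simp_all add: wedge_def algebra_simps)

lemma wedge_swap: "wedge a b = - wedge b a" by (simp add: wedge_def)

abbreviation edge_pt :: "plane list => nat => real => plane" where
 "edge_pt vs i \<equiv> linepath (vertex vs i) (vertex vs (Suc i))"

lemma edge_pt_in_boundary:
 assumes "i < length vs" "0 \<le> t" "t \<le> 1" shows "edge_pt vs i t \<in> boundary vs"
 using assms by (auto simp: boundary_def edge_def simp flip: linepath_image_01 intro!: bexI[of _ i])

lemma boundary_cases:
 assumes "x \<in> boundary vs"
 obtains i t where "i < length vs" "0 \<le> t" "t \<le> 1" "x = edge_pt vs i t"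
 using assms by (auto simp: boundary_def edge_def simp flip: linepath_image_01)

section \<open>Cones from the centre of the disc over the edges\<close>

locale star_polygon =
 fixes vs :: "plane list" and c :: plane and r :: real
 assumes poly: "polygon vs" and r_pos: "r > 0"
 and star: "star_shaped_wrt (domain vs) (ball c r)"
begin

abbreviation "F \<equiv> domain vs"
abbreviation "n \<equiv> length vs"
abbreviation "vx \<equiv> vertex vs"
abbreviation "edp i \<equiv> edge_pt vs i"
abbreviation "len \<equiv> edge_length vs"
abbreviation "EI \<equiv> edge_integral vs"

lemma n_ge3: "3 \<le> n" and distinct_vs: "distinct vs" and vs_ne: "vs \<noteq> []"
 using poly by (auto simp: polygon_def)

lemma ball_sub: "ball c r \<subseteq> F"
 using star by (simp add: star_shaped_wrt_def)

lemma c_in: "c \<in> F" using ball_sub r_pos by auto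

lemma seg_sub: "y \<in> ball c r ==> x \<in> F ==> closed_segment y x \<subseteq> F"
 using star by (auto simp: star_shaped_wrt_def)

lemma connected_F: "connected F"
proof -
 have "starlike F" unfolding starlike_def using c_in seg_sub[of c] r_pos by (intro bexI[of _ c]) auto
 then show ?thesis by (rule starlike_imp_connected)
qed

lemma frontier_F: "frontier F = boundary vs"
 using frontier_domain[OF poly connected_F] c_in by auto

lemma closure_F: "closure F = F \<union> boundary vs"
 using frontier_F closure_Un_frontier[of F] by simp

lemma disj_F: "F \<inter> boundary vs = {}"
 using frontier_F frontier_disjoint_eq[of F] open_domain[of vs] by auto

text \<open>The slack of the open disc absorbs the approximation: if \<open>x\<close> is replaced by
  a nearby \<open>x'\<close> in \<open>F\<close>, a small shift of \<open>y\<close> inside the disc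
  leaves the point at parameter \<open>s\<close> unchanged. At \<open>s = 0\<close> the point is
  \<open>x\<close> itself, which may lie on the boundary.\<close>

lemma seg_closure:
 assumes x: "x \<in> closure F" and y: "y \<in> ball c r" and s: "0 < s" "s \<le> 1"
 shows "(1 - s) *\<^sub>R x + s *\<^sub>R y \<in> F"
proof -
 obtain e where e: "e > 0" "ball y e \<subseteq> ball c r" using y open_ball openE by metis
 obtain x' where x': "x' \<in> F" "dist x' x < e * s" using x e s closure_approachable by (metis mult_pos_pos)
 define y' where "y' = y + ((1 - s) / s) *\<^sub>R (x - x')"
 have "norm (((1 - s) / s) *\<^sub>R (x - x')) = ((1 - s) / s) * norm (x - x')" using s by simp
 also have "\<dots> \<le> (1/s) * norm (x - x')" using s by (intro mult_right_mono) (auto simp: divide_right_mono)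
 also have "\<dots> < e" using x' s by (simp add: dist_norm norm_minus_commute field_simps)
 finally have "y' \<in> ball y e" by (simp add: y'_def dist_norm)
 then have y': "y' \<in> ball c r" using e by auto
 have "(1 - s) *\<^sub>R x + s *\<^sub>R y = (1 - s) *\<^sub>R x' + s *\<^sub>R y'"
  using s by (simp add: y'_def scaleR_add_right) (simp add: algebra_simps)
 also have "\<dots> \<in> closed_segment y' x'" using s unfolding closed_segment_def by (auto intro!: exI[of _ "1 - s"])
 finally show ?thesis using seg_sub[OF y' x'(1)] by auto
qed

lemma ray_in:
 assumes "x \<in> closure F" "0 \<le> s" "s < 1"
 shows "c + s *\<^sub>R (x - c) \<in> F"
 using seg_closure[OF assms(1), of c "1 - s"] assms(2,3) r_pos by (simp add: algebra_simps)

text \<open>Of two boundary points on one ray from \<open>c\<close>, the nearer one would be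
  interior by \<open>ray_in\<close>.\<close>

lemma ray_unique:
 assumes "x \<in> boundary vs" "y \<in> boundary vs" "y - c = s *\<^sub>R (x - c)" "s > 0"
 shows "s = 1"
proof (rule ccontr)
 assume "s \<noteq> 1"
 have cl: "x \<in> closure F" "y \<in> closure F" using assms closure_F by auto
 from \<open>s \<noteq> 1\<close> consider "s < 1" | "s > 1" by linarith
 then show False
 proof cases
  case 1
  moreover have "y = c + s *\<^sub>R (x - c)" by (simp flip: assms(3))
  ultimately have "y \<in> F" using ray_in[OF cl(1), of s] assms by simp
  then show False using disj_F assms by auto
 next
  case 2
  then have "x = c + (1/s) *\<^sub>R (y - c)" using assms by simp
  moreover have "0 \<le> 1/s" "1/s < 1" using 2 by auto
  ultimately have "x \<in> F" using ray_in[OF cl(2), of "1/s"] by simp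
  then show False using disj_F assms by auto
 qed
qed

abbreviation va :: "nat => plane" where "va i \<equiv> vx i - c"
abbreviation vb :: "nat => plane" where "vb i \<equiv> vx (Suc i) - c"

text \<open>Twice the signed area of the triangle with apex \<open>c\<close> over edge
  \<open>i\<close>; the sign records the sense in which the edge is traversed as seen from
  \<open>c\<close>.\<close>

definition D :: "nat => real" where "D i = wedge (va i) (vb i)"

lemma edge_length_pos: "len i > 0"
 using vertex_Suc_neq[OF poly] by (simp add: edge_length_def)

lemma vertex_in_boundary: "vx i \<in> boundary vs"
proof -
 have "i mod n < n" using n_ge3 by (intro mod_less_divisor) linarith
 then show ?thesis using edge_pt_in_boundary[of "i mod n" vs 0] by (simp add: linepath_def)
qed

text \<open>If the line through an edge met the ball, the segment from the intersection point to the
  farther end point of the edge would pass through the other end point.\<close>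

lemma line_misses_ball:
 assumes y: "y \<in> ball c r"
 shows "y \<noteq> vx i + t *\<^sub>R (vx (Suc i) - vx i)"
proof
 assume eq: "y = vx i + t *\<^sub>R (vx (Suc i) - vx i)"
 let ?p = "vx i" and ?q = "vx (Suc i)"
 have yF: "y \<in> F" using y ball_sub by auto
 have P: "?p \<in> boundary vs" "?q \<in> boundary vs" by (auto intro: vertex_in_boundary)
 then have cl: "?p \<in> closure F" "?q \<in> closure F" using closure_F by auto
 consider "t < 0" | "t > 1" | "0 \<le> t \<and> t \<le> 1" by linarith
 then show False
 proof cases
  case 1
  define u where "u = 1/(1-t)"
  have ut: "u * t = u - 1" using 1 by (simp add: u_def field_simps)
  have "(1 - u) *\<^sub>R ?q + u *\<^sub>R y = u *\<^sub>R ?p + (u * t) *\<^sub>R (?q - ?p) + (1 - u) *\<^sub>R ?q"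
   unfolding eq by (simp add: algebra_simps)
  then have "?p = (1 - 1/(1-t)) *\<^sub>R ?q + (1/(1-t)) *\<^sub>R y" unfolding ut u_def[symmetric] by (simp add: algebra_simps)
  then have "?p \<in> F" using seg_closure[OF cl(2) y, of "1/(1-t)"] 1 by simp
  then show False using P disj_F by auto
 next
  case 2
  then have "?q = (1 - 1/t) *\<^sub>R ?p + (1/t) *\<^sub>R y" unfolding eq by (simp add: algebra_simps)
  then have "?q \<in> F" using seg_closure[OF cl(1) y, of "1/t"] 2 by simp
  then show False using P disj_F by auto
 next
  case 3
  have "y = edp (i mod n) t" unfolding eq by (simp add: linepath_def vertex_def mod_Suc_eq algebra_simps)
  then have "y \<in> boundary vs" using edge_pt_in_boundary[of "i mod n" vs t] 3 n_ge3 mod_less_divisor[of n i] by fastforce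
  then show False using yF disj_F by auto
 qed
qed

text \<open>\<open>\<bar>D i\<bar> / len i\<close> is the distance from \<open>c\<close> to the line
  through the edge, and that line avoids the disc.\<close>

lemma D_ge: "r * len i \<le> \<bar>D i\<bar>"
proof (rule ccontr)
 assume "\<not> ?thesis"
 then have lt: "\<bar>D i\<bar> < r * len i" by simp
 define e where "e = vx (Suc i) - vx i"
 have en: "norm e = len i" by (simp add: e_def edge_length_def dist_norm norm_minus_commute)
 have en0: "norm e > 0" using edge_length_pos en by simp
 \<comment> \<open>\<open>y\<close> is the foot of the perpendicular from \<open>c\<close> onto the
   line; there Lagrange's identity turns the area into a distance.\<close>
 define t where "t = - (va i \<bullet> e) / (norm e)^2"
 define y where "y = vx i + t *\<^sub>R e"
 have D: "D i = wedge (va i) e" by (simp add: D_def e_def wedge_def algebra_simps)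
 have "(y - c) \<bullet> e = 0" using en0 unfolding y_def t_def by (simp add: inner_add_left inner_diff_left power2_norm_eq_inner field_simps)
 moreover have "wedge (y - c) e = D i" unfolding D y_def by simp
 ultimately have "(D i)^2 = (norm (y - c))^2 * (norm e)^2" using lagrange_plane[of "y - c" e] by simp
 then have "\<bar>D i\<bar>^2 = (norm (y - c) * norm e)^2" by (simp add: power_mult_distrib)
 then have "\<bar>D i\<bar> = norm (y - c) * norm e" by (subst (asm) power2_eq_iff_nonneg) auto
 then have "norm (y - c) < r" using lt en en0 by simp
 then have "y \<in> ball c r" by (simp add: dist_norm norm_minus_commute)
 then show False using line_misses_ball[of y i t] by (simp add: y_def e_def)
qed

lemma D_nz: "D i \<noteq> 0"
proof -
 have "0 < r * len i" using r_pos edge_length_pos by simp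
 then show ?thesis using D_ge[of i] by linarith
qed

text \<open>Both points lie on one ray, so they coincide by \<open>ray_unique\<close>, and two edges
  have only end points in common. Only \<open>t\<close> has to be inner; \<open>t'\<close> may be an
  end point, so that the lemma applies to every boundary point.\<close>

lemma cones_disjoint:
 assumes "i < n" "j < n" "0 < t" "t < 1" "0 \<le> t'" "t' \<le> 1" "0 < s"
 and "edp j t' - c = s *\<^sub>R (edp i t - c)"
 shows "i = j"
proof (rule ccontr)
 assume ne: "i \<noteq> j"
 have "s = 1" using ray_unique[OF edge_pt_in_boundary[of i vs t] edge_pt_in_boundary[of j vs t'] assms(8,7)] assms by auto
 then have eq: "edp j t' = edp i t" using assms(8) by simp
 have "edp i t \<in> edge vs i" "edp j t' \<in> edge vs j" using assms by (auto simp: edge_def simp flip: linepath_image_01)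
 then have "edp i t \<in> {vx i, vx (Suc i)}" using polygon_edge_inter[OF poly assms(1,2) ne] eq by auto
 moreover have "edp i t - vx i = t *\<^sub>R (vx (Suc i) - vx i)"
  "vx (Suc i) - edp i t = (1 - t) *\<^sub>R (vx (Suc i) - vx i)"
  by (simp_all add: linepath_def algebra_simps)
 ultimately show False using assms(3,4) vertex_Suc_neq[OF poly, of i] by auto
qed

text \<open>The open triangle with apex \<open>c\<close> over edge \<open>i\<close>;
  \<open>s\<close> runs along the ray and \<open>t\<close> along the edge.\<close>

definition sector :: "nat => plane set" where
 "sector i = (\<lambda>(s, t). c + s *\<^sub>R (edp i t - c)) ` ({0<..<1} \<times> {0<..<1})"

lemma sector_sub: "i < n ==> sector i \<subseteq> F"
 using ray_in[of "edp i t" for t] edge_pt_in_boundary[of i vs] closure_F by (auto simp: sector_def)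

lemma sectors_disjoint:
 assumes "i < n" "j < n" "i \<noteq> j" shows "sector i \<inter> sector j = {}"
proof (rule ccontr)
 assume "sector i \<inter> sector j \<noteq> {}"
 then obtain s t s' t' where st: "0 < s" "s < 1" "0 < t" "t < 1" "0 < s'" "s' < 1" "0 < t'" "t' < 1"
  "c + s *\<^sub>R (edp i t - c) = c + s' *\<^sub>R (edp j t' - c)"
  by (auto simp: sector_def)
 then have "edp j t' - c = (s / s') *\<^sub>R (edp i t - c)" by (simp add: plane_eq_iff field_simps)
 then have "i = j" using cones_disjoint[of i j t t' "s/s'"] st assms by auto
 then show False using assms by simp
qed

text \<open>Each point is pushed along its ray from \<open>c\<close> until it leaves
  \<open>F\<close>. Rays through vertices make up the segments that the open sectors miss; these
  form a null set.\<close>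

lemma F_cover:
 "F \<subseteq> (\<Union>i<n. sector i) \<union> (\<Union>i<n. closed_segment c (vx i))"
proof
 fix x assume x: "x \<in> F"
 show "x \<in> (\<Union>i<n. sector i) \<union> (\<Union>i<n. closed_segment c (vx i))"
 proof (cases "x = c")
  case True
  moreover have "0 < n" using n_ge3 by linarith
  ultimately show ?thesis by blast
 next
  case False
  obtain d where d: "0 < d" "x + d *\<^sub>R (x - c) \<in> frontier F"
   using ray_to_frontier[OF bounded_domain, of x vs "x - c"] x False open_domain[of vs] by (metis interior_open right_minus_eq)
  then obtain i t where it: "i < n" "0 \<le> t" "t \<le> 1" "x + d *\<^sub>R (x - c) = edp i t" unfolding frontier_F by (meson boundary_cases)
  define s where "s = 1 / (1 + d)"
  have s: "0 < s" "s < 1" using d by (auto simp: s_def)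
  have xs: "x = c + s *\<^sub>R (edp i t - c)"
  proof -
   have "x + d *\<^sub>R (x - c) - c = (1 + d) *\<^sub>R (x - c)" by (simp add: algebra_simps)
   then show ?thesis using d by (simp add: s_def flip: it(4))
  qed
  consider "0 < t \<and> t < 1" | "t = 0" | "t = 1" using it by linarith
  then show ?thesis
  proof cases
   case 1
   then have "x \<in> sector i" using xs s by (auto simp: sector_def)
   then show ?thesis using it by auto
  next
   case 2
   then have "x \<in> closed_segment c (vx i)" using xs s unfolding closed_segment_def by (auto simp: linepath_def algebra_simps intro!: exI[of _ s])
   then show ?thesis using it by auto
  next
   case 3
   then have "x \<in> closed_segment c (vx (Suc i mod n))" using xs s unfolding closed_segment_def
    by (auto simp: linepath_def algebra_simps intro!: exI[of _ s])
   moreover have "Suc i mod n < n" using n_ge3 by (intro mod_less_divisor) linarith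
   ultimately show ?thesis by blast
  qed
 qed
qed

end

section \<open>Square-integrable functions and integration over sectors\<close>

text \<open>Stated for an arbitrary measure, so that one calculus serves the polygon, the parameter
  interval of an edge and \<open>lborel\<close> on the plane.\<close>

definition sqi :: "'a measure => ('a => 'b::euclidean_space) => bool" where
 "sqi M f \<longleftrightarrow> f \<in> borel_measurable M \<and> integrable M (\<lambda>x. (norm (f x))^2)"

definition nrm :: "'a measure => ('a => 'b::euclidean_space) => real" where
 "nrm M f = sqrt (LINT x|M. (norm (f x))^2)"

lemma square_integrable_sqi: "square_integrable S v \<longleftrightarrow> sqi (leb S) v"
 by (simp add: square_integrable_def sqi_def)

lemma L2_norm_on_nrm: "L2_norm_on S v = nrm (leb S) v" by (simp add: L2_norm_on_def nrm_def)

lemma sqi_meas: "sqi M f ==> f \<in> borel_measurable M"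
 and sqi_int: "sqi M f ==> integrable M (\<lambda>x. (norm (f x))^2)"
 by (simp_all add: sqi_def)

lemma nrm_nonneg [simp]: "0 \<le> nrm M f" by (simp add: nrm_def)

lemma nrm_sq: "(nrm M f)^2 = (LINT x|M. (norm (f x))^2)" by (simp add: nrm_def)

lemma sqi_inner:
 assumes "sqi M f" "sqi M g" shows "integrable M (\<lambda>x. f x \<bullet> g x)"
proof (rule Bochner_Integration.integrable_bound[OF Bochner_Integration.integrable_add[OF sqi_int[OF assms(1)] sqi_int[OF assms(2)]]])
 show "(\<lambda>x. f x \<bullet> g x) \<in> borel_measurable M" using assms by (intro borel_measurable_inner) (auto simp: sqi_def)
 have "\<bar>f x \<bullet> g x\<bar> \<le> (norm (f x))^2 + (norm (g x))^2" for x
 proof -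
  have "\<bar>f x \<bullet> g x\<bar> \<le> norm (f x) * norm (g x)" by (rule Cauchy_Schwarz_ineq2)
  moreover have "0 \<le> norm (f x) * norm (g x)" by simp
  moreover have "2 * (norm (f x) * norm (g x)) \<le> (norm (f x))^2 + (norm (g x))^2" using sum_squares_bound[of "norm (f x)" "norm (g x)"] by simp
  ultimately show ?thesis by linarith
 qed
 then show "AE x in M. norm (f x \<bullet> g x) \<le> norm ((norm (f x))^2 + (norm (g x))^2)" by simp
qed

lemma sqi_add:
 assumes "sqi M f" "sqi M g" shows "sqi M (\<lambda>x. f x + g x)"
proof -
 have "(\<lambda>x. (norm (f x + g x))^2) = (\<lambda>x. (norm (f x))^2 + (norm (g x))^2 + 2 * (f x \<bullet> g x))"
  by (simp add: fun_eq_iff power2_norm_eq_inner inner_add_left inner_add_right inner_commute)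
 then show ?thesis using assms sqi_inner[OF assms] by (auto simp: sqi_def)
qed

lemma sqi_uminus: "sqi M f ==> sqi M (\<lambda>x. - f x)" by (auto simp: sqi_def)

lemma sqi_diff: "sqi M f ==> sqi M g ==> sqi M (\<lambda>x. f x - g x)"
 using sqi_add[of M f "\<lambda>x. - g x"] sqi_uminus[of M g] by simp

lemma nrm_Cauchy_Schwarz:
 assumes f: "sqi M f" and g: "sqi M g"
 shows "\<bar>LINT x|M. f x \<bullet> g x\<bar> \<le> nrm M f * nrm M g"
proof -
 define A where "A = (LINT x|M. (norm (f x))^2)"
 define B where "B = (LINT x|M. f x \<bullet> g x)"
 define C where "C = (LINT x|M. (norm (g x))^2)"
 have AC: "0 \<le> A" "0 \<le> C" by (auto simp: A_def C_def)
 \<comment> \<open>The squared norm of \<open>s *\<^sub>R f + g\<close> is a quadratic in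
   \<open>s\<close> that is never negative.\<close>
 have q: "0 \<le> A * s^2 + 2 * B * s + C" for s
 proof -
  have "0 \<le> (LINT x|M. (norm (s *\<^sub>R f x + g x))^2)" by simp
  also have "\<dots> = (LINT x|M. s^2 * (norm (f x))^2 + 2 * s * (f x \<bullet> g x) + (norm (g x))^2)"
   unfolding power2_norm_eq_inner by (intro LINT_cong)
   (simp_all add: inner_add_left inner_add_right inner_commute power2_eq_square algebra_simps)
  also have "\<dots> = A * s^2 + 2 * B * s + C" using sqi_int[OF f] sqi_int[OF g] sqi_inner[OF f g] by (simp add: A_def B_def C_def)
  finally show ?thesis .
 qed
 have "B^2 \<le> A * C"
 proof (cases "A = 0")
  case True
  have "B = 0"
  proof (rule ccontr)
   assume "B \<noteq> 0"
   \<comment> \<open>At this \<open>s\<close> the now linear polynomial takes the value -1.\<close>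
   then show False using q[of "- (C + 1) / (2 * B)"] True AC by (simp add: field_simps)
  qed
  then show ?thesis using AC by simp
 next
  case False
  then have "0 < A" using AC by simp
  have "A * (- B / A)^2 + 2 * B * (- B / A) + C = C - B^2 / A" using False by (simp add: power2_eq_square field_simps)
  then have "B^2 / A \<le> C" using q[of "- B / A"] by simp
  then show ?thesis using \<open>0 < A\<close> by (simp add: field_simps)
 qed
 then have "\<bar>B\<bar> \<le> sqrt (A * C)" by (simp add: real_le_rsqrt)
 then show ?thesis by (simp add: A_def B_def C_def nrm_def real_sqrt_mult)
qed

lemma nrm_triangle:
 assumes f: "sqi M f" and g: "sqi M g"
 shows "nrm M (\<lambda>x. f x + g x) \<le> nrm M f + nrm M g"
proof (rule power2_le_imp_le)
 have "(nrm M (\<lambda>x. f x + g x))^2 = (LINT x|M. (norm (f x))^2 + 2 * (f x \<bullet> g x) + (norm (g x))^2)"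
  unfolding nrm_sq power2_norm_eq_inner by (intro LINT_cong)
  (simp_all add: inner_add_left inner_add_right inner_commute algebra_simps)
 also have "\<dots> = (nrm M f)^2 + 2 * (LINT x|M. f x \<bullet> g x) + (nrm M g)^2"
  using sqi_int[OF f] sqi_int[OF g] sqi_inner[OF f g] by (simp add: nrm_sq)
 also have "\<dots> \<le> (nrm M f)^2 + 2 * (nrm M f * nrm M g) + (nrm M g)^2" using nrm_Cauchy_Schwarz[OF f g] by simp
 finally show "(nrm M (\<lambda>x. f x + g x))^2 \<le> (nrm M f + nrm M g)^2" by (simp add: power2_sum)
qed simp

lemma nrm_scale: "nrm M (\<lambda>x. a *\<^sub>R f x) = \<bar>a\<bar> * nrm M f"
 by (simp add: nrm_def power_mult_distrib real_sqrt_mult)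

lemma nrm_uminus: "nrm M (\<lambda>x. - f x) = nrm M f" by (simp add: nrm_def)

lemma nrm_diff_triangle:
 assumes "sqi M f" "sqi M g"
 shows "nrm M (\<lambda>x. f x - g x) \<le> nrm M f + nrm M g"
 using nrm_triangle[OF assms(1) sqi_uminus[OF assms(2)]] by (simp add: nrm_uminus)

lemma nrm_zero_AE:
 assumes "sqi M f" "nrm M f = 0" shows "AE x in M. f x = 0"
 using assms integral_nonneg_eq_0_iff_AE[OF sqi_int[OF assms(1)]] by (simp add: nrm_def)

lemma nrm_cong_AE:
 assumes "f \<in> borel_measurable M" "g \<in> borel_measurable M" "AE x in M. f x = g x"
 shows "nrm M f = nrm M g"
proof -
 have "(LINT x|M. (norm (f x))^2) = (LINT x|M. (norm (g x))^2)" by (rule integral_cong_AE) (use assms in auto)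
 then show ?thesis by (simp add: nrm_def)
qed

lemma nrm_le_sup:
 assumes f: "f \<in> borel_measurable M" and M: "finite_measure M" and "0 \<le> C"
 and b: "\<And>x. x \<in> space M ==> norm (f x) \<le> C"
 shows "sqi M f" "(nrm M f)^2 \<le> C^2 * measure M (space M)"
proof -
 interpret finite_measure M by fact
 have b2: "(norm (f x))^2 \<le> C^2" if "x \<in> space M" for x using b[OF that] by (intro power_mono) auto
 have i: "integrable M (\<lambda>x. (norm (f x))^2)" using f b2 by (intro integrable_const_bound[of _ "C^2"]) (auto intro!: AE_I2)
 then show "sqi M f" using f by (simp add: sqi_def)
 have "(LINT x|M. (norm (f x))^2) \<le> (LINT x|M. C^2)" using i b2 by (intro integral_mono) auto
 then show "(nrm M f)^2 \<le> C^2 * measure M (space M)" unfolding nrm_sq by (simp add: mult.commute)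
qed

lemma open_lebesgue: "open S ==> S \<in> sets lebesgue" by (simp add: borel_open)

lemma finite_measure_lebesgue_on:
 assumes "open S \<or> closed S" "bounded (S :: 'a::euclidean_space set)"
 shows "finite_measure (leb S)"
proof (rule finite_measureI)
 have S: "S \<in> sets borel" using assms by auto
 have "emeasure (leb S) (space (leb S)) = emeasure lborel S" using S by (simp add: space_restrict_space emeasure_restrict_space)
 also have "\<dots> < \<infinity>" by (rule emeasure_bounded_finite) fact
 finally show "emeasure (leb S) (space (leb S)) \<noteq> \<infinity>" by simp
qed

lemma cont_measurable:
 fixes f :: "'a::euclidean_space => 'b::euclidean_space"
 assumes "cont f"
 shows "f \<in> borel_measurable (leb S)"
proof -
 have "f \<in> borel_measurable borel" using assms by (rule cont_borel)
 then have "f \<in> borel_measurable lebesgue" by (simp add: measurable_completion)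
 then show ?thesis by (rule measurable_restrict_space1)
qed

lemma continuous_bounded_on:
 fixes f :: "'a::euclidean_space => 'b::euclidean_space"
 assumes "cont f" "bounded S"
 obtains C where "C > 0" "\<And>x. x \<in> S ==> norm (f x) \<le> C"
proof -
 have "compact (closure S)" using assms(2) by simp
 then have "bounded (f ` closure S)" using assms(1) by (intro compact_imp_bounded compact_continuous_image) (auto intro: continuous_on_subset)
 then obtain C where "C > 0" "\<forall>y\<in>f ` closure S. norm y \<le> C" by (meson bounded_pos)
 then show ?thesis using that closure_subset by blast
qed

lemma continuous_integrable_on:
 fixes f :: "'a::euclidean_space => 'b::euclidean_space"
 assumes f: "cont f" and S: "open S \<or> closed S" "bounded S"
 shows "integrable (leb S) f"
proof -
 obtain C where C: "\<And>x. x \<in> S ==> norm (f x) \<le> C" using continuous_bounded_on[OF f S(2)] by metis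
 interpret finite_measure "leb S" by (rule finite_measure_lebesgue_on[OF S])
 show ?thesis by (rule integrable_const_bound[of _ C])
  (use C cont_measurable[OF f] in \<open>auto simp: space_restrict_space intro!: AE_I2\<close>)
qed

lemma continuous_sqi_on:
 fixes f :: "'a::euclidean_space => 'b::euclidean_space"
 assumes f: "cont f" and S: "open S \<or> closed S" "bounded S"
 shows "sqi (leb S) f"
 unfolding sqi_def by (intro conjI cont_measurable continuous_integrable_on f S continuous_intros)

lemma integral_lebesgue_on_borel:
 fixes f :: "'a::euclidean_space => 'b::euclidean_space"
 assumes "S \<in> sets borel" "f \<in> borel_measurable borel"
 shows "(LINT x|leb S. f x) = (LINT x|lborel. indicator S x *\<^sub>R f x)"
 using assms by (simp add: integral_restrict_space integral_completion)

lemma integrable_lebesgue_on_borel: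
 fixes f :: "'a::euclidean_space => 'b::euclidean_space"
 assumes "S \<in> sets borel" "f \<in> borel_measurable borel"
 shows "integrable (leb S) f \<longleftrightarrow> integrable lborel (\<lambda>x. indicator S x *\<^sub>R f x)"
 using assms by (simp add: integrable_restrict_space integrable_completion)

lemma LINT_mono_subset:
 fixes f g :: "'a::euclidean_space => real"
 assumes f: "cont f" and g: "cont g" and ST: "S \<subseteq> T"
 and S: "open S \<or> closed S" and T: "open T \<or> closed T" "bounded T"
 and gf: "\<And>x. x \<in> S ==> g x \<le> f x" and f0: "\<And>x. x \<in> T ==> 0 \<le> f x"
 shows "(LINT x|leb S. g x) \<le> (LINT x|leb T. f x)"
proof -
 have m: "f \<in> borel_measurable borel" "g \<in> borel_measurable borel" "S \<in> sets borel" "T \<in> sets borel"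
  using f g S T by (auto intro: cont_borel)
 have "integrable lborel (\<lambda>x. indicator S x *\<^sub>R g x)" "integrable lborel (\<lambda>x. indicator T x *\<^sub>R f x)"
  using continuous_integrable_on[OF g S bounded_subset[OF T(2) ST]] continuous_integrable_on[OF f T] m by (simp_all add: integrable_lebesgue_on_borel)
 then have "(LINT x|lborel. indicator S x *\<^sub>R g x) \<le> (LINT x|lborel. indicator T x *\<^sub>R f x)"
  using gf f0 ST by (intro integral_mono) (auto simp: indicator_def)
 then show ?thesis using m by (simp add: integral_lebesgue_on_borel)
qed

lemma LINT_01_eq_integral:
 fixes f :: "real => 'b::euclidean_space"
 assumes "continuous_on {a..b} f"
 shows "(LINT t|leb {a..b}. f t) = integral {a..b} f"
 by (intro lebesgue_integral_eq_integral continuous_imp_integrable_real assms) auto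

section \<open>Planar Lebesgue measure as a product, and integration over sectors\<close>

definition mk :: "real => real => plane" where "mk x y = vector [x, y]"

lemma mk_nth [simp]: "mk x y $ 1 = x" "mk x y $ 2 = y" by (simp_all add: mk_def)

lemma mk_eta [simp]: "mk (z $ 1) (z $ 2) = z" by (simp add: plane_eq_iff)

lemma mk_alt: "mk x y = x *\<^sub>R axis 1 1 + y *\<^sub>R axis 2 1" by (simp add: plane_eq_iff axis_def)

lemma axis_mk: "axis 1 1 = mk 1 0" "axis 2 1 = mk 0 1" by (simp_all add: plane_eq_iff axis_def)

lemma continuous_on_mk [continuous_intros]:
 "continuous_on S f ==> continuous_on S g ==> continuous_on S (\<lambda>x. mk (f x) (g x))"
 unfolding mk_alt by (intro continuous_intros)

lemma Basis_plane: "(Basis :: plane set) = {axis 1 1, axis 2 1}" by (auto simp: Basis_vec_def UNIV_2)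

lemma box_plane: "box (a::plane) b = {z. a $ 1 < z $ 1 \<and> z $ 1 < b $ 1 \<and> a $ 2 < z $ 2 \<and> z $ 2 < b $ 2}"
 by (auto simp: box_def Basis_plane inner_axis)

lemma measurable_mk: "(\<lambda>(x, y). mk x y) \<in> borel_measurable (lborel \<Otimes>\<^sub>M lborel)"
proof -
 have "(\<lambda>p::real \<times> real. mk (fst p) (snd p)) \<in> borel_measurable borel" by (intro cont_borel continuous_intros)
 then show ?thesis by (simp add: lborel_prod split_beta)
qed

text \<open>Measures that agree on boxes are equal. The identification brings Fubini's theorem to
  integrals over \<open>plane\<close>.\<close>

lemma lborel_plane: "(lborel :: plane measure) = distr (lborel \<Otimes>\<^sub>M lborel) borel (\<lambda>(x, y). mk x y)"
proof (rule lborel_eqI)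
 fix l u :: plane
 assume le: "\<And>b. b \<in> Basis ==> l \<bullet> b \<le> u \<bullet> b"
 have le': "l $ 1 \<le> u $ 1" "l $ 2 \<le> u $ 2" using le[of "axis 1 1"] le[of "axis 2 1"] by (simp_all add: Basis_plane inner_axis)
 have ne: "axis 1 (1::real) \<noteq> (axis 2 1 :: plane)" by (simp add: axis_eq_axis)
 have pre: "(\<lambda>(x, y). mk x y) -` box l u \<inter> space (lborel \<Otimes>\<^sub>M lborel) = {l$1<..<u$1} \<times> {l$2<..<u$2}"
  by (auto simp: box_plane space_pair_measure)
 have "emeasure (distr (lborel \<Otimes>\<^sub>M lborel) borel (\<lambda>(x, y). mk x y)) (box l u) =
  emeasure lborel {l$1<..<u$1} * emeasure lborel {l$2<..<u$2}"
  by (subst emeasure_distr) (simp_all add: measurable_mk pre lborel.emeasure_pair_measure_Times)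
 also have "\<dots> = (\<Prod>b\<in>Basis. (u - l) \<bullet> b)" using le' ne by (simp add: Basis_plane inner_axis ennreal_mult)
 finally show "emeasure (distr (lborel \<Otimes>\<^sub>M lborel) borel (\<lambda>(x, y). mk x y)) (box l u) =
  (\<Prod>b\<in>Basis. (u - l) \<bullet> b)" .
qed simp

text \<open>The square on the left is open, as the change of variables needs injectivity; the
  intervals on the right are closed, as in the edge integrals. The sides are null sets.\<close>

lemma integral_unit_square:
 fixes f :: "plane => real"
 assumes f: "cont f"
 shows "(LINT z|leb (box 0 (mk 1 1)). f z) =
 (LINT t|leb {0..1}. LINT s|leb {0..1}. f (mk s t))"
proof -
 let ?I = "\<lambda>x. indicat_real {0<..<1} x"
 have fb: "f \<in> borel_measurable borel" using f by (rule cont_borel)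
 have ind: "indicat_real (box 0 (mk 1 1)) (mk x y) = ?I x * ?I y" for x y by (auto simp: box_plane indicator_def)
 have "integrable (leb (box 0 (mk 1 1))) f" by (rule continuous_integrable_on[OF f]) auto
 then have i: "integrable lborel (\<lambda>z. indicator (box 0 (mk 1 1)) z *\<^sub>R f z)" using fb by (subst (asm) integrable_lebesgue_on_borel) auto
 have m: "(\<lambda>z. indicator (box 0 (mk 1 1)) z *\<^sub>R f z) \<in> borel_measurable borel" using fb by measurable
 have i2: "integrable (lborel \<Otimes>\<^sub>M lborel) (\<lambda>(x, y). ?I x * ?I y * f (mk x y))" using i unfolding lborel_plane
  by (subst (asm) integrable_distr_eq[OF measurable_mk m]) (simp add: ind split_beta')
 have "(LINT z|leb (box 0 (mk 1 1)). f z) = (LINT z|lborel. indicator (box 0 (mk 1 1)) z *\<^sub>R f z)"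
  using fb by (intro integral_lebesgue_on_borel) auto
 also have "\<dots> = integral\<^sup>L (lborel \<Otimes>\<^sub>M lborel) (\<lambda>(x,y). ?I x * ?I y * f (mk x y))" unfolding lborel_plane
  by (subst integral_distr[OF measurable_mk m]) (simp add: ind split_beta')
 also have "\<dots> = (LINT y|lborel. LINT x|lborel. ?I x * ?I y * f (mk x y))" using lborel_pair.integral_snd[OF i2] by simp
 also have "\<dots> = (LINT y|lborel. ?I y * (LINT x|lborel. ?I x * f (mk x y)))"
 proof -
  have "(LINT x|lborel. ?I x * ?I y * f (mk x y)) = ?I y * (LINT x|lborel. ?I x * f (mk x y))" for y
   by (subst integral_mult_right_zero[symmetric]) (simp add: ac_simps)
  then show ?thesis by simp
 qed
 also have "\<dots> = (LINT y|lborel. indicator {0..1} y * (LINT x|lborel. indicator {0..1} x * f (mk x y)))"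
 proof -
  have AE: "AE x::real in lborel. ?I x = indicator {0..1} x"
  proof -
   have "AE x in lborel. x \<noteq> 0 \<and> x \<noteq> (1::real)" by (intro AE_conjI AE_lborel_singleton)
   then show ?thesis by (rule eventually_mono) (auto simp: indicator_def)
  qed
  have c1: "(\<lambda>x. f (mk x y)) \<in> borel_measurable borel" for y by (intro cont_borel continuous_on_compose2[OF f] continuous_intros) auto
  have in1: "(LINT x|lborel. ?I x * f (mk x y)) = (LINT x|lborel. indicator {0..1} x * f (mk x y))" for y
  proof (rule integral_cong_AE)
   show "AE x in lborel. ?I x * f (mk x y) = indicator {0..1} x * f (mk x y)" using AE by (rule eventually_mono) simp
  qed (use c1 in auto)
  have m2: "(\<lambda>y. (LINT x|lborel. indicator {0..1} x * f (mk x y))) \<in> borel_measurable borel"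
  proof -
   have c2: "cont (\<lambda>(y, x). f (mk x y))" unfolding split_beta by (intro continuous_on_compose2[OF f] continuous_intros) auto
   then have [measurable]: "(\<lambda>(y, x). f (mk x y)) \<in> borel_measurable (borel \<Otimes>\<^sub>M borel)"
    unfolding borel_prod by (rule cont_borel)
   have "(\<lambda>p. indicat_real {0..1} (snd p) * (\<lambda>(y, x). f (mk x y)) p) \<in> borel_measurable (borel \<Otimes>\<^sub>M borel)"
    by measurable
   then have "(\<lambda>(y, x). indicator {0..1} x * f (mk x y)) \<in> borel_measurable (borel \<Otimes>\<^sub>M borel)" by (simp add: split_beta)
   then have "(\<lambda>(y, x). indicator {0..1} x * f (mk x y)) \<in> borel_measurable (borel \<Otimes>\<^sub>M lborel)"
    by (simp cong: measurable_cong_sets)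
   then show ?thesis by (rule lborel.borel_measurable_lebesgue_integral)
  qed
  show ?thesis unfolding in1
  proof (rule integral_cong_AE)
   show "AE y in lborel. ?I y * (LINT x|lborel. indicator {0..1} x * f (mk x y)) =
    indicator {0..1} y * (LINT x|lborel. indicator {0..1} x * f (mk x y))"
    using AE by (rule eventually_mono) simp
  qed (use m2 in auto)
 qed
 also have "\<dots> = (LINT y|lborel. indicator {0..1} y *\<^sub>R (LINT x|leb {0..1}. f (mk x y)))"
 proof -
  have "(\<lambda>x. f (mk x y)) \<in> borel_measurable borel" for y by (intro cont_borel continuous_on_compose2[OF f] continuous_intros) auto
  then show ?thesis by (simp add: integral_lebesgue_on_borel)
 qed
 also have "\<dots> = (LINT t|leb {0..1}. LINT s|leb {0..1}. f (mk s t))"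
 proof -
  have "cont (\<lambda>y. LINT x|leb {0..1}. f (mk x y))"
  proof -
   have "continuous_on (UNIV \<times> cbox 0 1) (\<lambda>(y, x). f (mk x y))"
    unfolding split_beta by (intro continuous_on_compose2[OF f] continuous_intros) auto
   then have "cont (\<lambda>y. integral (cbox 0 1) (\<lambda>x. f (mk x y)))" by (rule integral_continuous_on_param)
   moreover have "(LINT x|leb {0..1}. f (mk x y)) = integral (cbox 0 1) (\<lambda>x. f (mk x y))" for y unfolding cbox_interval
    by (intro LINT_01_eq_integral continuous_on_compose2[OF f] continuous_intros) auto
   ultimately show ?thesis by simp
  qed
  then have "(\<lambda>y. LINT x|leb {0..1}. f (mk x y)) \<in> borel_measurable borel" by (rule cont_borel)
  then show ?thesis by (simp add: integral_lebesgue_on_borel)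
 qed
 finally show ?thesis .
qed


context star_polygon
begin

definition sector_map :: "nat => plane => plane" where
 "sector_map i z = c + z $ 1 *\<^sub>R (edp i (z $ 2) - c)"

lemma sector_map_mk: "sector_map i (mk s t) = c + s *\<^sub>R (edp i t - c)" by (simp add: sector_map_def)

lemma sector_eq_image: "sector i = sector_map i ` box 0 (mk 1 1)"
proof -
 have "box 0 (mk 1 1) = (\<lambda>(s, t). mk s t) ` ({0<..<1} \<times> {0<..<1})" by (force simp: box_plane image_iff plane_eq_iff)
 then show ?thesis by (simp add: sector_def image_image split_beta sector_map_mk)
qed

lemma wedge_edge: "wedge (edp i t - c) (vx (Suc i) - vx i) = D i"
 by (simp add: D_def linepath_def wedge_def algebra_simps)

lemma continuous_on_nth2 [continuous_intros]:
 "continuous_on S f ==> continuous_on S (\<lambda>x. (f x :: plane) $ i)"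
 by (rule continuous_on_component)

lemma continuous_sector_map: "continuous_on S (sector_map i)"
 unfolding sector_map_def linepath_def by (intro continuous_intros)

lemma inj_sector_map: "inj_on (sector_map i) (box 0 (mk 1 1))"
proof (rule inj_onI)
 fix z w :: plane assume z: "z \<in> box 0 (mk 1 1)" and w: "w \<in> box 0 (mk 1 1)"
  and eq: "sector_map i z = sector_map i w"
 let ?q = "vx (Suc i) - vx i"
 have e: "z $ 1 *\<^sub>R (edp i (z $ 2) - c) = w $ 1 *\<^sub>R (edp i (w $ 2) - c)" using eq by (simp add: sector_map_def)
 then have "wedge (z $ 1 *\<^sub>R (edp i (z $ 2) - c)) ?q = wedge (w $ 1 *\<^sub>R (edp i (w $ 2) - c)) ?q" by simp
 then have 1: "z $ 1 = w $ 1" using D_nz[of i] by (simp only: wedge_linear(5) wedge_edge) simp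
 then have "edp i (z $ 2) = edp i (w $ 2)" using e w by (simp add: box_plane)
 moreover have "edp i (z $ 2) - edp i (w $ 2) = (z $ 2 - w $ 2) *\<^sub>R ?q" by (simp add: linepath_def algebra_simps)
 ultimately have "z $ 2 = w $ 2" using vertex_Suc_neq[OF poly, of i] by simp
 then show "z = w" using 1 by (simp add: plane_eq_iff)
qed

lemma sector_map_derivative:
 "(sector_map i has_derivative (\<lambda>d. d $ 1 *\<^sub>R (edp i (z $ 2) - c) +
 (z $ 1 * d $ 2) *\<^sub>R (vx (Suc i) - vx i))) (at z within S)"
 unfolding sector_map_def linepath_def
 by (auto intro!: derivative_eq_intros bounded_linear_imp_has_derivative bounded_linear_vec_nth simp: algebra_simps)

text \<open>The Jacobian grows linearly along the ray; this is the weight \<open>s\<close> that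
  later makes the radial integrals exact.\<close>

lemma det_sector_map:
 "det (matrix (\<lambda>d. d $ 1 *\<^sub>R (edp i (z $ 2) - c) +
 (z $ 1 * d $ 2) *\<^sub>R (vx (Suc i) - vx i))) = z $ 1 * D i"
proof -
 have "det (matrix (\<lambda>d::plane. d $ 1 *\<^sub>R a + (s * d $ 2) *\<^sub>R b)) = s * wedge a b" for a b :: plane and s
  by (simp add: det_2 matrix_def axis_def wedge_def algebra_simps)
 then show ?thesis by (simp only: wedge_edge)
qed

lemma sector_lebesgue: "sector i \<in> sets lebesgue"
 unfolding sector_eq_image by (rule differentiable_image_in_sets_lebesgue)
 (auto simp: differentiable_on_def differentiable_def intro: sector_map_derivative)

lemma sector_integral:
 fixes f :: "plane => real"
 assumes f: "cont f"
 shows "integrable (leb (sector i)) f"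
 and "(LINT x|leb (sector i). f x) = \<bar>D i\<bar> *
 (LINT t|leb {0..1}. LINT s|leb {0..1}. s * f (c + s *\<^sub>R (edp i t - c)))"
proof -
 \<comment> \<open>\<open>f\<close> is wrapped into a one-dimensional vector to fit the form of the
   change-of-variables theorem.\<close>
 let ?S = "box 0 (mk 1 1)" and ?f = "\<lambda>x. (\<chi> j. f x) :: real ^ 1"
 let ?g = "\<lambda>z::plane. \<bar>z $ 1 * D i\<bar> *\<^sub>R ?f (sector_map i z)"
 let ?h = "\<lambda>z::plane. \<bar>D i\<bar> * (z $ 1 * f (sector_map i z))"
 have fc: "cont (\<lambda>z. f (sector_map i z))" by (intro continuous_on_compose2[OF f] continuous_sector_map) auto
 have hc: "cont ?h" by (intro continuous_intros fc)
 have gc: "cont ?g" by (intro continuous_intros fc continuous_on_vec_lambda)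
 have S: "?S \<in> sets lebesgue" by simp
 have gi: "integrable (leb ?S) ?g" by (rule continuous_integrable_on[OF gc]) auto
 then have gi': "?g absolutely_integrable_on ?S" by (simp add: set_integrable_def integrable_restrict_space)
 have "(?f absolutely_integrable_on (sector_map i ` ?S)) \<and>
  integral (sector_map i ` ?S) ?f = integral ?S ?g"
  using has_absolute_integral_change_of_variables[OF S sector_map_derivative inj_sector_map,
  where f = ?f and b = "integral ?S ?g"] gi' unfolding det_sector_map by blast
 then have fi: "?f absolutely_integrable_on sector i" and fe: "integral (sector i) ?f = integral ?S ?g" by (auto simp: sector_eq_image)
 have fi2: "integrable (leb (sector i)) ?f" using fi sector_lebesgue by (simp add: set_integrable_def integrable_restrict_space)
 then have "integrable (leb (sector i)) (\<lambda>x. ?f x \<bullet> axis 1 1)" by (rule integrable_inner_left)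
 then show "integrable (leb (sector i)) f" by (simp add: inner_axis)
 have "(LINT x|leb (sector i). f x) = (LINT x|leb (sector i). ?f x \<bullet> axis 1 1)" by (simp add: inner_axis)
 also have "\<dots> = (LINT x|leb (sector i). ?f x) \<bullet> axis 1 1" using fi2 by (rule integral_inner_left)
 also have "\<dots> = integral (sector i) ?f \<bullet> axis 1 1" using lebesgue_integral_eq_integral[OF fi2 sector_lebesgue] by simp
 also have "\<dots> = (LINT z|leb ?S. ?g z) \<bullet> axis 1 1" unfolding fe using lebesgue_integral_eq_integral[OF gi S] by simp
 also have "\<dots> = (LINT z|leb ?S. ?g z \<bullet> axis 1 1)" using gi by (rule integral_inner_left[symmetric])
 also have "\<dots> = (LINT z|leb ?S. ?h z)" by (intro LINT_cong)
  (auto simp: inner_axis abs_mult space_restrict_space box_plane)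
 also have "\<dots> = (LINT t|leb {0..1}. LINT s|leb {0..1}. ?h (mk s t))" by (rule integral_unit_square[OF hc])
 finally show "(LINT x|leb (sector i). f x) = \<bar>D i\<bar> *
  (LINT t|leb {0..1}. LINT s|leb {0..1}. s * f (c + s *\<^sub>R (edp i t - c)))"
  by (simp add: sector_map_mk)
qed

end

section \<open>Divergence theorem and trace inequality\<close>

lemma C1_has_derivative:
 assumes "C1 \<phi>"
 shows "(\<phi> has_derivative (\<lambda>d. grad \<phi> x \<bullet> d)) (at x within S)"
proof -
 let ?f = "frechet_derivative \<phi> (at x)"
 have d: "(\<phi> has_derivative ?f) (at x)" using assms by (auto simp: C1_def frechet_derivative_works)
 then have "linear ?f" by (rule has_derivative_linear)
 then have "?f d = grad \<phi> x \<bullet> d" for d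
 proof -
  have "d = (d $ 1) *\<^sub>R axis 1 1 + (d $ 2) *\<^sub>R axis 2 1" by (simp add: plane_eq_iff axis_def)
  then have "?f d = ?f ((d $ 1) *\<^sub>R axis 1 1 + (d $ 2) *\<^sub>R axis 2 1)" by simp
  also have "\<dots> = d $ 1 * ?f (axis 1 1) + d $ 2 * ?f (axis 2 1)" using \<open>linear ?f\<close> by (simp add: linear_add linear_cmul)
  finally show ?thesis by (simp add: grad_def partial_def plane_inner)
 qed
 then have "?f = (\<lambda>d. grad \<phi> x \<bullet> d)" by auto
 then show ?thesis using d has_derivative_at_withinI by metis
qed

lemma C1I:
 assumes d: "\<And>x. (\<phi> has_derivative (\<lambda>d. g x \<bullet> d)) (at x)" and g: "cont g"
 shows "C1 \<phi>" "grad \<phi> = g"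
proof -
 have fd: "frechet_derivative \<phi> (at x) = (\<lambda>d. g x \<bullet> d)" for x using frechet_derivative_at[OF d] by simp
 have p: "partial i \<phi> = (\<lambda>x. g x $ i)" for i by (simp add: partial_def fd inner_axis fun_eq_iff)
 have "cont (\<lambda>x. g x $ i)" for i using g by (rule continuous_on_component)
 then show "C1 \<phi>" using d by (auto simp: C1_def p differentiable_def)
 show "grad \<phi> = g" by (simp add: grad_def p fun_eq_iff plane_eq_iff)
qed

lemma C1_continuous: "C1 \<phi> ==> continuous_on S \<phi>"
 by (rule has_derivative_continuous_on) (rule C1_has_derivative)

lemma C1_grad_continuous: "C1 \<phi> ==> continuous_on S (grad \<phi>)"
proof -
 assume "C1 \<phi>"
 then have "cont (\<lambda>x. mk (partial 1 \<phi> x) (partial 2 \<phi> x))" by (intro continuous_intros) (auto simp: C1_def)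
 then show ?thesis by (auto simp: grad_def[abs_def] mk_def intro: continuous_on_subset)
qed

lemma C1_const [simp]: "C1 (\<lambda>x. a)" "grad (\<lambda>x. a) = (\<lambda>x. 0)"
 using C1I[of "\<lambda>x. a" "\<lambda>x. 0"] by auto

lemma C1_add: assumes "C1 f" "C1 g"
 shows "C1 (\<lambda>x. f x + g x)" "grad (\<lambda>x. f x + g x) = (\<lambda>x. grad f x + grad g x)"
proof -
 have "((\<lambda>x. f x + g x) has_derivative (\<lambda>d. (grad f x + grad g x) \<bullet> d)) (at x)" for x
  using C1_has_derivative[OF assms(1)] C1_has_derivative[OF assms(2)] by (auto intro!: derivative_eq_intros simp: inner_add_left)
 moreover have "cont (\<lambda>x. grad f x + grad g x)" using assms by (intro continuous_intros C1_grad_continuous)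
 ultimately show "C1 (\<lambda>x. f x + g x)" "grad (\<lambda>x. f x + g x) = (\<lambda>x. grad f x + grad g x)" by (fact C1I)+
qed

lemma C1_mult: assumes "C1 f" "C1 g"
 shows "C1 (\<lambda>x. f x * g x)" "grad (\<lambda>x. f x * g x) = (\<lambda>x. f x *\<^sub>R grad g x + g x *\<^sub>R grad f x)"
proof -
 have "((\<lambda>x. f x * g x) has_derivative (\<lambda>d. (f x *\<^sub>R grad g x + g x *\<^sub>R grad f x) \<bullet> d)) (at x)" for x
  using C1_has_derivative[OF assms(1)] C1_has_derivative[OF assms(2)] by (auto intro!: derivative_eq_intros simp: inner_add_left)
 moreover have "cont (\<lambda>x. f x *\<^sub>R grad g x + g x *\<^sub>R grad f x)"
  using assms by (intro continuous_intros C1_grad_continuous C1_continuous)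
 ultimately show "C1 (\<lambda>x. f x * g x)" "grad (\<lambda>x. f x * g x) = (\<lambda>x. f x *\<^sub>R grad g x + g x *\<^sub>R grad f x)"
  by (fact C1I)+
qed

lemma C1_cmult: assumes "C1 f"
 shows "C1 (\<lambda>x. a * f x)" "grad (\<lambda>x. a * f x) = (\<lambda>x. a *\<^sub>R grad f x)"
 using C1_mult[of "\<lambda>x. a" f] assms by auto

lemma LINT_FTC:
 fixes f :: "real => real"
 assumes "\<And>s. 0 \<le> s ==> s \<le> 1 ==> (f has_real_derivative f' s) (at s within {0..1})"
 and "continuous_on {0..1} f'"
 shows "(LINT s|leb {0..1}. f' s) = f 1 - f 0"
proof -
 have "(f' has_integral f 1 - f 0) {0..1}" using assms(1) by (intro fundamental_theorem_of_calculus)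
  (auto simp: has_real_derivative_iff_has_vector_derivative)
 then show ?thesis using LINT_01_eq_integral[OF assms(2)] by (simp add: integral_unique)
qed

lemma C1_ray_derivative:
 assumes "C1 \<phi>"
 shows "((\<lambda>s. \<phi> (c + s *\<^sub>R e)) has_real_derivative (grad \<phi> (c + s *\<^sub>R e) \<bullet> e)) (at s within S)"
proof -
 have "((\<lambda>s. \<phi> (c + s *\<^sub>R e)) has_derivative (\<lambda>d. grad \<phi> (c + s *\<^sub>R e) \<bullet> (d *\<^sub>R e))) (at s within S)"
  by (rule has_derivative_compose[OF _ C1_has_derivative[OF assms, of _ UNIV], where f="\<lambda>s. c + s *\<^sub>R e"])
  (auto intro!: derivative_eq_intros)
 then show ?thesis by (simp add: has_field_derivative_def mult.commute[of _ "_ \<bullet> _"])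
qed

context star_polygon
begin

definition h :: real where "h = diameter F"

lemma bounded_closure_F: "bounded (closure F)"
 using bounded_domain by (rule bounded_closure)

lemma dist_le_h: "x \<in> closure F ==> y \<in> closure F ==> norm (x - y) \<le> h"
 using diameter_bounded_bound[OF bounded_closure_F] diameter_closure[OF bounded_domain] by (simp add: h_def dist_norm)

lemma F_sub_closure: "x \<in> F ==> x \<in> closure F"
 using closure_subset by auto

lemma r_le_h: "2 * r \<le> h"
 using diameter_subset[OF ball_sub bounded_domain] r_pos by (simp add: h_def)

lemma h_pos: "h > 0" using r_le_h r_pos by linarith

lemma F_sub_cball: "closure F \<subseteq> cball c h"
 using dist_le_h F_sub_closure[OF c_in] by (auto simp: dist_norm norm_minus_commute)

lemma near_c: "x \<in> closure F ==> norm (x - c) \<le> h" "x \<in> F ==> norm (x - c) \<le> h"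
 using dist_le_h[OF _ F_sub_closure[OF c_in]] F_sub_closure by auto

text \<open>The barycentre may lie outside a nonconvex polygon, and segments from it may leave
  \<open>F\<close>; polynomial bounds are therefore established on the disc of radius
  \<open>2 * h\<close> about \<open>c\<close>.\<close>

lemma near_segment:
 assumes "norm (b - c) \<le> h" "norm (x - c) \<le> h"
 shows "norm (x - b) \<le> 2 * h" and "\<And>t. 0 \<le> t ==> t \<le> 1 ==> norm (b + t *\<^sub>R (x - b) - c) \<le> 2 * h"
proof -
 show "norm (x - b) \<le> 2 * h" using norm_triangle_ineq4[of "x - c" "b - c"] assms by simp
 fix t :: real assume t: "0 \<le> t" "t \<le> 1"
 have "b + t *\<^sub>R (x - b) - c = (1 - t) *\<^sub>R (b - c) + t *\<^sub>R (x - c)" by (simp add: algebra_simps)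
 also have "norm \<dots> \<le> (1 - t) * norm (b - c) + t * norm (x - c)" using t by (intro norm_triangle_le) simp
 also have "\<dots> \<le> (1 - t) * h + t * h" using t assms by (intro add_mono mult_left_mono) auto
 finally show "norm (b + t *\<^sub>R (x - b) - c) \<le> 2 * h" using h_pos by (simp add: algebra_simps)
qed

lemma edge_length_le: "len i \<le> h"
 using dist_le_h[of "vx i" "vx (Suc i)"] vertex_in_boundary closure_F by (auto simp: edge_length_def dist_norm)

lemma F_integral_sectors:
 fixes f :: "plane => real"
 assumes f: "integrable (leb F) f"
 shows "(LINT x|leb F. f x) = (\<Sum>i<n. LINT x|leb (sector i). f x)"
proof -
 let ?N = "\<Union>i<n. closed_segment c (vx i)"
 have F: "F \<in> sets lebesgue" using open_domain by (rule open_lebesgue)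
 have fi: "integrable lebesgue (\<lambda>x. indicator F x *\<^sub>R f x)" using f F by (simp add: integrable_restrict_space)
 have "negligible ?N"
 proof (rule negligible_Union)
  fix t assume "t \<in> (\<lambda>i. closed_segment c (vx i)) ` {..<n}"
  then obtain i where "t = closed_segment c (vx i)" by blast
  moreover have "interior (closed_segment c (vx i)) = {}" by (rule interior_closed_segment_ge2) simp
  ultimately show "negligible t" by (simp add: negligible_convex_interior)
 qed simp
 then have N: "?N \<in> null_sets lebesgue" by (simp add: negligible_iff_null_sets)
 have AE: "AE x in lebesgue. indicator F x *\<^sub>R f x = (\<Sum>i<n. indicator (sector i) x *\<^sub>R (indicator F x *\<^sub>R f x))"
 proof (rule AE_I'[OF N], safe)
  fix x assume ne: "indicator F x *\<^sub>R f x \<noteq> (\<Sum>i<n. indicator (sector i) x *\<^sub>R (indicator F x *\<^sub>R f x))"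
  show "x \<in> ?N"
  proof (rule ccontr)
   assume nN: "x \<notin> ?N"
   show False
   proof (cases "x \<in> F")
    case False then show False using ne by simp
   next
    case True
    then obtain j where j: "j < n" "x \<in> sector j" using F_cover nN by auto
    have "(\<Sum>i<n. indicator (sector i) x *\<^sub>R (indicator F x *\<^sub>R f x)) =
     (\<Sum>i<n. if i = j then f x else 0)"
     using j True sectors_disjoint[of _ j] by (intro sum.cong) (auto simp: indicator_def)
    then show False using ne j True by simp
   qed
  qed
 qed
 have si: "integrable lebesgue (\<lambda>x. indicator (sector i) x *\<^sub>R (indicator F x *\<^sub>R f x))" for i
  using fi by (intro integrable_mult_indicator[OF sector_lebesgue])
 have "(LINT x|leb F. f x) = (LINT x|lebesgue. indicator F x *\<^sub>R f x)" using F by (simp add: integral_restrict_space)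
 also have "\<dots> = (LINT x|lebesgue. (\<Sum>i<n. indicator (sector i) x *\<^sub>R (indicator F x *\<^sub>R f x)))"
  by (rule integral_cong_AE[OF borel_measurable_integrable[OF fi] borel_measurable_sum[OF borel_measurable_integrable[OF si]] AE])
 also have "\<dots> = (\<Sum>i<n. LINT x|lebesgue. indicator (sector i) x *\<^sub>R (indicator F x *\<^sub>R f x))"
  using si by (intro Bochner_Integration.integral_sum) auto
 also have "\<dots> = (\<Sum>i<n. LINT x|lebesgue. indicator (sector i) x *\<^sub>R f x)"
  using sector_sub by (intro sum.cong LINT_cong) (auto simp: indicator_def)
 also have "\<dots> = (\<Sum>i<n. LINT x|leb (sector i). f x)" using sector_lebesgue by (simp add: integral_restrict_space)
 finally show ?thesis .
qed

text \<open>Along each ray the integrand times the Jacobian \<open>s\<close> is the derivative of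
  \<open>s^2 * \<phi>\<close>, so the inner integral is the value at the edge.\<close>

lemma sector_divergence:
 assumes C: "C1 \<phi>"
 shows "(LINT x|leb (sector i). 2 * \<phi> x + grad \<phi> x \<bullet> (x - c)) =
 \<bar>D i\<bar> * (LINT t|leb {0..1}. \<phi> (edp i t))"
proof -
 let ?f = "\<lambda>x. 2 * \<phi> x + grad \<phi> x \<bullet> (x - c)"
 have fc: "cont ?f" by (intro continuous_intros C1_continuous C1_grad_continuous C)
 have "(LINT s|leb {0..1}. s * ?f (c + s *\<^sub>R (edp i t - c))) = \<phi> (edp i t)" for t
 proof -
  let ?e = "edp i t - c"
  have "(LINT s|leb {0..1}. s * ?f (c + s *\<^sub>R ?e)) =
   (\<lambda>s. s^2 * \<phi> (c + s *\<^sub>R ?e)) 1 - (\<lambda>s. s^2 * \<phi> (c + s *\<^sub>R ?e)) 0"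
  proof (rule LINT_FTC)
   show "((\<lambda>s. s^2 * \<phi> (c + s *\<^sub>R ?e)) has_real_derivative s * ?f (c + s *\<^sub>R ?e)) (at s within {0..1})" for s
   proof -
    have "((\<lambda>s. s^2 * \<phi> (c + s *\<^sub>R ?e)) has_real_derivative
     (2 * s) * \<phi> (c + s *\<^sub>R ?e) + (grad \<phi> (c + s *\<^sub>R ?e) \<bullet> ?e) * s^2) (at s within {0..1})"
     by (rule DERIV_mult[OF _ C1_ray_derivative[OF C]]) (auto intro!: derivative_eq_intros)
    moreover have "(2 * s) * \<phi> (c + s *\<^sub>R ?e) + (grad \<phi> (c + s *\<^sub>R ?e) \<bullet> ?e) * s^2 = s * ?f (c + s *\<^sub>R ?e)"
     unfolding add_diff_cancel_left' inner_scaleR_right by (simp only: power2_eq_square distrib_left ac_simps)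
    ultimately show ?thesis by simp
   qed
   show "continuous_on {0..1} (\<lambda>s. s * ?f (c + s *\<^sub>R ?e))"
    by (intro continuous_intros continuous_on_compose2[OF C1_continuous[OF C, of UNIV]]
    continuous_on_compose2[OF C1_grad_continuous[OF C, of UNIV]]) auto
  qed
  then show ?thesis by simp
 qed
 then show ?thesis using sector_integral(2)[OF fc, of i] by simp
qed

text \<open>The divergence theorem for the field \<open>\<phi> x *\<^sub>R (x - c)\<close>: its flux
  density on edge \<open>i\<close> is \<open>\<phi>\<close> times the distance of \<open>c\<close>
  from the edge line.\<close>

lemma F_radial_divergence:
 assumes C: "C1 \<phi>"
 shows "(LINT x|leb F. 2 * \<phi> x + grad \<phi> x \<bullet> (x - c)) =
 (\<Sum>i<n. \<bar>D i\<bar> * (LINT t|leb {0..1}. \<phi> (edp i t)))"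
proof -
 have "integrable (leb F) (\<lambda>x. 2 * \<phi> x + grad \<phi> x \<bullet> (x - c))"
  by (intro continuous_integrable_on continuous_intros C1_continuous C1_grad_continuous C)
  (auto simp: open_domain bounded_domain)
 then show ?thesis by (simp add: F_integral_sectors sector_divergence[OF C])
qed

text \<open>The radial identity for the square of \<open>\<psi>\<close>: its boundary term dominates
  \<open>r\<close> times the squared trace, because every triangle has height at least
  \<open>r\<close>.\<close>

lemma trace_inequality:
 assumes C: "C1 \<psi>"
 shows "r * (\<Sum>i<n. EI i (\<lambda>x. (\<psi> x)^2)) \<le>
 3 * (nrm (leb F) \<psi>)^2 + h^2 * (nrm (leb F) (grad \<psi>))^2"
proof -
 let ?q = "\<lambda>x. \<psi> x * \<psi> x"
 have C2: "C1 ?q" and g2: "grad ?q = (\<lambda>x. \<psi> x *\<^sub>R grad \<psi> x + \<psi> x *\<^sub>R grad \<psi> x)" using C1_mult[OF C C] by auto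
 have ob: "open F \<or> closed F" "bounded F" by (auto simp: open_domain bounded_domain)
 have "r * (\<Sum>i<n. EI i (\<lambda>x. (\<psi> x)^2)) \<le>
  (\<Sum>i<n. \<bar>D i\<bar> * (LINT t|leb {0..1}. ?q (edp i t)))"
  unfolding sum_distrib_left edge_integral_def power2_eq_square mult.assoc[symmetric] using D_ge by (intro sum_mono mult_right_mono) auto
 also have "\<dots> = (LINT x|leb F. 2 * ?q x + grad ?q x \<bullet> (x - c))" using F_radial_divergence[OF C2] by simp
 also have "\<dots> \<le> (LINT x|leb F. 3 * (norm (\<psi> x))^2 + h^2 * (norm (grad \<psi> x))^2)"
 proof (rule integral_mono)
  show "integrable (leb F) (\<lambda>x. 2 * ?q x + grad ?q x \<bullet> (x - c))"
   by (intro continuous_integrable_on[OF _ ob] continuous_intros C1_continuous C1_grad_continuous C2 C)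
  show "integrable (leb F) (\<lambda>x. 3 * (norm (\<psi> x))^2 + h^2 * (norm (grad \<psi> x))^2)"
   by (intro continuous_integrable_on[OF _ ob] continuous_intros C1_continuous C1_grad_continuous C)
  fix x assume "x \<in> space (leb F)"
  then have x: "x \<in> F" by (simp add: space_restrict_space)
  have "\<bar>grad \<psi> x \<bullet> (x - c)\<bar> \<le> norm (grad \<psi> x) * norm (x - c)" by (rule Cauchy_Schwarz_ineq2)
  also have "\<dots> \<le> norm (grad \<psi> x) * h" using dist_le_h[OF F_sub_closure[OF x] F_sub_closure[OF c_in]] by (intro mult_left_mono) auto
  finally have 1: "\<bar>\<psi> x\<bar> * \<bar>grad \<psi> x \<bullet> (x - c)\<bar> \<le> \<bar>\<psi> x\<bar> * (h * norm (grad \<psi> x))"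
   by (intro mult_left_mono) (auto simp: mult.commute)
  have "2 * (\<psi> x * (grad \<psi> x \<bullet> (x - c))) \<le> 2 * (\<bar>\<psi> x\<bar> * \<bar>grad \<psi> x \<bullet> (x - c)\<bar>)"
   by (metis abs_ge_self abs_mult mult_left_mono zero_le_numeral)
  also have "\<dots> \<le> 2 * (\<bar>\<psi> x\<bar> * (h * norm (grad \<psi> x)))" using 1 by simp
  \<comment> \<open>Young's inequality; the additional square of \<open>\<psi>\<close> raises the
    factor 2 to 3.\<close>
  also have "\<dots> \<le> (\<psi> x)^2 + (h * norm (grad \<psi> x))^2"
   using sum_squares_bound[of "\<bar>\<psi> x\<bar>" "h * norm (grad \<psi> x)"] by simp
  finally have *: "2 * (\<psi> x * (grad \<psi> x \<bullet> (x - c))) \<le> (\<psi> x)^2 + (h * norm (grad \<psi> x))^2" .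
  show "2 * ?q x + grad ?q x \<bullet> (x - c) \<le> 3 * (norm (\<psi> x))^2 + h^2 * (norm (grad \<psi> x))^2"
  proof -
   have "grad ?q x \<bullet> (x - c) = 2 * (\<psi> x * (grad \<psi> x \<bullet> (x - c)))" unfolding g2 by (simp only: inner_add_left inner_scaleR_left)
   then show ?thesis using * by (simp add: power_mult_distrib) (simp add: power2_eq_square)
  qed
 qed
 also have "\<dots> = 3 * (nrm (leb F) \<psi>)^2 + h^2 * (nrm (leb F) (grad \<psi>))^2" using sqi_int[OF continuous_sqi_on[OF C1_continuous[OF C] ob]]
  sqi_int[OF continuous_sqi_on[OF C1_grad_continuous[OF C] ob]]
  unfolding nrm_sq by simp
 finally show ?thesis .
qed

text \<open>The edge vector turned by a right angle and normalised; \<open>sgn (D i)\<close> points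
  it away from \<open>c\<close> for either orientation of the vertex list. Agreement with
  \<open>outer_normal\<close> is proved for convex polygons.\<close>

definition nv :: "nat => plane" where
 "nv i = (sgn (D i) / len i) *\<^sub>R
 mk ((vx (Suc i) - vx i) $ 2) (- (vx (Suc i) - vx i) $ 1)"

lemma nv_inner: "len i * (nv i \<bullet> y) = sgn (D i) * wedge y (vx (Suc i) - vx i)"
 using edge_length_pos[of i] by (simp add: nv_def plane_inner wedge_def algebra_simps)

lemma edge_length_norm: "len i = norm (vx (Suc i) - vx i)"
 by (simp add: edge_length_def dist_norm norm_minus_commute)

lemma norm_nv: "norm (nv i) = 1"
proof -
 let ?e = "vx (Suc i) - vx i"
 have "norm (mk (?e $ 2) (- ?e $ 1)) = norm ?e"
 proof -
  have "(norm (mk (?e $ 2) (- ?e $ 1)))^2 = (norm ?e)^2" unfolding plane_norm_sq by (simp only: mk_nth power2_minus)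
  then show ?thesis by simp
 qed
 then show ?thesis using edge_length_pos[of i] D_nz[of i] by (simp add: nv_def edge_length_norm abs_sgn_eq)
qed

lemma D_nv: "len i * (nv i \<bullet> (edp i t - c)) = \<bar>D i\<bar>"
 unfolding nv_inner wedge_edge by (simp add: sgn_mult_self_eq abs_sgn mult.commute)

text \<open>\<open>F\<close> is star-shaped about \<open>c + y\<close> as well. Subtracting the
  radial identities for the two centres leaves the flux of the constant field
  \<open>y\<close>.\<close>

lemma divergence_theorem_small:
 assumes C: "C1 \<phi>" and y: "norm y < r"
 shows "(LINT x|leb F. grad \<phi> x \<bullet> y) = (\<Sum>i<n. EI i \<phi> * (nv i \<bullet> y))"
proof -
 interpret c': star_polygon vs "c + y" "r - norm y"
 proof
  have "ball (c + y) (r - norm y) \<subseteq> ball c r"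
  proof
   fix x assume "x \<in> ball (c + y) (r - norm y)"
   then have "norm (x - c) \<le> norm (x - (c + y)) + norm y" "norm (x - (c + y)) < r - norm y"
    using norm_triangle_ineq[of "x - (c+y)" y] by (auto simp: dist_norm norm_minus_commute algebra_simps)
   then show "x \<in> ball c r" by (simp add: dist_norm norm_minus_commute)
  qed
  then show "star_shaped_wrt F (ball (c + y) (r - norm y))" using star unfolding star_shaped_wrt_def by blast
 qed (use poly y in auto)
 \<comment> \<open>The shift is too small to change the sign of a triangle area, so the absolute
   values depend linearly on \<open>y\<close>.\<close>
 have dd: "\<bar>D i\<bar> - \<bar>c'.D i\<bar> = len i * (nv i \<bullet> y)" for i
 proof -
  let ?e = "vx (Suc i) - vx i"
  have D': "c'.D i = D i - wedge y ?e" by (simp add: D_def c'.D_def wedge_def algebra_simps)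
  have "\<bar>wedge y ?e\<bar> \<le> norm y * len i" using abs_wedge_le[of y ?e] by (simp add: edge_length_norm)
  also have "\<dots> < r * len i" using y edge_length_pos by simp
  also have "\<dots> \<le> \<bar>D i\<bar>" by (rule D_ge)
  finally have "\<bar>D i - wedge y ?e\<bar> = \<bar>D i\<bar> - sgn (D i) * wedge y ?e" by (auto simp: abs_if sgn_if split: if_splits)
  then show ?thesis unfolding nv_inner D' by simp
 qed
 have i: "integrable (leb F) (\<lambda>x. 2 * \<phi> x + grad \<phi> x \<bullet> (x - a))" for a
  by (intro continuous_integrable_on continuous_intros C1_continuous C1_grad_continuous C)
  (auto simp: open_domain bounded_domain)
 have "(LINT x|leb F. grad \<phi> x \<bullet> y) =
  (LINT x|leb F. (2 * \<phi> x + grad \<phi> x \<bullet> (x - c)) - (2 * \<phi> x + grad \<phi> x \<bullet> (x - (c + y))))"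
  by (intro LINT_cong) (auto simp: inner_diff_right inner_add_right)
 also have "\<dots> = (\<Sum>i<n. (\<bar>D i\<bar> - \<bar>c'.D i\<bar>) * (LINT t|leb {0..1}. \<phi> (edp i t)))"
  unfolding LINT_diff[OF i i] F_radial_divergence[OF C] c'.F_radial_divergence[OF C] by (simp add: sum_subtractf left_diff_distrib)
 also have "\<dots> = (\<Sum>i<n. EI i \<phi> * (nv i \<bullet> y))" unfolding dd edge_integral_def by (simp add: ac_simps)
 finally show ?thesis .
qed

text \<open>Both sides are linear in \<open>y\<close>, so \<open>y\<close> may be scaled to be
  shorter than \<open>r\<close>.\<close>

lemma divergence_theorem:
 assumes C: "C1 \<phi>"
 shows "(LINT x|leb F. grad \<phi> x \<bullet> y) = (\<Sum>i<n. EI i \<phi> * (nv i \<bullet> y))"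
proof -
 define a where "a = r / (2 * (norm y + 1))"
 have a: "a > 0" using r_pos by (simp add: a_def add_nonneg_pos)
 have "norm (a *\<^sub>R y) < r"
 proof -
  have "norm y / (2 * (norm y + 1)) < 1"  using norm_ge_zero[of y] by (auto simp: divide_less_eq simp del: norm_ge_zero)
  then have "r * (norm y / (2 * (norm y + 1))) < r * 1" using r_pos by (rule mult_strict_left_mono)
  then show ?thesis using r_pos by (simp add: a_def)
 qed
 from divergence_theorem_small[OF C this] a show ?thesis by (simp add: mult.left_commute flip: sum_distrib_left)
qed

end

section \<open>Poincare inequality and approximation\<close>

lemma nn_integral_lborel_affine:
 fixes f :: "plane => ennreal"
 assumes [measurable]: "f \<in> borel_measurable borel" and a: "a \<noteq> 0"
 shows "(\<integral>\<^sup>+x. f x \<partial>lborel) = ennreal (a^2) * (\<integral>\<^sup>+x. f (t + a *\<^sub>R x) \<partial>lborel)"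
 by (subst lborel_affine[OF a, of t])
 (simp add: nn_integral_density nn_integral_distr nn_integral_cmult)

lemma lborel_integral_affine:
 fixes f :: "plane => real"
 assumes [measurable]: "f \<in> borel_measurable borel" and a: "a \<noteq> 0"
 shows "(\<integral>x. f x \<partial>lborel) = a^2 * (\<integral>x. f (t + a *\<^sub>R x) \<partial>lborel)"
 by (subst lborel_affine[OF a, of t])
 (simp add: integral_density integral_distr)

lemma lborel_integrable_affine:
 fixes f :: "plane => real"
 assumes f: "integrable lborel f" and a: "a \<noteq> 0"
 shows "integrable lborel (\<lambda>x. f (t + a *\<^sub>R x))"
proof -
 have [measurable]: "f \<in> borel_measurable borel" using f by (simp add: borel_measurable_integrable)
 show ?thesis using f unfolding integrable_iff_bounded by (subst (asm) nn_integral_lborel_affine[OF _ a, of _ t]) (auto simp: ennreal_mult_less_top a)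
qed

text \<open>The factor 4 is \<open>1 / a^2\<close> in the worst case. On a segment one of the
  weights \<open>t\<close> and \<open>1 - t\<close> is always in this range, and so is the
  contraction factor \<open>1 - e\<close> of the mollifier below.\<close>

lemma nn_integral_affine_le:
 fixes f :: "plane => ennreal"
 assumes [measurable]: "f \<in> borel_measurable borel" and a: "1/2 \<le> \<bar>a\<bar>"
 shows "(\<integral>\<^sup>+x. f (t + a *\<^sub>R x) \<partial>lborel) \<le> 4 * (\<integral>\<^sup>+x. f x \<partial>lborel)"
proof -
 have a0: "a \<noteq> 0" using a by auto
 have "(1/2)^2 \<le> \<bar>a\<bar>^2" using a by (intro power_mono) auto
 then have "1 \<le> 4 * a^2" by (simp add: power2_eq_square)
 then have "1 * (\<integral>\<^sup>+x. f (t + a *\<^sub>R x) \<partial>lborel) \<le> ennreal (4 * a^2) * (\<integral>\<^sup>+x. f (t + a *\<^sub>R x) \<partial>lborel)"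
  by (intro mult_right_mono) (auto simp: ennreal_le_1 simp flip: ennreal_1 intro: ennreal_leI)
 also have "\<dots> = 4 * (\<integral>\<^sup>+x. f x \<partial>lborel)"
  by (subst nn_integral_lborel_affine[OF _ a0, of f t]) (auto simp: ennreal_mult mult.assoc)
 finally show ?thesis by simp
qed

lemma nn_integral_lebesgue_on:
 assumes "S \<in> sets borel" "f \<in> borel_measurable borel"
 shows "(\<integral>\<^sup>+x. f x \<partial>leb S) = (\<integral>\<^sup>+x. indicator S x * f x \<partial>lborel)"
 using assms by (simp add: nn_integral_restrict_space nn_integral_completion mult.commute)

lemma nn_integral_continuous_sq:
 fixes f :: "'a::euclidean_space => 'b::euclidean_space"
 assumes f: "cont f" and S: "open S \<or> closed S" "bounded S"
 shows "(\<integral>\<^sup>+x. indicator S x * ennreal ((norm (f x))^2) \<partial>lborel) = ennreal ((nrm (leb S) f)^2)"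
proof -
 have [measurable]: "f \<in> borel_measurable borel" using f by (rule cont_borel)
 have Sb: "S \<in> sets borel" using S by auto
 have "(\<integral>\<^sup>+x. ennreal ((norm (f x))^2) \<partial>leb S) = ennreal ((nrm (leb S) f)^2)"
  unfolding nrm_sq using sqi_int[OF continuous_sqi_on[OF f S]] by (intro nn_integral_eq_integral) auto
 then show ?thesis using Sb by (simp add: nn_integral_lebesgue_on)
qed

lemma C1_increment_bound:
 assumes C: "C1 \<psi>"
 shows "ennreal ((\<psi> x - \<psi> y)^2) \<le> ennreal ((norm (x - y))^2) *
 (\<integral>\<^sup>+t. indicator {0..1} t * ennreal ((norm (grad \<psi> (y + t *\<^sub>R (x - y))))^2) \<partial>lborel)"
proof -
 let ?g = "\<lambda>t. grad \<psi> (y + t *\<^sub>R (x - y))" and ?M = "leb {0..1::real}"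
 have gc: "cont ?g" by (intro continuous_on_compose2[OF C1_grad_continuous[OF C, of UNIV]] continuous_intros) auto
 have "(LINT t|?M. ?g t \<bullet> (x - y)) = \<psi> (y + 1 *\<^sub>R (x - y)) - \<psi> (y + 0 *\<^sub>R (x - y))"
  by (rule LINT_FTC[of "\<lambda>t. \<psi> (y + t *\<^sub>R (x - y))"])
  (auto intro!: C1_ray_derivative[OF C] continuous_intros continuous_on_subset[OF gc])
 then have "\<psi> x - \<psi> y = (LINT t|?M. ?g t \<bullet> (x - y))" by simp
 then have "\<bar>\<psi> x - \<psi> y\<bar> \<le> nrm ?M ?g * nrm ?M (\<lambda>t. x - y)"
  using nrm_Cauchy_Schwarz[of ?M ?g "\<lambda>t. x - y"] continuous_sqi_on[OF gc, of "{0..1}"]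
  continuous_sqi_on[of "\<lambda>t::real. x - y" "{0..1}"] by simp
 also have "nrm ?M (\<lambda>t. x - y) = norm (x - y)" by (simp add: nrm_def space_restrict_space measure_restrict_space)
 finally have "\<bar>\<psi> x - \<psi> y\<bar>^2 \<le> (nrm ?M ?g * norm (x - y))^2" by (intro power_mono) auto
 then have "ennreal ((\<psi> x - \<psi> y)^2) \<le> ennreal ((norm (x - y))^2 * (nrm ?M ?g)^2)"
  by (intro ennreal_leI) (simp add: power_mult_distrib mult.commute)
 then show ?thesis using nn_integral_continuous_sq[OF gc, of "{0..1}"] by (simp add: ennreal_mult)
qed

context star_polygon
begin

lemma emeasure_F_le: "emeasure lborel F \<le> ennreal (pi * h^2)"
proof -
 have "emeasure lborel F \<le> emeasure lborel (cball c h)" using F_sub_cball F_sub_closure by (intro emeasure_mono) auto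
 also have "\<dots> = ennreal (pi * h^2)" using h_pos by (simp add: emeasure_cball unit_ball_vol_2)
 finally show ?thesis .
qed

lemma emeasure_B: "emeasure lborel (ball c r) = ennreal (pi * r^2)"
 using r_pos by (simp add: emeasure_ball unit_ball_vol_2)

text \<open>Segments from \<open>F\<close> to the disc stay in \<open>F\<close>, so increments of
  \<open>\<psi>\<close> are line integrals of its gradient. Normalising the mean over the disc, and
  not over \<open>F\<close>, lets the average over \<open>y\<close> recover the square of
  \<open>\<psi> x\<close>. One factor \<open>h^2\<close> is the squared length of a segment, the
  other bounds an area; \<open>r^2\<close> is the area of the disc up to pi.\<close>

lemma poincare_inequality:
 assumes C: "C1 \<psi>" and z: "(LINT x|leb (ball c r). \<psi> x) = 0"
 shows "r^2 * (nrm (leb F) \<psi>)^2 \<le> 8 * h^4 * (nrm (leb F) (grad \<psi>))^2"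
proof -
 let ?B = "ball c r"
 define E where "E = (\<lambda>z. ennreal ((norm (grad \<psi> z))^2))"
 \<comment> \<open>Extension by zero loses nothing on the segments, and it lets the integral run
   over the whole plane after a substitution.\<close>
 define G where "G = (\<lambda>z. indicator F z * E z)"
 define N where "N = (nrm (leb F) (grad \<psi>))^2"
 have ob: "open F \<or> closed F" "bounded F" by (auto simp: open_domain bounded_domain)
 have [measurable]: "\<psi> \<in> borel_measurable borel" "grad \<psi> \<in> borel_measurable borel"
  by (intro cont_borel C1_continuous C1_grad_continuous C)+
 have [measurable]: "F \<in> sets borel" "?B \<in> sets borel" using ob open_domain by auto
 have [measurable]: "E \<in> borel_measurable borel" "G \<in> borel_measurable borel" unfolding E_def G_def by measurable
 have IG: "(\<integral>\<^sup>+z. G z \<partial>lborel) = ennreal N"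
  unfolding G_def E_def N_def by (rule nn_integral_continuous_sq[OF C1_grad_continuous[OF C] ob])
 define K where "K x y t = indicator F x * indicator ?B y * indicator {0..1} t * G (y + t *\<^sub>R (x - y))"
  for x y :: plane and t :: real
 have [measurable]: "(\<lambda>((x, y), t). K x y t) \<in> borel_measurable ((borel \<Otimes>\<^sub>M borel) \<Otimes>\<^sub>M borel)"
  unfolding K_def split_beta by measurable
 let ?V = "4 * ennreal N * (ennreal (pi * h^2) + ennreal (pi * r^2))"
 \<comment> \<open>For \<open>t \<ge> 1/2\<close> the point of the segment is substituted for
   \<open>x\<close>, otherwise for \<open>y\<close>; so the Jacobian degenerates at neither
   end.\<close>
 have bt: "(\<integral>\<^sup>+x. \<integral>\<^sup>+y. K x y t \<partial>lborel \<partial>lborel) \<le> indicator {0..1} t * ?V" for t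
 proof (cases "0 \<le> t \<and> t \<le> 1")
  case False
  then show ?thesis by (auto simp: K_def indicator_def)
 next
  case True
  have Kt: "K x y t \<le> indicator F x * indicator ?B y * G ((1-t) *\<^sub>R y + t *\<^sub>R x)" for x y
   using True by (simp add: K_def indicator_def algebra_simps)
  show ?thesis
  proof (cases "t \<ge> 1/2")
   case True
   have "(\<integral>\<^sup>+x. \<integral>\<^sup>+y. K x y t \<partial>lborel \<partial>lborel) = (\<integral>\<^sup>+y. \<integral>\<^sup>+x. K x y t \<partial>lborel \<partial>lborel)"
    by (rule lborel_pair.Fubini') (measurable, simp add: K_def, measurable)
   also have "\<dots> \<le> (\<integral>\<^sup>+y. indicator ?B y * (\<integral>\<^sup>+x. G ((1-t) *\<^sub>R y + t *\<^sub>R x) \<partial>lborel) \<partial>lborel)"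
   proof (intro nn_integral_mono)
    fix y
    have "(\<integral>\<^sup>+x. K x y t \<partial>lborel) \<le> (\<integral>\<^sup>+x. indicator ?B y * G ((1-t) *\<^sub>R y + t *\<^sub>R x) \<partial>lborel)"
     by (intro nn_integral_mono order_trans[OF Kt]) (auto simp: indicator_def)
    then show "(\<integral>\<^sup>+x. K x y t \<partial>lborel) \<le> indicator ?B y * (\<integral>\<^sup>+x. G ((1-t) *\<^sub>R y + t *\<^sub>R x) \<partial>lborel)"
     by (simp add: nn_integral_cmult)
   qed
   also have "\<dots> \<le> (\<integral>\<^sup>+y. indicator ?B y * (4 * ennreal N) \<partial>lborel)"
    unfolding IG[symmetric] using True by (intro nn_integral_mono mult_left_mono nn_integral_affine_le) auto
   also have "\<dots> = 4 * ennreal N * ennreal (pi * r^2)" by (simp add: nn_integral_multc emeasure_B mult.commute)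
   finally show ?thesis using \<open>0 \<le> t \<and> t \<le> 1\<close> by (simp add: distrib_left) (meson add_increasing order_trans zero_le)
  next
   case False
   have "(\<integral>\<^sup>+x. \<integral>\<^sup>+y. K x y t \<partial>lborel \<partial>lborel) \<le>
    (\<integral>\<^sup>+x. indicator F x * (\<integral>\<^sup>+y. G (t *\<^sub>R x + (1-t) *\<^sub>R y) \<partial>lborel) \<partial>lborel)"
   proof (intro nn_integral_mono)
    fix x
    have "(\<integral>\<^sup>+y. K x y t \<partial>lborel) \<le> (\<integral>\<^sup>+y. indicator F x * G (t *\<^sub>R x + (1-t) *\<^sub>R y) \<partial>lborel)"
     by (intro nn_integral_mono order_trans[OF Kt]) (auto simp: indicator_def add.commute)
    then show "(\<integral>\<^sup>+y. K x y t \<partial>lborel) \<le> indicator F x * (\<integral>\<^sup>+y. G (t *\<^sub>R x + (1-t) *\<^sub>R y) \<partial>lborel)"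
     by (simp add: nn_integral_cmult)
   qed
   also have "\<dots> \<le> (\<integral>\<^sup>+x. indicator F x * (4 * ennreal N) \<partial>lborel)"
    unfolding IG[symmetric] using False by (intro nn_integral_mono mult_left_mono nn_integral_affine_le) auto
   also have "\<dots> = 4 * ennreal N * emeasure lborel F" by (simp add: nn_integral_multc mult.commute)
   also have "\<dots> \<le> 4 * ennreal N * ennreal (pi * h^2)" by (intro mult_left_mono emeasure_F_le) auto
   finally show ?thesis using \<open>0 \<le> t \<and> t \<le> 1\<close> by (simp add: distrib_left) (meson add_increasing2 order_trans zero_le)
  qed
 qed
 have inc: "indicator F x * indicator ?B y * ennreal ((\<psi> x - \<psi> y)^2) \<le>
  ennreal (h^2) * (\<integral>\<^sup>+t. K x y t \<partial>lborel)" for x y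
 proof (cases "x \<in> F \<and> y \<in> ?B")
  case False then show ?thesis by (auto simp: indicator_def)
 next
  case True
  have yF: "y \<in> F" using True ball_sub by auto
  have K1: "K x y t = indicator {0..1} t * ennreal ((norm (grad \<psi> (y + t *\<^sub>R (x - y))))^2)" for t
  proof (cases "0 \<le> t \<and> t \<le> 1")
   case t: True
   have "y + t *\<^sub>R (x - y) \<in> closed_segment y x" using t unfolding closed_segment_def by (auto intro!: exI[of _ t] simp: algebra_simps)
   then have "y + t *\<^sub>R (x - y) \<in> F" using seg_sub[of y x] True by auto
   then show ?thesis using True by (simp add: K_def G_def E_def)
  qed (auto simp: K_def)
  have "ennreal ((\<psi> x - \<psi> y)^2) \<le> ennreal ((norm (x - y))^2) * (\<integral>\<^sup>+t. K x y t \<partial>lborel)"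
   unfolding K1 by (rule C1_increment_bound[OF C])
  also have "\<dots> \<le> ennreal (h^2) * (\<integral>\<^sup>+t. K x y t \<partial>lborel)"
   using dist_le_h[OF F_sub_closure F_sub_closure, of x y] True yF by (intro mult_right_mono ennreal_leI power_mono) auto
  finally show ?thesis using True by simp
 qed
 \<comment> \<open>As the mean over the disc is zero, the average of the squared increment is the
   square of \<open>\<psi> x\<close> plus a nonnegative term.\<close>
 have low: "ennreal (pi * r^2) * (indicator F x * ennreal ((norm (\<psi> x))^2)) \<le>
  (\<integral>\<^sup>+y. indicator F x * indicator ?B y * ennreal ((\<psi> x - \<psi> y)^2) \<partial>lborel)" for x
 proof -
  have ob': "open ?B \<or> closed ?B" "bounded ?B" by auto
  have c: "cont (\<lambda>y. \<psi> x - \<psi> y)" "cont \<psi>" by (intro continuous_intros C1_continuous C)+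
  have mB: "measure (leb ?B) ?B = pi * r^2" using emeasure_B by (simp add: measure_def emeasure_restrict_space emeasure_completion)
  interpret fB: finite_measure "leb ?B" by (rule finite_measure_lebesgue_on[OF ob'])
  have i: "integrable (leb ?B) \<psi>" "integrable (leb ?B) (\<lambda>y. (\<psi> y)^2)"
   by (intro continuous_integrable_on[OF _ ob'] continuous_intros c)+
  have "(nrm (leb ?B) (\<lambda>y. \<psi> x - \<psi> y))^2 =
   (LINT y|leb ?B. (\<psi> x)^2 - 2 * \<psi> x * \<psi> y + (\<psi> y)^2)"
   unfolding nrm_sq by (simp add: power2_diff algebra_simps)
  also have "\<dots> = (LINT y|leb ?B. (\<psi> x)^2) + (LINT y|leb ?B. (\<psi> y)^2)" using i z by simp
  also have "\<dots> \<ge> pi * r^2 * (\<psi> x)^2" using mB by (simp add: space_restrict_space)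
  finally have "ennreal (pi * r^2 * (\<psi> x)^2) \<le> ennreal ((nrm (leb ?B) (\<lambda>y. \<psi> x - \<psi> y))^2)" by (rule ennreal_leI)
  also have "\<dots> = (\<integral>\<^sup>+y. indicator ?B y * ennreal ((\<psi> x - \<psi> y)^2) \<partial>lborel)"
   using nn_integral_continuous_sq[OF c(1) ob'] by simp
  finally show ?thesis by (simp add: indicator_def ennreal_mult mult.assoc)
 qed
 have "ennreal (pi * r^2) * ennreal ((nrm (leb F) \<psi>)^2) =
  (\<integral>\<^sup>+x. ennreal (pi * r^2) * (indicator F x * ennreal ((norm (\<psi> x))^2)) \<partial>lborel)"
  using nn_integral_continuous_sq[OF C1_continuous[OF C] ob] by (simp add: nn_integral_cmult)
 also have "\<dots> \<le> (\<integral>\<^sup>+x. \<integral>\<^sup>+y. ennreal (h^2) * (\<integral>\<^sup>+t. K x y t \<partial>lborel) \<partial>lborel \<partial>lborel)"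
  by (intro nn_integral_mono order_trans[OF low] inc)
 also have "\<dots> = ennreal (h^2) * (\<integral>\<^sup>+x. \<integral>\<^sup>+y. \<integral>\<^sup>+t. K x y t \<partial>lborel \<partial>lborel \<partial>lborel)"
 proof -
  have m1: "(\<lambda>y. \<integral>\<^sup>+t. K x y t \<partial>lborel) \<in> borel_measurable lborel" for x unfolding K_def by measurable
  have m2: "(\<lambda>x. \<integral>\<^sup>+y. \<integral>\<^sup>+t. K x y t \<partial>lborel \<partial>lborel) \<in> borel_measurable lborel"
   unfolding K_def by measurable
  show ?thesis by (simp only: nn_integral_cmult[OF m1] nn_integral_cmult[OF m2])
 qed
 also have "(\<integral>\<^sup>+x. \<integral>\<^sup>+y. \<integral>\<^sup>+t. K x y t \<partial>lborel \<partial>lborel \<partial>lborel) =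
  (\<integral>\<^sup>+x. \<integral>\<^sup>+t. \<integral>\<^sup>+y. K x y t \<partial>lborel \<partial>lborel \<partial>lborel)"
  by (intro nn_integral_cong lborel_pair.Fubini') (simp add: K_def)
 also have "\<dots> = (\<integral>\<^sup>+t. \<integral>\<^sup>+x. \<integral>\<^sup>+y. K x y t \<partial>lborel \<partial>lborel \<partial>lborel)"
  by (intro lborel_pair.Fubini') (simp add: K_def)
 also have "\<dots> \<le> (\<integral>\<^sup>+t. indicator {0..1::real} t * ?V \<partial>lborel)" by (rule nn_integral_mono) (rule bt)
 also have "\<dots> = ?V" by (simp add: nn_integral_multc)
 finally have "ennreal (pi * r^2) * ennreal ((nrm (leb F) \<psi>)^2) \<le> ennreal (h^2) * ?V" by (simp add: mult_left_mono)
 also have "\<dots> = ennreal (h^2 * (4 * N * (pi * h^2 + pi * r^2)))" by (simp add: ennreal_mult N_def)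
 finally have "pi * r^2 * (nrm (leb F) \<psi>)^2 \<le> h^2 * (4 * N * (pi * h^2 + pi * r^2))" by (simp add: N_def flip: ennreal_mult)
 also have "\<dots> \<le> h^2 * (4 * N * (pi * h^2 + pi * h^2))"
  using r_le_h r_pos by (intro mult_left_mono add_left_mono power_mono) (auto simp: N_def)
 also have "\<dots> = pi * (8 * h^4 * N)" by (simp add: algebra_simps power2_eq_square power4_eq_xxxx)
 finally show ?thesis by (simp add: N_def mult.assoc)
qed

end

section \<open>Density of bounded continuous functions in L2\<close>

lemma integrable_sq_bound_conv:
 fixes u :: "nat => 'a => real"
 assumes [measurable]: "\<And>m. u m \<in> borel_measurable M" and w: "integrable M w"
 and b: "\<And>m. AE x in M. (u m x)^2 \<le> w x" and l: "AE x in M. (\<lambda>m. u m x) \<longlonglongrightarrow> 0"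
 shows "(\<lambda>m. nrm M (u m)) \<longlonglongrightarrow> 0"
proof -
 have "(\<lambda>m. LINT x|M. (u m x)^2) \<longlonglongrightarrow> (LINT x|M. 0)"
 proof (rule integral_dominated_convergence[where w=w])
  show "AE x in M. (\<lambda>m. (u m x)^2) \<longlonglongrightarrow> 0" using l by (rule eventually_mono) (auto dest: tendsto_power[where n=2])
 qed (use b w in \<open>auto\<close>)
 then have "(\<lambda>m. sqrt (LINT x|M. (u m x)^2)) \<longlonglongrightarrow> sqrt 0" by (intro tendsto_real_sqrt) simp
 then show ?thesis by (simp add: nrm_def)
qed

text \<open>Measurability supplies continuous functions converging almost everywhere, but without
  any bound. Truncating \<open>f\<close>, and the approximants at the same level, makes dominated
  convergence applicable.\<close>

lemma L2_approx_continuous: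
 fixes f :: "'a::euclidean_space => real"
 assumes f: "sqi (leb S) f" and S: "open S \<or> closed S" "bounded S" and e: "e > 0"
 shows "\<exists>g M. cont g \<and> (\<forall>x. \<bar>g x\<bar> \<le> M) \<and> nrm (leb S) (\<lambda>x. f x - g x) < e"
proof -
 have Sl: "S \<in> sets lebesgue" using S by (auto simp: borel_open borel_closed)
 interpret finite_measure "leb S" by (rule finite_measure_lebesgue_on[OF S])
 have fm[measurable]: "f \<in> borel_measurable (leb S)" using f by (rule sqi_meas)
 define cl where "cl M y = max (- real M) (min y (real M))" for M and y :: real
 have clb: "\<bar>cl M y\<bar> \<le> real M" for M y by (auto simp: cl_def)
 have clc: "cont (cl M)" for M unfolding cl_def[abs_def] by (intro continuous_intros)
 have [measurable]: "cl M \<in> borel_measurable borel" for M using clc by (rule cont_borel)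
 have lim1: "(\<lambda>M. cl M y) \<longlonglongrightarrow> y" for y
 proof (rule tendsto_eventually)
  obtain M0 where "real M0 \<ge> \<bar>y\<bar>" using real_arch_simple by blast
  then show "eventually (\<lambda>M. cl M y = y) sequentially" by (intro eventually_sequentiallyI[of M0]) (auto simp: cl_def)
 qed
 have cld: "\<bar>y - cl M y\<bar> \<le> \<bar>y\<bar>" for M y by (auto simp: cl_def)
 have "(\<lambda>M. nrm (leb S) (\<lambda>x. f x - cl M (f x))) \<longlonglongrightarrow> 0"
 proof (rule integrable_sq_bound_conv)
  show "integrable (leb S) (\<lambda>x. (f x)^2)" using sqi_int[OF f] by simp
  show "AE x in leb S. (f x - cl M (f x))^2 \<le> (f x)^2" for M using cld by (auto simp: abs_le_square_iff)
  show "AE x in leb S. (\<lambda>M. f x - cl M (f x)) \<longlonglongrightarrow> 0"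
  proof (rule AE_I2)
   fix x show "(\<lambda>M. f x - cl M (f x)) \<longlonglongrightarrow> 0"
    using tendsto_diff[OF tendsto_const[of "f x"] lim1[of "f x"]] by simp
  qed
 qed measurable
 then have "eventually (\<lambda>M. nrm (leb S) (\<lambda>x. f x - cl M (f x)) < e/2) sequentially" using e by (intro order_tendstoD) auto
 then obtain M where M: "nrm (leb S) (\<lambda>x. f x - cl M (f x)) < e/2" by (auto simp: eventually_sequentially)
 obtain N g where N: "negligible N" and gc: "\<And>m. cont (g m)"
  and gl: "\<And>x. x \<notin> N ==> (\<lambda>m. g m x) \<longlonglongrightarrow> (if x \<in> S then f x else 0)"
  using fm unfolding measurable_on_iff_borel_measurable[OF Sl, symmetric] measurable_on_def by blast
 have gc': "cont (\<lambda>x. cl M (g m x))" for m by (rule continuous_on_compose2[OF clc gc]) auto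
 have [measurable]: "(\<lambda>x. cl M (g m x)) \<in> borel_measurable (leb S)" for m by (rule cont_measurable[OF gc'])
 have "(\<lambda>m. nrm (leb S) (\<lambda>x. cl M (f x) - cl M (g m x))) \<longlonglongrightarrow> 0"
 proof (rule integrable_sq_bound_conv)
  show "integrable (leb S) (\<lambda>x. (2 * real M)^2)" by simp
  show "AE x in leb S. (cl M (f x) - cl M (g m x))^2 \<le> (2 * real M)^2" for m
  proof (rule AE_I2)
   fix x show "(cl M (f x) - cl M (g m x))^2 \<le> (2 * real M)^2"
    using clb[of M "f x"] clb[of M "g m x"] unfolding abs_le_square_iff[symmetric] by auto
  qed
  have "AE x in lebesgue. x \<notin> N" using N by (intro AE_not_in) (simp add: negligible_iff_null_sets)
  then have "AE x in leb S. x \<notin> N" using Sl by (auto simp: AE_restrict_space_iff elim: eventually_mono)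
  then show "AE x in leb S. (\<lambda>m. cl M (f x) - cl M (g m x)) \<longlonglongrightarrow> 0"
  proof (rule AE_mp, intro AE_I2 impI)
   fix x assume x: "x \<in> space (leb S)" "x \<notin> N"
   then have "(\<lambda>m. g m x) \<longlonglongrightarrow> f x" using gl[of x] by (simp add: space_restrict_space)
   moreover have "isCont (cl M) (f x)" using clc by (simp add: continuous_on_eq_continuous_at)
   ultimately have "(\<lambda>m. cl M (g m x)) \<longlonglongrightarrow> cl M (f x)" by (metis isCont_tendsto_compose)
   then show "(\<lambda>m. cl M (f x) - cl M (g m x)) \<longlonglongrightarrow> 0" using tendsto_diff[OF tendsto_const[of "cl M (f x)"]] by fastforce
  qed
 qed measurable
 then have "eventually (\<lambda>m. nrm (leb S) (\<lambda>x. cl M (f x) - cl M (g m x)) < e/2) sequentially" using e by (intro order_tendstoD) auto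
 then obtain m where m: "nrm (leb S) (\<lambda>x. cl M (f x) - cl M (g m x)) < e/2" by (auto simp: eventually_sequentially)
 have "(\<lambda>x. cl M (f x)) \<in> borel_measurable (leb S)" by measurable
 then have s1: "sqi (leb S) (\<lambda>x. cl M (f x))" by (rule nrm_le_sup(1)[where C="real M"]) (use clb finite_measure_axioms in auto)
 have s2: "sqi (leb S) (\<lambda>x. cl M (g m x))" by (rule continuous_sqi_on[OF gc' S])
 have "nrm (leb S) (\<lambda>x. (f x - cl M (f x)) + (cl M (f x) - cl M (g m x))) < e"
  using nrm_triangle[OF sqi_diff[OF f s1] sqi_diff[OF s1 s2]] M m by linarith
 then have "nrm (leb S) (\<lambda>x. f x - cl M (g m x)) < e" by simp
 then show ?thesis using gc' clb by blast
qed

section \<open>Smoothing and potentials\<close>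

text \<open>Squaring makes the positive part continuously differentiable. All cut-off functions
  below are built from it, since test functions only have to be \<open>C1\<close>.\<close>

lemma pos_sq_deriv: "((\<lambda>u::real. (max 0 u)^2) has_real_derivative 2 * max 0 u) (at u)"
proof -
 consider "u > 0" | "u < 0" | "u = 0" by linarith
 then show ?thesis
 proof cases
  case 1
  have "((\<lambda>u::real. u^2) has_real_derivative 2 * max 0 u) (at u)" using 1 by (auto intro!: derivative_eq_intros)
  then show ?thesis by (rule has_field_derivative_transform_within_open[of _ _ _ "{0<..}"]) (use 1 in auto)
 next
  case 2
  have "((\<lambda>u::real. 0) has_real_derivative 2 * max 0 u) (at u)" using 2 by (auto intro!: derivative_eq_intros)
  then show ?thesis by (rule has_field_derivative_transform_within_open[of _ _ _ "{..<0}"]) (use 2 in auto)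
 next
  case 3
  have "(\<lambda>y::real. ((max 0 y)^2 - 0) / (y - 0)) \<midarrow>0\<rightarrow> 0"
  proof (rule Lim_null_comparison)
   show "eventually (\<lambda>y::real. norm (((max 0 y)^2 - 0) / (y - 0)) \<le> \<bar>y\<bar>) (at 0)"
    by (rule always_eventually) (auto simp: max_def power2_eq_square)
   show "(\<lambda>y::real. \<bar>y\<bar>) \<midarrow>0\<rightarrow> 0" by (rule tendsto_eq_intros | simp)+
  qed
  then show ?thesis using 3 by (simp add: has_field_derivative_iff)
 qed
qed

lemma C1_pos_sq:
 assumes "C1 f"
 shows "C1 (\<lambda>x. (max 0 (f x))^2)" "grad (\<lambda>x. (max 0 (f x))^2) = (\<lambda>x. (2 * max 0 (f x)) *\<^sub>R grad f x)"
proof -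
 have "((\<lambda>x. (max 0 (f x))^2) has_derivative (\<lambda>d. ((2 * max 0 (f x)) *\<^sub>R grad f x) \<bullet> d)) (at x)" for x
  using has_derivative_compose[OF C1_has_derivative[OF assms]
  pos_sq_deriv[of "f x", unfolded has_field_derivative_def]] by simp
 moreover have "cont (\<lambda>x. (2 * max 0 (f x)) *\<^sub>R grad f x)" using assms by (intro continuous_intros C1_grad_continuous C1_continuous)
 ultimately show "C1 (\<lambda>x. (max 0 (f x))^2)" "grad (\<lambda>x. (max 0 (f x))^2) = (\<lambda>x. (2 * max 0 (f x)) *\<^sub>R grad f x)"
  by (fact C1I)+
qed

definition bump :: "plane => real => plane => real" where
 "bump a s x = (max 0 (s^2 - (norm (x - a))^2))^2"

lemma C1_quad:
 shows "C1 (\<lambda>x. s - (norm (x - a))^2)" "grad (\<lambda>x. s - (norm (x - a))^2) = (\<lambda>x. (-2) *\<^sub>R (x - a))"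
proof -
 have "((\<lambda>x. s - (norm (x - a))^2) has_derivative (\<lambda>d. ((-2) *\<^sub>R (x - a)) \<bullet> d)) (at x)" for x
  unfolding power2_norm_eq_inner by (auto intro!: derivative_eq_intros simp: inner_commute)
 moreover have "cont (\<lambda>x. (-2) *\<^sub>R (x - a))" by (intro continuous_intros)
 ultimately show "C1 (\<lambda>x. s - (norm (x - a))^2)" "grad (\<lambda>x. s - (norm (x - a))^2) = (\<lambda>x. (-2) *\<^sub>R (x - a))"
  by (fact C1I)+
qed

lemma C1_bump: "C1 (bump a s)"
 and grad_bump: "grad (bump a s) = (\<lambda>x. (- 4 * max 0 (s^2 - (norm (x - a))^2)) *\<^sub>R (x - a))"
 using C1_pos_sq[OF C1_quad(1)[of "s^2" a]] C1_quad(2)[of "s^2" a] by (simp_all add: bump_def[abs_def])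

lemma bump_nonneg: "0 \<le> bump a s x" by (simp add: bump_def)

lemma sq_norm_le_iff: "s \<ge> 0 ==> s\<^sup>2 - (norm x)^2 \<le> 0 \<longleftrightarrow> s \<le> norm x"
 by (metis diff_le_0_iff_le norm_ge_zero power2_le_imp_le power_mono)

lemma bump_zero: "s \<ge> 0 ==> s \<le> norm (x - a) ==> bump a s x = 0"
 and grad_bump_zero: "s \<ge> 0 ==> s \<le> norm (x - a) ==> grad (bump a s) x = 0"
 by (simp_all add: bump_def grad_bump sq_norm_le_iff max_absorb1)

lemma bump_pos: "s \<ge> 0 ==> norm (x - a) < s ==> bump a s x > 0"
 using sq_norm_le_iff[of s "x - a"] by (auto simp: bump_def max_def not_le)

lemma bump_le: "s \<ge> 0 ==> bump a s x \<le> s^4"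
proof -
 assume "s \<ge> 0"
 have "(max 0 (s^2 - (norm (x - a))^2))^2 \<le> (s^2)^2" by (intro power_mono) auto
 then show ?thesis by (simp add: bump_def)
qed

lemma uniformly_continuous_compact_support:
 fixes g :: "'a::euclidean_space => 'b::real_normed_vector"
 assumes g: "cont g" and z: "\<And>x. s \<le> norm (x - a) ==> g x = 0" and e: "e > 0"
 shows "\<exists>d>0. \<forall>x y. norm (y - x) < d --> norm (g y - g x) < e"
proof -
 have "uniformly_continuous_on (cball a (s + 1)) g" by (intro compact_uniformly_continuous continuous_on_subset[OF g]) auto
 then obtain d where d: "d > 0" "\<And>x y. x \<in> cball a (s+1) ==> y \<in> cball a (s+1) ==> dist y x < d ==> dist (g y) (g x) < e"
  using e unfolding uniformly_continuous_on_def by metis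
 have "norm (g y - g x) < e" if "norm (y - x) < min d 1" for x y
 proof (cases "x \<in> cball a (s+1) \<and> y \<in> cball a (s+1)")
  case True then show ?thesis using d(2)[of x y] that by (simp add: dist_norm)
 next
  case False
  have "norm (x - a) \<le> norm (y - a) + norm (y - x)" "norm (y - a) \<le> norm (x - a) + norm (y - x)"
   using norm_triangle_ineq[of "y - a" "x - y"] norm_triangle_ineq[of "x - a" "y - x"] by (simp_all add: norm_minus_commute)
  then have "s \<le> norm (x - a)" "s \<le> norm (y - a)" using False that by (auto simp: dist_norm norm_minus_commute)
  then show ?thesis using z e by simp
 qed
 then show ?thesis using d(1) by (intro exI[of _ "min d 1"]) auto
qed

lemma C1_linearization:
 assumes C: "C1 \<phi>" and e: "\<And>u. norm (u - x) \<le> norm (y - x) ==> norm (grad \<phi> u - grad \<phi> x) \<le> e"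
 shows "\<bar>\<phi> y - \<phi> x - grad \<phi> x \<bullet> (y - x)\<bar> \<le> e * norm (y - x)"
proof -
 have "\<exists>t::real. 0 < t \<and> t < 1 \<and> (\<lambda>t. \<phi> (x + t *\<^sub>R (y - x))) 1 - (\<lambda>t. \<phi> (x + t *\<^sub>R (y - x))) 0 =
  (1 - 0) * (grad \<phi> (x + t *\<^sub>R (y - x)) \<bullet> (y - x))"
  by (rule MVT2) (auto intro: C1_ray_derivative[OF C])
 then obtain t :: real where t: "0 < t" "t < 1"
  "\<phi> y - \<phi> x = grad \<phi> (x + t *\<^sub>R (y - x)) \<bullet> (y - x)" by auto
 have "\<bar>\<phi> y - \<phi> x - grad \<phi> x \<bullet> (y - x)\<bar> = \<bar>(grad \<phi> (x + t *\<^sub>R (y - x)) - grad \<phi> x) \<bullet> (y - x)\<bar>"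
  by (simp add: t inner_diff_left)
 also have "\<dots> \<le> norm (grad \<phi> (x + t *\<^sub>R (y - x)) - grad \<phi> x) * norm (y - x)" by (rule Cauchy_Schwarz_ineq2)
 also have "\<dots> \<le> e * norm (y - x)" using t by (intro mult_right_mono e) (auto simp: mult_left_le_one_le)
 finally show ?thesis .
qed

lemma LINT_norm_bound:
 fixes f :: "'a => 'b::{banach, second_countable_topology}"
 assumes "integrable M f" "integrable M g" "\<And>x. norm (f x) \<le> g x"
 shows "norm (LINT x|M. f x) \<le> (LINT x|M. g x)"
proof -
 have "norm (LINT x|M. f x) \<le> (LINT x|M. norm (f x))" by (rule Bochner_Integration.integral_norm_bound)
 also have "\<dots> \<le> (LINT x|M. g x)" using assms by (intro integral_mono) auto
 finally show ?thesis .
qed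

text \<open>Differentiation under the integral for a merely integrable \<open>w\<close>: uniform
  continuity of \<open>grad \<phi>\<close> bounds the remainder of the linearisation uniformly in
  \<open>z\<close>. The scalings \<open>a\<close> and \<open>b\<close> fit the contracted mollifier,
  whose kernel depends on \<open>x\<close> through \<open>b *\<^sub>R x\<close>.\<close>

lemma convolution_C1:
 fixes w :: "plane => real"
 assumes w: "integrable lborel w" and C: "C1 \<phi>" and z: "\<And>x. s \<le> norm (x - p) ==> grad \<phi> x = 0"
 and pb: "\<And>x. \<bar>\<phi> x\<bar> \<le> M"
 shows "integrable lborel (\<lambda>z. w z * \<phi> (a *\<^sub>R z + b *\<^sub>R x))"
 and "integrable lborel (\<lambda>z. (b * w z) *\<^sub>R grad \<phi> (a *\<^sub>R z + b *\<^sub>R x))"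
 and "C1 (\<lambda>x. LINT z|lborel. w z * \<phi> (a *\<^sub>R z + b *\<^sub>R x))"
 and "grad (\<lambda>x. LINT z|lborel. w z * \<phi> (a *\<^sub>R z + b *\<^sub>R x)) =
 (\<lambda>x. LINT z|lborel. (b * w z) *\<^sub>R grad \<phi> (a *\<^sub>R z + b *\<^sub>R x))"
proof -
 have [measurable]: "\<phi> \<in> borel_measurable borel" "grad \<phi> \<in> borel_measurable borel"
  by (intro cont_borel C1_continuous C1_grad_continuous C)+
 have [measurable]: "w \<in> borel_measurable borel" using w by (simp add: borel_measurable_integrable)
 have wa: "integrable lborel (\<lambda>z. \<bar>w z\<bar>)" using w by simp
 show i1: "integrable lborel (\<lambda>z. w z * \<phi> (a *\<^sub>R z + b *\<^sub>R x))" for x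
 proof (rule Bochner_Integration.integrable_bound[of _ "\<lambda>z. \<bar>w z\<bar> * M"])
  show "integrable lborel (\<lambda>z. \<bar>w z\<bar> * M)" using wa by simp
  show "AE z in lborel. norm (w z * \<phi> (a *\<^sub>R z + b *\<^sub>R x)) \<le> norm (\<bar>w z\<bar> * M)"
  proof (rule AE_I2)
   fix z
   have "\<bar>w z\<bar> * \<bar>\<phi> (a *\<^sub>R z + b *\<^sub>R x)\<bar> \<le> \<bar>w z\<bar> * M" by (intro mult_left_mono pb) auto
   then show "norm (w z * \<phi> (a *\<^sub>R z + b *\<^sub>R x)) \<le> norm (\<bar>w z\<bar> * M)"
    using order_trans[OF abs_ge_zero pb[of 0]] by (simp add: abs_mult)
  qed
 qed measurable
 obtain G where G: "G > 0" "\<And>x. norm (grad \<phi> x) \<le> G"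
 proof -
  obtain G where G: "G > 0" "\<And>x. x \<in> cball p s ==> norm (grad \<phi> x) \<le> G"
   using continuous_bounded_on[OF C1_grad_continuous[OF C], of "cball p s"] by auto
  have "norm (grad \<phi> x) \<le> G" for x using G(2)[of x] z[of x] G(1) by (cases "s \<le> norm (x - p)") (auto simp: dist_norm norm_minus_commute)
  then show ?thesis using G that by blast
 qed
 have bG: "norm ((b * w z) *\<^sub>R grad \<phi> y) \<le> \<bar>b\<bar> * G * \<bar>w z\<bar>" for z y
  using mult_left_mono[OF G(2)[of y], of "\<bar>b * w z\<bar>"] by (simp add: abs_mult ac_simps)
 show i2: "integrable lborel (\<lambda>z. (b * w z) *\<^sub>R grad \<phi> (a *\<^sub>R z + b *\<^sub>R x))" for x
 proof (rule Bochner_Integration.integrable_bound[of _ "\<lambda>z. \<bar>b\<bar> * G * \<bar>w z\<bar>"])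
  show "integrable lborel (\<lambda>z. \<bar>b\<bar> * G * \<bar>w z\<bar>)" using wa by simp
  show "(\<lambda>z. (b * w z) *\<^sub>R grad \<phi> (a *\<^sub>R z + b *\<^sub>R x)) \<in> borel_measurable lborel" by measurable
  show "AE z in lborel. norm ((b * w z) *\<^sub>R grad \<phi> (a *\<^sub>R z + b *\<^sub>R x)) \<le> norm (\<bar>b\<bar> * G * \<bar>w z\<bar>)"
   using order_trans[OF bG] by (intro AE_I2) simp
 qed
 define K where "K x = (LINT z|lborel. w z * \<phi> (a *\<^sub>R z + b *\<^sub>R x))" for x
 define V where "V x = (LINT z|lborel. (b * w z) *\<^sub>R grad \<phi> (a *\<^sub>R z + b *\<^sub>R x))" for x
 \<comment> \<open>The final summand 1 keeps \<open>I\<close> positive even if \<open>w\<close>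
   vanishes, so that \<open>e / I\<close> is a positive tolerance.\<close>
 define I where "I = (LINT z|lborel. \<bar>w z\<bar>) * (\<bar>b\<bar> + 1) + 1"
 have W0: "0 \<le> (LINT z|lborel. \<bar>w z\<bar>)" by simp
 have I1: "I > 0" using W0 by (simp add: I_def add_nonneg_pos)
 have bI: "(LINT z|lborel. \<bar>w z\<bar>) * \<bar>b\<bar> \<le> I" using W0 by (simp add: I_def distrib_left)
 have unif: "\<exists>d>0. \<forall>x y. norm (y - x) < d --> norm (grad \<phi> y - grad \<phi> x) < e" if "e > 0" for e
  by (rule uniformly_continuous_compact_support[OF C1_grad_continuous[OF C] z that])
 have der: "(K has_derivative (\<lambda>d. V x \<bullet> d)) (at x)" for x unfolding has_derivative_at_alt
 proof (intro conjI allI impI)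
  show "bounded_linear (\<lambda>d. V x \<bullet> d)" by (rule bounded_linear_inner_right)
  fix e :: real assume "e > 0"
  then have "e / I > 0" using I1 by simp
  then obtain d where d: "d > 0" "\<And>x y. norm (y - x) < d ==> norm (grad \<phi> y - grad \<phi> x) < e / I" using unif by blast
  have "norm (K y - K x - V x \<bullet> (y - x)) \<le> e * norm (y - x)" if y: "norm (y - x) < d / (\<bar>b\<bar> + 1)" for y
  proof -
   have bd: "norm (b *\<^sub>R (y - x)) < d"
   proof -
    have "\<bar>b\<bar> * norm (y - x) \<le> (\<bar>b\<bar> + 1) * norm (y - x)" by (intro mult_right_mono) auto
    also have "\<dots> < d" using y by (simp add: pos_less_divide_eq mult.commute add_nonneg_pos)
    finally show ?thesis by simp
   qed
   let ?R = "\<lambda>z. \<phi> (a *\<^sub>R z + b *\<^sub>R y) - \<phi> (a *\<^sub>R z + b *\<^sub>R x) - b * (grad \<phi> (a *\<^sub>R z + b *\<^sub>R x) \<bullet> (y - x))"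
   have R: "\<bar>?R z\<bar> \<le> e / I * (\<bar>b\<bar> * norm (y - x))" for z
   proof -
    have yx: "a *\<^sub>R z + b *\<^sub>R y - (a *\<^sub>R z + b *\<^sub>R x) = b *\<^sub>R (y - x)" by (simp add: algebra_simps)
    have "\<bar>\<phi> (a *\<^sub>R z + b *\<^sub>R y) - \<phi> (a *\<^sub>R z + b *\<^sub>R x) - grad \<phi> (a *\<^sub>R z + b *\<^sub>R x) \<bullet> (a *\<^sub>R z + b *\<^sub>R y - (a *\<^sub>R z + b *\<^sub>R x))\<bar>
     \<le> e / I * norm (a *\<^sub>R z + b *\<^sub>R y - (a *\<^sub>R z + b *\<^sub>R x))"
    proof (rule C1_linearization[OF C])
     fix u assume "norm (u - (a *\<^sub>R z + b *\<^sub>R x)) \<le> norm (a *\<^sub>R z + b *\<^sub>R y - (a *\<^sub>R z + b *\<^sub>R x))"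
     then have "norm (u - (a *\<^sub>R z + b *\<^sub>R x)) < d" using bd unfolding yx by linarith
     then show "norm (grad \<phi> u - grad \<phi> (a *\<^sub>R z + b *\<^sub>R x)) \<le> e / I" by (intro less_imp_le d(2))
    qed
    then show ?thesis unfolding yx by simp
   qed
   have "K y - K x - V x \<bullet> (y - x) = (LINT z|lborel. w z * ?R z)"
   proof -
    have "V x \<bullet> (y - x) = (LINT z|lborel. ((b * w z) *\<^sub>R grad \<phi> (a *\<^sub>R z + b *\<^sub>R x)) \<bullet> (y - x))"
     unfolding V_def using i2 by (rule integral_inner_left[symmetric])
    then have "K y - K x - V x \<bullet> (y - x) = (LINT z|lborel. w z * \<phi> (a *\<^sub>R z + b *\<^sub>R y) - w z * \<phi> (a *\<^sub>R z + b *\<^sub>R x)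
     - ((b * w z) *\<^sub>R grad \<phi> (a *\<^sub>R z + b *\<^sub>R x)) \<bullet> (y - x))"
     unfolding K_def using i1 integrable_inner_left[OF i2] by simp
    also have "\<dots> = (LINT z|lborel. w z * ?R z)" by (rule LINT_cong) (auto simp: algebra_simps)
    finally show ?thesis .
   qed
   also have "norm \<dots> \<le> (LINT z|lborel. \<bar>w z\<bar> * (e / I * (\<bar>b\<bar> * norm (y - x))))"
   proof (rule LINT_norm_bound)
    show "integrable lborel (\<lambda>z. w z * ?R z)"
    proof (rule Bochner_Integration.integrable_bound)
     show "integrable lborel (\<lambda>z. \<bar>w z\<bar> * (e / I * (\<bar>b\<bar> * norm (y - x))))" using wa by simp
     show "AE z in lborel. norm (w z * ?R z) \<le> norm (\<bar>w z\<bar> * (e / I * (\<bar>b\<bar> * norm (y - x))))"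
     proof (rule AE_I2)
      fix z show "norm (w z * ?R z) \<le> norm (\<bar>w z\<bar> * (e / I * (\<bar>b\<bar> * norm (y - x))))"
       using mult_left_mono[OF R[of z], of "\<bar>w z\<bar>"] \<open>e > 0\<close> I1 by (simp add: abs_mult)
     qed
    qed measurable
    show "integrable lborel (\<lambda>z. \<bar>w z\<bar> * (e / I * (\<bar>b\<bar> * norm (y - x))))" using wa by simp
    show "norm (w z * ?R z) \<le> \<bar>w z\<bar> * (e / I * (\<bar>b\<bar> * norm (y - x)))" for z
     using mult_left_mono[OF R[of z], of "\<bar>w z\<bar>"] by (simp add: abs_mult)
   qed
   also have "\<dots> = ((LINT z|lborel. \<bar>w z\<bar>) * \<bar>b\<bar>) * (e / I * norm (y - x))" by simp
   also have "\<dots> \<le> I * (e / I * norm (y - x))" using \<open>e > 0\<close> I1 by (intro mult_right_mono bI) auto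
   also have "\<dots> = e * norm (y - x)" using I1 by simp
   finally show ?thesis .
  qed
  moreover have "d / (\<bar>b\<bar> + 1) > 0" using d by (simp add: add_nonneg_pos)
  ultimately show "\<exists>d>0. \<forall>y. norm (y - x) < d --> norm (K y - K x - V x \<bullet> (y - x)) \<le> e * norm (y - x)" by blast
 qed
 have cont: "cont V" unfolding continuous_on_sequentially
 proof (intro allI ballI impI)
  fix u :: "nat => plane" and y assume u: "(\<forall>m. u m \<in> UNIV) \<and> u \<longlonglongrightarrow> y"
  show "(V \<circ> u) \<longlonglongrightarrow> V y" unfolding V_def o_def
  proof (rule integral_dominated_convergence[where w="\<lambda>z. \<bar>b\<bar> * G * \<bar>w z\<bar>"])
   have "isCont (grad \<phi>) x" for x using C1_grad_continuous[OF C, of UNIV] by (simp add: continuous_on_eq_continuous_at)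
   then show "AE z in lborel. (\<lambda>m. (b * w z) *\<^sub>R grad \<phi> (a *\<^sub>R z + b *\<^sub>R u m)) \<longlonglongrightarrow> (b * w z) *\<^sub>R grad \<phi> (a *\<^sub>R z + b *\<^sub>R y)"
    using u by (intro AE_I2 tendsto_scaleR tendsto_const isCont_tendsto_compose[of _ "grad \<phi>"] tendsto_add) auto
  qed (use wa bG in auto)
 qed
 show "C1 (\<lambda>x. LINT z|lborel. w z * \<phi> (a *\<^sub>R z + b *\<^sub>R x))"
  "grad (\<lambda>x. LINT z|lborel. w z * \<phi> (a *\<^sub>R z + b *\<^sub>R x)) =
  (\<lambda>x. LINT z|lborel. (b * w z) *\<^sub>R grad \<phi> (a *\<^sub>R z + b *\<^sub>R x))"
  using C1I[OF der cont] by (simp_all add: K_def[abs_def] V_def[abs_def])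
qed

text \<open>The Poincare lemma with line integrals from \<open>c\<close>. The components live on the
  whole plane but are rotation-free only in \<open>F\<close>, so the curl condition is asked just on
  the segment to the point \<open>x\<close> at which the gradient is computed.\<close>

lemma radial_potential:
 assumes U: "C1 u1" "C1 u2"
 and curlfree: "\<And>s. 0 \<le> s ==> s \<le> 1 ==> grad u2 (c + s *\<^sub>R (x - c)) $ 1 = grad u1 (c + s *\<^sub>R (x - c)) $ 2"
 defines "\<psi> \<equiv> \<lambda>x. integral (cbox 0 1) (\<lambda>s. u1 (c + s *\<^sub>R (x - c)) * (x - c) $ 1 + u2 (c + s *\<^sub>R (x - c)) * (x - c) $ 2)"
 shows "C1 \<psi>" "grad \<psi> x = mk (u1 x) (u2 x)"
proof -
 define P where "P = (\<lambda>y s. u1 (c + s *\<^sub>R (y - c)) * (y - c) $ 1 + u2 (c + s *\<^sub>R (y - c)) * (y - c) $ 2)"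
 define Q where "Q = (\<lambda>y s. ((y - c) $ 1 * s) *\<^sub>R grad u1 (c + s *\<^sub>R (y - c)) + u1 (c + s *\<^sub>R (y - c)) *\<^sub>R axis 1 1
  + ((y - c) $ 2 * s) *\<^sub>R grad u2 (c + s *\<^sub>R (y - c)) + u2 (c + s *\<^sub>R (y - c)) *\<^sub>R axis 2 (1::real))"
 have nth: "((\<lambda>y. (y - c) $ i) has_derivative (\<lambda>d. d $ i)) (at y within S)" for i y S
  by (auto intro!: derivative_eq_intros bounded_linear_imp_has_derivative bounded_linear_vec_nth
  bounded_linear_compose[OF bounded_linear_vec_nth])
 have ray: "((\<lambda>y. u (c + s *\<^sub>R (y - c))) has_derivative (\<lambda>d. s * (grad u (c + s *\<^sub>R (y - c)) \<bullet> d))) (at y within S)"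
  if "C1 u" for u s y S
 proof -
  have "((\<lambda>y. c + s *\<^sub>R (y - c)) has_derivative (\<lambda>d. s *\<^sub>R d)) (at y within S)" by (auto intro!: derivative_eq_intros)
  from has_derivative_compose[OF this C1_has_derivative[OF that]] show ?thesis by simp
 qed
 have pd: "((\<lambda>y. P y s) has_derivative blinfun_apply (blinfun_inner_left (Q y s))) (at y within UNIV)" for y s
 proof -
  have "((\<lambda>y. P y s) has_derivative (\<lambda>d. u1 (c + s *\<^sub>R (y - c)) * d $ 1 + s * (grad u1 (c + s *\<^sub>R (y - c)) \<bullet> d) * (y - c) $ 1
   + (u2 (c + s *\<^sub>R (y - c)) * d $ 2 + s * (grad u2 (c + s *\<^sub>R (y - c)) \<bullet> d) * (y - c) $ 2))) (at y within UNIV)"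
   unfolding P_def by (intro has_derivative_add has_derivative_mult ray nth U)
  moreover have "(\<lambda>d. u1 (c + s *\<^sub>R (y - c)) * d $ 1 + s * (grad u1 (c + s *\<^sub>R (y - c)) \<bullet> d) * (y - c) $ 1
   + (u2 (c + s *\<^sub>R (y - c)) * d $ 2 + s * (grad u2 (c + s *\<^sub>R (y - c)) \<bullet> d) * (y - c) $ 2)) = blinfun_apply (blinfun_inner_left (Q y s))"
   by (simp add: fun_eq_iff Q_def plane_inner axis_def algebra_simps)
  ultimately show ?thesis by simp
 qed
 have cu: "cont (\<lambda>p. u (c + snd p *\<^sub>R (fst p - c)))" "cont (\<lambda>p. grad u (c + snd p *\<^sub>R (fst p - c)))"
  if "C1 u" for u
  by (intro continuous_on_compose2[OF C1_continuous[OF that, of UNIV]] continuous_on_compose2[OF C1_grad_continuous[OF that, of UNIV]]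
  continuous_intros; simp)+
 have cQ: "cont (\<lambda>p. Q (fst p) (snd p))" unfolding Q_def by (intro continuous_intros cu U)
 have cP: "cont (\<lambda>p. P (fst p) (snd p))" unfolding P_def by (intro continuous_intros cu U)
 have cPs: "P y integrable_on cbox 0 1" for y
  by (intro integrable_continuous continuous_on_compose2[OF cP, of _ "\<lambda>s. (y, s)", simplified] continuous_intros)
 have cQs: "Q y integrable_on cbox 0 1" for y
  by (intro integrable_continuous continuous_on_compose2[OF cQ, of _ "\<lambda>s. (y, s)", simplified] continuous_intros)
 have cbQ: "continuous_on (UNIV \<times> cbox 0 1) (\<lambda>(y, s). blinfun_inner_left (Q y s))" unfolding split_beta
  by (intro bounded_linear.continuous_on[OF bounded_linear_blinfun_inner_left] continuous_on_subset[OF cQ]) auto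
 have der: "(\<psi> has_derivative (\<lambda>d. integral (cbox 0 1) (Q y) \<bullet> d)) (at y)" for y
 proof -
  have "((\<lambda>y. integral (cbox 0 1) (P y)) has_derivative integral (cbox 0 1) (\<lambda>s. blinfun_inner_left (Q y s))) (at y within UNIV)"
   by (rule leibniz_rule[OF pd cPs cbQ]) auto
  moreover have "integral (cbox 0 1) (\<lambda>s. blinfun_inner_left (Q y s)) = blinfun_inner_left (integral (cbox 0 1) (Q y))"
   using integral_linear[OF cQs bounded_linear_blinfun_inner_left, of y] by (simp add: o_def)
  ultimately show ?thesis by (simp add: \<psi>_def P_def inner_commute[of "integral _ _"])
 qed
 have cI: "cont (\<lambda>y. integral (cbox 0 1) (Q y))"
  by (rule integral_continuous_on_param) (auto simp: split_beta intro: continuous_on_subset[OF cQ])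
 show "C1 \<psi>" and g: "grad \<psi> x = mk (u1 x) (u2 x)"
 proof -
  show "C1 \<psi>" by (rule C1I(1)[OF der cI])
  have gx: "grad \<psi> x = integral (cbox 0 1) (Q x)" using C1I(2)[OF der cI] by simp
  have "(Q x has_integral mk (u1 x) (u2 x)) {0..1}"
  proof -
   let ?f = "\<lambda>s. s *\<^sub>R mk (u1 (c + s *\<^sub>R (x - c))) (u2 (c + s *\<^sub>R (x - c)))"
   have "(Q x has_integral ?f 1 - ?f 0) {0..1}"
   proof (rule fundamental_theorem_of_calculus)
    fix s :: real assume s: "s \<in> {0..1}"
    have r1: "((\<lambda>s. u (c + s *\<^sub>R (x - c))) has_vector_derivative grad u (c + s *\<^sub>R (x - c)) \<bullet> (x - c)) (at s within {0..1})"
     if "C1 u" for u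
     using C1_ray_derivative[OF that] by (simp add: has_real_derivative_iff_has_vector_derivative)
    have e: "?f = (\<lambda>s. (s * u1 (c + s *\<^sub>R (x - c))) *\<^sub>R axis 1 1 + (s * u2 (c + s *\<^sub>R (x - c))) *\<^sub>R axis 2 1)"
     by (simp add: mk_alt scaleR_add_right)
    have r2: "((\<lambda>s. s * u (c + s *\<^sub>R (x - c))) has_vector_derivative s * (grad u (c + s *\<^sub>R (x - c)) \<bullet> (x - c)) + 1 * u (c + s *\<^sub>R (x - c))) (at s within {0..1})"
     if "C1 u" for u
     by (rule has_vector_derivative_mult[OF has_vector_derivative_id r1[OF that], unfolded id_def])
    have "(?f has_vector_derivative
     (s * (grad u1 (c + s *\<^sub>R (x - c)) \<bullet> (x - c)) + 1 * u1 (c + s *\<^sub>R (x - c))) *\<^sub>R axis 1 1 +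
     (s * (grad u2 (c + s *\<^sub>R (x - c)) \<bullet> (x - c)) + 1 * u2 (c + s *\<^sub>R (x - c))) *\<^sub>R axis 2 1) (at s within {0..1})"
     unfolding e by (intro has_vector_derivative_add bounded_linear.has_vector_derivative[OF bounded_linear_scaleR_left] r2 U)
    \<comment> \<open>The curl condition exchanges the mixed derivatives and thereby turns the
      gradient of the integrand into a total derivative in \<open>s\<close>.\<close>
    also have "(s * (grad u1 (c + s *\<^sub>R (x - c)) \<bullet> (x - c)) + 1 * u1 (c + s *\<^sub>R (x - c))) *\<^sub>R axis 1 1 +
     (s * (grad u2 (c + s *\<^sub>R (x - c)) \<bullet> (x - c)) + 1 * u2 (c + s *\<^sub>R (x - c))) *\<^sub>R axis 2 1 = Q x s"
     using curlfree[of s] s unfolding axis_mk Q_def plane_eq_iff plane_inner by (simp add: algebra_simps)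
    finally show "(?f has_vector_derivative Q x s) (at s within {0..1})" .
   qed simp
   then show ?thesis by simp
  qed
  then show "grad \<psi> x = mk (u1 x) (u2 x)" unfolding gx by (simp add: integral_unique)
 qed
qed

lemma ennreal_nrm_sq:
 assumes "sqi M f" shows "(\<integral>\<^sup>+x. ennreal ((norm (f x))^2) \<partial>M) = ennreal ((nrm M f)^2)"
 unfolding nrm_sq using sqi_int[OF assms] by (intro nn_integral_eq_integral) auto

lemma sqi_nrm_bound:
 assumes f: "f \<in> borel_measurable M" and b: "(\<integral>\<^sup>+x. ennreal ((norm (f x))^2) \<partial>M) \<le> ennreal (C^2)" and C: "0 \<le> C"
 shows "sqi M f" "nrm M f \<le> C"
proof -
 have "(\<integral>\<^sup>+x. ennreal (norm ((norm (f x))^2)) \<partial>M) < \<infinity>" using b by (simp add: order_le_less_trans)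
 then have "integrable M (\<lambda>x. (norm (f x))^2)" using f by (intro integrableI_bounded) auto
 then show s: "sqi M f" using f by (simp add: sqi_def)
 have "(nrm M f)^2 \<le> C^2" using b ennreal_nrm_sq[OF s] by simp
 then show "nrm M f \<le> C" using C by (rule power2_le_imp_le)
qed

section \<open>Mollification that stays inside the polygon\<close>

context star_polygon
begin

text \<open>Borel representatives vanishing off \<open>F\<close>: substitutions and Fubini are
  carried out with \<open>lborel\<close> on the plane, while the given fields are only Lebesgue
  measurable on \<open>F\<close>.\<close>

definition sqF :: "(plane => real) => bool" where
 "sqF w \<longleftrightarrow> w \<in> borel_measurable borel \<and> (\<forall>x. x \<notin> F --> w x = 0) \<and> integrable lborel (\<lambda>x. (w x)^2)"

lemma F_ob: "open F \<or> closed F" "bounded F" by (auto simp: open_domain bounded_domain)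

lemma F_borel [measurable]: "F \<in> sets borel" using open_domain by auto

lemma sqF_meas: "sqF w ==> w \<in> borel_measurable borel" by (simp add: sqF_def)

lemma sqF_sqi: "sqF w ==> sqi lborel w" by (simp add: sqF_def sqi_def)

lemma sqF_integrable: assumes "sqF w" shows "integrable lborel w"
proof (rule Bochner_Integration.integrable_bound)
 have "emeasure lborel F < \<infinity>" using bounded_domain by (rule emeasure_bounded_finite)
 then show "integrable lborel (\<lambda>x. indicat_real F x + (w x)^2)" using assms by (simp add: sqF_def)
 show "AE x in lborel. norm (w x) \<le> norm (indicat_real F x + (w x)^2)"
 proof (rule AE_I2)
  fix x
  have "\<bar>w x\<bar> \<le> 1 + (w x)^2" using sum_squares_bound[of "\<bar>w x\<bar>" 1] by simp
  then show "norm (w x) \<le> norm (indicat_real F x + (w x)^2)" using assms by (auto simp: sqF_def indicator_def)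
 qed
qed (use assms in \<open>simp add: sqF_def\<close>)

lemma sqF_restrict:
 assumes w: "sqF w"
 shows "sqi (leb F) w" "nrm (leb F) w = nrm lborel w"
 and "integrable (leb F) w"
proof -
 have wm: "w \<in> borel_measurable borel" using w by (rule sqF_meas)
 then have w2m: "(\<lambda>x. (norm (w x))^2) \<in> borel_measurable borel" by measurable
 have e: "(\<lambda>x. indicat_real F x *\<^sub>R (norm (w x))^2) = (\<lambda>x. (w x)^2)" "(\<lambda>x. indicat_real F x *\<^sub>R w x) = w"
  using w by (auto simp: sqF_def indicator_def fun_eq_iff)
 have "w \<in> borel_measurable (leb F)" using wm by (intro measurable_restrict_space1 measurable_completion) simp
 moreover have "integrable (leb F) (\<lambda>x. (norm (w x))^2)"
  using integrable_lebesgue_on_borel[OF F_borel w2m] w unfolding e by (simp add: sqF_def)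
 ultimately show "sqi (leb F) w" by (simp add: sqi_def)
 show "nrm (leb F) w = nrm lborel w" using integral_lebesgue_on_borel[OF F_borel w2m] unfolding e by (simp add: nrm_def)
 show "integrable (leb F) w" using integrable_lebesgue_on_borel[OF F_borel wm] sqF_integrable[OF w] unfolding e by simp
qed

lemma nrm_F_le_lborel:
 assumes f: "sqi lborel (f :: plane => real)"
 shows "sqi (leb F) f" "nrm (leb F) f \<le> nrm lborel f"
proof -
 have fm[measurable]: "f \<in> borel_measurable borel" using sqi_meas[OF f] by simp
 have "(\<integral>\<^sup>+x. ennreal ((norm (f x))^2) \<partial>leb F) = (\<integral>\<^sup>+x. indicator F x * ennreal ((norm (f x))^2) \<partial>lborel)"
  by (intro nn_integral_lebesgue_on) auto
 also have "\<dots> \<le> (\<integral>\<^sup>+x. ennreal ((norm (f x))^2) \<partial>lborel)" by (intro nn_integral_mono) (auto simp: indicator_def)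
 also have "\<dots> = ennreal ((nrm lborel f)^2)" by (rule ennreal_nrm_sq[OF f])
 finally have b: "(\<integral>\<^sup>+x. ennreal ((norm (f x))^2) \<partial>leb F) \<le> ennreal ((nrm lborel f)^2)" .
 have m: "f \<in> borel_measurable (leb F)" by (intro measurable_restrict_space1 measurable_completion) simp
 show "sqi (leb F) f" "nrm (leb F) f \<le> nrm lborel f" using sqi_nrm_bound[OF m b] by auto
qed

lemma sqF_diff: assumes "sqF w" "sqF w'" shows "sqF (\<lambda>x. w x - w' x)"
 using sqi_diff[OF sqF_sqi[OF assms(1)] sqF_sqi[OF assms(2)]] assms by (auto simp: sqF_def sqi_def)

text \<open>A Lebesgue measurable function agrees almost everywhere with a Borel measurable one, and
  weak identities do not notice the change.\<close>

lemma sqF_ex: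
 fixes f :: "plane => real"
 assumes f: "sqi (leb F) f"
 shows "\<exists>w. sqF w \<and> (AE x in leb F. w x = f x)"
proof -
 have Fl: "F \<in> sets lebesgue" using open_domain by (rule open_lebesgue)
 have "(\<lambda>x. indicat_real F x *\<^sub>R f x) \<in> borel_measurable lebesgue"
  using sqi_meas[OF f] Fl by (simp add: borel_measurable_restrict_space_iff)
 then obtain g where g: "g \<in> borel_measurable lborel" "AE x in lborel. indicat_real F x *\<^sub>R f x = g x"
  using completion_ex_borel_measurable_real by blast
 have gm: "g \<in> borel_measurable borel" using g by simp
 define w where "w x = indicat_real F x * g x" for x
 have wm[measurable]: "w \<in> borel_measurable borel" unfolding w_def using gm by measurable
 have AE1: "AE x in lebesgue. indicat_real F x *\<^sub>R f x = g x" using g(2) by (rule AE_completion)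
 then have AEF: "AE x in leb F. w x = f x" using Fl by (auto simp: AE_restrict_space_iff w_def indicator_def elim!: eventually_mono)
 have "integrable (leb F) (\<lambda>x. (w x)^2)"
 proof (rule integrable_cong_AE_imp)
  show "integrable (leb F) (\<lambda>x. (f x)^2)" using sqi_int[OF f] by simp
  show "(\<lambda>x. (w x)^2) \<in> borel_measurable (leb F)" by (intro measurable_restrict_space1 measurable_completion) measurable
  show "AE x in leb F. (f x)^2 = (w x)^2" using AEF by (auto elim: eventually_mono)
 qed
 then have "integrable lborel (\<lambda>x. indicat_real F x *\<^sub>R (w x)^2)" by (subst (asm) integrable_lebesgue_on_borel) auto
 also have "(\<lambda>x. indicat_real F x *\<^sub>R (w x)^2) = (\<lambda>x. (w x)^2)" by (auto simp: w_def indicator_def)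
 finally have "sqF w" using wm by (auto simp: sqF_def w_def)
 then show ?thesis using AEF by blast
qed

definition molZ :: real where "molZ = (LINT y|lborel. bump c (r/2) y)"
definition mol :: "plane => real" where "mol y = (1 / molZ) * bump c (r/2) y"

lemma integrable_bump: "integrable lborel (bump c (r/2))"
proof -
 have "integrable (leb (ball c r)) (bump c (r/2))" by (intro continuous_integrable_on C1_continuous C1_bump) auto
 then have "integrable lborel (\<lambda>x. indicator (ball c r) x *\<^sub>R bump c (r/2) x)" by (subst (asm) integrable_lebesgue_on_borel)
  (auto intro!: cont_borel C1_continuous C1_bump)
 also have "(\<lambda>x. indicator (ball c r) x *\<^sub>R bump c (r/2) x) = bump c (r/2)"
 proof
  fix x
  have "bump c (r/2) x = 0" if "x \<notin> ball c r" using that r_pos by (intro bump_zero) (auto simp: dist_norm norm_minus_commute)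
  then show "indicator (ball c r) x *\<^sub>R bump c (r/2) x = bump c (r/2) x" by (auto simp: indicator_def)
 qed
 finally show ?thesis .
qed

lemma molZ_pos: "molZ > 0"
proof -
 have "molZ \<ge> 0" unfolding molZ_def by (intro LINT_nonneg bump_nonneg)
 moreover have "molZ \<noteq> 0"
 proof
  assume "molZ = 0"
  then have "AE y in lborel. bump c (r/2) y = 0" unfolding molZ_def using integral_nonneg_eq_0_iff_AE[OF integrable_bump] bump_nonneg by auto
  then have "AE y in lborel. y \<notin> ball c (r/2)"
   by (rule eventually_mono) (use bump_pos[of "r/2" _ c] r_pos in \<open>force simp: dist_norm norm_minus_commute\<close>)
  then have "ball c (r/2) \<in> null_sets lborel" by (subst AE_iff_null_sets) auto
  then have "emeasure lborel (ball c (r/2)) = 0" by auto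
  then show False using r_pos by (simp add: emeasure_ball unit_ball_vol_2)
 qed
 ultimately show ?thesis by simp
qed

lemma mol_C1: "C1 mol" and mol_grad: "grad mol = (\<lambda>y. (1 / molZ) *\<^sub>R grad (bump c (r/2)) y)"
 using C1_cmult[OF C1_bump, of "1 / molZ" c "r/2"] by (simp_all add: mol_def[abs_def])

lemma mol_nonneg: "0 \<le> mol y" using molZ_pos bump_nonneg by (simp add: mol_def)

lemma mol_zero: "r/2 \<le> norm (y - c) ==> mol y = 0"
 using r_pos by (simp add: mol_def bump_zero)

lemma mol_grad_zero: "r/2 \<le> norm (y - c) ==> grad mol y = 0"
 using r_pos by (simp add: mol_grad grad_bump_zero)

lemma mol_integrable: "integrable lborel mol"
 unfolding mol_def using integrable_bump by simp

lemma mol_integral: "(LINT y|lborel. mol y) = 1"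
 unfolding mol_def using molZ_pos by (simp add: molZ_def)

lemma mol_borel [measurable]: "mol \<in> borel_measurable borel" by (intro cont_borel C1_continuous mol_C1)

lemma mol_bound: "\<bar>mol y\<bar> \<le> (r/2)^4 / molZ"
 using molZ_pos bump_le[of "r/2" c y] bump_nonneg[of c "r/2" y] r_pos by (simp add: mol_def divide_right_mono)

text \<open>Convolution combined with a contraction towards the disc: by star-shapedness all sampled
  points with \<open>y\<close> in the support of \<open>mol\<close> lie in \<open>F\<close>, so the
  mean is formed up to the boundary from values of \<open>w\<close> in \<open>F\<close>
  alone.\<close>

definition T :: "real => (plane => real) => plane => real" where
 "T e w x = (LINT y|lborel. w ((1 - e) *\<^sub>R x + e *\<^sub>R y) * mol y)"

lemma T_sub:
 assumes "x \<in> F" "0 < e" "e < 1" "norm (y - c) \<le> r/2"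
 shows "(1 - e) *\<^sub>R x + e *\<^sub>R y \<in> F"
 using seg_closure[OF F_sub_closure[OF assms(1)], of y e] assms r_pos by (simp add: dist_norm norm_minus_commute)

text \<open>Substituting \<open>z = (1 - e) *\<^sub>R x + e *\<^sub>R y\<close> moves the dependence
  on \<open>x\<close> from the rough \<open>w\<close> to the differentiable kernel.\<close>

lemma T_form:
 assumes [measurable]: "w \<in> borel_measurable borel" and e: "0 < e"
 shows "T e w = (\<lambda>x. (1 / e^2) * (LINT z|lborel. w z * mol ((1/e) *\<^sub>R z + (- (1 - e) / e) *\<^sub>R x)))"
proof
 fix x
 have "(LINT z|lborel. w z * mol ((1/e) *\<^sub>R z + (- (1 - e) / e) *\<^sub>R x)) =
  e^2 * (LINT y|lborel. w ((1-e) *\<^sub>R x + e *\<^sub>R y) * mol ((1/e) *\<^sub>R ((1-e) *\<^sub>R x + e *\<^sub>R y) + (- (1 - e) / e) *\<^sub>R x))"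
  by (rule lborel_integral_affine) (use e in auto)
 also have "(\<lambda>y. mol ((1/e) *\<^sub>R ((1-e) *\<^sub>R x + e *\<^sub>R y) + (- (1 - e) / e) *\<^sub>R x)) = mol"
 proof
  fix y
  have k: "- (1 - e) / e = - ((1 - e) / e)" by (rule minus_divide_left[symmetric])
  have "(1/e) *\<^sub>R ((1-e) *\<^sub>R x + e *\<^sub>R y) + (- (1 - e) / e) *\<^sub>R x = y"
   unfolding k scaleR_minus_left using e by (simp add: scaleR_add_right)
  then show "mol ((1/e) *\<^sub>R ((1-e) *\<^sub>R x + e *\<^sub>R y) + (- (1 - e) / e) *\<^sub>R x) = mol y" by simp
 qed
 finally show "T e w x = (1 / e^2) * (LINT z|lborel. w z * mol ((1/e) *\<^sub>R z + (- (1 - e) / e) *\<^sub>R x))"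
  using e unfolding T_def by (simp add: fun_eq_iff)
qed

lemma T_integrable:
 assumes w: "integrable lborel w" and e: "0 < e"
 shows "integrable lborel (\<lambda>y. w ((1 - e) *\<^sub>R x + e *\<^sub>R y) * mol y)"
proof (rule Bochner_Integration.integrable_bound)
 have [measurable]: "w \<in> borel_measurable borel" using w by (simp add: borel_measurable_integrable)
 have "integrable lborel (\<lambda>y. w ((1 - e) *\<^sub>R x + e *\<^sub>R y))" using lborel_integrable_affine[OF w] e by simp
 then show "integrable lborel (\<lambda>y. \<bar>w ((1 - e) *\<^sub>R x + e *\<^sub>R y)\<bar> * ((r/2)^4 / molZ))" by simp
 show "(\<lambda>y. w ((1 - e) *\<^sub>R x + e *\<^sub>R y) * mol y) \<in> borel_measurable lborel" by measurable
 show "AE y in lborel. norm (w ((1 - e) *\<^sub>R x + e *\<^sub>R y) * mol y) \<le> norm (\<bar>w ((1 - e) *\<^sub>R x + e *\<^sub>R y)\<bar> * ((r/2)^4 / molZ))"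
 proof (rule AE_I2)
  fix y
  have "\<bar>w ((1 - e) *\<^sub>R x + e *\<^sub>R y)\<bar> * \<bar>mol y\<bar> \<le> \<bar>w ((1 - e) *\<^sub>R x + e *\<^sub>R y)\<bar> * \<bar>(r/2)^4 / molZ\<bar>"
   using mol_bound[of y] molZ_pos by (intro mult_left_mono) auto
  then show "norm (w ((1 - e) *\<^sub>R x + e *\<^sub>R y) * mol y) \<le> norm (\<bar>w ((1 - e) *\<^sub>R x + e *\<^sub>R y)\<bar> * ((r/2)^4 / molZ))"
   by (simp only: real_norm_def abs_mult abs_abs)
 qed
qed

lemma T_diff:
 assumes "integrable lborel w" "integrable lborel w'" "0 < e"
 shows "T e (\<lambda>x. w x - w' x) x = T e w x - T e w' x"
 unfolding T_def left_diff_distrib by (rule LINT_diff[OF T_integrable[OF assms(1,3)] T_integrable[OF assms(2,3)]])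

text \<open>Jensen's inequality for the probability density \<open>mol\<close>, then Fubini; undoing
  the contraction costs at most a factor 4 in the squared norm.\<close>

lemma T_bound:
 assumes w: "sqF w" and e: "0 < e" "e \<le> 1/2"
 shows "sqi lborel (T e w)" "nrm lborel (T e w) \<le> 2 * nrm lborel w"
proof -
 have wm[measurable]: "w \<in> borel_measurable borel" using w by (rule sqF_meas)
 have w2: "integrable lborel (\<lambda>x. (w x)^2)" using w by (simp add: sqF_def)
 have wi: "integrable lborel w" by (rule sqF_integrable[OF w])
 have Tm: "T e w \<in> borel_measurable lborel" unfolding T_def[abs_def] by measurable
 have pt: "ennreal ((norm (T e w x))^2) \<le> (\<integral>\<^sup>+y. ennreal (mol y) * ennreal ((w (e *\<^sub>R y + (1 - e) *\<^sub>R x))^2) \<partial>lborel)" for x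
 proof -
  \<comment> \<open>Jensen by way of Cauchy-Schwarz, with the density split into two square
    roots.\<close>
  let ?f = "\<lambda>y. w ((1 - e) *\<^sub>R x + e *\<^sub>R y) * sqrt (mol y)" and ?g = "\<lambda>y. sqrt (mol y)"
  have g2: "(norm (?g y))^2 = mol y" for y using mol_nonneg by simp
  have f2: "(norm (?f y))^2 = (w ((1 - e) *\<^sub>R x + e *\<^sub>R y))^2 * mol y" for y using mol_nonneg by (simp add: power_mult_distrib)
  have g: "sqi lborel ?g" unfolding sqi_def g2 using mol_integrable by simp
  have f: "sqi lborel ?f" unfolding sqi_def f2 using T_integrable[OF w2 e(1)] by simp
  have "nrm lborel ?g = 1" unfolding nrm_def g2 mol_integral by simp
  then have "\<bar>LINT y|lborel. ?f y \<bullet> ?g y\<bar> \<le> nrm lborel ?f" using nrm_Cauchy_Schwarz[OF f g] by simp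
  moreover have "(LINT y|lborel. ?f y \<bullet> ?g y) = T e w x" unfolding T_def using mol_nonneg by (simp add: mult.assoc)
  ultimately have "\<bar>T e w x\<bar>^2 \<le> (nrm lborel ?f)^2" by (intro power_mono) auto
  then have "ennreal ((norm (T e w x))^2) \<le> (\<integral>\<^sup>+y. ennreal ((norm (?f y))^2) \<partial>lborel)"
   unfolding ennreal_nrm_sq[OF f] by (simp add: ennreal_leI)
  then show ?thesis unfolding f2 using mol_nonneg by (simp add: ennreal_mult mult.commute add.commute)
 qed
 have "(\<integral>\<^sup>+x. ennreal ((norm (T e w x))^2) \<partial>lborel) \<le>
  (\<integral>\<^sup>+x. \<integral>\<^sup>+y. ennreal (mol y) * ennreal ((w (e *\<^sub>R y + (1 - e) *\<^sub>R x))^2) \<partial>lborel \<partial>lborel)"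
  by (rule nn_integral_mono) (rule pt)
 also have "\<dots> = (\<integral>\<^sup>+y. \<integral>\<^sup>+x. ennreal (mol y) * ennreal ((w (e *\<^sub>R y + (1 - e) *\<^sub>R x))^2) \<partial>lborel \<partial>lborel)"
  by (rule lborel_pair.Fubini') measurable
 also have "\<dots> = (\<integral>\<^sup>+y. ennreal (mol y) * (\<integral>\<^sup>+x. ennreal ((w (e *\<^sub>R y + (1 - e) *\<^sub>R x))^2) \<partial>lborel) \<partial>lborel)"
  by (intro nn_integral_cong nn_integral_cmult) measurable
 also have "\<dots> \<le> (\<integral>\<^sup>+y. ennreal (mol y) * (4 * (\<integral>\<^sup>+x. ennreal ((w x)^2) \<partial>lborel)) \<partial>lborel)"
  using e by (intro nn_integral_mono mult_left_mono nn_integral_affine_le[where f="\<lambda>x. ennreal ((w x)^2)"]) auto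
 also have "\<dots> = (\<integral>\<^sup>+y. ennreal (mol y) \<partial>lborel) * (4 * (\<integral>\<^sup>+x. ennreal ((w x)^2) \<partial>lborel))"
  by (intro nn_integral_multc) measurable
 also have "(\<integral>\<^sup>+y. ennreal (mol y) \<partial>lborel) = 1"
  using nn_integral_eq_integral[OF mol_integrable] mol_nonneg mol_integral by simp
 also have "1 * (4 * (\<integral>\<^sup>+x. ennreal ((w x)^2) \<partial>lborel)) = ennreal ((2 * nrm lborel w)^2)"
  using ennreal_nrm_sq[OF sqF_sqi[OF w]] by (simp add: power_mult_distrib ennreal_mult)
 finally have b: "(\<integral>\<^sup>+x. ennreal ((norm (T e w x))^2) \<partial>lborel) \<le> ennreal ((2 * nrm lborel w)^2)" .
 show "sqi lborel (T e w)" "nrm lborel (T e w) \<le> 2 * nrm lborel w" using sqi_nrm_bound[OF Tm b] by auto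
qed

definition ep :: "nat => real" where "ep m = 1 / (real m + 2)"

lemma ep: "0 < ep m" "ep m \<le> 1/2" "ep m < 1" "ep \<longlonglongrightarrow> 0"
proof -
 show "0 < ep m" "ep m \<le> 1/2" "ep m < 1" by (simp_all add: ep_def field_simps)
 show "ep \<longlonglongrightarrow> 0" unfolding ep_def[abs_def]
  using LIMSEQ_ignore_initial_segment[OF lim_1_over_n[where 'a=real], of 2] by (simp add: add.commute)
qed

lemma T_continuous_conv:
 assumes g: "cont g" and M: "\<And>x. \<bar>g x\<bar> \<le> M"
 shows "(\<lambda>m. T (ep m) g x) \<longlonglongrightarrow> g x"
proof -
 have [measurable]: "g \<in> borel_measurable borel" using g by (rule cont_borel)
 have "(\<lambda>m. LINT y|lborel. g ((1 - ep m) *\<^sub>R x + ep m *\<^sub>R y) * mol y) \<longlonglongrightarrow> (LINT y|lborel. g x * mol y)"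
 proof (rule integral_dominated_convergence[where w="\<lambda>y. M * mol y"])
  show "integrable lborel (\<lambda>y. M * mol y)" using mol_integrable by simp
  show "AE y in lborel. (\<lambda>m. g ((1 - ep m) *\<^sub>R x + ep m *\<^sub>R y) * mol y) \<longlonglongrightarrow> g x * mol y"
  proof (rule AE_I2)
   fix y
   have "(\<lambda>m. (1 - ep m) *\<^sub>R x + ep m *\<^sub>R y) \<longlonglongrightarrow> (1 - 0) *\<^sub>R x + 0 *\<^sub>R y"
    by (intro tendsto_intros ep(4))
   then have "(\<lambda>m. (1 - ep m) *\<^sub>R x + ep m *\<^sub>R y) \<longlonglongrightarrow> x" by simp
   moreover have "isCont g x" using g by (simp add: continuous_on_eq_continuous_at)
   ultimately have "(\<lambda>m. g ((1 - ep m) *\<^sub>R x + ep m *\<^sub>R y)) \<longlonglongrightarrow> g x" by (rule isCont_tendsto_compose[rotated])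
   then show "(\<lambda>m. g ((1 - ep m) *\<^sub>R x + ep m *\<^sub>R y) * mol y) \<longlonglongrightarrow> g x * mol y" by (intro tendsto_intros)
  qed
  show "AE y in lborel. norm (g ((1 - ep m) *\<^sub>R x + ep m *\<^sub>R y) * mol y) \<le> M * mol y" for m
   using mult_right_mono[OF M mol_nonneg] mol_nonneg by (intro AE_I2) (simp add: abs_mult)
 qed measurable
 then show ?thesis by (simp add: T_def mol_integral)
qed

lemma T_cong_F:
 assumes x: "x \<in> F" and e: "0 < e" "e < 1" and eq: "\<And>z. z \<in> F ==> w z = w' z"
 shows "T e w x = T e w' x"
 unfolding T_def
proof (rule LINT_cong[OF refl])
 fix y
 show "w ((1 - e) *\<^sub>R x + e *\<^sub>R y) * mol y = w' ((1 - e) *\<^sub>R x + e *\<^sub>R y) * mol y"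
  using T_sub[OF x e, of y] mol_zero[of y] eq by (cases "norm (y - c) \<le> r/2") auto
qed

text \<open>Uniform boundedness of \<open>T\<close> reduces the claim to bounded continuous
  functions, for which convergence is pointwise and dominated.\<close>

lemma T_conv:
 assumes w: "sqF w"
 shows "(\<lambda>m. nrm (leb F) (\<lambda>x. T (ep m) w x - w x)) \<longlonglongrightarrow> 0"
proof (rule LIMSEQ_I)
 fix d :: real assume d: "d > 0"
 obtain g M where g: "cont g" "\<And>x. \<bar>g x\<bar> \<le> M"
  "nrm (leb F) (\<lambda>x. w x - g x) < d / 6"
  using L2_approx_continuous[OF sqF_restrict(1)[OF w] F_ob, of "d/6"] d by auto
 have M0: "0 \<le> M" using g(2)[of 0] by simp
 \<comment> \<open>\<open>T_bound\<close> asks for functions vanishing off \<open>F\<close>. The cut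
   creates a jump at the boundary, which \<open>T\<close> does not see at points of
   \<open>F\<close>.\<close>
 define g1 where "g1 x = indicat_real F x * g x" for x
 have gm[measurable]: "g \<in> borel_measurable borel" using g(1) by (rule cont_borel)
 have g1m[measurable]: "g1 \<in> borel_measurable borel" unfolding g1_def by measurable
 have g1s: "sqF g1"
 proof -
  have "integrable (leb F) (\<lambda>x. (g x)^2)" by (intro continuous_integrable_on[OF _ F_ob] continuous_intros g(1))
  then have "integrable lborel (\<lambda>x. indicat_real F x *\<^sub>R (g x)^2)" by (subst (asm) integrable_lebesgue_on_borel) auto
  also have "(\<lambda>x. indicat_real F x *\<^sub>R (g x)^2) = (\<lambda>x. (g1 x)^2)" by (auto simp: g1_def indicator_def)
  finally show ?thesis by (auto simp: sqF_def g1_def[symmetric]) (simp add: g1_def)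
 qed
 have wg: "sqF (\<lambda>x. w x - g1 x)" by (rule sqF_diff[OF w g1s])
 have n1: "nrm lborel (\<lambda>x. w x - g1 x) < d / 6"
 proof -
  have "nrm lborel (\<lambda>x. w x - g1 x) = nrm (leb F) (\<lambda>x. w x - g1 x)" using sqF_restrict(2)[OF wg] by simp
  also have "\<dots> = nrm (leb F) (\<lambda>x. w x - g x)"
   unfolding nrm_def g1_def by (intro arg_cong[where f=sqrt] LINT_cong) (auto simp: space_restrict_space)
  finally show ?thesis using g(3) by simp
 qed
 interpret fin: finite_measure "leb F" by (rule finite_measure_lebesgue_on[OF F_ob])
 have "(\<lambda>m. nrm (leb F) (\<lambda>x. T (ep m) g1 x - g1 x)) \<longlonglongrightarrow> 0"
 proof (rule integrable_sq_bound_conv)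
  show "(\<lambda>x. T (ep m) g1 x - g1 x) \<in> borel_measurable (leb F)" for m
  proof -
   have "(\<lambda>x. T (ep m) g1 x - g1 x) \<in> borel_measurable borel" unfolding T_def by measurable
   then show ?thesis by (intro measurable_restrict_space1 measurable_completion) simp
  qed
  show "integrable (leb F) (\<lambda>x. (2 * M)^2)" by simp
  have g1M: "\<bar>g1 x\<bar> \<le> M" for x using g(2)[of x] M0 by (auto simp: g1_def indicator_def)
  have TM: "\<bar>T (ep m) g1 x\<bar> \<le> M" for m x
  proof -
   have "norm (T (ep m) g1 x) \<le> (LINT y|lborel. M * mol y)" unfolding T_def
    using T_integrable[OF sqF_integrable[OF g1s] ep(1)] mol_integrable mult_right_mono[OF g1M mol_nonneg] mol_nonneg
    by (intro LINT_norm_bound) (auto simp: abs_mult)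
   then show ?thesis using mol_integral by simp
  qed
  show "AE x in leb F. (T (ep m) g1 x - g1 x)^2 \<le> (2 * M)^2" for m
  proof (rule AE_I2)
   fix x show "(T (ep m) g1 x - g1 x)^2 \<le> (2 * M)^2"
    using g1M[of x] TM[of m x] M0 unfolding abs_le_square_iff[symmetric] by linarith
  qed
  show "AE x in leb F. (\<lambda>m. T (ep m) g1 x - g1 x) \<longlonglongrightarrow> 0"
  proof (rule AE_I2)
   fix x assume "x \<in> space (leb F)"
   then have x: "x \<in> F" by (simp add: space_restrict_space)
   have "(\<lambda>m. T (ep m) g x - g x) \<longlonglongrightarrow> g x - g x" by (intro tendsto_intros T_continuous_conv[OF g(1,2)])
   moreover have "T (ep m) g1 x = T (ep m) g x" for m by (rule T_cong_F[OF x ep(1,3)]) (simp add: g1_def)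
   ultimately show "(\<lambda>m. T (ep m) g1 x - g1 x) \<longlonglongrightarrow> 0" using x by (simp add: g1_def)
  qed
 qed
 then obtain m0 where m0: "\<And>m. m \<ge> m0 ==> norm (nrm (leb F) (\<lambda>x. T (ep m) g1 x - g1 x) - 0) < d / 6"
  using LIMSEQ_D[of "\<lambda>m. nrm (leb F) (\<lambda>x. T (ep m) g1 x - g1 x)" 0 "d/6"] d by fastforce
 have "norm (nrm (leb F) (\<lambda>x. T (ep m) w x - w x) - 0) < d" if m: "m \<ge> m0" for m
 proof -
  have a: "sqi (leb F) (T (ep m) (\<lambda>x. w x - g1 x))"
   "nrm (leb F) (T (ep m) (\<lambda>x. w x - g1 x)) \<le> 2 * nrm lborel (\<lambda>x. w x - g1 x)"
   using nrm_F_le_lborel(1)[OF T_bound(1)[OF wg ep(1,2)]]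
   order_trans[OF nrm_F_le_lborel(2)[OF T_bound(1)[OF wg ep(1,2)]] T_bound(2)[OF wg ep(1,2)]] by auto
  have b: "sqi (leb F) (\<lambda>x. T (ep m) g1 x - g1 x)" by (intro sqi_diff sqF_restrict(1)[OF g1s] nrm_F_le_lborel(1)[OF T_bound(1)[OF g1s ep(1,2)]])
  have c: "sqi (leb F) (\<lambda>x. w x - g1 x)" "nrm (leb F) (\<lambda>x. w x - g1 x) = nrm lborel (\<lambda>x. w x - g1 x)"
   by (rule sqF_restrict[OF wg])+
  have "(\<lambda>x. T (ep m) w x - w x) =
   (\<lambda>x. (T (ep m) (\<lambda>x. w x - g1 x) x + (T (ep m) g1 x - g1 x)) - (w x - g1 x))"
   using T_diff[OF sqF_integrable[OF w] sqF_integrable[OF g1s] ep(1)] by (simp add: fun_eq_iff)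
  then have "nrm (leb F) (\<lambda>x. T (ep m) w x - w x) \<le>
   nrm (leb F) (T (ep m) (\<lambda>x. w x - g1 x)) + nrm (leb F) (\<lambda>x. T (ep m) g1 x - g1 x)
   + nrm (leb F) (\<lambda>x. w x - g1 x)"
   using nrm_diff_triangle[OF sqi_add[OF a(1) b] c(1)] nrm_triangle[OF a(1) b] by simp
  moreover have "nrm (leb F) (\<lambda>x. T (ep m) g1 x - g1 x) < d / 6" using m0[OF m] by simp
  \<comment> \<open>Two sixths come from the bound on \<open>T\<close>, one from the convergence for
    \<open>g1\<close>, one from the approximation itself.\<close>
  ultimately have "nrm (leb F) (\<lambda>x. T (ep m) w x - w x) < d" using a(2) c(2) n1 d by linarith
  then show ?thesis by simp
 qed
 then show "\<exists>m0. \<forall>m\<ge>m0. norm (nrm (leb F) (\<lambda>x. T (ep m) w x - w x) - 0) < d" by blast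
qed

definition kern :: "real => plane => plane => real" where
 "kern e x z = mol ((1/e) *\<^sub>R z + (- (1 - e) / e) *\<^sub>R x)"

lemma kern_C1: "C1 (kern e x)" "grad (kern e x) = (\<lambda>z. (1/e) *\<^sub>R grad mol ((1/e) *\<^sub>R z + (- (1 - e) / e) *\<^sub>R x))"
proof -
 have "(kern e x has_derivative (\<lambda>d. ((1/e) *\<^sub>R grad mol ((1/e) *\<^sub>R z + (- (1 - e) / e) *\<^sub>R x)) \<bullet> d)) (at z)" for z
 proof -
  have "((\<lambda>z. (1/e) *\<^sub>R z + (- (1 - e) / e) *\<^sub>R x) has_derivative (\<lambda>d. (1/e) *\<^sub>R d)) (at z)"
   by (auto intro!: derivative_eq_intros)
  from has_derivative_compose[OF this C1_has_derivative[OF mol_C1]]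
  show ?thesis by (simp add: kern_def[abs_def])
 qed
 moreover have "cont (\<lambda>z. (1/e) *\<^sub>R grad mol ((1/e) *\<^sub>R z + (- (1 - e) / e) *\<^sub>R x))"
  by (intro continuous_intros continuous_on_compose2[OF C1_grad_continuous[OF mol_C1, of UNIV]]) auto
 ultimately show "C1 (kern e x)" "grad (kern e x) = (\<lambda>z. (1/e) *\<^sub>R grad mol ((1/e) *\<^sub>R z + (- (1 - e) / e) *\<^sub>R x))"
  by (fact C1I)+
qed

text \<open>The support is the contracted disc, compact in \<open>F\<close>. Hence for every
  \<open>x\<close> in \<open>F\<close> the kernel is an admissible test function for weak
  derivatives.\<close>

lemma kern_support:
 assumes x: "x \<in> F" and e: "0 < e" "e < 1"
 shows "C1_compact_support F (kern e x)"
 unfolding C1_compact_support_def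
proof (intro conjI exI)
 let ?K = "(\<lambda>y. (1 - e) *\<^sub>R x + e *\<^sub>R y) ` cball c (r/2)"
 show "C1 (kern e x)" by (rule kern_C1)
 show "compact ?K" by (intro compact_continuous_image continuous_intros) auto
 show "?K \<subseteq> F" using T_sub[OF x e] by (auto simp: dist_norm norm_minus_commute)
 show "\<forall>z. z \<notin> ?K --> kern e x z = 0"
 proof (intro allI impI)
  fix z assume z: "z \<notin> ?K"
  let ?y = "(1/e) *\<^sub>R z + (- (1 - e) / e) *\<^sub>R x"
  have k: "- (1 - e) / e = - ((1 - e) / e)" by (rule minus_divide_left[symmetric])
  have "z = (1 - e) *\<^sub>R x + e *\<^sub>R ?y" unfolding k scaleR_minus_left using e by (simp add: scaleR_diff_right)
  then have "?y \<notin> cball c (r/2)" using z by blast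
  then show "kern e x z = 0" by (simp add: kern_def mol_zero dist_norm norm_minus_commute)
 qed
qed

text \<open>A derivative in \<open>x\<close> is a derivative of the kernel in \<open>z\<close> up to
  a factor. The factor is the same for both partial derivatives, so a weakly vanishing rotation
  passes to the mollified field.\<close>

lemma T_kern:
 assumes w: "sqF w" and e: "0 < e"
 shows "T e w x = (1 / e^2) * (LINT z|leb F. w z * kern e x z)"
 and "C1 (T e w)"
 and "grad (T e w) x $ i = (- (1 - e) / e^2) * (LINT z|leb F. w z * grad (kern e x) z $ i)"
proof -
 have wm[measurable]: "w \<in> borel_measurable borel" using w by (rule sqF_meas)
 have restr: "(LINT z|lborel. w z * f z) = (LINT z|leb F. w z * f z)"
  if [measurable]: "f \<in> borel_measurable borel" for f
 proof -
  have "(LINT z|leb F. w z * f z) = (LINT z|lborel. indicat_real F z *\<^sub>R (w z * f z))" by (rule integral_lebesgue_on_borel) auto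
  also have "\<dots> = (LINT z|lborel. w z * f z)" using w by (intro LINT_cong) (auto simp: sqF_def indicator_def)
  finally show ?thesis by simp
 qed
 have km: "kern e x \<in> borel_measurable borel" "(\<lambda>z. grad (kern e x) z $ i) \<in> borel_measurable borel"
  by (intro cont_borel C1_continuous continuous_on_component C1_grad_continuous kern_C1)+
 show "T e w x = (1 / e^2) * (LINT z|leb F. w z * kern e x z)" unfolding T_form[OF wm e] restr[OF km(1), symmetric] by (simp add: kern_def)
 note conv = convolution_C1[where s="r/2" and p=c and \<phi>=mol and w=w and a="1/e" and b="- (1 - e) / e",
  OF sqF_integrable[OF w] mol_C1 mol_grad_zero mol_bound]
 show "C1 (T e w)" unfolding T_form[OF wm e] by (intro C1_cmult conv)
 have "grad (T e w) x = (1 / e^2) *\<^sub>R (LINT z|lborel. (- (1 - e) / e * w z) *\<^sub>R grad mol ((1/e) *\<^sub>R z + (- (1 - e) / e) *\<^sub>R x))"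
  by (simp only: T_form[OF wm e] C1_cmult(2)[OF conv(3)] conv(4))
 also have "(LINT z|lborel. (- (1 - e) / e * w z) *\<^sub>R grad mol ((1/e) *\<^sub>R z + (- (1 - e) / e) *\<^sub>R x)) =
  (LINT z|lborel. (- (1 - e) * w z) *\<^sub>R grad (kern e x) z)"
  by (simp add: kern_C1(2))
 also have "((1 / e^2) *\<^sub>R (LINT z|lborel. (- (1 - e) * w z) *\<^sub>R grad (kern e x) z)) $ i =
  (1 / e^2) * (LINT z|lborel. ((- (1 - e) * w z) *\<^sub>R grad (kern e x) z) $ i)"
 proof -
  have "integrable lborel (\<lambda>z. (- (1 - e) * w z) *\<^sub>R grad (kern e x) z)" using conv(2)[where x=x] by (simp add: kern_C1(2))
  then have "(LINT z|lborel. (- (1 - e) * w z) *\<^sub>R grad (kern e x) z) \<bullet> axis i 1 = (LINT z|lborel. ((- (1 - e) * w z) *\<^sub>R grad (kern e x) z) \<bullet> axis i 1)"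
   by (simp only: integral_inner_left)
  then show ?thesis by (simp add: inner_axis)
 qed
 also have "\<dots> = (- (1 - e) / e^2) * (LINT z|lborel. w z * grad (kern e x) z $ i)" by (simp add: mult.assoc)
 finally show "grad (T e w) x $ i = (- (1 - e) / e^2) * (LINT z|leb F. w z * grad (kern e x) z $ i)" unfolding restr[OF km(2)] .
qed

lemma LINT_cong_AE_mult:
 fixes f w :: "plane => real"
 assumes "AE x in leb F. w x = f x" "sqF w" "sqi (leb F) f" "cont g"
 shows "(LINT x|leb F. w x * g x) = (LINT x|leb F. f x * g x)"
 by (rule integral_cong_AE)
 (use assms sqi_meas[OF sqF_restrict(1)[OF assms(2)]] sqi_meas[OF assms(3)] cont_measurable[OF assms(4)] in
 \<open>auto elim: eventually_mono\<close>)

text \<open>The fundamental lemma of the calculus of variations: testing with the kernels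
  annihilates every mollification, and these converge to \<open>d\<close>.\<close>

lemma weak_zero:
 assumes d: "sqi (leb F) d"
 and z: "\<And>\<phi>. C1_compact_support F \<phi> ==> (LINT x|leb F. d x * \<phi> x) = 0"
 shows "AE x in leb F. d x = 0"
proof -
 obtain w where w: "sqF w" "AE x in leb F. w x = d x" using sqF_ex[OF d] by blast
 have "T (ep m) w x = 0" if "x \<in> F" for m x using T_kern(1)[OF w(1) ep(1)] LINT_cong_AE_mult[OF w(2,1) d C1_continuous[OF kern_C1(1)]]
  z[OF kern_support[OF that ep(1,3)]] by simp
 then have "nrm (leb F) (\<lambda>x. T (ep m) w x - w x) = nrm (leb F) w" for m
  unfolding nrm_def by (intro arg_cong[where f=sqrt] LINT_cong) (auto simp: space_restrict_space)
 then have "nrm (leb F) w = 0" using T_conv[OF w(1)] by (simp add: LIMSEQ_const_iff)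
 then have "AE x in leb F. w x = 0" by (rule nrm_zero_AE[OF sqF_restrict(1)[OF w(1)]])
 then show ?thesis using w(2) by eventually_elim simp
qed

lemma nrm_plane_sq:
 assumes "sqi M (f :: 'a => plane)"
 shows "sqi M (\<lambda>x. f x $ i)" "(nrm M f)^2 = (nrm M (\<lambda>x. f x $ 1))^2 + (nrm M (\<lambda>x. f x $ 2))^2"
proof -
 have m: "(\<lambda>x. f x $ i) \<in> borel_measurable M" for i
  using borel_measurable_inner[OF sqi_meas[OF assms] borel_measurable_const[of "axis i 1"]] by (simp add: inner_axis)
 show s: "sqi M (\<lambda>x. f x $ i)" for i unfolding sqi_def
 proof
  show "integrable M (\<lambda>x. (norm (f x $ i))^2)"
  proof (rule Bochner_Integration.integrable_bound[OF sqi_int[OF assms]])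
   show "AE x in M. norm ((norm (f x $ i))^2) \<le> norm ((norm (f x))^2)"
    by (intro AE_I2) (simp add: component_le_norm_cart abs_le_square_iff[symmetric])
  qed (use m in measurable)
 qed (rule m)
 show "(nrm M f)^2 = (nrm M (\<lambda>x. f x $ 1))^2 + (nrm M (\<lambda>x. f x $ 2))^2" unfolding nrm_sq plane_norm_sq using sqi_int[OF s] by simp
qed

text \<open>Mollifying both components with the same kernels gives a field that is exactly
  rotation-free in \<open>F\<close>, hence there the gradient of its radial potential.\<close>

lemma curl_free_approx:
 fixes w :: "plane => plane"
 assumes w: "sqi (leb F) w" and cf: "has_weak_rot F w (\<lambda>x. 0)"
 shows "\<exists>\<psi>. (\<forall>m::nat. C1 (\<psi> m)) \<and> (\<lambda>m. nrm (leb F) (\<lambda>x. grad (\<psi> m) x - w x)) \<longlonglongrightarrow> 0"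
proof -
 obtain w1 where w1: "sqF w1" "AE x in leb F. w1 x = w x $ 1" using sqF_ex[OF nrm_plane_sq(1)[OF w]] by blast
 obtain w2 where w2: "sqF w2" "AE x in leb F. w2 x = w x $ 2" using sqF_ex[OF nrm_plane_sq(1)[OF w]] by blast
 have curlfree: "grad (T (ep m) w2) x $ 1 = grad (T (ep m) w1) x $ 2" if x: "x \<in> F" for x m
 proof -
  let ?k = "kern (ep m) x"
  have gc: "cont (\<lambda>z. grad ?k z $ i)" for i by (intro continuous_on_component C1_grad_continuous kern_C1)
  have "0 = (LINT z|leb F. w z \<bullet> curl ?k z)" using cf kern_support[OF x ep(1,3)] by (simp add: has_weak_rot_def)
  also have "\<dots> = (LINT z|leb F. w z $ 1 * grad ?k z $ 2 - w z $ 2 * grad ?k z $ 1)" by (simp add: curl_def grad_def plane_inner)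
  also have "\<dots> = (LINT z|leb F. w z $ 1 * grad ?k z $ 2) - (LINT z|leb F. w z $ 2 * grad ?k z $ 1)"
   using sqi_inner[OF nrm_plane_sq(1)[OF w] continuous_sqi_on[OF gc F_ob]] by (intro LINT_diff) simp_all
  finally show ?thesis unfolding T_kern(3)[OF w1(1) ep(1)] T_kern(3)[OF w2(1) ep(1)]
   LINT_cong_AE_mult[OF w1(2,1) nrm_plane_sq(1)[OF w] gc] LINT_cong_AE_mult[OF w2(2,1) nrm_plane_sq(1)[OF w] gc]
   by simp
 qed
 \<comment> \<open>One function for all \<open>x\<close>, although \<open>radial_potential\<close>
   is invoked separately at each point of \<open>F\<close>.\<close>
 define \<psi> where "\<psi> m x = integral (cbox 0 1) (\<lambda>s. T (ep m) w1 (c + s *\<^sub>R (x - c)) * (x - c) $ 1 + T (ep m) w2 (c + s *\<^sub>R (x - c)) * (x - c) $ 2)" for m x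
 have C: "C1 (\<psi> m)" for m unfolding \<psi>_def[abs_def]
  by (rule radial_potential(1)[OF T_kern(2)[OF w1(1) ep(1)] T_kern(2)[OF w2(1) ep(1)], where x=c and c=c]) (use curlfree c_in in simp)
 have g: "grad (\<psi> m) x = mk (T (ep m) w1 x) (T (ep m) w2 x)" if x: "x \<in> F" for x m unfolding \<psi>_def[abs_def]
 proof (rule radial_potential(2)[OF T_kern(2)[OF w1(1) ep(1)] T_kern(2)[OF w2(1) ep(1)]])
  fix s :: real assume s: "0 \<le> s" "s \<le> 1"
  have "c + s *\<^sub>R (x - c) \<in> F" using ray_in[OF F_sub_closure[OF x], of s] s x by (cases "s = 1") auto
  then show "grad (T (ep m) w2) (c + s *\<^sub>R (x - c)) $ 1 = grad (T (ep m) w1) (c + s *\<^sub>R (x - c)) $ 2" by (rule curlfree)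
 qed
 have lim: "(\<lambda>m. nrm (leb F) (\<lambda>x. grad (\<psi> m) x $ i - w x $ i)) \<longlonglongrightarrow> 0"
  if wi: "sqF wi" "AE x in leb F. wi x = w x $ i" and gi: "\<And>m x. x \<in> F ==> grad (\<psi> m) x $ i = T (ep m) wi x" for i wi
 proof -
  have "nrm (leb F) (\<lambda>x. grad (\<psi> m) x $ i - w x $ i) = nrm (leb F) (\<lambda>x. T (ep m) wi x - wi x)" for m
  proof (rule nrm_cong_AE)
   show "(\<lambda>x. grad (\<psi> m) x $ i - w x $ i) \<in> borel_measurable (leb F)"
    by (intro borel_measurable_diff sqi_meas[OF nrm_plane_sq(1)[OF w]] cont_measurable continuous_on_component C1_grad_continuous C)
   show "(\<lambda>x. T (ep m) wi x - wi x) \<in> borel_measurable (leb F)"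
    by (intro borel_measurable_diff sqi_meas[OF sqF_restrict(1)[OF wi(1)]] cont_measurable C1_continuous T_kern(2)[OF wi(1) ep(1)])
   have "AE x in leb F. x \<in> F" by (rule AE_I2) (simp add: space_restrict_space)
   then show "AE x in leb F. grad (\<psi> m) x $ i - w x $ i = T (ep m) wi x - wi x" using wi(2) by eventually_elim (simp add: gi)
  qed
  then show ?thesis using T_conv[OF wi(1)] by simp
 qed
 have s: "sqi (leb F) (\<lambda>x. grad (\<psi> m) x - w x)" for m by (intro sqi_diff w continuous_sqi_on[OF C1_grad_continuous[OF C] F_ob])
 have "nrm (leb F) (\<lambda>x. grad (\<psi> m) x - w x) =
  sqrt ((nrm (leb F) (\<lambda>x. grad (\<psi> m) x $ 1 - w x $ 1))^2 + (nrm (leb F) (\<lambda>x. grad (\<psi> m) x $ 2 - w x $ 2))^2)" for m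
  using nrm_plane_sq(2)[OF s, of m] by (simp add: real_sqrt_unique[symmetric])
 moreover have "(\<lambda>m. sqrt ((nrm (leb F) (\<lambda>x. grad (\<psi> m) x $ 1 - w x $ 1))^2 + (nrm (leb F) (\<lambda>x. grad (\<psi> m) x $ 2 - w x $ 2))^2)) \<longlonglongrightarrow> sqrt (0^2 + 0^2)"
  by (intro tendsto_intros lim[OF w1] lim[OF w2]) (simp_all add: g)
 ultimately show ?thesis using C by (intro exI[of _ \<psi>]) simp
qed

end

section \<open>Polynomials\<close>

definition qf :: "'i set => ('i => 'i => real) => ('i => real) => real" where
 "qf A G c = (\<Sum>a\<in>A. \<Sum>b\<in>A. c a * c b * G a b)"

lemma qf_insert:
 assumes "finite A" "z \<notin> A" "\<And>a b. G a b = G b a"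
 shows "qf (insert z A) G c = qf A G c + 2 * c z * (\<Sum>a\<in>A. c a * G a z) + (c z)^2 * G z z"
proof -
 have "qf (insert z A) G c = c z * c z * G z z + (\<Sum>b\<in>A. c z * c b * G z b) +
  (\<Sum>a\<in>A. c a * c z * G a z + (\<Sum>b\<in>A. c a * c b * G a b))"
  using assms by (simp add: qf_def)
 also have "(\<Sum>b\<in>A. c z * c b * G z b) = c z * (\<Sum>a\<in>A. c a * G a z)"
  unfolding sum_distrib_left by (intro sum.cong refl) (metis assms(3) mult.assoc)
 also have "(\<Sum>a\<in>A. c a * c z * G a z + (\<Sum>b\<in>A. c a * c b * G a b)) = c z * (\<Sum>a\<in>A. c a * G a z) + qf A G c"
  unfolding qf_def sum.distrib sum_distrib_left by (intro arg_cong2[where f="(+)"] sum.cong refl) simp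
 also have "c z * c z * G z z + c z * (\<Sum>a\<in>A. c a * G a z) + (c z * (\<Sum>a\<in>A. c a * G a z) + qf A G c)
  = qf A G c + 2 * c z * (\<Sum>a\<in>A. c a * G a z) + (c z)^2 * G z z"
  by (simp add: power2_eq_square algebra_simps)
 finally show ?thesis .
qed

lemma qf_cong: "(\<And>a. a \<in> A ==> c a = d a) ==> qf A G c = qf A G d" by (simp add: qf_def)

lemma linear_nonneg_zero:
 fixes p q :: real
 assumes "\<And>s. 0 \<le> 2 * s * p + s^2 * q" shows "p = 0"
proof (rule ccontr)
 assume p: "p \<noteq> 0"
 define s where "s = - p / (\<bar>q\<bar> + 1)"
 have "2 * s * p + s^2 * q \<le> 2 * s * p + s^2 * (\<bar>q\<bar> + 1)" by (intro add_left_mono mult_left_mono) auto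
 also have "\<dots> = - (p^2 / (\<bar>q\<bar> + 1))"
 proof -
  have "s * (\<bar>q\<bar> + 1) = - p" by (simp add: s_def add_nonneg_pos)
  then have "s^2 * (\<bar>q\<bar> + 1) = s * (- p)" by (simp add: power2_eq_square mult.assoc)
  then show ?thesis by (simp add: s_def power2_eq_square)
 qed
 also have "\<dots> < 0" using p by (simp add: add_nonneg_pos)
 finally show False using assms[of s] by simp
qed

text \<open>Riesz representation for a positive semidefinite Gram matrix, by Gram-Schmidt.\<close>

lemma gram_solve:
 fixes G :: "'i => 'i => real"
 assumes "finite A" and sym: "\<And>a b. G a b = G b a" and "\<And>c. 0 \<le> qf A G c"
 and "\<And>c. qf A G c = 0 ==> (\<Sum>a\<in>A. c a * l a) = 0"
 shows "\<exists>u. \<forall>a\<in>A. (\<Sum>b\<in>A. G a b * u b) = l a"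
 using assms(1,3,4)
proof (induction A arbitrary: l rule: finite_induct)
 case empty then show ?case by simp
next
 case (insert z A)
 note ins = qf_insert[OF insert.hyps sym]
 have ext: "qf (insert z A) G (c(z := 0)) = qf A G c" for c
 proof -
  have "qf A G (c(z := 0)) = qf A G c" by (rule qf_cong) (use insert.hyps in auto)
  then show ?thesis by (simp add: ins)
 qed
 have psd: "0 \<le> qf A G c" for c using insert.prems(1)[of "c(z := 0)"] unfolding ext .
 have ker: "(\<Sum>a\<in>A. c a * l' a) = 0"
  if "qf A G c = 0" "\<And>c. qf (insert z A) G c = 0 ==> (\<Sum>a\<in>insert z A. c a * l' a) = 0" for c l'
 proof -
  have "(\<Sum>a\<in>insert z A. (c(z := 0)) a * l' a) = 0" using that(1) by (intro that(2)) (simp only: ext)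
  moreover have "(\<Sum>a\<in>A. (c(z := 0)) a * l' a) = (\<Sum>a\<in>A. c a * l' a)" by (intro sum.cong) (use insert.hyps in auto)
  ultimately show ?thesis using insert.hyps by simp
 qed
 obtain u0 where u0: "\<And>a. a \<in> A ==> (\<Sum>b\<in>A. G a b * u0 b) = l a" using insert.IH[OF psd ker[OF _ insert.prems(2)]] by blast
 \<comment> \<open>The projection of the new vector onto the old ones, again from the induction
   hypothesis. Nonnegativity of the form shows that a kernel vector of the old form is orthogonal to
   the new vector.\<close>
 have "\<exists>w. \<forall>a\<in>A. (\<Sum>b\<in>A. G a b * w b) = G a z"
 proof (rule insert.IH[OF psd])
  fix c assume c: "qf A G c = 0"
  show "(\<Sum>a\<in>A. c a * G a z) = 0"
  proof (rule linear_nonneg_zero[where q="G z z"])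
   fix s
   have "0 \<le> qf (insert z A) G (c(z := s))" by (rule insert.prems)
   also have "\<dots> = qf A G c + 2 * s * (\<Sum>a\<in>A. c a * G a z) + s^2 * G z z"
   proof -
    have "qf A G (c(z := s)) = qf A G c" by (rule qf_cong) (use insert.hyps in auto)
    moreover have "(\<Sum>a\<in>A. (c(z := s)) a * G a z) = (\<Sum>a\<in>A. c a * G a z)" by (intro sum.cong) (use insert.hyps in auto)
    ultimately show ?thesis by (simp add: ins)
   qed
   finally show "0 \<le> 2 * s * (\<Sum>a\<in>A. c a * G a z) + s^2 * G z z" using c by simp
  qed
 qed
 then obtain w where w: "\<And>a. a \<in> A ==> (\<Sum>b\<in>A. G a b * w b) = G a z" by blast
 have dual: "(\<Sum>b\<in>A. G z b * u b) = (\<Sum>a\<in>A. w a * l' a)"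
  if "\<And>a. a \<in> A ==> (\<Sum>b\<in>A. G a b * u b) = l' a" for u l'
 proof -
  have "(\<Sum>b\<in>A. G z b * u b) = (\<Sum>b\<in>A. \<Sum>a\<in>A. G b a * w a * u b)"
   by (intro sum.cong refl, subst sym) (simp add: w flip: sum_distrib_right)
  also have "\<dots> = (\<Sum>a\<in>A. \<Sum>b\<in>A. G b a * w a * u b)" by (rule sum.swap)
  also have "\<dots> = (\<Sum>a\<in>A. w a * (\<Sum>b\<in>A. G a b * u b))"
   unfolding sum_distrib_left by (intro sum.cong refl) (metis sym mult.assoc mult.commute)
  finally show ?thesis using that by simp
 qed
 \<comment> \<open>The part of the new vector orthogonal to the old ones; \<open>\<sigma>\<close> is
   its squared length and \<open>\<tau>\<close> the value of the functional on it.\<close>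
 define g where "g a = (if a = z then 1 else - w a)" for a
 define \<sigma> where "\<sigma> = G z z - (\<Sum>b\<in>A. G z b * w b)"
 define \<tau> where "\<tau> = l z - (\<Sum>a\<in>A. w a * l a)"
 have gA: "(\<Sum>b\<in>insert z A. G a b * g b) = (if a = z then \<sigma> else 0)" if "a \<in> insert z A" for a
 proof -
  have "(\<Sum>b\<in>insert z A. G a b * g b) = G a z - (\<Sum>b\<in>A. G a b * w b)"
  proof -
   have "(\<Sum>b\<in>A. G a b * g b) = - (\<Sum>b\<in>A. G a b * w b)"
    unfolding sum_negf[symmetric] by (intro sum.cong) (use insert.hyps in \<open>auto simp: g_def\<close>)
   then show ?thesis using insert.hyps by (simp add: g_def)
  qed
  then show ?thesis using that w by (auto simp: \<sigma>_def)
 qed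
 have "qf (insert z A) G g = (\<Sum>a\<in>insert z A. g a * (\<Sum>b\<in>insert z A. G a b * g b))" by (simp add: qf_def sum_distrib_left ac_simps)
 also have "\<dots> = (\<Sum>a\<in>insert z A. if a = z then \<sigma> else 0)" using gA by (intro sum.cong) (auto simp: g_def)
 also have "\<dots> = \<sigma>" using insert.hyps by simp
 finally have qg: "qf (insert z A) G g = \<sigma>" .
 have lg: "(\<Sum>a\<in>insert z A. g a * l a) = \<tau>"
 proof -
  have "(\<Sum>a\<in>A. g a * l a) = (\<Sum>a\<in>A. - (w a * l a))" using insert.hyps by (intro sum.cong) (auto simp: g_def)
  then show ?thesis using insert.hyps by (simp add: g_def \<tau>_def sum_negf)
 qed
 \<comment> \<open>For \<open>\<sigma> = 0\<close> the hypothesis on \<open>l\<close> forces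
   \<open>\<tau> = 0\<close>, so any coefficient would do.\<close>
 define k where "k = (if \<sigma> = 0 then 0 else \<tau> / \<sigma>)"
 have k: "k * \<sigma> = \<tau>" using insert.prems(2)[of g] qg lg by (auto simp: k_def)
 define u where "u b = (if b = z then 0 else u0 b) + k * g b" for b
 have "(\<Sum>b\<in>insert z A. G a b * u b) = l a" if a: "a \<in> insert z A" for a
 proof -
  have "(\<Sum>b\<in>insert z A. G a b * u b) = (\<Sum>b\<in>insert z A. G a b * (if b = z then 0 else u0 b)) + k * (\<Sum>b\<in>insert z A. G a b * g b)"
   by (simp only: u_def distrib_left sum.distrib sum_distrib_left mult.left_commute[of k])
  also have "(\<Sum>b\<in>insert z A. G a b * (if b = z then 0 else u0 b)) = (\<Sum>b\<in>A. G a b * u0 b)" using insert.hyps by (auto intro!: sum.cong)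
  also have "(\<Sum>b\<in>insert z A. G a b * g b) = (if a = z then \<sigma> else 0)" by (rule gA[OF a])
  finally show ?thesis using a u0 dual[of u0 l] k insert.hyps by (auto simp: \<tau>_def)
 qed
 then show ?case by blast
qed

lemma qf_form: "qf A G c = (\<Sum>a\<in>A. c a * (\<Sum>b\<in>A. G a b * c b))"
 by (simp add: qf_def sum_distrib_left ac_simps)

text \<open>Each coordinate functional has a Riesz representative, and Cauchy-Schwarz for the form
  bounds the coordinate by it. This gives equivalence of norms without a compactness
  argument.\<close>

lemma gram_coefficient_bound:
 fixes G :: "'i => 'i => real"
 assumes A: "finite A" and sym: "\<And>a b. G a b = G b a" and psd: "\<And>c. 0 \<le> qf A G c"
 and pd: "\<And>c a. qf A G c = 0 ==> a \<in> A ==> c a = 0"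
 shows "\<exists>C>0. \<forall>c. \<forall>a\<in>A. (c a)^2 \<le> C * qf A G c"
proof -
 have "\<exists>C\<ge>0. \<forall>c. (c a)^2 \<le> C * qf A G c" if a: "a \<in> A" for a
 proof -
  have "\<exists>u. \<forall>b\<in>A. (\<Sum>d\<in>A. G b d * u d) = (if b = a then 1 else 0)"
   by (rule gram_solve[OF A sym psd]) (use pd a in \<open>auto intro!: sum.neutral\<close>)
  then obtain u where u: "\<And>b. b \<in> A ==> (\<Sum>d\<in>A. G b d * u d) = (if b = a then 1 else 0)" by blast
  have "(c a)^2 \<le> qf A G u * qf A G c" for c
  proof -
   have cu: "(\<Sum>b\<in>A. c b * (\<Sum>d\<in>A. G b d * u d)) = c a" using A a by (simp add: u if_distrib cong: if_cong)
   have uc: "(\<Sum>b\<in>A. u b * (\<Sum>d\<in>A. G b d * c d)) = c a"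
   proof -
    have "(\<Sum>b\<in>A. u b * (\<Sum>d\<in>A. G b d * c d)) = (\<Sum>b\<in>A. \<Sum>d\<in>A. u b * (G b d * c d))" by (simp add: sum_distrib_left)
    also have "\<dots> = (\<Sum>d\<in>A. \<Sum>b\<in>A. u b * (G b d * c d))" by (rule sum.swap)
    also have "\<dots> = (\<Sum>b\<in>A. c b * (\<Sum>d\<in>A. G b d * u d))"
     unfolding sum_distrib_left by (intro sum.cong refl) (metis sym mult.assoc mult.commute)
    finally show ?thesis using cu by simp
   qed
   have q: "0 \<le> qf A G c * s^2 + 2 * s * c a + qf A G u" for s
   proof -
    have "0 \<le> qf A G (\<lambda>b. s * c b + u b)" by (rule psd)
    also have "\<dots> = s^2 * qf A G c + s * (\<Sum>b\<in>A. c b * (\<Sum>d\<in>A. G b d * u d)) + s * (\<Sum>b\<in>A. u b * (\<Sum>d\<in>A. G b d * c d)) + qf A G u"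
     unfolding qf_form by (simp add: distrib_left distrib_right sum.distrib sum_distrib_left power2_eq_square ac_simps)
    finally show ?thesis unfolding cu uc by (simp add: ac_simps)
   qed
   show ?thesis
   proof (cases "qf A G c = 0")
    case True then show ?thesis using pd a by simp
   next
    case False
    then have pos: "qf A G c > 0" using psd[of c] by simp
    have "qf A G c * (- c a / qf A G c)^2 + 2 * (- c a / qf A G c) * c a = - (c a)\<^sup>2 / qf A G c"
     using pos by (simp add: power2_eq_square field_simps)
    then have "(c a)^2 / qf A G c \<le> qf A G u" using q[of "- c a / qf A G c"] by simp
    then show ?thesis using pos by (simp add: field_simps)
   qed
  qed
  then show ?thesis using psd by blast
 qed
 then obtain C where C: "\<And>a. a \<in> A ==> 0 \<le> C a" "\<And>a c. a \<in> A ==> (c a)^2 \<le> C a * qf A G c" by metis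
 have "(c a)^2 \<le> (sum C A + 1) * qf A G c" if "a \<in> A" for a c
 proof -
  have "C a \<le> sum C A" using member_le_sum[of a A C] that C(1) A by auto
  then have "C a * qf A G c \<le> (sum C A + 1) * qf A G c" using psd by (intro mult_right_mono) auto
  then show ?thesis using C(2)[OF that, of c] by linarith
 qed
 moreover have "sum C A + 1 > 0" using C(1) by (simp add: sum_nonneg add_nonneg_pos)
 ultimately show ?thesis by blast
qed

section \<open>Polynomials of bounded degree\<close>

definition idx :: "int => (nat \<times> nat) set" where "idx k = {(i, j). int i + int j \<le> k}"

definition mon :: "nat \<times> nat => plane => real" where "mon a x = (x $ 1) ^ fst a * (x $ 2) ^ snd a"

lemma finite_idx [simp]: "finite (idx k)"
proof (rule finite_subset)
 show "idx k \<subseteq> {..nat k} \<times> {..nat k}" by (auto simp: idx_def)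
qed simp

lemma polys_iff: "p \<in> polys k \<longleftrightarrow> (\<exists>c. p = (\<lambda>x. \<Sum>a\<in>idx k. c a * mon a x))"
proof
 assume "p \<in> polys k"
 then obtain c where c: "p = (\<lambda>x. \<Sum>(i, j) | int i + int j \<le> k. c i j * (x $ 1) ^ i * (x $ 2) ^ j)" by (auto simp: polys_def)
 have "p = (\<lambda>x. \<Sum>a\<in>idx k. (\<lambda>(i,j). c i j) a * mon a x)"
  unfolding c idx_def mon_def by (intro ext sum.cong) (auto simp: mult.assoc)
 then show "\<exists>c. p = (\<lambda>x. \<Sum>a\<in>idx k. c a * mon a x)" by blast
next
 assume "\<exists>c. p = (\<lambda>x. \<Sum>a\<in>idx k. c a * mon a x)"
 then obtain c where c: "p = (\<lambda>x. \<Sum>a\<in>idx k. c a * mon a x)" by blast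
 have "p = (\<lambda>x. \<Sum>(i, j) | int i + int j \<le> k. (\<lambda>i j. c (i, j)) i j * (x $ 1) ^ i * (x $ 2) ^ j)"
  unfolding c idx_def mon_def by (intro ext sum.cong) (auto simp: mult.assoc)
 then show "p \<in> polys k" unfolding polys_def mem_Collect_eq by (rule exI[of _ "\<lambda>i j. c (i, j)"])
qed

lemma polysI: "(\<lambda>x. \<Sum>a\<in>idx k. c a * mon a x) \<in> polys k" by (auto simp: polys_iff)

lemma polysE: assumes "p \<in> polys k" obtains c where "p = (\<lambda>x. \<Sum>a\<in>idx k. c a * mon a x)"
 using assms by (auto simp: polys_iff)

lemma polys_zero: "(\<lambda>x. 0) \<in> polys k"
 using polysI[of "\<lambda>a. 0" k] by simp

lemma polys_add: assumes "p \<in> polys k" "q \<in> polys k" shows "(\<lambda>x. p x + q x) \<in> polys k"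
proof -
 obtain c d where "p = (\<lambda>x. \<Sum>a\<in>idx k. c a * mon a x)" "q = (\<lambda>x. \<Sum>a\<in>idx k. d a * mon a x)"
  using assms by (metis polysE)
 then have "(\<lambda>x. p x + q x) = (\<lambda>x. \<Sum>a\<in>idx k. (c a + d a) * mon a x)" by (simp add: sum.distrib distrib_right)
 then show ?thesis by (simp add: polysI)
qed

lemma polys_cmult: assumes "p \<in> polys k" shows "(\<lambda>x. s * p x) \<in> polys k"
proof -
 obtain c where "p = (\<lambda>x. \<Sum>a\<in>idx k. c a * mon a x)" using assms by (metis polysE)
 then have "(\<lambda>x. s * p x) = (\<lambda>x. \<Sum>a\<in>idx k. (s * c a) * mon a x)" by (simp add: sum_distrib_left mult.assoc)
 then show ?thesis by (simp add: polysI)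
qed

lemma polys_uminus: "p \<in> polys k ==> (\<lambda>x. - p x) \<in> polys k"
 using polys_cmult[of p k "-1"] by simp

lemma polys_diff: "p \<in> polys k ==> q \<in> polys k ==> (\<lambda>x. p x - q x) \<in> polys k"
 using polys_add[of p k "\<lambda>x. - q x"] polys_uminus[of q k] by simp

lemma polys_sum: "(\<And>a. a \<in> A ==> p a \<in> polys k) ==> (\<lambda>x. \<Sum>a\<in>A. p a x) \<in> polys k"
 by (induction A rule: infinite_finite_induct) (auto intro: polys_zero polys_add)

lemma polys_mon: assumes "a \<in> idx k" shows "mon a \<in> polys k"
 unfolding polys_iff
proof (intro exI[of _ "\<lambda>b. if b = a then 1 else 0"] ext)
 fix x
 have "(\<Sum>b\<in>idx k. (if b = a then 1 else 0) * mon b x) = (\<Sum>b\<in>idx k. if b = a then mon b x else 0)" by (intro sum.cong) auto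
 then show "mon a x = (\<Sum>b\<in>idx k. (if b = a then 1 else 0) * mon b x)" using assms by simp
qed

lemma polys_mono: assumes "p \<in> polys k" "k \<le> l" shows "p \<in> polys l"
proof -
 obtain c where c: "p = (\<lambda>x. \<Sum>a\<in>idx k. c a * mon a x)" using assms by (metis polysE)
 have "idx k \<subseteq> idx l" using assms by (auto simp: idx_def)
 then show ?thesis unfolding c by (intro polys_sum polys_cmult polys_mon) auto
qed

lemma polys_const: "0 \<le> k ==> (\<lambda>x. s) \<in> polys k"
 using polys_cmult[OF polys_mon[of "(0,0)" k], of s] by (simp add: idx_def mon_def)

lemma polys_coord: "(\<lambda>x. x $ i) \<in> polys 1"
proof -
 have "i = 1 \<or> i = 2" using exhaust_2 by blast
 then show ?thesis using polys_mon[of "(1,0)" 1] polys_mon[of "(0,1)" 1] by (auto simp: idx_def mon_def[abs_def])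
qed

lemma polys_mult: assumes "p \<in> polys k" "q \<in> polys l" shows "(\<lambda>x. p x * q x) \<in> polys (k + l)"
proof -
 obtain c d where c: "p = (\<lambda>x. \<Sum>a\<in>idx k. c a * mon a x)" and d: "q = (\<lambda>x. \<Sum>a\<in>idx l. d a * mon a x)"
  using assms by (metis polysE)
 have "(\<lambda>x. p x * q x) = (\<lambda>x. \<Sum>a\<in>idx k. \<Sum>b\<in>idx l. (c a * d b) * mon (fst a + fst b, snd a + snd b) x)"
  unfolding c d sum_product by (intro ext sum.cong) (auto simp: mon_def power_add)
 also have "\<dots> \<in> polys (k + l)" by (intro polys_sum polys_cmult polys_mon) (auto simp: idx_def)
 finally show ?thesis .
qed

lemma polys_power: "p \<in> polys 1 ==> (\<lambda>x. p x ^ m) \<in> polys (int m)"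
proof (induction m)
 case 0 then show ?case by (simp add: polys_const)
next
 case (Suc m)
 then have "(\<lambda>x. p x * p x ^ m) \<in> polys (1 + int m)" by (intro polys_mult) auto
 then show ?case by simp
qed

lemma polys_compose:
 assumes p: "p \<in> polys k" and u: "u \<in> polys 1" "v \<in> polys 1"
 shows "(\<lambda>x. p (mk (u x) (v x))) \<in> polys k"
proof -
 obtain c where c: "p = (\<lambda>x. \<Sum>a\<in>idx k. c a * mon a x)" using p by (metis polysE)
 show ?thesis unfolding c
 proof (intro polys_sum polys_cmult)
  fix a assume "a \<in> idx k"
  then have "int (fst a) + int (snd a) \<le> k" by (auto simp: idx_def)
  then show "(\<lambda>x. mon a (mk (u x) (v x))) \<in> polys k"
   using polys_mono[OF polys_mult[OF polys_power[OF u(1)] polys_power[OF u(2)]], of "fst a" "snd a" k] by (simp add: mon_def)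
 qed
qed

lemma polys_affine1: "(\<lambda>x. s + t * x $ i) \<in> polys 1"
 by (intro polys_add polys_const polys_cmult polys_coord) simp

lemma polys_inner: "(\<lambda>x. s + (x - b) \<bullet> y) \<in> polys 1"
proof -
 have "(\<lambda>x. (s - b \<bullet> y) + (y $ 1 * x $ 1 + y $ 2 * x $ 2)) \<in> polys 1" by (intro polys_add polys_const polys_cmult polys_coord) simp
 also have "(\<lambda>x. (s - b \<bullet> y) + (y $ 1 * x $ 1 + y $ 2 * x $ 2)) = (\<lambda>x. s + (x - b) \<bullet> y)"
  by (simp add: fun_eq_iff plane_inner algebra_simps)
 finally show ?thesis .
qed

lemma polys_rescale: assumes "p \<in> polys k" shows "(\<lambda>x. p (z + s *\<^sub>R x)) \<in> polys k"
proof -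
 have "mk (z $ 1 + s * x $ 1) (z $ 2 + s * x $ 2) = z + s *\<^sub>R x" for x by (simp add: plane_eq_iff)
 then show ?thesis using polys_compose[OF assms polys_affine1 polys_affine1, of "z $ 1" s 1 "z $ 2" s 2] by simp
qed

lemma C1_mon: "C1 (mon a)" and grad_mon: "grad (mon a) = (\<lambda>x.
 mk (real (fst a) * mon (fst a - 1, snd a) x) (real (snd a) * mon (fst a, snd a - 1) x))"
proof -
 have nth: "((\<lambda>x::plane. x $ i) has_derivative (\<lambda>d. d $ i)) (at x)" for i x
  by (rule bounded_linear_imp_has_derivative[OF bounded_linear_vec_nth])
 have "(mon a has_derivative (\<lambda>d. (mk (real (fst a) * mon (fst a - 1, snd a) x) (real (snd a) * mon (fst a, snd a - 1) x)) \<bullet> d)) (at x)" for x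
  unfolding mon_def[abs_def] by (rule has_derivative_eq_rhs[OF has_derivative_mult[OF has_derivative_power[OF nth] has_derivative_power[OF nth]]])
  (auto simp: plane_inner fun_eq_iff algebra_simps)
 moreover have "cont (\<lambda>x. mk (real (fst a) * mon (fst a - 1, snd a) x) (real (snd a) * mon (fst a, snd a - 1) x))"
  unfolding mon_def by (intro continuous_intros)
 ultimately show "C1 (mon a)" "grad (mon a) = (\<lambda>x.
  mk (real (fst a) * mon (fst a - 1, snd a) x) (real (snd a) * mon (fst a, snd a - 1) x))"
  by (fact C1I)+
qed

lemma C1_sum:
 assumes "\<And>a. a \<in> A ==> C1 (f a)"
 shows "C1 (\<lambda>x. \<Sum>a\<in>A. f a x) \<and> grad (\<lambda>x. \<Sum>a\<in>A. f a x) = (\<lambda>x. \<Sum>a\<in>A. grad (f a) x)"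
 using assms by (induction A rule: infinite_finite_induct) (auto simp: C1_add)

lemma polys_C1: "p \<in> polys k ==> C1 p"
 by (erule polysE) (auto intro!: conjunct1[OF C1_sum] C1_cmult C1_mon)

lemma grad_polys:
 "grad (\<lambda>x. \<Sum>a\<in>B. c a * mon a x) = (\<lambda>x. \<Sum>a\<in>B. c a *\<^sub>R
 mk (real (fst a) * mon (fst a - 1, snd a) x) (real (snd a) * mon (fst a, snd a - 1) x))"
 using conjunct2[OF C1_sum[of B "\<lambda>a x. c a * mon a x"]] C1_cmult[OF C1_mon] by (simp add: grad_mon)

lemma polys_grad: assumes "p \<in> polys k" shows "(\<lambda>x. grad p x $ i) \<in> polys (k - 1)"
proof -
 obtain c where c: "p = (\<lambda>x. \<Sum>a\<in>idx k. c a * mon a x)" using assms by (metis polysE)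
 have m: "(\<lambda>x. real (fst a) * mon (fst a - 1, snd a) x) \<in> polys (k - 1)"
  "(\<lambda>x. real (snd a) * mon (fst a, snd a - 1) x) \<in> polys (k - 1)" if "a \<in> idx k" for a
 proof -
  show "(\<lambda>x. real (fst a) * mon (fst a - 1, snd a) x) \<in> polys (k - 1)"
  proof (cases "fst a = 0")
   case False then show ?thesis using that by (intro polys_cmult polys_mon) (auto simp: idx_def)
  qed (simp add: polys_zero)
  show "(\<lambda>x. real (snd a) * mon (fst a, snd a - 1) x) \<in> polys (k - 1)"
  proof (cases "snd a = 0")
   case False then show ?thesis using that by (intro polys_cmult polys_mon) (auto simp: idx_def)
  qed (simp add: polys_zero)
 qed
 have "i = 1 \<or> i = 2" using exhaust_2 by blast
 then show ?thesis
 proof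
  assume "i = 1"
  then have "(\<lambda>x. grad p x $ i) = (\<lambda>x. \<Sum>a\<in>idx k. c a * (real (fst a) * mon (fst a - 1, snd a) x))"
   unfolding c grad_polys by (simp add: sum_component)
  then show ?thesis using polys_sum[OF polys_cmult[OF m(1)]] by simp
 next
  assume "i = 2"
  then have "(\<lambda>x. grad p x $ i) = (\<lambda>x. \<Sum>a\<in>idx k. c a * (real (snd a) * mon (fst a, snd a - 1) x))"
   unfolding c grad_polys by (simp add: sum_component)
  then show ?thesis using polys_sum[OF polys_cmult[OF m(2)]] by simp
 qed
qed

lemma polys_recenter:
 assumes "p \<in> polys k"
 obtains c where "p = (\<lambda>x. \<Sum>a\<in>idx k. c a * mon a (x - b))"
proof -
 obtain c where c: "(\<lambda>x. p (b + 1 *\<^sub>R x)) = (\<lambda>x. \<Sum>a\<in>idx k. c a * mon a x)"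
  using polys_rescale[OF assms] by (metis polysE)
 have "p x = (\<Sum>a\<in>idx k. c a * mon a (x - b))" for x using fun_cong[OF c, of "x - b"] by simp
 then show ?thesis using that by blast
qed

lemma polys_edge:
 assumes "p \<in> polys (int k)"
 shows "\<exists>a. \<forall>t. p (x + t *\<^sub>R y) = (\<Sum>i\<le>k. a i * t ^ i)"
proof -
 have "(\<lambda>z. p (mk (x $ 1 + y $ 1 * z $ 1) (x $ 2 + y $ 2 * z $ 1))) \<in> polys (int k)"
  by (rule polys_compose[OF assms polys_affine1 polys_affine1])
 then obtain c where c: "(\<lambda>z. p (mk (x $ 1 + y $ 1 * z $ 1) (x $ 2 + y $ 2 * z $ 1))) = (\<lambda>z. \<Sum>a\<in>idx (int k). c a * mon a z)"
  by (rule polysE)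
 have "p (x + t *\<^sub>R y) = (\<Sum>i\<le>k. c (i, 0) * t ^ i)" for t
 proof -
  have e: "mk (x $ 1 + y $ 1 * mk t 0 $ 1) (x $ 2 + y $ 2 * mk t 0 $ 1) = x + t *\<^sub>R y"
   unfolding plane_eq_iff mk_nth vector_add_component vector_scaleR_component by simp
  have "p (x + t *\<^sub>R y) = (\<Sum>a\<in>idx (int k). c a * mon a (mk t 0))" using fun_cong[OF c, of "mk t 0"] unfolding e .
  also have "\<dots> = (\<Sum>a\<in>(\<lambda>i. (i, 0::nat)) ` {..k}. c a * mon a (mk t 0))"
   by (rule sum.mono_neutral_right[OF finite_idx]) (auto simp: idx_def mon_def power_0_left image_iff)
  also have "\<dots> = (\<Sum>i\<le>k. c (i, 0) * t ^ i)" by (subst sum.reindex) (auto simp: inj_on_def mon_def)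
  finally show ?thesis .
 qed
 then show ?thesis by (intro exI[of _ "\<lambda>i. c (i, 0)"] allI)
qed

lemma poly1_zero:
 fixes a :: "nat => real"
 assumes "l < u" "\<And>t. l < t ==> t < u ==> (\<Sum>i\<le>k. a i * t ^ i) = 0" "i \<le> k"
 shows "a i = 0"
proof (rule ccontr)
 assume "a i \<noteq> 0"
 then have "finite {t. (\<Sum>i\<le>k. a i * t ^ i) = 0}" using assms(3) polyfun_finite_roots by blast
 moreover have "{l<..<u} \<subseteq> {t. (\<Sum>i\<le>k. a i * t ^ i) = 0}" using assms(2) by auto
 ultimately have "finite {l<..<u}" by (rule finite_subset[rotated])
 then show False using assms(1) by (simp add: infinite_Ioo)
qed

text \<open>The one-variable statement is applied twice, in \<open>s\<close> for fixed
  \<open>t\<close> and then in \<open>t\<close> for each coefficient. For this the triangular index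
  set is padded by zeros to the square array \<open>d\<close>.\<close>

lemma polys_zero_coeffs:
 assumes e: "e > 0" and z: "\<And>x. norm x < e ==> (\<Sum>a\<in>idx k. c a * mon a x) = 0" and a: "a \<in> idx k"
 shows "c a = 0"
proof -
 define K where "K = nat k"
 define d where "d i j = (if (i, j) \<in> idx k then c (i, j) else 0)" for i j
 have sub: "idx k \<subseteq> {..K} \<times> {..K}" by (auto simp: idx_def K_def)
 have eq: "(\<Sum>a\<in>idx k. c a * mon a (mk s t)) = (\<Sum>i\<le>K. (\<Sum>j\<le>K. d i j * t ^ j) * s ^ i)" for s t
 proof -
  have "(\<Sum>a\<in>idx k. c a * mon a (mk s t)) = (\<Sum>a\<in>idx k. d (fst a) (snd a) * mon a (mk s t))" by (intro sum.cong) (auto simp: d_def)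
  also have "\<dots> = (\<Sum>a\<in>{..K} \<times> {..K}. d (fst a) (snd a) * mon a (mk s t))"
   using sub by (intro sum.mono_neutral_left) (auto simp: d_def)
  also have "\<dots> = (\<Sum>i\<le>K. \<Sum>j\<le>K. d i j * (s ^ i * t ^ j))" by (simp add: sum.cartesian_product mon_def split_beta)
  finally show ?thesis by (simp add: sum_distrib_left sum_distrib_right ac_simps)
 qed
 have small: "norm (mk s t) < e" if "\<bar>s\<bar> < e/2" "\<bar>t\<bar> < e/2" for s t
 proof -
  have "norm (mk s t) \<le> \<bar>s\<bar> + \<bar>t\<bar>"
   using norm_triangle_ineq[of "s *\<^sub>R axis 1 1" "t *\<^sub>R axis 2 1 :: plane"] by (simp add: mk_alt)
  then show ?thesis using that by simp
 qed
 have 1: "(\<Sum>j\<le>K. d i j * t ^ j) = 0" if "i \<le> K" "\<bar>t\<bar> < e/2" for i t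
 proof (rule poly1_zero[where l="-(e/2)" and u="e/2" and k=K and a="\<lambda>i. \<Sum>j\<le>K. d i j * t ^ j"])
  fix s :: real assume "-(e/2) < s" "s < e/2"
  then show "(\<Sum>i\<le>K. (\<Sum>j\<le>K. d i j * t ^ j) * s ^ i) = 0" using z[OF small[of s t]] that(2) unfolding eq[symmetric] by auto
 qed (use e that in auto)
 have 2: "d i j = 0" if "i \<le> K" "j \<le> K" for i j by (rule poly1_zero[where l="-(e/2)" and u="e/2" and k=K and a="d i"]) (use 1 e that in auto)
 obtain i j where ij: "a = (i, j)" by (cases a)
 show ?thesis using 2[of i j] a sub unfolding ij by (auto simp: d_def)
qed

lemma continuous_AE_zero:
 fixes f :: "'a::euclidean_space => real"
 assumes f: "cont f" and S: "open S" and AE: "AE x in leb S. f x = 0" and x: "x \<in> S"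
 shows "f x = 0"
proof (rule ccontr)
 assume nz: "f x \<noteq> 0"
 have Sl: "S \<in> sets lebesgue" using S by (rule open_lebesgue)
 have o: "open (S \<inter> f -` (- {0}))" by (intro open_Int S open_vimage f) auto
 have "AE y in lebesgue. y \<in> S --> f y = 0" using AE Sl by (simp add: AE_restrict_space_iff)
 then have "AE y in lebesgue. y \<notin> S \<inter> f -` (- {0})" by (auto elim: eventually_mono)
 then have "S \<inter> f -` (- {0}) \<in> null_sets lebesgue" using o by (subst AE_iff_null_sets) (auto intro: open_lebesgue)
 then have "negligible (S \<inter> f -` (- {0}))" by (simp add: negligible_iff_null_sets)
 moreover have "S \<inter> f -` (- {0}) \<noteq> {}" using x nz by auto
 ultimately show False using open_not_negligible[OF o] by simp
qed

text \<open>Norm equivalence with a bounded family \<open>g\<close> in place of the functions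
  themselves, so that values and gradients, also at points outside \<open>S\<close>, are covered at
  once.\<close>

lemma finite_dim_bound:
 fixes f :: "'i => 'x::euclidean_space => real" and g :: "'i => 'y => 'z::real_normed_vector"
 assumes A: "finite A" and f: "\<And>a. cont (f a)" and S: "open S" "bounded S"
 and indep: "\<And>c a. (\<And>x. x \<in> S ==> (\<Sum>a\<in>A. c a * f a x) = 0) ==> a \<in> A ==> c a = 0"
 and g: "\<And>a y. a \<in> A ==> y \<in> Y ==> norm (g a y) \<le> B"
 shows "\<exists>C>0. \<forall>c. \<forall>y\<in>Y. norm (\<Sum>a\<in>A. c a *\<^sub>R g a y) \<le> C * nrm (leb S) (\<lambda>x. \<Sum>a\<in>A. c a * f a x)"
proof -
 define G where "G a b = (LINT x|leb S. f a x * f b x)" for a b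
 have ob: "open S \<or> closed S" using S by simp
 have ff: "integrable (leb S) (\<lambda>x. f a x * f b x)" for a b by (intro continuous_integrable_on ob S continuous_intros f)
 have fc: "cont (\<lambda>x. \<Sum>a\<in>A. c a * f a x)" for c by (intro continuous_intros f)
 have q: "qf A G c = (nrm (leb S) (\<lambda>x. \<Sum>a\<in>A. c a * f a x))^2" for c
 proof -
  have "(nrm (leb S) (\<lambda>x. \<Sum>a\<in>A. c a * f a x))^2 = (LINT x|leb S. (\<Sum>a\<in>A. \<Sum>b\<in>A. c a * c b * (f a x * f b x)))"
   unfolding nrm_sq by (simp add: power2_eq_square sum_product ac_simps)
  also have "\<dots> = (\<Sum>a\<in>A. \<Sum>b\<in>A. c a * c b * G a b)" unfolding G_def using ff by (simp add: Bochner_Integration.integral_sum)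
  finally show ?thesis by (simp add: qf_def)
 qed
 have "\<exists>C>0. \<forall>c. \<forall>a\<in>A. (c a)^2 \<le> C * qf A G c"
 proof (rule gram_coefficient_bound[OF A])
  show "G a b = G b a" for a b by (simp add: G_def mult.commute)
  show "0 \<le> qf A G c" for c by (simp add: q)
  fix c a assume z: "qf A G c = 0" and a: "a \<in> A"
  then have "nrm (leb S) (\<lambda>x. \<Sum>a\<in>A. c a * f a x) = 0" by (simp add: q)
  then have "AE x in leb S. (\<Sum>a\<in>A. c a * f a x) = 0" by (rule nrm_zero_AE[OF continuous_sqi_on[OF fc ob S(2)]])
  then have "(\<Sum>a\<in>A. c a * f a x) = 0" if "x \<in> S" for x using continuous_AE_zero[OF fc S(1) _ that] by simp
  then show "c a = 0" using indep a by blast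
 qed
 then obtain C where C: "C > 0" "\<And>c a. a \<in> A ==> (c a)^2 \<le> C * (nrm (leb S) (\<lambda>x. \<Sum>a\<in>A. c a * f a x))^2"
  unfolding q by blast
 define K where "K = real (card A) * (sqrt C * (\<bar>B\<bar> + 1)) + 1"
 have "norm (\<Sum>a\<in>A. c a *\<^sub>R g a y) \<le> K * nrm (leb S) (\<lambda>x. \<Sum>a\<in>A. c a * f a x)" if y: "y \<in> Y" for c y
 proof -
  let ?N = "nrm (leb S) (\<lambda>x. \<Sum>a\<in>A. c a * f a x)"
  have "norm (\<Sum>a\<in>A. c a *\<^sub>R g a y) \<le> (\<Sum>a\<in>A. \<bar>c a\<bar> * norm (g a y))"
   using norm_sum[of "\<lambda>a. c a *\<^sub>R g a y" A] by simp
  also have "\<dots> \<le> (\<Sum>a\<in>A. (sqrt C * ?N) * (\<bar>B\<bar> + 1))"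
  proof (intro sum_mono mult_mono)
   fix a assume a: "a \<in> A"
   have "\<bar>c a\<bar> = sqrt ((c a)^2)" by simp
   also have "\<dots> \<le> sqrt (C * ?N^2)" by (intro real_sqrt_le_mono C(2) a)
   finally show "\<bar>c a\<bar> \<le> sqrt C * ?N" by (simp add: real_sqrt_mult)
   show "norm (g a y) \<le> \<bar>B\<bar> + 1" using g[OF a y] by simp
  qed (use C in auto)
  also have "\<dots> = (real (card A) * (sqrt C * (\<bar>B\<bar> + 1))) * ?N" by simp
  also have "\<dots> \<le> K * ?N" by (intro mult_right_mono) (auto simp: K_def)
  finally show ?thesis .
 qed
 moreover have "K > 0" using C by (simp add: K_def add_nonneg_pos)
 ultimately show ?thesis by blast
qed

lemma nrm_ball_rescale:
 fixes f :: "plane => real"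
 assumes f: "cont f" and R: "R > 0"
 shows "nrm (leb (ball z (R * s))) f = R * nrm (leb (ball 0 s)) (\<lambda>y. f (z + R *\<^sub>R y))"
proof -
 have fm[measurable]: "f \<in> borel_measurable borel" using f by (rule cont_borel)
 have ind: "indicat_real (ball z (R * s)) (z + R *\<^sub>R y) = indicator (ball 0 s) y" for y using R by (auto simp: indicator_def dist_norm)
 have "(LINT x|leb (ball z (R * s)). (norm (f x))^2) = (LINT x|lborel. indicator (ball z (R * s)) x *\<^sub>R (norm (f x))^2)"
  by (intro integral_lebesgue_on_borel) measurable
 also have "\<dots> = R^2 * (LINT y|lborel. indicator (ball z (R * s)) (z + R *\<^sub>R y) *\<^sub>R (norm (f (z + R *\<^sub>R y)))^2)"
  by (rule lborel_integral_affine)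
  (use R fm in \<open>auto intro!: borel_measurable_times borel_measurable_indicator borel_measurable_power simp: power2_eq_square\<close>)
 also have "\<dots> = R^2 * (LINT y|leb (ball 0 s). (norm (f (z + R *\<^sub>R y)))^2)" unfolding ind by (subst integral_lebesgue_on_borel) auto
 finally show ?thesis using R by (simp add: nrm_def real_sqrt_mult)
qed

text \<open>The constant is found on the disc of radius 1/2 about the origin and then scaled: the
  planar L2 norm contributes one power of \<open>R\<close>, a derivative another. \<open>L\<close>
  admits evaluation outside the disc, since the polygon lies within a multiple of its
  radius.\<close>

lemma poly_ball_bound:
 "\<exists>C>0. \<forall>p\<in>polys k. \<forall>z R x. R > 0 --> norm (x - z) \<le> L * R -->
 \<bar>p x\<bar> \<le> C / R * nrm (leb (ball z (R/2))) p \<and>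
 norm (grad p x) \<le> C / R^2 * nrm (leb (ball z (R/2))) p"
proof -
 let ?S = "ball (0::plane) (1/2)"
 have indep: "c a = 0" if "\<And>x. x \<in> ?S ==> (\<Sum>a\<in>idx k. c a * mon a x) = 0" "a \<in> idx k" for c a
  by (rule polys_zero_coeffs[where e="1/2" and k=k and c=c]) (use that in auto)
 have mc: "cont (mon a)" for a by (intro C1_continuous C1_mon)
 have "\<exists>B. \<forall>y\<in>cball 0 L. norm (mon a y) \<le> B \<and> norm (grad (mon a) y) \<le> B" for a
 proof -
  obtain B1 where "\<And>y. y \<in> cball 0 L ==> norm (mon a y) \<le> B1" using continuous_bounded_on[OF mc[of a], of "cball 0 L"] by auto
  moreover obtain B2 where "\<And>y. y \<in> cball 0 L ==> norm (grad (mon a) y) \<le> B2"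
   using continuous_bounded_on[OF C1_grad_continuous[OF C1_mon], of "cball 0 L" a] by auto
  ultimately show ?thesis by (intro exI[of _ "max B1 B2"]) force
 qed
 then obtain B0 where B0: "\<And>a y. y \<in> cball 0 L ==> norm (mon a y) \<le> B0 a" "\<And>a y. y \<in> cball 0 L ==> norm (grad (mon a) y) \<le> B0 a"
  by metis
 define B where "B = Max (insert 0 (B0 ` idx k))"
 have BB: "B0 a \<le> B" if "a \<in> idx k" for a using that by (auto simp: B_def)
 obtain C1' where C1': "C1' > 0" "\<And>c y. y \<in> cball 0 L ==> norm (\<Sum>a\<in>idx k. c a *\<^sub>R mon a y) \<le> C1' * nrm (leb ?S) (\<lambda>x. \<Sum>a\<in>idx k. c a * mon a x)"
 proof -
  have gB: "norm (mon a y) \<le> B" if "a \<in> idx k" "y \<in> cball 0 L" for a y by (rule order_trans[OF B0(1) BB]) (use that in auto)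
  have "\<exists>C>0. \<forall>c. \<forall>y\<in>cball 0 L. norm (\<Sum>a\<in>idx k. c a *\<^sub>R mon a y) \<le> C * nrm (leb ?S) (\<lambda>x. \<Sum>a\<in>idx k. c a * mon a x)"
   by (rule finite_dim_bound[where B=B]) (fact finite_idx mc open_ball bounded_ball | (rule indep; assumption) | (rule gB; assumption))+
  then show ?thesis using that by blast
 qed
 obtain C2' where C2': "C2' > 0" "\<And>c y. y \<in> cball 0 L ==> norm (\<Sum>a\<in>idx k. c a *\<^sub>R grad (mon a) y) \<le> C2' * nrm (leb ?S) (\<lambda>x. \<Sum>a\<in>idx k. c a * mon a x)"
 proof -
  have gB: "norm (grad (mon a) y) \<le> B" if "a \<in> idx k" "y \<in> cball 0 L" for a y by (rule order_trans[OF B0(2) BB]) (use that in auto)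
  have "\<exists>C>0. \<forall>c. \<forall>y\<in>cball 0 L. norm (\<Sum>a\<in>idx k. c a *\<^sub>R grad (mon a) y) \<le> C * nrm (leb ?S) (\<lambda>x. \<Sum>a\<in>idx k. c a * mon a x)"
   by (rule finite_dim_bound[where B=B]) (fact finite_idx mc open_ball bounded_ball | (rule indep; assumption) | (rule gB; assumption))+
  then show ?thesis using that by blast
 qed
 have "\<bar>p x\<bar> \<le> (C1' + C2') / R * nrm (leb (ball z (R/2))) p \<and>
  norm (grad p x) \<le> (C1' + C2') / R^2 * nrm (leb (ball z (R/2))) p"
  if p: "p \<in> polys k" and R: "R > 0" and x: "norm (x - z) \<le> L * R" for p z R x
 proof -
  define y where "y = (1/R) *\<^sub>R (x - z)"
  have xy: "x = z + R *\<^sub>R y" using R by (simp add: y_def)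
  have "norm y = norm (x - z) / R" using R by (simp add: y_def)
  then have yL: "y \<in> cball 0 L" using x R by (simp add: pos_divide_le_eq)
  define q where "q = (\<lambda>y. p (z + R *\<^sub>R y))"
  have "q \<in> polys k" unfolding q_def by (rule polys_rescale[OF p])
  then obtain c where c: "q = (\<lambda>x. \<Sum>a\<in>idx k. c a * mon a x)" by (rule polysE)
  have pc: "cont p" by (intro C1_continuous polys_C1[OF p])
  have N: "nrm (leb ?S) q = nrm (leb (ball z (R/2))) p / R" using nrm_ball_rescale[OF pc R, of z "1/2"] R by (simp add: q_def)
  have q1: "\<bar>q y\<bar> \<le> C1' * nrm (leb ?S) q" using C1'(2)[OF yL, of c] by (simp add: c)
  have gq: "grad q y = (\<Sum>a\<in>idx k. c a *\<^sub>R grad (mon a) y)"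
   unfolding c using conjunct2[OF C1_sum[of "idx k" "\<lambda>a x. c a * mon a x"]] C1_cmult[OF C1_mon] by simp
  have q2: "norm (grad q y) \<le> C2' * nrm (leb ?S) q" unfolding gq using C2'(2)[OF yL, of c] by (simp add: c)
  have "grad q y = R *\<^sub>R grad p x"
  proof -
   have "(q has_derivative (\<lambda>d. (R *\<^sub>R grad p (z + R *\<^sub>R y)) \<bullet> d)) (at y)" for y
   proof -
    have "((\<lambda>y. z + R *\<^sub>R y) has_derivative (\<lambda>d. R *\<^sub>R d)) (at y)" by (auto intro!: derivative_eq_intros)
    from has_derivative_compose[OF this C1_has_derivative[OF polys_C1[OF p]]]
    show ?thesis by (simp add: q_def)
   qed
   moreover have "cont (\<lambda>y. R *\<^sub>R grad p (z + R *\<^sub>R y))"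
    by (intro continuous_intros continuous_on_compose2[OF C1_grad_continuous[OF polys_C1[OF p], of UNIV]]) auto
   ultimately have "grad q = (\<lambda>y. R *\<^sub>R grad p (z + R *\<^sub>R y))" by (fact C1I)
   then show ?thesis by (simp add: xy)
  qed
  then have gp: "norm (grad p x) = norm (grad q y) / R" using R by simp
  have px: "p x = q y" by (simp add: q_def xy)
  have n0: "0 \<le> nrm (leb ?S) q" by simp
  have "\<bar>p x\<bar> \<le> (C1' + C2') * nrm (leb ?S) q" using q1 mult_right_mono[of C1' "C1' + C2'" "nrm (leb ?S) q"] C2'(1) px by simp
  moreover have "norm (grad p x) \<le> (C1' + C2') * nrm (leb ?S) q / R"
   unfolding gp using q2 mult_right_mono[of C2' "C1' + C2'" "nrm (leb ?S) q"] C1'(1) R by (intro divide_right_mono) auto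
  ultimately show ?thesis unfolding N by (simp add: power2_eq_square)
 qed
 then show ?thesis using C1'(1) C2'(1) by (intro exI[of _ "C1' + C2'"]) auto
qed

text \<open>The norm is taken over the middle half of the interval, where the cut-off functions and
  the heights over the other edges are bounded below. Parameters up to \<open>T\<close> admit points
  on the line of an edge beyond its end points.\<close>

lemma poly1_bound:
 "\<exists>C>0. \<forall>a::nat => real. \<forall>t. \<bar>t\<bar> \<le> T -->
 \<bar>\<Sum>i\<le>k. a i * t ^ i\<bar> \<le> C * nrm (leb {1/4<..<3/4::real}) (\<lambda>t. \<Sum>i\<le>k. a i * t ^ i) \<and>
 \<bar>\<Sum>i\<le>k. a i * (real i * t ^ (i - 1))\<bar> \<le> C * nrm (leb {1/4<..<3/4::real}) (\<lambda>t. \<Sum>i\<le>k. a i * t ^ i)"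
proof -
 let ?S = "{1/4<..<3/4::real}" and ?Y = "{t::real. \<bar>t\<bar> \<le> T}"
 let ?B = "(real k + 1) * (\<bar>T\<bar> + 1) ^ k"
 have indep: "c a = 0" if "\<And>x. x \<in> ?S ==> (\<Sum>a\<in>{..k}. c a * x ^ a) = 0" "a \<in> {..k}" for c a
  by (rule poly1_zero[where l="1/4" and u="3/4" and k=k]) (use that in auto)
 have pw: "\<bar>t\<bar> ^ j \<le> (\<bar>T\<bar> + 1) ^ k" if "\<bar>t\<bar> \<le> T" "j \<le> k" for t j
 proof -
  have "\<bar>t\<bar> ^ j \<le> (\<bar>T\<bar> + 1) ^ j" using that by (intro power_mono) auto
  also have "\<dots> \<le> (\<bar>T\<bar> + 1) ^ k" using that by (intro power_increasing) auto
  finally show ?thesis .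
 qed
 have g1: "norm (t ^ i) \<le> ?B" if "i \<in> {..k}" "t \<in> ?Y" for i and t :: real
 proof -
  have "\<bar>t\<bar> ^ i \<le> 1 * (\<bar>T\<bar> + 1) ^ k" using pw[of t i] that by simp
  also have "\<dots> \<le> ?B" by (intro mult_right_mono) auto
  finally show ?thesis by (simp add: power_abs)
 qed
 have g2: "norm (real i * t ^ (i - 1)) \<le> ?B" if "i \<in> {..k}" "t \<in> ?Y" for i and t :: real
 proof -
  have "real i * \<bar>t\<bar> ^ (i - 1) \<le> (real k + 1) * (\<bar>T\<bar> + 1) ^ k" using pw[of t "i - 1"] that by (intro mult_mono) auto
  then show ?thesis by (simp add: abs_mult power_abs)
 qed
 have fc: "cont (\<lambda>t::real. t ^ i)" for i by (intro continuous_intros)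
 have bS: "open ?S" "bounded ?S" by auto
 obtain C1' where C1': "C1' > 0" "\<And>c y. y \<in> ?Y ==> norm (\<Sum>a\<in>{..k}. c a *\<^sub>R y ^ a) \<le> C1' * nrm (leb ?S) (\<lambda>x. \<Sum>a\<in>{..k}. c a * x ^ a)"
 proof -
  have "\<exists>C>0. \<forall>c. \<forall>y\<in>?Y. norm (\<Sum>a\<in>{..k}. c a *\<^sub>R y ^ a) \<le> C * nrm (leb ?S) (\<lambda>x. \<Sum>a\<in>{..k}. c a * x ^ a)"
   by (rule finite_dim_bound[where B="?B"]) (fact finite_atMost fc bS | (rule indep; assumption) | (rule g1; assumption))+
  then show ?thesis using that by blast
 qed
 obtain C2' where C2': "C2' > 0" "\<And>c y. y \<in> ?Y ==> norm (\<Sum>a\<in>{..k}. c a *\<^sub>R (real a * y ^ (a - 1))) \<le> C2' * nrm (leb ?S) (\<lambda>x. \<Sum>a\<in>{..k}. c a * x ^ a)"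
 proof -
  have "\<exists>C>0. \<forall>c. \<forall>y\<in>?Y. norm (\<Sum>a\<in>{..k}. c a *\<^sub>R (real a * y ^ (a - 1))) \<le> C * nrm (leb ?S) (\<lambda>x. \<Sum>a\<in>{..k}. c a * x ^ a)"
   by (rule finite_dim_bound[where B="?B"]) (fact finite_atMost fc bS | (rule indep; assumption) | (rule g2; assumption))+
  then show ?thesis using that by blast
 qed
 have mono: "a \<le> (C1' + C2') * N" if "a \<le> C1' * N \<or> a \<le> C2' * N" "0 \<le> N" for a N
 proof -
  have "C1' * N \<le> (C1' + C2') * N" "C2' * N \<le> (C1' + C2') * N" using C1'(1) C2'(1) that by (auto intro!: mult_right_mono)
  then show ?thesis using that by linarith
 qed
 show ?thesis by (rule exI[of _ "C1' + C2'"])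
  (use C1' C2' in \<open>auto intro!: mono[OF _ nrm_nonneg] add_pos_pos\<close>)
qed

section \<open>Sup norms, area and the number of edges\<close>

context star_polygon
begin

lemma measure_F_le: "measure (leb F) (space (leb F)) \<le> pi * h^2"
proof -
 have "emeasure (leb F) (space (leb F)) = emeasure lborel F" by (simp add: space_restrict_space emeasure_restrict_space)
 then have "measure (leb F) (space (leb F)) = enn2real (emeasure lborel F)" by (simp add: measure_def)
 also have "\<dots> \<le> pi * h^2" using emeasure_F_le by (intro enn2real_leI) auto
 finally show ?thesis .
qed

lemma nrm_le_sup_h:
 assumes f: "f \<in> borel_measurable (leb F)" and M: "0 \<le> M" "\<And>x. x \<in> F ==> norm (f x) \<le> M"
 shows "sqi (leb F) f" "nrm (leb F) f \<le> 2 * h * M"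
proof -
 have fin: "finite_measure (leb F)" by (rule finite_measure_lebesgue_on[OF F_ob])
 have s: "sqi (leb F) f" "(nrm (leb F) f)^2 \<le> M^2 * measure (leb F) (space (leb F))"
  using nrm_le_sup[OF f fin M(1)] M(2) by (auto simp: space_restrict_space)
 show "sqi (leb F) f" by (rule s)
 have "M^2 * measure (leb F) (space (leb F)) \<le> M^2 * (pi * h^2)" by (intro mult_left_mono measure_F_le) auto
 also have "\<dots> \<le> M^2 * (4 * h^2)" using pi_less_4 by (intro mult_left_mono mult_right_mono) auto
 also have "\<dots> = (2 * h * M)^2" by (simp add: power_mult_distrib)
 finally have "(nrm (leb F) f)^2 \<le> (2 * h * M)^2" using s(2) by linarith
 then show "nrm (leb F) f \<le> 2 * h * M" by (rule power2_le_imp_le) (use h_pos M in auto)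
qed

text \<open>Comparison of areas: the triangles over the edges make up \<open>F\<close>, which lies
  in a disc of radius \<open>h\<close>.\<close>

lemma n_bound: "real n * (r * (\<Sum>i<n. len i)) \<le> real n * (2 * pi * h^2)"
proof -
 have one: "(LINT t|leb {0..1::real}. (1::real)) = 1" by (simp add: space_restrict_space measure_restrict_space)
 have "(\<Sum>i<n. \<bar>D i\<bar>) = (LINT x|leb F. 2)" using F_radial_divergence[of "\<lambda>x. 1"] one by simp
 also have "\<dots> = 2 * measure (leb F) (space (leb F))" by simp
 also have "\<dots> \<le> 2 * (pi * h^2)" using measure_F_le by simp
 finally have "(\<Sum>i<n. \<bar>D i\<bar>) \<le> 2 * pi * h^2" by simp
 moreover have "r * (\<Sum>i<n. len i) \<le> (\<Sum>i<n. \<bar>D i\<bar>)" unfolding sum_distrib_left by (intro sum_mono D_ge)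
 ultimately show ?thesis by (intro mult_left_mono) auto
qed

end

locale regular_polygon = star_polygon +
 fixes \<rho> :: real
 assumes rho: "\<rho> > 0" "r \<ge> \<rho> * diameter (domain vs)"
 and edges: "\<And>i. i < length vs ==> edge_length vs i \<ge> \<rho> * diameter (domain vs)"
begin

lemma r_ge: "\<rho> * h \<le> r" using rho by (simp add: h_def)

lemma edge_ge: "\<rho> * h \<le> len i"
proof -
 have "i mod n < n" using n_ge3 by (intro mod_less_divisor) linarith
 moreover have "len (i mod n) = len i" by (simp add: edge_length_def vertex_def mod_Suc_eq)
 ultimately show ?thesis using edges[of "i mod n"] by (simp add: h_def)
qed

text \<open>Each triangle has base and height at least \<open>\<rho> * h\<close>, and together they
  fill an area of order \<open>h^2\<close>.\<close>

lemma n_le: "real n \<le> 2 * pi / \<rho>^2"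
proof -
 have n0: "real n > 0" using vs_ne by simp
 have "\<rho> * h * (real n * (\<rho> * h)) \<le> r * (\<Sum>i<n. len i)"
 proof (rule mult_mono)
  show "real n * (\<rho> * h) \<le> (\<Sum>i<n. len i)" using sum_mono[of "{..<n}" "\<lambda>i. \<rho> * h" "edge_length vs"] edge_ge by simp
 qed (use r_ge r_pos rho h_pos in auto)
 also have "\<dots> \<le> 2 * pi * h^2" using n_bound n0 by simp
 finally have "h^2 * (real n * \<rho>^2) \<le> h^2 * (2 * pi)" by (simp add: power2_eq_square ac_simps)
 then have "real n * \<rho>^2 \<le> 2 * pi" using h_pos by simp
 then show ?thesis using rho by (simp add: field_simps)
qed

text \<open>An integer bound depending on \<open>\<rho>\<close> alone; it replaces \<open>n\<close>
  in exponents and products inside the constants.\<close>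

definition NN :: nat where "NN = nat \<lceil>2 * pi / \<rho>^2\<rceil>"

lemma n_le_N: "n \<le> NN" using order_trans[OF n_le real_nat_ceiling_ge] unfolding NN_def by simp

lemma rho_le: "\<rho> \<le> 1/2"
proof -
 have "\<rho> * h \<le> 1/2 * h" using r_ge r_le_h by simp
 then show ?thesis using h_pos by (simp only: mult_le_cancel_right_pos)
qed

end

text \<open>\<open>C\<close> and \<open>G\<close> are the constants of the norm equivalences for polynomials on an edge and on
  discs; all the constants below depend on \<open>C\<close>, \<open>G\<close>, \<open>k\<close> and the shape parameters only.\<close>

locale polygon_constants = regular_polygon +
 fixes k :: nat and C G :: real
 assumes C_ge1: "C \<ge> 1" and G_pos: "G > 0"
 and C: "\<And>a t. \<bar>t\<bar> \<le> 3 / \<rho> ==>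
 \<bar>\<Sum>i\<le>Suc k. a i * t ^ i\<bar> \<le> C * nrm (leb {1/4<..<3/4::real}) (\<lambda>t. \<Sum>i\<le>Suc k. a i * t ^ i) \<and>
 \<bar>\<Sum>i\<le>Suc k. a i * (real i * t ^ (i - 1))\<bar> \<le> C * nrm (leb {1/4<..<3/4::real}) (\<lambda>t. \<Sum>i\<le>Suc k. a i * t ^ i)"
 and G: "\<And>p z R x. p \<in> polys (int (Suc k)) ==> R > 0 ==> norm (x - z) \<le> (4/\<rho> + 1) * R ==>
 \<bar>p x\<bar> \<le> G / R * nrm (leb (ball z (R/2))) p \<and> norm (grad p x) \<le> G / R^2 * nrm (leb (ball z (R/2))) p"

text \<open>\<open>C\<close> and \<open>G\<close> are fixed before the polygon; this order of
  quantifiers is the mesh independence. \<open>3 / \<rho>\<close> and \<open>4 / \<rho> + 1\<close>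
  bound how far evaluation points can lie, relative to an edge and to the disc.\<close>

lemma polygon_constants_exist:
 "\<exists>C G. \<forall>vs c r. regular_polygon vs c r \<rho> --> polygon_constants vs c r \<rho> k C G"
proof -
 obtain C where C: "\<And>a t. \<bar>t\<bar> \<le> 3 / \<rho> ==>
  \<bar>\<Sum>i\<le>Suc k. a i * t ^ i\<bar> \<le> C * nrm (leb {1/4<..<3/4::real}) (\<lambda>t. \<Sum>i\<le>Suc k. a i * t ^ i) \<and>
  \<bar>\<Sum>i\<le>Suc k. a i * (real i * t ^ (i - 1))\<bar> \<le> C * nrm (leb {1/4<..<3/4::real}) (\<lambda>t. \<Sum>i\<le>Suc k. a i * t ^ i)"
  using poly1_bound[of "3 / \<rho>" "Suc k"] by meson
 obtain G where G: "G > 0" "\<And>p z R x. p \<in> polys (int (Suc k)) ==> R > 0 ==> norm (x - z) \<le> (4/\<rho> + 1) * R ==>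
  \<bar>p x\<bar> \<le> G / R * nrm (leb (ball z (R/2))) p \<and> norm (grad p x) \<le> G / R^2 * nrm (leb (ball z (R/2))) p"
  using poly_ball_bound[of "int (Suc k)" "4/\<rho> + 1"] by meson
 have max: "C * nrm M f \<le> max 1 C * nrm M f" for M :: "real measure" and f :: "real => real" by (intro mult_right_mono) auto
 have "polygon_constants vs c r \<rho> k (max 1 C) G" if "regular_polygon vs c r \<rho>" for vs c r
 proof -
  interpret regular_polygon vs c r \<rho> by (rule that)
  show ?thesis
  proof
   fix a :: "nat => real" and t :: real assume "\<bar>t\<bar> \<le> 3 / \<rho>"
   note c = C[OF this, of a]
   show "\<bar>\<Sum>i\<le>Suc k. a i * t ^ i\<bar> \<le> max 1 C * nrm (leb {1/4<..<3/4::real}) (\<lambda>t. \<Sum>i\<le>Suc k. a i * t ^ i) \<and>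
    \<bar>\<Sum>i\<le>Suc k. a i * (real i * t ^ (i - 1))\<bar> \<le> max 1 C * nrm (leb {1/4<..<3/4::real}) (\<lambda>t. \<Sum>i\<le>Suc k. a i * t ^ i)"
    by (rule conjI[OF order_trans[OF conjunct1[OF c] max] order_trans[OF conjunct2[OF c] max]])
  qed (simp, rule G(1), rule G(2))
 qed
 then show ?thesis by blast
qed

section \<open>Inverse estimate from a dual norm\<close>

context polygon_constants
begin

text \<open>From the proof of \<open>inverse_bound\<close>: \<open>G\<close> evaluates
  \<open>p\<close> from the disc, \<open>16 / 9\<close> inverts the lower bound of the bump,
  \<open>10 * G\<close> comes from the gradient of the test function, and
  \<open>(2/\<rho>)^3\<close> turns \<open>h / R^3\<close> into \<open>1 / h^2\<close>.\<close>

definition IC :: real where "IC = G * ((16 / 9) * (10 * G)) * (2/\<rho>)^3"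

lemma IC_pos: "IC > 0" using G_pos rho by (simp add: IC_def)

text \<open>\<open>p\<close> is known only through its pairing with test functions, measured by the
  norm of their gradients. Testing with \<open>p\<close> times a bump recovers the norm of
  \<open>p\<close> on a disc inside \<open>F\<close>, and norm equivalence spreads it to the
  neighbourhood. It will be applied to weak rotations and divergences.\<close>

lemma inverse_bound:
 assumes p: "p \<in> polys (int (Suc k))" and N0: "0 \<le> N"
 and N: "\<And>\<phi>. C1_compact_support F \<phi> ==> \<bar>LINT x|leb F. p x * \<phi> x\<bar> \<le> N * nrm (leb F) (grad \<phi>)"
 and x: "norm (x - c) \<le> 2 * h"
 shows "\<bar>p x\<bar> \<le> IC / h^2 * N"
proof -
 \<comment> \<open>Half the radius, so that the closed disc supporting the bump lies in
   \<open>F\<close>.\<close>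
 define R where "R = r / 2"
 have R: "R > 0" using r_pos by (simp add: R_def)
 have hR: "h \<le> (2/\<rho>) * R" using r_ge rho by (simp add: R_def field_simps)
 have inL: "norm (y - c) \<le> (4/\<rho> + 1) * R" if "norm (y - c) \<le> 2 * h \<or> norm (y - c) \<le> R" for y
 proof -
  have "2 * h \<le> (4/\<rho>) * R" using hR by simp
  moreover have "0 \<le> (4/\<rho>) * R" using R rho by simp
  ultimately show ?thesis using that R by (auto simp: distrib_right)
 qed
 let ?B = "ball c (R/2)"
 define M where "M = nrm (leb ?B) p"
 have M0: "0 \<le> M" by (simp add: M_def)
 define \<phi> where "\<phi> y = p y * bump c R y" for y
 have pC: "C1 p" by (rule polys_C1[OF p])
 have phC: "C1 \<phi>" and phg: "grad \<phi> = (\<lambda>y. p y *\<^sub>R grad (bump c R) y + bump c R y *\<^sub>R grad p y)"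
  unfolding \<phi>_def[abs_def] using C1_mult[OF pC C1_bump] by auto
 have supp: "C1_compact_support F \<phi>" unfolding C1_compact_support_def
 proof (intro conjI exI)
  show "cball c R \<subseteq> F" using ball_sub R by (auto simp: R_def)
  show "\<forall>y. y \<notin> cball c R --> \<phi> y = 0" using R by (auto simp: \<phi>_def dist_norm norm_minus_commute intro!: bump_zero)
 qed (auto simp: phC)
 have pcont: "cont p" by (rule C1_continuous[OF pC])
 \<comment> \<open>On the disc of radius \<open>R/2\<close> the bump is at least the square of
   \<open>(3/4) * R^2\<close>.\<close>
 have low: "(9/16) * R^4 * M^2 \<le> (LINT x|leb F. p x * \<phi> x)"
 proof -
  have "(9/16) * R^4 * M^2 = (LINT y|leb ?B. (9/16) * R^4 * (p y)^2)" by (simp add: M_def nrm_sq)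
  also have "\<dots> \<le> (LINT x|leb F. p x * \<phi> x)"
  proof (rule LINT_mono_subset)
   show "?B \<subseteq> F" using ball_sub R by (auto simp: R_def subset_eq)
   fix y
   show "0 \<le> p y * \<phi> y" using bump_nonneg by (simp add: \<phi>_def mult.assoc[symmetric])
   assume "y \<in> ?B"
   then have "(norm (y - c))^2 \<le> (R/2)^2" by (intro power_mono) (auto simp: dist_norm norm_minus_commute)
   then have "(3/4) * R^2 \<le> R^2 - (norm (y - c))^2" by (simp add: power2_eq_square)
   then have "((3/4) * R^2)^2 \<le> bump c R y" unfolding bump_def by (intro power_mono) (simp_all add: le_max_iff_disj)
   then have "(9/16) * R^4 * (p y)^2 \<le> bump c R y * (p y)^2" by (intro mult_right_mono) (auto simp: power2_eq_square power4_eq_xxxx)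
   then show "(9/16) * R^4 * (p y)^2 \<le> p y * \<phi> y" by (simp add: \<phi>_def power2_eq_square ac_simps)
  qed (auto intro!: continuous_intros pcont C1_continuous[OF phC] simp: F_ob)
  finally show ?thesis .
 qed
 have gb: "norm (grad \<phi> y) \<le> 5 * G * R^2 * M" for y
 proof (cases "norm (y - c) < R")
  case False
  then have "grad \<phi> y = 0" using R by (simp add: phg bump_zero grad_bump_zero)
  then show ?thesis using G_pos M0 by simp
 next
  case True
  have pb: "\<bar>p y\<bar> \<le> G / R * M" "norm (grad p y) \<le> G / R^2 * M" using G[OF p R inL[of y]] True unfolding M_def by auto
  have "norm (grad (bump c R) y) \<le> 4 * R^2 * R"
  proof -
   have "max 0 (R^2 - (norm (y - c))^2) \<le> R^2" by simp
   then have "(4 * max 0 (R^2 - (norm (y - c))^2)) * norm (y - c) \<le> (4 * R^2) * R" using True by (intro mult_mono) auto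
   then show ?thesis by (simp add: grad_bump abs_mult)
  qed
  then have 1: "\<bar>p y\<bar> * norm (grad (bump c R) y) \<le> (G / R * M) * (4 * R^2 * R)" using pb G_pos R M0 by (intro mult_mono) auto
  have 2: "bump c R y * norm (grad p y) \<le> R^4 * (G / R^2 * M)" using bump_le[of R c y] bump_nonneg[of c R y] pb R by (intro mult_mono) auto
  have "norm (grad \<phi> y) \<le> \<bar>p y\<bar> * norm (grad (bump c R) y) + bump c R y * norm (grad p y)"
   unfolding phg using norm_triangle_ineq[of "p y *\<^sub>R grad (bump c R) y" "bump c R y *\<^sub>R grad p y"] bump_nonneg[of c R y] by simp
  also have "\<dots> \<le> (G / R * M) * (4 * R^2 * R) + R^4 * (G / R^2 * M)" using 1 2 by simp
  also have "\<dots> = 5 * G * R^2 * M" using R by (simp add: power2_eq_square power4_eq_xxxx field_simps)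
  finally show ?thesis .
 qed
 have gm: "grad \<phi> \<in> borel_measurable (leb F)" by (intro cont_measurable C1_grad_continuous phC)
 have gn: "nrm (leb F) (grad \<phi>) \<le> 2 * h * (5 * G * R^2 * M)" by (rule nrm_le_sup_h(2)[OF gm]) (use gb G_pos M0 in auto)
 have "(9/16) * R^4 * M^2 \<le> N * (2 * h * (5 * G * R^2 * M))" using low N[OF supp] mult_left_mono[OF gn N0] by linarith
 then have Mb: "M * ((9/16) * R^2) \<le> N * (10 * G * h)"
 proof (cases "M = 0")
  case False
  have "(M * R^2) * (M * ((9/16) * R^2)) \<le> (M * R^2) * (N * (10 * G * h))"
   using \<open>(9/16) * R^4 * M^2 \<le> N * (2 * h * (5 * G * R^2 * M))\<close> by (simp add: power2_eq_square power4_eq_xxxx ac_simps)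
  moreover have "M * R^2 > 0" using False M0 R by simp
  ultimately show ?thesis by (rule mult_left_le_imp_le)
 qed (use N0 G_pos h_pos in simp)
 have "\<bar>p x\<bar> \<le> G / R * M" using G[OF p R inL[of x]] x unfolding M_def by auto
 also have "\<dots> = G / R * ((16/9) / R^2 * (M * ((9/16) * R^2)))" using R by simp
 also have "\<dots> \<le> G / R * ((16/9) / R^2 * (N * (10 * G * h)))" using G_pos R by (intro mult_left_mono Mb) auto
 also have "\<dots> = (G * ((16/9) * (10 * G)) * N) * (h / R^3)" using R by (simp add: power2_eq_square power3_eq_cube field_simps)
 also have "\<dots> \<le> (G * ((16/9) * (10 * G)) * N) * ((2/\<rho>)^3 / h^2)"
 proof (intro mult_left_mono)
  have "h^3 \<le> ((2/\<rho>) * R)^3" using hR h_pos by (intro power_mono) auto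
  then have "h^3 / (R^3 * h^2) \<le> ((2/\<rho>) * R)^3 / (R^3 * h^2)" using R h_pos by (intro divide_right_mono) auto
  moreover have "h^3 / (R^3 * h^2) = h / R^3" using h_pos by (simp add: power2_eq_square power3_eq_cube)
  moreover have "((2/\<rho>) * R)^3 / (R^3 * h^2) = (2/\<rho>)^3 / h^2" using R unfolding power_mult_distrib by simp
  ultimately show "h / R^3 \<le> (2/\<rho>)^3 / h^2" by simp
 qed (use G_pos N0 in auto)
 finally show ?thesis by (simp add: IC_def mult_ac)
qed

end

section \<open>Lower bound\<close>

text \<open>By Euler's identity a monomial of degree \<open>m\<close> centred at \<open>b\<close> is
  an eigenfunction with eigenvalue \<open>2 + m\<close>, so the operator is inverted
  coefficientwise. The sup bound comes from the other form of the inverse, the integral of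
  \<open>s * p (b + s *\<^sub>R (x - b))\<close> over the unit interval.\<close>

lemma radial_inverse:
 assumes p: "p \<in> polys k"
 shows "\<exists>q\<in>polys k. (\<forall>x. 2 * q x + grad q x \<bullet> (x - b) = p x) \<and>
 (\<forall>x M. (\<forall>s. 0 \<le> s \<and> s \<le> 1 --> \<bar>p (b + s *\<^sub>R (x - b))\<bar> \<le> M) --> \<bar>q x\<bar> \<le> M)"
proof -
 obtain c where c: "p = (\<lambda>x. \<Sum>a\<in>idx k. c a * mon a (x - b))" using polys_recenter[OF p] by blast
 define c' where "c' a = c a / (2 + real (fst a) + real (snd a))" for a
 define q0 where "q0 = (\<lambda>x. \<Sum>a\<in>idx k. c' a * mon a x)"
 define q where "q x = q0 (- b + 1 *\<^sub>R x)" for x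
 have q0p: "q0 \<in> polys k" unfolding q0_def by (rule polysI)
 have qp: "q \<in> polys k" unfolding q_def[abs_def] by (rule polys_rescale[OF q0p])
 have qx: "q x = q0 (x - b)" for x by (simp add: q_def)
 have gq: "grad q x = grad q0 (x - b)" for x
 proof -
  have "(q has_derivative (\<lambda>d. grad q0 (x - b) \<bullet> d)) (at x)" for x
  proof -
   have "((\<lambda>x. x - b) has_derivative (\<lambda>d. d)) (at x)" by (auto intro!: derivative_eq_intros)
   from has_derivative_compose[OF this C1_has_derivative[OF polys_C1[OF q0p]]]
   show ?thesis by (simp add: qx[abs_def])
  qed
  moreover have "cont (\<lambda>x. grad q0 (x - b))"
   by (intro continuous_on_compose2[OF C1_grad_continuous[OF polys_C1[OF q0p], of UNIV]] continuous_intros) auto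
  ultimately have "grad q = (\<lambda>x. grad q0 (x - b))" by (fact C1I)
  then show ?thesis by simp
 qed
 have euler: "mk (real (fst a) * mon (fst a - 1, snd a) y) (real (snd a) * mon (fst a, snd a - 1) y) \<bullet> y
  = (real (fst a) + real (snd a)) * mon a y" for a y
  by (cases "fst a"; cases "snd a") (auto simp: plane_inner mon_def algebra_simps)
 have eq: "2 * q x + grad q x \<bullet> (x - b) = p x" for x
 proof -
  have "2 * q0 y + grad q0 y \<bullet> y = (\<Sum>a\<in>idx k. c a * mon a y)" for y
  proof -
   have "grad q0 y \<bullet> y = (\<Sum>a\<in>idx k. c' a * ((real (fst a) + real (snd a)) * mon a y))"
    unfolding q0_def grad_polys by (simp add: inner_sum_left euler[unfolded One_nat_def])
   then have "2 * q0 y + grad q0 y \<bullet> y = (\<Sum>a\<in>idx k. (2 + real (fst a) + real (snd a)) * c' a * mon a y)"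
    by (simp add: q0_def sum_distrib_left sum.distrib[symmetric] algebra_simps)
   also have "\<dots> = (\<Sum>a\<in>idx k. c a * mon a y)"
   proof (intro sum.cong refl)
    fix a
    have "2 + real (fst a) + real (snd a) \<noteq> 0" by (simp add: add_nonneg_eq_0_iff)
    then show "(2 + real (fst a) + real (snd a)) * c' a * mon a y = c a * mon a y" by (simp add: c'_def)
   qed
   finally show ?thesis .
  qed
  then show ?thesis by (simp add: qx gq c)
 qed
 have bound: "\<bar>q x\<bar> \<le> M" if M: "\<And>s. 0 \<le> s ==> s \<le> 1 ==> \<bar>p (b + s *\<^sub>R (x - b))\<bar> \<le> M" for x M
 proof -
  let ?y = "\<lambda>s. b + s *\<^sub>R (x - b)"
  have pc: "cont p" by (intro C1_continuous polys_C1[OF p])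
  have cs: "continuous_on {0..1} (\<lambda>s. s * p (?y s))" by (intro continuous_intros continuous_on_compose2[OF pc]) auto
  have M0: "0 \<le> M" using M[of 0] by simp
  have "(LINT s|leb {0..1}. s * p (?y s)) = (\<lambda>s. s^2 * q (?y s)) 1 - (\<lambda>s. s^2 * q (?y s)) 0"
  proof (rule LINT_FTC[OF _ cs])
   fix s :: real
   have "((\<lambda>s. s^2 * q (?y s)) has_real_derivative
    (2 * s) * q (?y s) + (grad q (?y s) \<bullet> (x - b)) * s^2) (at s within {0..1})"
    by (rule DERIV_mult[OF _ C1_ray_derivative[OF polys_C1[OF qp]]]) (auto intro!: derivative_eq_intros)
   moreover have "(2 * s) * q (?y s) + (grad q (?y s) \<bullet> (x - b)) * s^2 = s * p (?y s)"
    unfolding eq[of "?y s", symmetric] add_diff_cancel_left' inner_scaleR_right by (simp only: power2_eq_square distrib_left ac_simps)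
   ultimately show "((\<lambda>s. s^2 * q (?y s)) has_real_derivative s * p (?y s)) (at s within {0..1})" by simp
  qed
  then have "q x = (LINT s|leb {0..1}. s * p (?y s))" by simp
  also have "norm \<dots> \<le> (LINT s|leb {0..1::real}. M)"
  proof -
   have i: "integrable (leb {0..1}) (\<lambda>s. s * p (?y s))" by (rule continuous_imp_integrable_real[OF cs])
   have "norm (LINT s|leb {0..1}. s * p (?y s)) \<le> (LINT s|leb {0..1}. norm (s * p (?y s)))" by (rule Bochner_Integration.integral_norm_bound)
   also have "\<dots> \<le> (LINT s|leb {0..1::real}. M)"
   proof (rule integral_mono)
    show "integrable (leb {0..1::real}) (\<lambda>s. M)" by (rule continuous_imp_integrable_real) (intro continuous_intros)
    fix s assume "s \<in> space (leb {0..1::real})"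
    then have "0 \<le> s" "s \<le> 1" by (auto simp: space_restrict_space)
    then show "norm (s * p (?y s)) \<le> M" using M[of s] mult_mono[of s 1 "\<bar>p (?y s)\<bar>" M] by (simp add: abs_mult)
   qed (use i in simp)
   finally show ?thesis .
  qed
  also have "\<dots> = M" by (simp add: space_restrict_space measure_restrict_space)
  finally show ?thesis by simp
 qed
 show ?thesis using qp eq bound by blast
qed

lemma norm_curl: "norm (curl \<phi> x) = norm (grad \<phi> x)"
proof -
 have "(norm (curl \<phi> x))^2 = (norm (grad \<phi> x))^2" unfolding plane_norm_sq by (simp add: curl_def grad_def)
 then show ?thesis by simp
qed

lemma perp_curl: "perp y \<bullet> curl \<phi> x = - (grad \<phi> x \<bullet> y)"
 by (simp add: plane_inner curl_def grad_def)

lemma curl_mk: "curl \<phi> x = mk (grad \<phi> x $ 2) (- grad \<phi> x $ 1)"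
 by (simp add: plane_eq_iff curl_def grad_def)

lemma C1_curl_continuous: "C1 \<phi> ==> continuous_on S (curl \<phi>)"
 unfolding curl_mk[abs_def] by (intro continuous_intros C1_grad_continuous)

section \<open>Edge integrals and weak derivatives\<close>

context star_polygon
begin

lemma edge_integral_abs_sq: "EI i (\<lambda>x. (g x)^2) = len i * (nrm (leb {0..1}) (\<lambda>t. g (edp i t)))^2"
 by (simp add: edge_integral_def nrm_sq)

lemma L2_norm_edge_sq: "(L2_norm_edge vs i g)^2 = len i * (nrm (leb {0..1}) (\<lambda>t. g (edp i t)))^2"
 using edge_length_pos[of i] by (simp add: L2_norm_edge_def edge_integral_abs_sq)

lemma square_integrable_edge_sqi:
 "square_integrable_edge vs i g \<longleftrightarrow> sqi (leb {0..1}) (\<lambda>t. g (edp i t))"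
 by (simp add: square_integrable_edge_def sqi_def Let_def)

lemma continuous_edge:
 fixes f :: "plane => real"
 assumes "cont f" shows "cont (\<lambda>t. f (edp i t))"
 unfolding linepath_def by (intro continuous_on_compose2[OF assms] continuous_intros) auto

lemma sqi_edge:
 fixes f :: "plane => real"
 assumes "cont f" shows "sqi (leb {0..1}) (\<lambda>t. f (edp i t))"
 by (rule continuous_sqi_on[OF continuous_edge[OF assms]]) auto

lemma edge_sum_Cauchy_Schwarz:
 fixes f :: "plane => real"
 assumes g: "\<And>i. i < n ==> square_integrable_edge vs i (g i)" and f: "cont f"
 shows "\<bar>\<Sum>i<n. EI i (\<lambda>x. g i x * f x)\<bar> \<le>
 sqrt (\<Sum>i<n. (L2_norm_edge vs i (g i))^2) * sqrt (\<Sum>i<n. EI i (\<lambda>x. (f x)^2))"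
proof -
 let ?a = "\<lambda>i. L2_norm_edge vs i (g i)" and ?b = "\<lambda>i. sqrt (EI i (\<lambda>x. (f x)^2))"
 have b: "\<bar>EI i (\<lambda>x. g i x * f x)\<bar> \<le> ?a i * ?b i" if "i < n" for i
 proof -
  let ?G = "\<lambda>t. g i (edp i t)" and ?f = "\<lambda>t. f (edp i t)"
  have "\<bar>EI i (\<lambda>x. g i x * f x)\<bar> = len i * \<bar>LINT t|leb {0..1}. ?G t \<bullet> ?f t\<bar>"
   using edge_length_pos[of i] by (simp add: edge_integral_def abs_mult)
  also have "\<dots> \<le> len i * (nrm (leb {0..1}) ?G * nrm (leb {0..1}) ?f)"
   using nrm_Cauchy_Schwarz[OF g[OF that, unfolded square_integrable_edge_sqi] sqi_edge[OF f, of i]] edge_length_pos[of i] by (intro mult_left_mono) auto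
  also have "\<dots> = ?a i * ?b i"
  proof -
   have "?a i = sqrt (len i) * nrm (leb {0..1}) ?G" by (simp add: L2_norm_edge_def edge_integral_abs_sq real_sqrt_mult)
   moreover have "?b i = sqrt (len i) * nrm (leb {0..1}) ?f" by (simp add: edge_integral_abs_sq real_sqrt_mult)
   ultimately show ?thesis using edge_length_pos[of i] by simp
  qed
  finally show ?thesis .
 qed
 have pos: "0 \<le> EI i (\<lambda>x. (f x)^2)" for i using edge_length_pos[of i] by (simp add: edge_integral_abs_sq)
 have "\<bar>\<Sum>i<n. EI i (\<lambda>x. g i x * f x)\<bar> \<le> (\<Sum>i<n. ?a i * ?b i)" using b by (intro order_trans[OF sum_abs] sum_mono) auto
 also have "\<dots> \<le> sqrt ((\<Sum>i<n. (?a i)^2) * (\<Sum>i<n. (?b i)^2))" by (rule real_le_rsqrt) (rule Cauchy_Schwarz_ineq_sum)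
 finally show ?thesis using pos by (simp add: real_sqrt_mult)
qed

text \<open>Without boundary values the integral of the gradient vanishes, so the centre of the
  radial identity can be moved from \<open>c\<close> to any point, in particular to the
  barycentre.\<close>

lemma radial_divergence_center:
 assumes C: "C1 f" and z: "\<And>i t. i < n ==> 0 \<le> t ==> t \<le> 1 ==> f (edp i t) = 0"
 shows "(LINT x|leb F. grad f x \<bullet> y) = 0"
 and "(LINT x|leb F. 2 * f x + grad f x \<bullet> (x - b)) = 0"
proof -
 have I0: "(LINT t|leb {0..1}. f (edp i t)) = 0" if "i < n" for i
 proof -
  have "(LINT t|leb {0..1}. f (edp i t)) = (LINT t|leb {0..1::real}. 0)"
   by (rule LINT_cong) (use z[OF that] in \<open>auto simp: space_restrict_space\<close>)
  then show ?thesis by simp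
 qed
 show g0: "(LINT x|leb F. grad f x \<bullet> y) = 0" for y unfolding divergence_theorem[OF C] by (intro sum.neutral) (simp add: edge_integral_def I0)
 have "(LINT x|leb F. 2 * f x + grad f x \<bullet> (x - b)) =
  (LINT x|leb F. (2 * f x + grad f x \<bullet> (x - c)) + grad f x \<bullet> (c - b))"
  by (intro LINT_cong) (auto simp: inner_diff_right)
 also have "\<dots> = (LINT x|leb F. 2 * f x + grad f x \<bullet> (x - c)) + (LINT x|leb F. grad f x \<bullet> (c - b))"
  by (intro LINT_add continuous_integrable_on[OF _ F_ob] continuous_intros C1_continuous C1_grad_continuous C)
 also have "\<dots> = 0" unfolding g0 F_radial_divergence[OF C] by (simp add: I0)
 finally show "(LINT x|leb F. 2 * f x + grad f x \<bullet> (x - b)) = 0" .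
qed

lemma compact_support_boundary:
 assumes "C1_compact_support F \<phi>" "x \<in> boundary vs" shows "\<phi> x = 0"
 using assms disj_F by (auto simp: C1_compact_support_def)

lemma sqi_C1: "cont (f :: plane => 'b::euclidean_space) ==> sqi (leb F) f"
 by (rule continuous_sqi_on[OF _ F_ob])

lemma integrable_C1: "cont (f :: plane => 'b::euclidean_space) ==> integrable (leb F) f"
 by (rule continuous_integrable_on[OF _ F_ob])

text \<open>The radial identity for \<open>q * \<phi>\<close>, which vanishes on the boundary, read
  as an integration by parts.\<close>

lemma weak_rot_perp:
 assumes q: "q \<in> polys k" and eq: "\<And>x. 2 * q x + grad q x \<bullet> (x - b) = p x" and p: "p \<in> polys k"
 shows "has_weak_rot F (\<lambda>x. q x *\<^sub>R perp (x - b)) p"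
 unfolding has_weak_rot_def square_integrable_sqi
proof (intro conjI allI impI)
 show "sqi (leb F) p" by (intro sqi_C1 C1_continuous polys_C1[OF p])
 fix \<phi> assume s: "C1_compact_support F \<phi>"
 then have C: "C1 \<phi>" by (simp add: C1_compact_support_def)
 note qC = polys_C1[OF q]
 have C2: "C1 (\<lambda>x. q x * \<phi> x)" and g2: "grad (\<lambda>x. q x * \<phi> x) = (\<lambda>x. q x *\<^sub>R grad \<phi> x + \<phi> x *\<^sub>R grad q x)"
  using C1_mult[OF qC C] by auto
 have "(LINT x|leb F. 2 * (q x * \<phi> x) + grad (\<lambda>x. q x * \<phi> x) x \<bullet> (x - b)) = 0"
  by (rule radial_divergence_center[OF C2]) (simp add: compact_support_boundary[OF s edge_pt_in_boundary])
 also have "(\<lambda>x. 2 * (q x * \<phi> x) + grad (\<lambda>x. q x * \<phi> x) x \<bullet> (x - b)) =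
  (\<lambda>x. p x * \<phi> x - (q x *\<^sub>R perp (x - b)) \<bullet> curl \<phi> x)"
  unfolding g2 by (simp add: fun_eq_iff eq[symmetric] perp_curl inner_add_left algebra_simps)
 also have "(LINT x|leb F. p x * \<phi> x - (q x *\<^sub>R perp (x - b)) \<bullet> curl \<phi> x) =
  (LINT x|leb F. p x * \<phi> x) - (LINT x|leb F. (q x *\<^sub>R perp (x - b)) \<bullet> curl \<phi> x)"
 proof (rule LINT_diff)
  have cp: "cont (\<lambda>x. perp (x - b))"
  proof -
   have "(\<lambda>x. perp (x - b)) = (\<lambda>x. mk (- (x - b) $ 2) ((x - b) $ 1))" by (simp add: fun_eq_iff plane_eq_iff)
   then show ?thesis by (simp only:) (intro continuous_intros)
  qed
  show "integrable (leb F) (\<lambda>x. p x * \<phi> x)" by (intro integrable_C1 continuous_intros C1_continuous C polys_C1[OF p])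
  show "integrable (leb F) (\<lambda>x. (q x *\<^sub>R perp (x - b)) \<bullet> curl \<phi> x)"
   by (intro integrable_C1 continuous_intros C1_continuous C qC cp C1_curl_continuous)
 qed
 finally show "(LINT x|leb F. p x * \<phi> x) = (LINT x|leb F. (q x *\<^sub>R perp (x - b)) \<bullet> curl \<phi> x)" by simp
qed

lemma continuous_perp: "cont (\<lambda>x. perp (x - b))"
proof -
 have "(\<lambda>x. perp (x - b)) = (\<lambda>x. mk (- (x - b) $ 2) ((x - b) $ 1))" by (simp add: fun_eq_iff plane_eq_iff)
 then show ?thesis by (simp only:) (intro continuous_intros)
qed

text \<open>\<open>weak_div\<close> is an arbitrary choice; \<open>weak_zero\<close> shows that any
  two weak divergences agree almost everywhere.\<close>

lemma weak_div_AE: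
 assumes "has_weak_div F v d"
 shows "has_weak_div F v (weak_div F v)" "sqi (leb F) (weak_div F v)" "AE x in leb F. weak_div F v x = d x"
proof -
 show w: "has_weak_div F v (weak_div F v)" using someI[of "has_weak_div F v" d] assms unfolding weak_div_def by simp
 show s: "sqi (leb F) (weak_div F v)" using w by (simp add: has_weak_div_def square_integrable_sqi)
 have sd: "sqi (leb F) d" using assms by (simp add: has_weak_div_def square_integrable_sqi)
 have "AE x in leb F. weak_div F v x - d x = 0"
 proof (rule weak_zero[OF sqi_diff[OF s sd]])
  fix \<phi> assume p: "C1_compact_support F \<phi>"
  then have ps: "sqi (leb F) \<phi>" by (intro sqi_C1 C1_continuous) (simp add: C1_compact_support_def)
  have "(LINT x|leb F. (weak_div F v x - d x) * \<phi> x) =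
   (LINT x|leb F. weak_div F v x * \<phi> x) - (LINT x|leb F. d x * \<phi> x)"
   using sqi_inner[OF s ps] sqi_inner[OF sd ps] by (simp add: left_diff_distrib)
  then show "(LINT x|leb F. (weak_div F v x - d x) * \<phi> x) = 0" using w assms p by (simp add: has_weak_div_def)
 qed
 then show "AE x in leb F. weak_div F v x = d x" by simp
qed

lemma face_spaceD:
 assumes "v \<in> face_space k vs"
 shows "sqi (leb F) v" "has_normal_trace vs v (normal_trace vs v)"
 using assms someI_ex[of "has_normal_trace vs v"] by (auto simp: face_space_def square_integrable_sqi normal_trace_def)

end

definition bdry_div :: "plane list => (nat => plane => real) => (plane => real) => real" where
 "bdry_div vs g d = diameter (domain vs) * (\<Sum>i<length vs. (L2_norm_edge vs i (g i))^2) +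
 (diameter (domain vs))^2 * (nrm (leb (domain vs)) d)^2"

lemma boundary_div_terms_eq: "boundary_div_terms vs v = bdry_div vs (normal_trace vs v) (weak_div (domain vs) v)"
 by (simp add: boundary_div_terms_def bdry_div_def L2_norm_on_nrm)

context regular_polygon
begin

text \<open>The first root stems from the trace inequality, where \<open>24 = 3 * 8\<close> enters
  through the Poincare inequality; the second is the Poincare constant itself.\<close>

definition KG :: real where "KG = sqrt ((24/\<rho>^2 + 1) / \<rho>) + sqrt (8/\<rho>^2)"

lemma KG_nonneg: "0 \<le> KG" using rho by (simp add: KG_def)

lemma bdry_div_nonneg: "0 \<le> bdry_div vs g d"
 using h_pos by (auto simp: bdry_div_def h_def[symmetric] intro!: add_nonneg_nonneg mult_nonneg_nonneg sum_nonneg)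

text \<open>Subtracting from \<open>\<psi>\<close> its mean over the disc leaves the gradient
  unchanged and makes the Poincare inequality available; with the trace inequality this bounds the
  other two terms of Green's formula.\<close>

lemma green_bound:
 assumes v: "sqi (leb F) v" and d: "sqi (leb F) (weak_div F v)" and g: "has_normal_trace vs v g" and C: "C1 \<psi>"
 shows "\<bar>LINT x|leb F. v x \<bullet> grad \<psi> x\<bar> \<le> KG * sqrt (bdry_div vs g (weak_div F v)) * nrm (leb F) (grad \<psi>)"
proof -
 let ?B = "ball c r" and ?M = "leb F"
 define m where "m = (LINT x|leb ?B. \<psi> x) / measure (leb ?B) (space (leb ?B))"
 define f where "f x = \<psi> x + (- m)" for x
 have fC: "C1 f" and fg: "grad f = grad \<psi>" unfolding f_def[abs_def] using C1_add[OF C C1_const(1)[of "- m"]] by auto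
 have mB: "measure (leb ?B) (space (leb ?B)) = pi * r^2" using emeasure_B r_pos by (simp add: measure_def emeasure_restrict_space space_restrict_space)
 have i\<psi>: "integrable (leb ?B) \<psi>" by (intro continuous_integrable_on C1_continuous C) auto
 have "(LINT x|leb ?B. f x) = 0"
 proof -
  have ic: "integrable (leb ?B) (\<lambda>x. - m)" by (intro continuous_integrable_on continuous_intros) auto
  have "(LINT x|leb ?B. f x) = (LINT x|leb ?B. \<psi> x) + (LINT x|leb ?B. - m)" unfolding f_def by (rule LINT_add[OF i\<psi> ic])
  also have "\<dots> = 0" using r_pos mB by (simp add: m_def space_restrict_space)
  finally show ?thesis .
 qed
 then have P: "r^2 * (nrm ?M f)^2 \<le> 8 * h^4 * (nrm ?M (grad \<psi>))^2" using poincare_inequality[OF fC] by (simp add: fg)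
 define N where "N = nrm ?M (grad \<psi>)"
 have N0: "0 \<le> N" by (simp add: N_def)
 have r2: "\<rho>^2 * h^2 \<le> r^2" using power_mono[OF r_ge, of 2] rho h_pos by (simp add: power_mult_distrib)
 have "\<rho>^2 * h^2 * (nrm ?M f)^2 \<le> 8 * h^4 * N^2" using mult_right_mono[OF r2, of "(nrm ?M f)^2"] P by (simp add: N_def)
 then have "h^2 * (\<rho>^2 * (nrm ?M f)^2) \<le> h^2 * (8 * h^2 * N^2)" by (simp add: power4_eq_xxxx power2_eq_square ac_simps)
 then have "\<rho>^2 * (nrm ?M f)^2 \<le> 8 * h^2 * N^2" using h_pos by simp
 then have f2: "(nrm ?M f)^2 \<le> (8/\<rho>^2) * h^2 * N^2" using rho by (simp add: field_simps)
 have sq: "(sqrt (8/\<rho>^2) * h * N)^2 = (8/\<rho>^2) * h^2 * N^2" unfolding power_mult_distrib using rho by (subst real_sqrt_pow2) auto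
 have f1: "nrm ?M f \<le> sqrt (8/\<rho>^2) * h * N" by (rule power2_le_imp_le) (use f2 sq h_pos N0 rho in simp_all)
 define E where "E = (\<Sum>i<n. EI i (\<lambda>x. (f x)^2))"
 have E0: "0 \<le> E" unfolding E_def by (intro sum_nonneg) (simp add: edge_integral_abs_sq edge_length_pos less_imp_le)
 have "r * E \<le> 3 * (nrm ?M f)^2 + h^2 * N^2" using trace_inequality[OF fC] by (simp add: E_def N_def fg)
 also have "\<dots> \<le> 3 * ((8/\<rho>^2) * h^2 * N^2) + h^2 * N^2" using f2 by simp
 also have "\<dots> = h * ((24/\<rho>^2 + 1) * h * N^2)" by (simp add: power2_eq_square algebra_simps)
 finally have rE: "r * E \<le> h * ((24/\<rho>^2 + 1) * h * N^2)" .
 have "h * (\<rho> * E) \<le> r * E" using mult_right_mono[OF r_ge E0] by (simp add: ac_simps)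
 then have "h * (\<rho> * E) \<le> h * ((24/\<rho>^2 + 1) * h * N^2)" using rE by linarith
 then have "\<rho> * E \<le> (24/\<rho>^2 + 1) * h * N^2" using h_pos by simp
 then have E2: "E \<le> ((24/\<rho>^2 + 1) / \<rho>) * h * N^2" using rho by (simp add: field_simps)
 define S where "S = bdry_div vs g (weak_div F v)"
 define L where "L = (\<Sum>i<n. (L2_norm_edge vs i (g i))^2)"
 have L0: "0 \<le> L" by (simp add: L_def sum_nonneg)
 have S: "S = h * L + h^2 * (nrm ?M (weak_div F v))^2" by (simp add: S_def bdry_div_def L_def h_def)
 have S1: "sqrt (h * L) \<le> sqrt S" "h * nrm ?M (weak_div F v) \<le> sqrt S"
  using h_pos L0 by (auto simp: S power_mult_distrib intro!: real_le_rsqrt)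
 have fcont: "cont f" by (rule C1_continuous[OF fC])
 have ge: "\<And>i. i < n ==> square_integrable_edge vs i (g i)" using g by (simp add: has_normal_trace_def)
 have "(LINT x|?M. v x \<bullet> grad f x) + (LINT x|?M. weak_div F v x * f x) = (\<Sum>i<n. EI i (\<lambda>x. g i x * f x))"
  using g fC by (simp add: has_normal_trace_def)
 moreover have "\<bar>\<Sum>i<n. EI i (\<lambda>x. g i x * f x)\<bar> \<le> sqrt L * sqrt E"
  unfolding L_def E_def by (rule edge_sum_Cauchy_Schwarz[OF ge fcont])
 moreover have "\<bar>LINT x|?M. weak_div F v x * f x\<bar> \<le> nrm ?M (weak_div F v) * nrm ?M f"
  using nrm_Cauchy_Schwarz[OF d sqi_C1[OF fcont]] by simp
 ultimately have "\<bar>LINT x|?M. v x \<bullet> grad f x\<bar> \<le> sqrt L * sqrt E + nrm ?M (weak_div F v) * nrm ?M f" by linarith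
 also have "sqrt L * sqrt E \<le> sqrt L * (sqrt ((24/\<rho>^2 + 1) / \<rho>) * sqrt h * N)"
 proof (rule mult_left_mono)
  have "sqrt E \<le> sqrt (((24/\<rho>^2 + 1) / \<rho>) * h * N^2)" using E2 by simp
  also have "\<dots> = sqrt ((24/\<rho>^2 + 1) / \<rho>) * sqrt h * N" using N0 by (simp only: real_sqrt_mult) simp
  finally show "sqrt E \<le> sqrt ((24/\<rho>^2 + 1) / \<rho>) * sqrt h * N" .
 qed (use L0 in simp)
 also have "\<dots> = sqrt ((24/\<rho>^2 + 1) / \<rho>) * N * sqrt (h * L)" by (simp add: real_sqrt_mult)
 also have "\<dots> \<le> sqrt ((24/\<rho>^2 + 1) / \<rho>) * N * sqrt S" using S1 N0 rho by (intro mult_left_mono) auto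
 also have "nrm ?M (weak_div F v) * nrm ?M f \<le> nrm ?M (weak_div F v) * (sqrt (8/\<rho>^2) * h * N)" by (intro mult_left_mono f1) auto
 also have "\<dots> = sqrt (8/\<rho>^2) * N * (h * nrm ?M (weak_div F v))" by simp
 also have "\<dots> \<le> sqrt (8/\<rho>^2) * N * sqrt S" using S1 N0 rho by (intro mult_left_mono) auto
 finally show ?thesis unfolding fg S_def[symmetric] N_def[symmetric] KG_def by (simp add: algebra_simps)
qed

text \<open>\<open>w\<close> is only an L2 limit of gradients of \<open>C1\<close> functions, but
  \<open>green_bound\<close> involves no more than the L2 norm of the gradient and so survives the
  limit.\<close>

lemma curl_free_green:
 assumes v: "sqi (leb F) v" and d: "sqi (leb F) (weak_div F v)" and g: "has_normal_trace vs v g"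
 and w: "sqi (leb F) w" "has_weak_rot F w (\<lambda>x. 0)"
 shows "\<bar>LINT x|leb F. v x \<bullet> w x\<bar> \<le> KG * sqrt (bdry_div vs g (weak_div F v)) * nrm (leb F) w"
proof -
 let ?M = "leb F" and ?K = "KG * sqrt (bdry_div vs g (weak_div F v))"
 obtain \<psi> where \<psi>: "\<And>m::nat. C1 (\<psi> m)" "(\<lambda>m. nrm ?M (\<lambda>x. grad (\<psi> m) x - w x)) \<longlonglongrightarrow> 0"
  using curl_free_approx[OF w] by blast
 have K0: "0 \<le> ?K" using KG_nonneg bdry_div_nonneg by simp
 have b: "\<bar>LINT x|?M. v x \<bullet> w x\<bar> \<le> ?K * nrm ?M w + (?K + nrm ?M v) * nrm ?M (\<lambda>x. grad (\<psi> m) x - w x)" for m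
 proof -
  have gs: "sqi ?M (grad (\<psi> m))" by (intro sqi_C1 C1_grad_continuous \<psi>)
  have ds: "sqi ?M (\<lambda>x. grad (\<psi> m) x - w x)" by (rule sqi_diff[OF gs w(1)])
  have "(LINT x|?M. v x \<bullet> w x) = (LINT x|?M. v x \<bullet> grad (\<psi> m) x) - (LINT x|?M. v x \<bullet> (grad (\<psi> m) x - w x))"
   using sqi_inner[OF v gs] sqi_inner[OF v w(1)] by (simp add: inner_diff_right)
  moreover have "\<bar>LINT x|?M. v x \<bullet> (grad (\<psi> m) x - w x)\<bar> \<le> nrm ?M v * nrm ?M (\<lambda>x. grad (\<psi> m) x - w x)"
   by (rule nrm_Cauchy_Schwarz[OF v ds])
  moreover have "\<bar>LINT x|?M. v x \<bullet> grad (\<psi> m) x\<bar> \<le> ?K * nrm ?M (grad (\<psi> m))" by (rule green_bound[OF v d g \<psi>(1)])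
  moreover have "?K * nrm ?M (grad (\<psi> m)) \<le> ?K * (nrm ?M (\<lambda>x. grad (\<psi> m) x - w x) + nrm ?M w)"
   using nrm_triangle[OF ds w(1)] K0 by (intro mult_left_mono) auto
  ultimately show ?thesis by (simp add: algebra_simps)
 qed
 have "(\<lambda>m. ?K * nrm ?M w + (?K + nrm ?M v) * nrm ?M (\<lambda>x. grad (\<psi> m) x - w x)) \<longlonglongrightarrow> ?K * nrm ?M w + (?K + nrm ?M v) * 0"
  by (intro tendsto_intros \<psi>(2))
 then have "\<bar>LINT x|?M. v x \<bullet> w x\<bar> \<le> ?K * nrm ?M w + (?K + nrm ?M v) * 0" by (rule LIMSEQ_le_const) (use b in blast)
 then show ?thesis by simp
qed

end

context polygon_constants
begin

text \<open>The rotation of \<open>v\<close> is a polynomial whose pairing with a test function is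
  at most the norm of \<open>v\<close> times that of the gradient, so \<open>inverse_bound\<close>
  applies. The radial inverse then yields a polynomial field with the same rotation.\<close>

lemma perp_field_bound:
 assumes p: "p \<in> polys (int k)" and v: "sqi (leb F) v" and rot: "has_weak_rot F v p" and b: "norm (b - c) \<le> h"
 shows "\<exists>q\<in>polys (int k). has_weak_rot F (\<lambda>x. q x *\<^sub>R perp (x - b)) p \<and>
 nrm (leb F) (\<lambda>x. q x *\<^sub>R perp (x - b)) \<le> 4 * IC * nrm (leb F) v"
proof -
 let ?M = "leb F"
 define B where "B = IC / h^2 * nrm ?M v"
 have B0: "0 \<le> B" using IC_pos h_pos by (simp add: B_def)
 have pk: "p \<in> polys (int (Suc k))" using p by (rule polys_mono) simp
 have pb: "\<bar>p x\<bar> \<le> B" if "norm (x - c) \<le> 2 * h" for x unfolding B_def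
 proof (rule inverse_bound[OF pk nrm_nonneg _ that])
  fix \<phi> assume s: "C1_compact_support F \<phi>"
  then have cs: "sqi ?M (curl \<phi>)" by (intro sqi_C1 C1_curl_continuous) (simp add: C1_compact_support_def)
  have "(LINT x|?M. p x * \<phi> x) = (LINT x|?M. v x \<bullet> curl \<phi> x)" using rot s by (simp add: has_weak_rot_def)
  then have "\<bar>LINT x|?M. p x * \<phi> x\<bar> \<le> nrm ?M v * nrm ?M (curl \<phi>)" using nrm_Cauchy_Schwarz[OF v cs] by simp
  then show "\<bar>LINT x|?M. p x * \<phi> x\<bar> \<le> nrm ?M v * nrm ?M (grad \<phi>)" by (simp add: nrm_def norm_curl)
 qed
 obtain q where q: "q \<in> polys (int k)" "\<And>x. 2 * q x + grad q x \<bullet> (x - b) = p x"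
  "\<And>x M. (\<And>s. 0 \<le> s ==> s \<le> 1 ==> \<bar>p (b + s *\<^sub>R (x - b))\<bar> \<le> M) ==> \<bar>q x\<bar> \<le> M"
  using radial_inverse[OF p, of b] by metis
 note ns = near_segment[OF b near_c(2)]
 have qC: "cont q" by (intro C1_continuous polys_C1[OF q(1)])
 have "nrm ?M (\<lambda>x. q x *\<^sub>R perp (x - b)) \<le> 2 * h * (B * (2 * h))"
 proof (rule nrm_le_sup_h(2))
  show "(\<lambda>x. q x *\<^sub>R perp (x - b)) \<in> borel_measurable ?M" by (intro cont_measurable continuous_intros qC continuous_perp)
  fix x assume x: "x \<in> F"
  have "\<bar>q x\<bar> \<le> B" by (rule q(3), rule pb, rule ns(2)[OF x])
  then show "norm (q x *\<^sub>R perp (x - b)) \<le> B * (2 * h)" using ns(1)[OF x] B0 by (simp add: mult_mono)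
 qed (use B0 h_pos in simp)
 also have "\<dots> = 4 * IC * nrm ?M v" using h_pos by (simp add: B_def power2_eq_square)
 finally show ?thesis using q(1) weak_rot_perp[OF q(1,2) p] by blast
qed

definition LB :: real where "LB = KG * (1 + 4 * IC) + 4 * IC"

text \<open>\<open>Pr\<close> stands for either projection: all that is used of it is that it has
  the same moments as \<open>v\<close> against the fields \<open>q x *\<^sub>R perp (x - b)\<close>,
  one of which carries the rotation of \<open>v\<close>.\<close>

lemma lower_bound:
 assumes v: "v \<in> face_space k vs" and b: "norm (b - c) \<le> h" and Pr: "sqi (leb F) Pr"
 and eq: "\<And>q. q \<in> polys (int k) ==> (LINT x|leb F. v x \<bullet> (q x *\<^sub>R perp (x - b))) =
 (LINT x|leb F. Pr x \<bullet> (q x *\<^sub>R perp (x - b)))"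
 shows "(nrm (leb F) v)^2 \<le> (2 * LB^2) * (boundary_div_terms vs v + (nrm (leb F) Pr)^2)"
proof -
 let ?C = "4 * IC"
 let ?M = "leb F"
 note vs' = face_spaceD(1)[OF v] and g = face_spaceD(2)[OF v]
 obtain d where d: "has_weak_div F v d" using v by (auto simp: face_space_def)
 obtain p where p: "p \<in> polys (int k)" "has_weak_rot F v p" using v by (auto simp: face_space_def)
 define S where "S = bdry_div vs (normal_trace vs v) (weak_div F v)"
 have S0: "0 \<le> S" unfolding S_def by (rule bdry_div_nonneg)
 obtain q where q: "q\<in>polys (int k)" "has_weak_rot F (\<lambda>x. q x *\<^sub>R perp (x - b)) p"
  "nrm ?M (\<lambda>x. q x *\<^sub>R perp (x - b)) \<le> ?C * nrm ?M v"
  using perp_field_bound[OF p(1) vs' p(2) b] by blast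
 define X where "X = (\<lambda>x. q x *\<^sub>R perp (x - b))"
 have Xc: "cont X" unfolding X_def by (intro continuous_intros continuous_perp C1_continuous polys_C1[OF q(1)])
 have Xs: "sqi ?M X" by (rule sqi_C1[OF Xc])
 define w where "w = (\<lambda>x. v x - X x)"
 have ws: "sqi ?M w" unfolding w_def by (rule sqi_diff[OF vs' Xs])
 have wr: "has_weak_rot F w (\<lambda>x. 0)" unfolding has_weak_rot_def square_integrable_sqi
 proof (intro conjI allI impI)
  show "sqi ?M (\<lambda>x. 0::real)" by (intro sqi_C1 continuous_intros)
  fix \<phi> assume s: "C1_compact_support F \<phi>"
  then have cs: "sqi ?M (curl \<phi>)" by (intro sqi_C1 C1_curl_continuous) (simp add: C1_compact_support_def)
  have "(LINT x|?M. w x \<bullet> curl \<phi> x) = (LINT x|?M. v x \<bullet> curl \<phi> x) - (LINT x|?M. X x \<bullet> curl \<phi> x)"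
   unfolding w_def inner_diff_left by (rule LINT_diff[OF sqi_inner[OF vs' cs] sqi_inner[OF Xs cs]])
  also have "\<dots> = 0" using p(2) q(2) s by (simp add: has_weak_rot_def X_def)
  finally show "(LINT x|?M. 0 * \<phi> x) = (LINT x|?M. w x \<bullet> curl \<phi> x)" by simp
 qed
 define V where "V = nrm ?M v"
 define P where "P = nrm ?M Pr"
 have VP: "0 \<le> V" "0 \<le> P" by (simp_all add: V_def P_def)
 have wn: "nrm ?M w \<le> (1 + ?C) * V" using nrm_diff_triangle[OF vs' Xs] q(3) by (simp add: w_def V_def X_def algebra_simps)
 have "V^2 = (LINT x|?M. v x \<bullet> v x)" unfolding V_def nrm_sq by (simp add: power2_norm_eq_inner)
 also have "\<dots> = (LINT x|?M. v x \<bullet> w x) + (LINT x|?M. v x \<bullet> X x)"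
  using sqi_inner[OF vs' vs'] sqi_inner[OF vs' Xs] by (simp add: w_def inner_diff_right)
 also have "(LINT x|?M. v x \<bullet> X x) = (LINT x|?M. Pr x \<bullet> X x)" using eq[OF q(1)] by (simp add: X_def)
 also have "\<dots> \<le> P * (?C * V)"
 proof -
  have "\<bar>LINT x|?M. Pr x \<bullet> X x\<bar> \<le> P * nrm ?M X" unfolding P_def by (rule nrm_Cauchy_Schwarz[OF Pr Xs])
  also have "\<dots> \<le> P * (?C * V)" using q(3) VP by (intro mult_left_mono) (auto simp: X_def V_def)
  finally show ?thesis by simp
 qed
 also have "(LINT x|?M. v x \<bullet> w x) \<le> KG * sqrt S * ((1 + ?C) * V)"
 proof -
  have "\<bar>LINT x|?M. v x \<bullet> w x\<bar> \<le> KG * sqrt S * nrm ?M w"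
   using curl_free_green[OF vs' weak_div_AE(2)[OF d] g ws wr] unfolding S_def .
  also have "\<dots> \<le> KG * sqrt S * ((1 + ?C) * V)" using wn KG_nonneg S0 by (intro mult_left_mono) auto
  finally show ?thesis by simp
 qed
 finally have "V * V \<le> V * (KG * (1 + ?C) * sqrt S + ?C * P)" by (simp add: power2_eq_square algebra_simps)
 then have "V \<le> KG * (1 + ?C) * sqrt S + ?C * P" using VP IC_pos KG_nonneg S0 by (cases "V = 0") auto
 also have "\<dots> \<le> LB * sqrt S + LB * P" using IC_pos KG_nonneg VP S0 by (intro add_mono mult_right_mono) (auto simp: LB_def)
 finally have "V^2 \<le> (LB * (sqrt S + P))^2" using VP by (intro power_mono) (auto simp: algebra_simps)
 also have "\<dots> \<le> LB^2 * (2 * (S + P^2))" using sum_squares_bound[of "sqrt S" P] S0 unfolding power_mult_distrib power2_sum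
  by (intro mult_left_mono) auto
 finally show ?thesis unfolding V_def P_def S_def boundary_div_terms_eq by (simp add: algebra_simps)
qed

end

section \<open>Upper bounds\<close>

lemma C1_compose_real:
 assumes f: "C1 f" and P: "\<And>u. (P has_real_derivative P' u) (at u)" and c: "cont P'"
 shows "C1 (\<lambda>x. P (f x))" "grad (\<lambda>x. P (f x)) = (\<lambda>x. P' (f x) *\<^sub>R grad f x)"
proof -
 have "((\<lambda>x. P (f x)) has_derivative (\<lambda>d. (P' (f x) *\<^sub>R grad f x) \<bullet> d)) (at x)" for x
  using has_derivative_compose[OF C1_has_derivative[OF f] P[of "f x", unfolded has_field_derivative_def]] by simp
 moreover have "cont (\<lambda>x. P' (f x) *\<^sub>R grad f x)"
  using f by (intro continuous_intros continuous_on_compose2[OF c] C1_grad_continuous C1_continuous) auto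
 ultimately show "C1 (\<lambda>x. P (f x))" "grad (\<lambda>x. P (f x)) = (\<lambda>x. P' (f x) *\<^sub>R grad f x)" by (fact C1I)+
qed

lemma C1_linear:
 shows "C1 (\<lambda>x. (x - b) \<bullet> y)" "grad (\<lambda>x. (x - b) \<bullet> y) = (\<lambda>x. y)"
proof -
 have "((\<lambda>x. (x - b) \<bullet> y) has_derivative (\<lambda>d. y \<bullet> d)) (at x)" for x
  by (auto intro!: derivative_eq_intros simp: inner_commute)
 moreover have "cont (\<lambda>x::plane. y)" by (intro continuous_intros)
 ultimately show "C1 (\<lambda>x. (x - b) \<bullet> y)" "grad (\<lambda>x. (x - b) \<bullet> y) = (\<lambda>x. y)" by (fact C1I)+
qed

definition poly1 :: "nat => (nat => real) => real => real" where "poly1 k a t = (\<Sum>i\<le>k. a i * t ^ i)"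
definition dpoly1 :: "nat => (nat => real) => real => real" where "dpoly1 k a t = (\<Sum>i\<le>k. a i * (real i * t ^ (i - 1)))"

lemma poly1_deriv: "(poly1 k a has_real_derivative dpoly1 k a t) (at t)"
 unfolding poly1_def[abs_def] dpoly1_def by (auto intro!: derivative_eq_intros sum.cong)

lemma poly1_cont: "continuous_on S (poly1 k a)" "continuous_on S (dpoly1 k a)"
 unfolding poly1_def[abs_def] dpoly1_def[abs_def] by (intro continuous_intros)+

lemma has_normal_traceD:
 assumes "has_normal_trace vs v g" "C1 \<phi>"
 shows "(LINT x|leb (domain vs). v x \<bullet> grad \<phi> x) +
 (LINT x|leb (domain vs). weak_div (domain vs) v x * \<phi> x) =
 (\<Sum>i<length vs. edge_integral vs i (\<lambda>x. g i x * \<phi> x))"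
 using assms by (simp add: has_normal_trace_def)

context star_polygon
begin

text \<open>\<open>al\<close> and \<open>be\<close> are the barycentric coordinates of the two end
  points of edge \<open>i\<close> in the triangle with apex \<open>c\<close>; the open cone over the
  edge is where both are positive.\<close>

definition al :: "nat => plane => real" where "al i x = (x - c) \<bullet> ((1 / D i) *\<^sub>R mk (vb i $ 2) (- vb i $ 1))"
definition be :: "nat => plane => real" where "be i x = (x - c) \<bullet> ((1 / D i) *\<^sub>R mk (- va i $ 2) (va i $ 1))"

lemma al_wedge: "al i x = wedge (x - c) (vb i) / D i" and be_wedge: "be i x = wedge (va i) (x - c) / D i"
 by (simp_all add: al_def be_def wedge_def plane_inner algebra_simps add_divide_distrib diff_divide_distrib)

lemma cone_coordinates: "x - c = al i x *\<^sub>R va i + be i x *\<^sub>R vb i"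
proof -
 have "D i *\<^sub>R (x - c) = D i *\<^sub>R (al i x *\<^sub>R va i + be i x *\<^sub>R vb i)" using wedge_decomp[of "va i" "vb i" "x - c"] D_nz[of i]
  by (simp add: al_wedge be_wedge D_def[symmetric] scaleR_add_right del: wedge_linear)
 then show ?thesis using D_nz[of i] by simp
qed

lemma al_edge: "al i (edp i t) = 1 - t" and be_edge: "be i (edp i t) = t"
proof -
 have e: "edp i t - c = (1 - t) *\<^sub>R va i + t *\<^sub>R vb i" by (simp add: linepath_def algebra_simps)
 have w: "wedge ((1 - t) *\<^sub>R X + t *\<^sub>R Y) Y = (1 - t) * wedge X Y"
  "wedge X ((1 - t) *\<^sub>R X + t *\<^sub>R Y) = t * wedge X Y" for X Y by simp_all
 show "al i (edp i t) = 1 - t" "be i (edp i t) = t" using D_nz[of i] unfolding al_wedge be_wedge e w D_def[symmetric] by simp_all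
qed

lemma cone_point:
 assumes "al i x > 0" "be i x > 0"
 shows "x - c = (al i x + be i x) *\<^sub>R (edp i (be i x / (al i x + be i x)) - c)"
proof -
 let ?s = "al i x + be i x"
 have s: "?s > 0" using assms by simp
 have "edp i (be i x / ?s) - c = (al i x / ?s) *\<^sub>R va i + (be i x / ?s) *\<^sub>R vb i"
 proof -
  have A: "1 - be i x / ?s = al i x / ?s" using s by (simp add: field_simps)
  define u where "u = be i x / ?s"
  have "edp i u - c = (1 - u) *\<^sub>R va i + u *\<^sub>R vb i" by (simp add: linepath_def algebra_simps)
  then show ?thesis unfolding u_def A .
 qed
 then show ?thesis using cone_coordinates[of x i] s by (simp add: scaleR_add_right)
qed

lemma cone_boundary:
 assumes "i < n" "j < n" "0 \<le> t" "t \<le> 1" "al i (edp j t) > 0" "be i (edp j t) > 0"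
 shows "i = j"
proof -
 let ?x = "edp j t"
 let ?s = "al i ?x + be i ?x" and ?u = "be i ?x / (al i ?x + be i ?x)"
 have s: "?s > 0" using assms by simp
 have u: "0 < ?u" "?u < 1" using assms by (auto simp: field_simps)
 show ?thesis by (rule cones_disjoint[OF assms(1,2) u assms(3,4) s cone_point[OF assms(5,6)]])
qed

text \<open>Beyond the edge a ray from \<open>c\<close> has left \<open>F\<close>, so
  \<open>al\<close> and \<open>be\<close> add up to less than 1 in the part of the cone inside
  \<open>F\<close>. This bounds the cut-off by 1.\<close>

lemma cone_in_F:
 assumes "i < n" "x \<in> F" "al i x > 0" "be i x > 0"
 shows "al i x \<le> 1" "be i x \<le> 1"
proof -
 let ?s = "al i x + be i x" and ?u = "be i x / (al i x + be i x)"
 have s: "?s > 0" using assms by simp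
 have u: "0 < ?u" "?u < 1" using assms by (auto simp: field_simps)
 have eb: "edp i ?u \<in> boundary vs" using edge_pt_in_boundary[OF assms(1)] u by auto
 have "?s < 1"
 proof (rule ccontr)
  assume "\<not> ?s < 1"
  then have s1: "?s \<ge> 1" by simp
  have e: "edp i ?u = c + (1/?s) *\<^sub>R (x - c)" using cone_point[OF assms(3,4)] s by simp
  have "edp i ?u \<in> F"
  proof (cases "?s = 1")
   case True then show ?thesis using e assms(2) by simp
  next
   case False
   then show ?thesis unfolding e using s1 by (intro ray_in F_sub_closure assms(2)) auto
  qed
  then show False using eb disj_F by auto
 qed
 then show "al i x \<le> 1" "be i x \<le> 1" using assms by auto
qed

lemma al_C1: "C1 (al i)" "grad (al i) = (\<lambda>x. (1 / D i) *\<^sub>R mk (vb i $ 2) (- vb i $ 1))"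
 and be_C1: "C1 (be i)" "grad (be i) = (\<lambda>x. (1 / D i) *\<^sub>R mk (- va i $ 2) (va i $ 1))"
 unfolding al_def[abs_def] be_def[abs_def] by (rule C1_linear)+

lemma norm_mk_perp: "norm (mk (- y $ 2) (y $ 1)) = norm (y :: plane)" "norm (mk (y $ 2) (- y $ 1)) = norm (y :: plane)"
proof -
 have "(norm (mk (- y $ 2) (y $ 1)))^2 = (norm y)^2" "(norm (mk (y $ 2) (- y $ 1)))^2 = (norm y)^2" unfolding plane_norm_sq by simp_all
 then show "norm (mk (- y $ 2) (y $ 1)) = norm y" "norm (mk (y $ 2) (- y $ 1)) = norm y" by simp_all
qed

lemma norm_va: "norm (va i) \<le> h" "norm (vb i) \<le> h"
 using dist_le_h[OF _ F_sub_closure[OF c_in]] vertex_in_boundary closure_F by auto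

lemma grad_albe: "norm (grad (al i) x) \<le> h / \<bar>D i\<bar>" "norm (grad (be i) x) \<le> h / \<bar>D i\<bar>"
 unfolding al_C1 be_C1 norm_scaleR norm_mk_perp using norm_va[of i] by (simp_all add: divide_right_mono)

text \<open>A function on the edge, continued into the cone along \<open>be\<close> and cut off by
  squared positive parts. It vanishes on every edge but \<open>i\<close>, so Green's formula
  isolates a single normal trace; on edge \<open>i\<close> the cut-off reads
  \<open>(1 - t)^2 * t^2\<close>.\<close>

definition tf :: "(real => real) => nat => plane => real" where
 "tf P i x = P (be i x) * ((max 0 (al i x))^2 * (max 0 (be i x))^2)"

lemma tf_C1:
 assumes P: "\<And>u. (P has_real_derivative P' u) (at u)" and c: "cont P'"
 shows "C1 (tf P i)"
 and "grad (tf P i) = (\<lambda>x. P (be i x) *\<^sub>R ((max 0 (al i x))^2 *\<^sub>R ((2 * max 0 (be i x)) *\<^sub>R grad (be i) x) +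
 (max 0 (be i x))^2 *\<^sub>R ((2 * max 0 (al i x)) *\<^sub>R grad (al i) x)) +
 ((max 0 (al i x))^2 * (max 0 (be i x))^2) *\<^sub>R (P' (be i x) *\<^sub>R grad (be i) x))"
proof -
 note 1 = C1_compose_real[OF be_C1(1)[of i] P c]
 note 2 = C1_mult[OF C1_pos_sq(1)[OF al_C1(1)[of i]] C1_pos_sq(1)[OF be_C1(1)[of i]], unfolded C1_pos_sq(2)[OF al_C1(1)[of i]] C1_pos_sq(2)[OF be_C1(1)[of i]]]
 note 3 = C1_mult[OF 1(1) 2(1), unfolded 1(2) 2(2)]
 show "C1 (tf P i)" "grad (tf P i) = (\<lambda>x. P (be i x) *\<^sub>R ((max 0 (al i x))^2 *\<^sub>R ((2 * max 0 (be i x)) *\<^sub>R grad (be i) x) +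
  (max 0 (be i x))^2 *\<^sub>R ((2 * max 0 (al i x)) *\<^sub>R grad (al i) x)) +
  ((max 0 (al i x))^2 * (max 0 (be i x))^2) *\<^sub>R (P' (be i x) *\<^sub>R grad (be i) x))"
  using 3 by (simp_all add: tf_def[abs_def])
qed

lemma tf_edge_integral:
 assumes i: "i < n"
 shows "(\<Sum>j<n. EI j (\<lambda>x. g j x * tf P i x)) =
 len i * (LINT t|leb {0..1}. g i (edp i t) * (P t * ((1 - t)^2 * t^2)))"
proof -
 have "EI j (\<lambda>x. g j x * tf P i x) = (if j = i then len i * (LINT t|leb {0..1}. g i (edp i t) * (P t * ((1 - t)^2 * t^2))) else 0)"
  if j: "j < n" for j
 proof (cases "j = i")
  case True
  have "(LINT t|leb {0..1}. g i (edp i t) * tf P i (edp i t)) =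
   (LINT t|leb {0..1}. g i (edp i t) * (P t * ((1 - t)^2 * t^2)))"
   by (rule LINT_cong) (auto simp: tf_def al_edge be_edge space_restrict_space max_absorb2)
  then show ?thesis using True by (simp add: edge_integral_def)
 next
  case False
  have "(LINT t|leb {0..1}. g j (edp j t) * tf P i (edp j t)) = (LINT t|leb {0..1::real}. 0)"
  proof (rule LINT_cong[OF refl])
   fix t assume "t \<in> space (leb {0..1::real})"
   then have "0 \<le> t" "t \<le> 1" by (auto simp: space_restrict_space)
   then have "al i (edp j t) \<le> 0 \<or> be i (edp j t) \<le> 0" using cone_boundary[OF i j] False by force
   then show "g j (edp j t) * tf P i (edp j t) = 0" by (auto simp: tf_def max_absorb1)
  qed
  then show ?thesis using False by (simp add: edge_integral_def)
 qed
 then show ?thesis using i by simp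
qed

lemma trace_orthogonal:
 assumes g: "has_normal_trace vs v g" and g': "has_normal_trace vs v g'" and i: "i < n"
 shows "(LINT t|leb {0..1}. (g i (edp i t) - g' i (edp i t)) * (poly1 k a t * ((1 - t)^2 * t^2))) = 0"
proof -
 note C = tf_C1(1)[OF poly1_deriv poly1_cont(2), of k a i]
 let ?M = "leb {0..1::real}"
 let ?w = "\<lambda>t. poly1 k a t * ((1 - t)^2 * t^2)"
 have ws: "sqi ?M ?w" by (intro continuous_sqi_on continuous_intros poly1_cont) auto
 have s: "sqi ?M (\<lambda>t. g i (edp i t))" "sqi ?M (\<lambda>t. g' i (edp i t))"
  using g g' i by (auto simp: has_normal_trace_def square_integrable_edge_sqi)
 have "len i * (LINT t|?M. g i (edp i t) * ?w t) = len i * (LINT t|?M. g' i (edp i t) * ?w t)"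
  using has_normal_traceD[OF g C] has_normal_traceD[OF g' C] unfolding tf_edge_integral[OF i] by linarith
 then have "(LINT t|?M. g i (edp i t) * ?w t) = (LINT t|?M. g' i (edp i t) * ?w t)" using edge_length_pos[of i] by simp
 then show ?thesis using sqi_inner[OF s(1) ws] sqi_inner[OF s(2) ws] by (simp add: left_diff_distrib)
qed

text \<open>The difference of two traces, times the weight \<open>(1 - t)^2 * t^2\<close>, is
  orthogonal to all polynomials and hence zero by their density; the weight itself vanishes only at
  the end points.\<close>

lemma normal_trace_unique:
 assumes g: "has_normal_trace vs v g" and g': "has_normal_trace vs v g'" and i: "i < n"
 shows "AE t in leb {0..1}. g i (edp i t) = g' i (edp i t)"
proof -
 let ?M = "leb {0..1::real}"
 have ob: "open {0..1::real} \<or> closed {0..1::real}" "bounded {0..1::real}" by auto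
 have s: "sqi ?M (\<lambda>t. g i (edp i t))" "sqi ?M (\<lambda>t. g' i (edp i t))"
  using g g' i by (auto simp: has_normal_trace_def square_integrable_edge_sqi)
 define w :: "real => real" where "w t = (1 - t)^2 * t^2" for t
 define e where "e t = g i (edp i t) - g' i (edp i t)" for t
 have es: "sqi ?M e" unfolding e_def[abs_def] by (rule sqi_diff[OF s])
 define d where "d t = e t * w t" for t
 have w1: "\<bar>w t\<bar> \<le> 1" if "t \<in> {0..1}" for t
 proof -
  have "(1 - t)^2 * t^2 \<le> 1 * 1" using that by (intro mult_mono power_le_one) auto
  then show ?thesis by (simp add: w_def)
 qed
 have wm: "w \<in> borel_measurable ?M" unfolding w_def[abs_def] by (intro cont_measurable continuous_intros)
 have ds: "sqi ?M d" unfolding sqi_def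
 proof
  show m: "d \<in> borel_measurable ?M" unfolding d_def[abs_def] using sqi_meas[OF es] wm by simp
  show "integrable ?M (\<lambda>x. (norm (d x))^2)"
  proof (rule Bochner_Integration.integrable_bound[OF sqi_int[OF es]])
   show "AE x in ?M. norm ((norm (d x))^2) \<le> norm ((norm (e x))^2)"
   proof (rule AE_I2)
    fix x assume "x \<in> space ?M"
    then have "\<bar>w x\<bar> \<le> 1" using w1 by (simp add: space_restrict_space)
    then have "\<bar>e x\<bar> * \<bar>w x\<bar> \<le> \<bar>e x\<bar> * 1" by (intro mult_left_mono) auto
    then show "norm ((norm (d x))^2) \<le> norm ((norm (e x))^2)" by (simp add: d_def abs_le_square_iff[symmetric] abs_mult)
   qed
  qed (use m in measurable)
 qed
 define N where "N = nrm ?M d"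
 have "N^2 \<le> N * \<epsilon>" if \<epsilon>: "\<epsilon> > 0" for \<epsilon>
 proof -
  obtain f Mf where f: "cont f" "nrm ?M (\<lambda>x. d x - f x) < \<epsilon>/2"
   using L2_approx_continuous[OF ds ob half_gt_zero[OF \<epsilon>]] by blast
  obtain P where P: "real_polynomial_function P" "\<And>x. x \<in> {0..1} ==> \<bar>f x - P x\<bar> < \<epsilon>/2"
   using Stone_Weierstrass_real_polynomial_function[OF compact_Icc[of "0::real" 1] continuous_on_subset[OF f(1) subset_UNIV] half_gt_zero[OF \<epsilon>]]
   by blast
  then obtain a k where ak: "P = (\<lambda>x. \<Sum>i\<le>k. a i * x^i)" by (auto simp: real_polynomial_function_iff_sum)
  have Pp: "P = poly1 k a" by (simp add: ak poly1_def fun_eq_iff)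
  have Pc: "cont P" unfolding Pp by (rule poly1_cont)
  have Ps: "sqi ?M P" and fs: "sqi ?M f" by (intro continuous_sqi_on Pc f ob)+
  have fP: "nrm ?M (\<lambda>x. f x - P x) \<le> \<epsilon>/2"
  proof -
   have m: "(\<lambda>x. f x - P x) \<in> borel_measurable ?M" by (intro cont_measurable continuous_intros f Pc)
   have "(nrm ?M (\<lambda>x. f x - P x))^2 \<le> (\<epsilon>/2)^2 * measure ?M (space ?M)"
   proof (rule nrm_le_sup(2)[OF m finite_measure_lebesgue_on[OF ob]])
    fix x assume "x \<in> space ?M"
    then have "\<bar>f x - P x\<bar> < \<epsilon>/2" by (intro P(2)) (simp add: space_restrict_space)
    then show "norm (f x - P x) \<le> \<epsilon>/2" by simp
   qed (use \<epsilon> in simp)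
   also have "measure ?M (space ?M) = 1" by (simp add: space_restrict_space measure_restrict_space)
   finally have "(nrm ?M (\<lambda>x. f x - P x))^2 \<le> (\<epsilon>/2)^2" by (simp only: mult_1_right)
   then show ?thesis by (rule power2_le_imp_le) (use \<epsilon> in simp)
  qed
  have dP: "sqi ?M (\<lambda>x. d x - P x)" by (rule sqi_diff[OF ds Ps])
  have "nrm ?M (\<lambda>x. d x - P x) \<le> \<epsilon>" using nrm_triangle[OF sqi_diff[OF ds fs] sqi_diff[OF fs Ps]] f(2) fP by simp
  moreover have "N^2 = (LINT x|?M. d x \<bullet> (d x - P x))"
  proof -
   have "(LINT x|?M. d x * P x) = 0" using trace_orthogonal[OF g g' i, of k a] by (simp add: d_def e_def w_def Pp ac_simps)
   then show ?thesis using sqi_inner[OF ds ds] sqi_inner[OF ds Ps] unfolding N_def nrm_sq by (simp add: right_diff_distrib power2_eq_square)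
  qed
  moreover have "\<bar>LINT x|?M. d x \<bullet> (d x - P x)\<bar> \<le> N * nrm ?M (\<lambda>x. d x - P x)"
   unfolding N_def by (rule nrm_Cauchy_Schwarz[OF ds dP])
  moreover have "N * nrm ?M (\<lambda>x. d x - P x) \<le> N * \<epsilon>" using calculation(1) by (intro mult_left_mono) (auto simp: N_def)
  ultimately show ?thesis by linarith
 qed
 \<comment> \<open>For \<open>\<epsilon> = N / 2\<close> the estimate reads
   \<open>N^2 \<le> N^2 / 2\<close>, which leaves only zero.\<close>
 from this[of "N/2"] have "N = 0" using nrm_nonneg[of ?M d] unfolding N_def by (cases "nrm ?M d = 0") (auto simp: power2_eq_square)
 then have "AE t in ?M. d t = 0" unfolding N_def by (rule nrm_zero_AE[OF ds])
 moreover have "AE t in ?M. t \<noteq> 0 \<and> t \<noteq> 1"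
 proof -
  have "AE t in lebesgue. t \<noteq> 0 \<and> t \<noteq> (1::real)" by (rule AE_completion) (intro AE_conjI AE_lborel_singleton)
  then show ?thesis by (auto simp: AE_restrict_space_iff elim: eventually_mono)
 qed
 ultimately show ?thesis by eventually_elim (auto simp: d_def e_def w_def)
qed

end

context polygon_constants
begin

text \<open>The divergence pairs with a test function as \<open>v\<close> does with its gradient,
  which is the dual bound that \<open>inverse_bound\<close> asks for.\<close>

lemma div_upper_bound:
 assumes d: "d \<in> polys (int k - 1)" and v: "sqi (leb F) v" and wd: "has_weak_div F v d"
 shows "norm (x - c) \<le> 2 * h ==> \<bar>d x\<bar> \<le> IC / h^2 * nrm (leb F) v"
 and "h * nrm (leb F) (weak_div F v) \<le> 2 * IC * nrm (leb F) v"
proof -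
 let ?M = "leb F"
 define B where "B = IC / h^2 * nrm ?M v"
 have B0: "0 \<le> B" using IC_pos by (simp add: B_def)
 have dk: "d \<in> polys (int (Suc k))" using d by (rule polys_mono) simp
 have b: "\<bar>d x\<bar> \<le> B" if "norm (x - c) \<le> 2 * h" for x unfolding B_def
 proof (rule inverse_bound[OF dk nrm_nonneg _ that])
  fix \<phi> assume s: "C1_compact_support F \<phi>"
  then have cs: "sqi ?M (grad \<phi>)" by (intro sqi_C1 C1_grad_continuous) (simp add: C1_compact_support_def)
  have "(LINT x|?M. d x * \<phi> x) = - (LINT x|?M. v x \<bullet> grad \<phi> x)" using wd s by (simp add: has_weak_div_def)
  then show "\<bar>LINT x|?M. d x * \<phi> x\<bar> \<le> nrm ?M v * nrm ?M (grad \<phi>)" using nrm_Cauchy_Schwarz[OF v cs] by simp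
 qed
 then show "norm (x - c) \<le> 2 * h ==> \<bar>d x\<bar> \<le> IC / h^2 * nrm ?M v" by (simp add: B_def)
 have dm: "d \<in> borel_measurable ?M" by (intro cont_measurable C1_continuous polys_C1[OF d])
 have "nrm ?M (weak_div F v) = nrm ?M d" by (rule nrm_cong_AE[OF sqi_meas[OF weak_div_AE(2)[OF wd]] dm weak_div_AE(3)[OF wd]])
 also have "\<dots> \<le> 2 * h * B"
 proof (rule nrm_le_sup_h(2)[OF dm B0])
  show "norm (d x) \<le> B" if "x \<in> F" for x using b[of x] near_c(2)[OF that] h_pos by simp
 qed
 finally have "h * nrm ?M (weak_div F v) \<le> h * (2 * h * B)" using h_pos by simp
 also have "\<dots> = 2 * IC * nrm ?M v" using h_pos by (simp add: B_def power2_eq_square)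
 finally show "h * nrm ?M (weak_div F v) \<le> 2 * IC * nrm ?M v" .
qed

text \<open>\<open>256 / 9\<close> inverts the lower bound of \<open>(1 - t)^2 * t^2\<close> on the
  middle half, \<open>10 * C / \<rho>^2\<close> comes from the gradient of the test function,
  \<open>2 * C * (2 * IC)\<close> from the divergence; the division by \<open>\<rho>\<close>
  reflects the edge length, and the last \<open>C\<close> passes from the middle half to the sup
  norm.\<close>

definition KT :: real where "KT = (256/9) * (10 * C / \<rho>^2 + 2 * C * (2 * IC)) / \<rho> * C"

definition UB :: real where "UB = (2 * pi / \<rho>^2) * KT^2 + (2 * IC)^2"

text \<open>On each edge Green's formula is tested with the polynomial trace itself, continued into
  the cone and cut off. One side is quadratic in the trace and the other linear, so one factor
  cancels. Summation over the edges costs the factor of \<open>n_le\<close>.\<close>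

lemma upper_bound:
 assumes v: "v \<in> face_space k vs"
 shows "boundary_div_terms vs v \<le> UB * (nrm (leb F) v)^2"
proof -
 have C_pos: "C > 0" using C_ge1 by simp
 let ?Cd = "2 * IC"
 have K0: "KT > 0" using C_pos IC_pos rho unfolding KT_def by (intro mult_pos_pos divide_pos_pos add_pos_pos) auto
 let ?M = "leb F" and ?I = "leb {0..1::real}"
 define V where "V = nrm ?M v"
 have V0: "0 \<le> V" by (simp add: V_def)
 note vs' = face_spaceD(1)[OF v] and nt = face_spaceD(2)[OF v]
 obtain d where d: "d \<in> polys (int k - 1)" "has_weak_div F v d" using v by (auto simp: face_space_def)
 \<comment> \<open>Membership in the face space provides a polynomial trace;
   \<open>normal_trace\<close> is only known to equal it almost everywhere.\<close>
 obtain g where g: "has_normal_trace vs v g" "\<And>i. i < n ==> g i \<in> polys (int k)" using v by (auto simp: face_space_def)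
 have hd: "h * nrm ?M (weak_div F v) \<le> ?Cd * V" unfolding V_def by (rule div_upper_bound(2)[OF d(1) vs' d(2)])
 have ds: "sqi ?M (weak_div F v)" by (rule weak_div_AE(2)[OF d(2)])
 have edge: "h * (L2_norm_edge vs i (normal_trace vs v i))^2 \<le> KT^2 * V^2" if i: "i < n" for i
 proof -
  obtain a where a: "\<And>t. g i (vx i + t *\<^sub>R (vx (Suc i) - vx i)) = (\<Sum>j\<le>Suc k. a j * t ^ j)"
   using polys_edge[OF polys_mono[OF g(2)[OF i], of "int (Suc k)"], of "vx i" "vx (Suc i) - vx i"] by auto
  have ga: "g i (edp i t) = poly1 (Suc k) a t" for t
  proof -
   have "edp i t = vx i + t *\<^sub>R (vx (Suc i) - vx i)" by (simp add: linepath_def algebra_simps)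
   then show ?thesis using a by (simp add: poly1_def)
  qed
  define N1 where "N1 = nrm (leb {1/4<..<3/4::real}) (poly1 (Suc k) a)"
  have N10: "0 \<le> N1" by (simp add: N1_def)
  have b1: "\<bar>poly1 (Suc k) a t\<bar> \<le> C * N1" "\<bar>dpoly1 (Suc k) a t\<bar> \<le> C * N1" if "\<bar>t\<bar> \<le> 1" for t
  proof -
   have "1 \<le> 3 / \<rho>" using rho rho_le by (simp add: field_simps)
   then have "\<bar>t\<bar> \<le> 3 / \<rho>" using that by linarith
   from C[OF this, of a] show "\<bar>poly1 (Suc k) a t\<bar> \<le> C * N1" "\<bar>dpoly1 (Suc k) a t\<bar> \<le> C * N1"
    unfolding N1_def poly1_def[abs_def] dpoly1_def by auto
  qed
  let ?\<phi> = "tf (poly1 (Suc k) a) i"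
  note phC = tf_C1(1)[OF poly1_deriv poly1_cont(2), of "Suc k" a i] and phg = tf_C1(2)[OF poly1_deriv poly1_cont(2), of "Suc k" a i]
  \<comment> \<open>Bounds the gradients of \<open>al\<close> and \<open>be\<close>: base and height
    of the triangle are at least \<open>\<rho> * h\<close>.\<close>
  define H where "H = 1 / (\<rho>^2 * h)"
  have H0: "0 \<le> H" using h_pos by (simp add: H_def)
  have gH: "norm (grad (al i) x) \<le> H" "norm (grad (be i) x) \<le> H" for x
  proof -
   have "(\<rho> * h) * (\<rho> * h) \<le> r * len i" using r_ge edge_ge[of i] rho h_pos r_pos by (intro mult_mono) auto
   then have "(\<rho> * h) * (\<rho> * h) \<le> \<bar>D i\<bar>" using D_ge[of i] by linarith
   then have "h / \<bar>D i\<bar> \<le> h / ((\<rho> * h) * (\<rho> * h))" using h_pos rho by (intro divide_left_mono) (auto simp: D_nz)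
   also have "\<dots> = H" using h_pos by (simp add: H_def power2_eq_square)
   finally have "h / \<bar>D i\<bar> \<le> H" .
   then show "norm (grad (al i) x) \<le> H" "norm (grad (be i) x) \<le> H" using grad_albe[of i x] by auto
  qed
  have phb: "\<bar>?\<phi> x\<bar> \<le> C * N1" "norm (grad ?\<phi> x) \<le> 5 * (C * N1) * H" if x: "x \<in> F" for x
  proof -
   define A where "A = max 0 (al i x)"
   define B where "B = max 0 (be i x)"
   have AB0: "0 \<le> A" "0 \<le> B" by (simp_all add: A_def B_def)
   have CN: "0 \<le> C * N1" using C_pos N10 by simp
   have "\<bar>?\<phi> x\<bar> \<le> C * N1 \<and> norm (grad ?\<phi> x) \<le> 5 * (C * N1) * H"
   proof (cases "al i x > 0 \<and> be i x > 0")
    case False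
    then have "A = 0 \<or> B = 0" by (auto simp: A_def B_def)
    then have "?\<phi> x = 0" "grad ?\<phi> x = 0" unfolding tf_def phg A_def[symmetric] B_def[symmetric] by auto
    then show ?thesis using CN H0 by simp
   next
    case True
    then have ab: "al i x \<le> 1" "be i x \<le> 1" using cone_in_F[OF i x] by auto
    have AB1: "A \<le> 1" "B \<le> 1" "A^2 \<le> 1" "B^2 \<le> 1" using ab AB0 by (auto simp: A_def B_def power_le_one)
    have beb: "\<bar>be i x\<bar> \<le> 1" using True ab by simp
    have p0: "A^2 * B^2 \<le> 1" using AB1 by (simp add: mult_le_one)
    have "\<bar>?\<phi> x\<bar> = \<bar>poly1 (Suc k) a (be i x)\<bar> * (A^2 * B^2)" by (simp add: tf_def A_def B_def abs_mult)
    also have "\<dots> \<le> (C * N1) * 1" using b1(1)[OF beb] p0 CN by (intro mult_mono) auto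
    finally have 1: "\<bar>?\<phi> x\<bar> \<le> C * N1" by simp
    have t: "norm (a^2 *\<^sub>R ((2 * b) *\<^sub>R y)) \<le> 2 * H" if "0 \<le> b" "b \<le> 1" "a^2 \<le> 1" "norm y \<le> H" for a b and y :: plane
    proof -
     have "a^2 * ((2 * b) * norm y) \<le> 1 * ((2 * 1) * H)" using that H0 by (intro mult_mono) auto
     then show ?thesis using that by simp
    qed
    note t1 = t[OF AB0(2) AB1(2,3) gH(2)] and t2 = t[OF AB0(1) AB1(1,4) gH(1)]
    have t12: "norm (A^2 *\<^sub>R ((2 * B) *\<^sub>R grad (be i) x) + B^2 *\<^sub>R ((2 * A) *\<^sub>R grad (al i) x)) \<le> 4 * H"
     using norm_triangle_le[OF add_mono[OF t1 t2]] by simp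
    have u1: "norm (poly1 (Suc k) a (be i x) *\<^sub>R (A^2 *\<^sub>R ((2 * B) *\<^sub>R grad (be i) x) + B^2 *\<^sub>R ((2 * A) *\<^sub>R grad (al i) x))) \<le> (C * N1) * (4 * H)"
     unfolding norm_scaleR using b1(1)[OF beb] t12 CN by (intro mult_mono) auto
    have u2: "norm ((A^2 * B^2) *\<^sub>R (dpoly1 (Suc k) a (be i x) *\<^sub>R grad (be i) x)) \<le> 1 * ((C * N1) * H)"
     unfolding norm_scaleR using b1(2)[OF beb] gH[of x] p0 CN H0 by (intro mult_mono) auto
    have "norm (grad ?\<phi> x) \<le> (C * N1) * (4 * H) + 1 * ((C * N1) * H)" unfolding phg A_def[symmetric] B_def[symmetric]
     by (rule norm_triangle_le[OF add_mono[OF u1 u2]])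
    also have "\<dots> = 5 * (C * N1) * H" by (simp add: algebra_simps)
    finally have "norm (grad ?\<phi> x) \<le> 5 * (C * N1) * H" .
    then show ?thesis using 1 by blast
   qed
   then show "\<bar>?\<phi> x\<bar> \<le> C * N1" "norm (grad ?\<phi> x) \<le> 5 * (C * N1) * H" by auto
  qed
  have CN: "0 \<le> C * N1" using C_pos N10 by simp
  have n1: "nrm ?M ?\<phi> \<le> 2 * h * (C * N1)"
   by (rule nrm_le_sup_h(2)) (use phb CN in \<open>auto intro!: cont_measurable C1_continuous phC\<close>)
  have n2: "nrm ?M (grad ?\<phi>) \<le> 2 * h * (5 * (C * N1) * H)"
   by (rule nrm_le_sup_h(2)) (use phb CN H0 in \<open>auto intro!: cont_measurable C1_grad_continuous phC\<close>)
  have "len i * (LINT t|?I. poly1 (Suc k) a t * (poly1 (Suc k) a t * ((1 - t)^2 * t^2))) =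
   (LINT x|?M. v x \<bullet> grad ?\<phi> x) + (LINT x|?M. weak_div F v x * ?\<phi> x)"
   using has_normal_traceD[OF g(1) phC] unfolding tf_edge_integral[OF i] ga by simp
  also have "\<dots> \<le> V * (2 * h * (5 * (C * N1) * H)) + nrm ?M (weak_div F v) * (2 * h * (C * N1))"
  proof (rule add_mono)
   have "\<bar>LINT x|?M. v x \<bullet> grad ?\<phi> x\<bar> \<le> V * nrm ?M (grad ?\<phi>)"
    unfolding V_def by (rule nrm_Cauchy_Schwarz[OF vs' sqi_C1[OF C1_grad_continuous[OF phC]]])
   also have "\<dots> \<le> V * (2 * h * (5 * (C * N1) * H))" by (intro mult_left_mono n2 V0)
   finally show "(LINT x|?M. v x \<bullet> grad ?\<phi> x) \<le> V * (2 * h * (5 * (C * N1) * H))" by simp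
   have "\<bar>LINT x|?M. weak_div F v x * ?\<phi> x\<bar> \<le> nrm ?M (weak_div F v) * nrm ?M ?\<phi>"
    using nrm_Cauchy_Schwarz[OF ds sqi_C1[OF C1_continuous[OF phC]]] by simp
   also have "\<dots> \<le> nrm ?M (weak_div F v) * (2 * h * (C * N1))" by (intro mult_left_mono n1) simp
   finally show "(LINT x|?M. weak_div F v x * ?\<phi> x) \<le> nrm ?M (weak_div F v) * (2 * h * (C * N1))" by simp
  qed
  also have "\<dots> \<le> V * (2 * h * (5 * (C * N1) * H)) + (?Cd * V) * (2 * (C * N1))"
   using mult_right_mono[OF hd, of "2 * (C * N1)"] CN by (simp add: ac_simps)
  also have "V * (2 * h * (5 * (C * N1) * H)) + (?Cd * V) * (2 * (C * N1)) = N1 * (V * (10 * C / \<rho>^2 + 2 * C * ?Cd))"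
   using h_pos by (simp add: H_def algebra_simps)
  finally have up: "len i * (LINT t|?I. poly1 (Suc k) a t * (poly1 (Suc k) a t * ((1 - t)^2 * t^2))) \<le> N1 * (V * (10 * C / \<rho>^2 + 2 * C * ?Cd))" .
  have lowI: "(9/256) * N1^2 \<le> (LINT t|?I. poly1 (Suc k) a t * (poly1 (Suc k) a t * ((1 - t)^2 * t^2)))"
  proof -
   let ?J = "{1/4<..<3/4::real}"
   have "(9/256) * N1^2 = (LINT t|leb ?J. (9/256) * (poly1 (Suc k) a t)^2)" by (simp add: N1_def nrm_sq)
   also have "\<dots> \<le> (LINT t|?I. poly1 (Suc k) a t * (poly1 (Suc k) a t * ((1 - t)^2 * t^2)))"
   proof (rule LINT_mono_subset)
    fix t :: real assume t: "t \<in> ?J"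
    have "0 \<le> (t - 1/4) * (3/4 - t)" using t by auto
    moreover have "(1 - t) * t = 3/16 + (t - 1/4) * (3/4 - t)" by (simp add: field_simps)
    ultimately have "3/16 \<le> (1 - t) * t" by linarith
    then have "(3/16)^2 \<le> ((1 - t) * t)^2" by (intro power_mono) auto
    then have "9/256 \<le> (1 - t)^2 * t^2" unfolding power_mult_distrib by (simp add: power_divide)
    then have "(9/256) * (poly1 (Suc k) a t)^2 \<le> ((1 - t)^2 * t^2) * (poly1 (Suc k) a t)^2" by (intro mult_right_mono) auto
    then show "(9/256) * (poly1 (Suc k) a t)^2 \<le> poly1 (Suc k) a t * (poly1 (Suc k) a t * ((1 - t)^2 * t^2))" by (simp add: power2_eq_square ac_simps)
   next
    show "0 \<le> poly1 (Suc k) a t * (poly1 (Suc k) a t * ((1 - t)^2 * t^2))" for t by (simp add: mult.assoc[symmetric])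
   qed (auto intro!: continuous_intros poly1_cont)
   finally show ?thesis .
  qed
  have "(\<rho> * h) * ((9/256) * N1^2) \<le> len i * (LINT t|?I. poly1 (Suc k) a t * (poly1 (Suc k) a t * ((1 - t)^2 * t^2)))"
   using edge_ge[of i] edge_length_pos[of i] by (intro mult_mono lowI) auto
  also note up
  also have "(\<rho> * h) * ((9/256) * N1^2) = N1 * (N1 * ((9/256) * (\<rho> * h)))" by (simp add: power2_eq_square)
  finally have N1s: "N1 * (N1 * ((9/256) * (\<rho> * h))) \<le> N1 * (V * (10 * C / \<rho>^2 + 2 * C * ?Cd))" .
  have N1b: "N1 * ((9/256) * (\<rho> * h)) \<le> V * (10 * C / \<rho>^2 + 2 * C * ?Cd)"
  proof (cases "N1 = 0")
   case True
   have "0 \<le> 10 * C / \<rho>^2 + 2 * C * ?Cd" using C_pos IC_pos by simp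
   then show ?thesis using True V0 by simp
  next
   case False
   then have "N1 > 0" using N10 by simp
   with N1s show ?thesis by (rule mult_left_le_imp_le)
  qed
  have CNK: "C * N1 \<le> KT * V / h"
  proof -
   have "N1 = (N1 * ((9/256) * (\<rho> * h))) * ((256/9) / (\<rho> * h))" using rho h_pos by simp
   also have "\<dots> \<le> (V * (10 * C / \<rho>^2 + 2 * C * ?Cd)) * ((256/9) / (\<rho> * h))" using N1b rho h_pos by (intro mult_right_mono) auto
   finally have "C * N1 \<le> C * ((V * (10 * C / \<rho>^2 + 2 * C * ?Cd)) * ((256/9) / (\<rho> * h)))" using C_pos by (intro mult_left_mono) auto
   also have "\<dots> = KT * V / h"
   proof -
    have "C * ((V * Z) * ((256/9) / (\<rho> * h))) = ((256/9) * Z / \<rho> * C) * V / h" for Z by (simp add: ac_simps)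
    then show ?thesis unfolding KT_def .
   qed
   finally show ?thesis .
  qed
  have im: "(\<lambda>t. normal_trace vs v i (edp i t)) \<in> borel_measurable ?I"
   using nt i by (auto simp: has_normal_trace_def square_integrable_edge_sqi sqi_def)
  have pm: "poly1 (Suc k) a \<in> borel_measurable ?I" by (intro cont_measurable poly1_cont)
  have "nrm ?I (\<lambda>t. normal_trace vs v i (edp i t)) = nrm ?I (poly1 (Suc k) a)"
   using normal_trace_unique[OF nt g(1) i] by (intro nrm_cong_AE im pm) (simp add: ga)
  also have "(nrm ?I (poly1 (Suc k) a))^2 \<le> (KT * V / h)^2 * measure ?I (space ?I)"
  proof (rule nrm_le_sup(2)[OF pm])
   show "finite_measure ?I" by (rule finite_measure_lebesgue_on) auto
   fix t assume "t \<in> space ?I"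
   then show "norm (poly1 (Suc k) a t) \<le> KT * V / h" using b1(1)[of t] CNK by (simp add: space_restrict_space)
  qed (use K0 V0 h_pos in simp)
  also have "measure ?I (space ?I) = 1" by (simp add: space_restrict_space measure_restrict_space)
  finally have nn: "(nrm ?I (\<lambda>t. normal_trace vs v i (edp i t)))^2 \<le> (KT * V / h)^2" by simp
  have "h * (L2_norm_edge vs i (normal_trace vs v i))^2 \<le> h * (h * (KT * V / h)^2)"
   unfolding L2_norm_edge_sq using edge_length_le[of i] edge_length_pos[of i] nn h_pos by (intro mult_left_mono mult_mono) auto
  also have "\<dots> = KT^2 * V^2" using h_pos by (simp add: power2_eq_square)
  finally show ?thesis .
 qed
 have "h * (\<Sum>i<n. (L2_norm_edge vs i (normal_trace vs v i))^2) \<le> (\<Sum>i<n. KT^2 * V^2)"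
  unfolding sum_distrib_left by (rule sum_mono) (use edge in auto)
 also have "\<dots> = real n * (KT^2 * V^2)" by simp
 also have "\<dots> \<le> (2 * pi / \<rho>^2) * (KT^2 * V^2)" by (intro mult_right_mono n_le) auto
 finally have e1: "h * (\<Sum>i<n. (L2_norm_edge vs i (normal_trace vs v i))^2) \<le> (2 * pi / \<rho>^2) * (KT^2 * V^2)" .
 have "(h * nrm ?M (weak_div F v))^2 \<le> (?Cd * V)^2" using hd h_pos by (intro power_mono) auto
 then have e2: "h^2 * (nrm ?M (weak_div F v))^2 \<le> ?Cd^2 * V^2" by (simp add: power_mult_distrib)
 show ?thesis using e1 e2 by (simp add: boundary_div_terms_eq bdry_div_def h_def[symmetric] V_def[symmetric] UB_def distrib_right power_mult_distrib)
qed

end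

section \<open>Riesz representation and projection on polynomial spaces\<close>

lemma polys_zero_open:
 assumes p: "p \<in> polys k" and e: "e > 0" and z: "\<And>x. norm (x - z) < e ==> p x = 0"
 shows "p = (\<lambda>x. 0)"
proof -
 obtain c where c: "p = (\<lambda>x. \<Sum>a\<in>idx k. c a * mon a (x - z))" using polys_recenter[OF p] by blast
 have "(\<Sum>a\<in>idx k. c a * mon a y) = 0" if "norm y < e" for y using z[of "z + y"] that by (simp add: c)
 then have "c a = 0" if "a \<in> idx k" for a using polys_zero_coeffs[where e=e and k=k and c=c] e that by blast
 then show ?thesis by (simp add: c)
qed

text \<open>The form may be degenerate as long as the functional vanishes on its kernel. This
  matters for the boundary form of the serendipity projection, which does not see polynomials
  constant on the boundary.\<close>

lemma riesz_polys:
 fixes B :: "(plane => real) => (plane => real) => real"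
 assumes add: "\<And>p q s. p \<in> polys k ==> q \<in> polys k ==> s \<in> polys k ==> B (\<lambda>x. p x + q x) s = B p s + B q s"
 and cm: "\<And>a p s. p \<in> polys k ==> s \<in> polys k ==> B (\<lambda>x. a * p x) s = a * B p s"
 and sym: "\<And>p q. p \<in> polys k ==> q \<in> polys k ==> B p q = B q p"
 and psd: "\<And>p. p \<in> polys k ==> 0 \<le> B p p"
 and ladd: "\<And>p q. p \<in> polys k ==> q \<in> polys k ==> l (\<lambda>x. p x + q x) = l p + l q"
 and lcm: "\<And>a p. p \<in> polys k ==> l (\<lambda>x. a * p x) = a * l p"
 and ker: "\<And>p. p \<in> polys k ==> B p p = 0 ==> l p = 0"
 shows "\<exists>u\<in>polys k. \<forall>q\<in>polys k. B u q = l q"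
proof -
 let ?A = "idx k"
 define G where "G a b = (if a \<in> ?A \<and> b \<in> ?A then B (mon a) (mon b) else 0)" for a b
 define P where "P A c x = (\<Sum>a\<in>A. c a * mon a x)" for A and c :: "nat \<times> nat => real" and x
 have PA: "P A c \<in> polys k" if "A \<subseteq> ?A" for A c unfolding P_def[abs_def] by (intro polys_sum polys_cmult polys_mon) (use that in auto)
 have Bsum: "B (P A c) s = (\<Sum>a\<in>A. c a * B (mon a) s)" if "A \<subseteq> ?A" "s \<in> polys k" for A c s
 proof -
  have "finite A" using that(1) finite_subset finite_idx by blast
  then show ?thesis using that(1)
  proof (induction A rule: finite_induct)
   case empty
   then show ?case using cm[OF polys_zero that(2), of 0] by (simp add: P_def[abs_def])
  next
   case (insert a A)
   have "P (insert a A) c = (\<lambda>x. c a * mon a x + P A c x)" using insert.hyps by (simp add: P_def fun_eq_iff)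
   then show ?case using insert add[OF polys_cmult[OF polys_mon, of a k "c a"] PA[of A c] that(2)] cm[OF polys_mon that(2), of a "c a"] by simp
  qed
 qed
 have lsum: "l (P A c) = (\<Sum>a\<in>A. c a * l (mon a))" if "A \<subseteq> ?A" for A c
 proof -
  have "finite A" using that(1) finite_subset finite_idx by blast
  then show ?thesis using that(1)
  proof (induction A rule: finite_induct)
   case empty
   then show ?case using lcm[OF polys_zero, of 0] by (simp add: P_def[abs_def])
  next
   case (insert a A)
   have "P (insert a A) c = (\<lambda>x. c a * mon a x + P A c x)" using insert.hyps by (simp add: P_def fun_eq_iff)
   then show ?case using insert ladd[OF polys_cmult[OF polys_mon, of a k "c a"] PA[of A c]] lcm[OF polys_mon, of a "c a"] by simp
  qed
 qed
 have BP: "B (mon a) (P ?A c) = (\<Sum>b\<in>?A. G a b * c b)" if "a \<in> ?A" for a c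
 proof -
  have "B (mon a) (P ?A c) = B (P ?A c) (mon a)" by (rule sym[OF polys_mon[OF that] PA]) simp
  also have "\<dots> = (\<Sum>b\<in>?A. c b * B (mon b) (mon a))" by (rule Bsum[OF _ polys_mon[OF that]]) simp
  also have "\<dots> = (\<Sum>b\<in>?A. G a b * c b)" using that by (intro sum.cong refl) (simp add: G_def sym[OF polys_mon polys_mon])
  finally show ?thesis .
 qed
 have q: "qf ?A G c = B (P ?A c) (P ?A c)" for c unfolding qf_form Bsum[OF order_refl PA[OF order_refl]] by (intro sum.cong refl) (simp add: BP)
 have "\<exists>u. \<forall>a\<in>?A. (\<Sum>b\<in>?A. G a b * u b) = l (mon a)"
 proof (rule gram_solve[OF finite_idx])
  show "G a b = G b a" for a b by (auto simp: G_def intro: sym polys_mon)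
  show "0 \<le> qf ?A G c" for c unfolding q by (rule psd[OF PA]) simp
  fix c assume "qf ?A G c = 0"
  then have "l (P ?A c) = 0" unfolding q by (intro ker PA) simp
  then show "(\<Sum>a\<in>?A. c a * l (mon a)) = 0" using lsum[of ?A c] by simp
 qed
 then obtain u where u: "\<And>a. a \<in> ?A ==> (\<Sum>b\<in>?A. G a b * u b) = l (mon a)" by blast
 have "B (P ?A u) s = l s" if s: "s \<in> polys k" for s
 proof -
  obtain c where "s = (\<lambda>x. \<Sum>a\<in>?A. c a * mon a x)" using s by (rule polysE)
  then have c: "s = P ?A c" by (simp add: P_def fun_eq_iff)
  have "B (P ?A u) s = B s (P ?A u)" by (rule sym[OF PA s]) simp
  also have "\<dots> = (\<Sum>a\<in>?A. c a * B (mon a) (P ?A u))" unfolding c by (rule Bsum[OF order_refl PA]) simp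
  also have "\<dots> = (\<Sum>a\<in>?A. c a * l (mon a))" by (intro sum.cong refl) (simp add: BP u)
  also have "\<dots> = l s" unfolding c by (rule lsum[symmetric]) simp
  finally show ?thesis .
 qed
 then show ?thesis using PA[OF order_refl] by blast
qed

lemma vec_polysD: "q \<in> vec_polys k ==> (\<lambda>x. q x $ i) \<in> polys k" by (simp add: vec_polys_def)

lemma vec_polys_mk: "p \<in> polys k ==> s \<in> polys k ==> (\<lambda>x. mk (p x) (s x)) \<in> vec_polys k"
 using forall_2[of "\<lambda>i. (\<lambda>x. mk (p x) (s x) $ i) \<in> polys k"] by (simp add: vec_polys_def)

lemma vec_polys_continuous: assumes "q \<in> vec_polys k" shows "continuous_on S q"
proof -
 have "continuous_on S (\<lambda>x. mk (q x $ 1) (q x $ 2))" by (intro continuous_intros C1_continuous polys_C1[OF vec_polysD[OF assms]])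
 then show ?thesis by simp
qed

lemma vec_polys_diff: "p \<in> vec_polys k ==> q \<in> vec_polys k ==> (\<lambda>x. p x - q x) \<in> vec_polys k"
 by (simp add: vec_polys_def polys_diff)

lemma vec_polys_add: "p \<in> vec_polys k ==> q \<in> vec_polys k ==> (\<lambda>x. p x + q x) \<in> vec_polys k"
 by (simp add: vec_polys_def polys_add)

lemma perp_field_vec_polys: assumes "q \<in> polys k" shows "(\<lambda>x. q x *\<^sub>R perp (x - b)) \<in> vec_polys (k + 1)"
proof -
 have "(\<lambda>x. q x * (- (x - b) $ 2)) \<in> polys (k + 1)" using polys_mult[OF assms polys_affine1[of "b $ 2" "-1" 2]] by simp
 moreover have "(\<lambda>x. q x * (x - b) $ 1) \<in> polys (k + 1)" using polys_mult[OF assms polys_affine1[of "- b $ 1" 1 1]] by simp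
 ultimately have "(\<lambda>x. mk (q x * (- (x - b) $ 2)) (q x * (x - b) $ 1)) \<in> vec_polys (k + 1)" by (rule vec_polys_mk)
 moreover have "(\<lambda>x. mk (q x * (- (x - b) $ 2)) (q x * (x - b) $ 1)) = (\<lambda>x. q x *\<^sub>R perp (x - b))"
  by (simp add: fun_eq_iff plane_eq_iff)
 ultimately show ?thesis by simp
qed

context star_polygon
begin

lemma poly_zero_F:
 assumes p: "p \<in> polys k" and z: "\<And>x. x \<in> F ==> p x = 0" shows "p = (\<lambda>x. 0)"
proof (rule polys_zero_open[OF p r_pos, of c])
 fix x assume "norm (x - c) < r"
 then have "x \<in> ball c r" by (simp add: dist_norm norm_minus_commute)
 then show "p x = 0" using ball_sub z by blast
qed

lemma vec_poly_nrm_zero: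
 assumes q: "q \<in> vec_polys k" and z: "nrm (leb F) q = 0" shows "q = (\<lambda>x. 0)"
proof -
 have s: "sqi (leb F) q" by (intro sqi_C1 vec_polys_continuous[OF q])
 have "(\<lambda>x. q x $ i) = (\<lambda>x. 0)" for i
 proof (rule poly_zero_F[OF vec_polysD[OF q]])
  fix x assume x: "x \<in> F"
  have "AE x in leb F. q x $ i = 0" using nrm_zero_AE[OF s z] by (auto elim: eventually_mono)
  then show "q x $ i = 0" by (rule continuous_AE_zero[OF C1_continuous[OF polys_C1[OF vec_polysD[OF q]]] open_domain _ x])
 qed
 then show ?thesis by (simp add: fun_eq_iff vec_eq_iff)
qed

lemma polys_sqi: "p \<in> polys k ==> sqi (leb F) p" by (intro sqi_C1 C1_continuous polys_C1)

lemma scalar_projection: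
 assumes f: "sqi (leb F) f"
 shows "\<exists>u\<in>polys k. \<forall>q\<in>polys k. (LINT x|leb F. u x * q x) = (LINT x|leb F. f x * q x)"
proof (rule riesz_polys)
 note i = sqi_inner[OF polys_sqi polys_sqi, simplified]
 note j = sqi_inner[OF f polys_sqi, simplified]
 fix p q s :: "plane => real" and a :: real
 assume p: "p \<in> polys k"
 show "(LINT x|leb F. (a * p x) * q x) = a * (LINT x|leb F. p x * q x)" by (simp add: mult.assoc)
 show "(LINT x|leb F. f x * (a * p x)) = a * (LINT x|leb F. f x * p x)" by (simp add: mult.left_commute)
 show "(LINT x|leb F. p x * q x) = (LINT x|leb F. q x * p x)" by (simp add: mult.commute)
 show "0 \<le> (LINT x|leb F. p x * p x)" by simp
 show "(LINT x|leb F. f x * p x) = 0" if "(LINT x|leb F. p x * p x) = 0"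
 proof -
  have "nrm (leb F) p = 0" using that by (simp add: nrm_def power2_eq_square)
  then show ?thesis using nrm_Cauchy_Schwarz[OF f polys_sqi[OF p]] by simp
 qed
 assume q: "q \<in> polys k"
 show "(LINT x|leb F. f x * (p x + q x)) = (LINT x|leb F. f x * p x) + (LINT x|leb F. f x * q x)" using j[OF p] j[OF q] by (simp add: distrib_left)
 assume s: "s \<in> polys k"
 show "(LINT x|leb F. (p x + q x) * s x) = (LINT x|leb F. p x * s x) + (LINT x|leb F. q x * s x)"
  using i[OF p s] i[OF q s] by (simp add: distrib_right)
qed

lemma L2_projection:
 assumes v: "sqi (leb F) v"
 shows "L2_projection m F v \<in> vec_polys (int m)"
 and "\<And>p. p \<in> vec_polys (int m) ==> (LINT x|leb F. v x \<bullet> p x) = (LINT x|leb F. L2_projection m F v x \<bullet> p x)"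
 and "nrm (leb F) (L2_projection m F v) \<le> nrm (leb F) v"
 and "sqi (leb F) (L2_projection m F v)"
proof -
 let ?M = "leb F"
 let ?P = "\<lambda>q. q \<in> vec_polys (int m) \<and> (\<forall>p\<in>vec_polys (int m). (LINT x|leb F. (v x - q x) \<bullet> p x) = 0)"
 have split: "(LINT x|?M. w x \<bullet> p x) = (LINT x|?M. w x $ 1 * p x $ 1) + (LINT x|?M. w x $ 2 * p x $ 2)"
  if "sqi ?M w" "sqi ?M p" for w p :: "plane => plane"
 proof -
  have i: "integrable ?M (\<lambda>x. w x $ i * p x $ i)" for i using sqi_inner[OF nrm_plane_sq(1)[OF that(1)] nrm_plane_sq(1)[OF that(2)]] by simp
  show ?thesis unfolding plane_inner by (rule LINT_add[OF i i])
 qed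
 have vq: "sqi ?M q" if "q \<in> vec_polys l" for q l by (intro sqi_C1 vec_polys_continuous[OF that])
 have dec: "(LINT x|?M. (v x - q x) \<bullet> p x) = (LINT x|?M. v x \<bullet> p x) - (LINT x|?M. q x \<bullet> p x)"
  if "sqi ?M q" "sqi ?M p" for q p
  using sqi_inner[OF v that(2)] sqi_inner[OF that] by (simp add: inner_diff_left)
 have "\<exists>q. ?P q"
 proof -
  obtain u1 where u1: "u1 \<in> polys (int m)" "\<And>q. q \<in> polys (int m) ==> (LINT x|?M. u1 x * q x) = (LINT x|?M. v x $ 1 * q x)"
   using scalar_projection[OF nrm_plane_sq(1)[OF v]] by blast
  obtain u2 where u2: "u2 \<in> polys (int m)" "\<And>q. q \<in> polys (int m) ==> (LINT x|?M. u2 x * q x) = (LINT x|?M. v x $ 2 * q x)"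
   using scalar_projection[OF nrm_plane_sq(1)[OF v]] by blast
  have um: "(\<lambda>x. mk (u1 x) (u2 x)) \<in> vec_polys (int m)" by (rule vec_polys_mk[OF u1(1) u2(1)])
  have "(LINT x|?M. (v x - mk (u1 x) (u2 x)) \<bullet> p x) = 0" if p: "p \<in> vec_polys (int m)" for p
   unfolding dec[OF vq[OF um] vq[OF p]] split[OF v vq[OF p]] split[OF vq[OF um] vq[OF p]]
   using u1(2)[OF vec_polysD[OF p]] u2(2)[OF vec_polysD[OF p]] by simp
  then show ?thesis using um by blast
 qed
 moreover have "q = q'" if q: "?P q" "?P q'" for q q'
 proof -
  let ?d = "\<lambda>x. q x - q' x"
  have d: "?d \<in> vec_polys (int m)" using q by (intro vec_polys_diff) auto
  have "(LINT x|?M. (v x - q x) \<bullet> ?d x) = 0" "(LINT x|?M. (v x - q' x) \<bullet> ?d x) = 0" using q d by auto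
  then have e: "(LINT x|?M. q x \<bullet> ?d x) = (LINT x|?M. q' x \<bullet> ?d x)"
   using dec[OF vq[of q "int m"] vq[OF d]] dec[OF vq[of q' "int m"] vq[OF d]] q by (simp only:)
  have "(nrm ?M ?d)^2 = (LINT x|?M. q x \<bullet> ?d x - q' x \<bullet> ?d x)" unfolding nrm_sq power2_norm_eq_inner by (simp add: inner_diff_left)
  also have "\<dots> = 0" using sqi_inner[OF vq[of q "int m"] vq[OF d]] sqi_inner[OF vq[of q' "int m"] vq[OF d]] q e by simp
  finally have "nrm ?M ?d = 0" by simp
  from vec_poly_nrm_zero[OF d this] show ?thesis by (simp add: fun_eq_iff)
 qed
 ultimately have "\<exists>!q. ?P q" by blast
 then have P: "?P (L2_projection m F v)" unfolding L2_projection_def by (rule theI')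
 let ?q = "L2_projection m F v"
 show q: "?q \<in> vec_polys (int m)" using P by blast
 then show s: "sqi ?M ?q" by (rule vq)
 show eq: "(LINT x|?M. v x \<bullet> p x) = (LINT x|?M. ?q x \<bullet> p x)" if "p \<in> vec_polys (int m)" for p
  using P that dec[OF s vq[OF that]] by simp
 have "(nrm ?M ?q)^2 = (LINT x|?M. v x \<bullet> ?q x)" unfolding nrm_sq power2_norm_eq_inner eq[OF q] ..
 also have "\<dots> \<le> nrm ?M v * nrm ?M ?q" using nrm_Cauchy_Schwarz[OF v s] by simp
 finally have le: "nrm ?M ?q * nrm ?M ?q \<le> nrm ?M v * nrm ?M ?q" by (simp add: power2_eq_square)
 show "nrm ?M ?q \<le> nrm ?M v"
 proof (cases "nrm ?M ?q = 0")
  case False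
  then have "nrm ?M ?q > 0" using nrm_nonneg[of ?M ?q] by linarith
  with le show ?thesis by (rule mult_right_le_imp_le)
 qed simp
qed

lemma measure_F: "measure lebesgue F = measure (leb F) (space (leb F))"
 by (simp add: space_restrict_space measure_restrict_space)

lemma measure_F_pos: "measure lebesgue F > 0"
proof -
 have "F \<in> lmeasurable" using bounded_domain open_domain by (rule lmeasurable_open)
 moreover have "\<not> negligible F" using open_not_negligible[OF open_domain] c_in by blast
 ultimately have "measure lebesgue F \<noteq> 0" using negligible_iff_measure by blast
 then show ?thesis by (simp add: zero_less_measure_iff)
qed

lemma barycenter_near: "norm (barycenter F - c) \<le> h"
proof -
 let ?M = "leb F" and ?m = "measure lebesgue F"
 have i: "integrable ?M (\<lambda>x. x)" "integrable ?M (\<lambda>x. c)" "integrable ?M (\<lambda>x. x - c)"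
  by (intro integrable_C1 continuous_intros)+
 have cc: "(LINT x|?M. c) = ?m *\<^sub>R c" by (simp add: measure_F)
 have "(LINT x|?M. x - c) = (LINT x|?M. x) - ?m *\<^sub>R c" unfolding LINT_diff[OF i(1,2)] cc ..
 then have "barycenter F - c = (1 / ?m) *\<^sub>R (LINT x|?M. x - c)" using measure_F_pos by (simp add: barycenter_def scaleR_diff_right)
 moreover have "norm (LINT x|?M. x - c) \<le> (LINT x|?M. h)"
 proof -
  have "norm (LINT x|?M. x - c) \<le> (LINT x|?M. norm (x - c))" by (rule Bochner_Integration.integral_norm_bound)
  also have "\<dots> \<le> (LINT x|?M. h)"
  proof (rule integral_mono)
   show "integrable ?M (\<lambda>x. norm (x - c))" using i(3) by simp
   show "integrable ?M (\<lambda>x. h)" by (intro integrable_C1 continuous_intros)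
   fix x assume "x \<in> space ?M"
   then show "norm (x - c) \<le> h" using near_c(2) by (simp add: space_restrict_space)
  qed
  finally show ?thesis .
 qed
 ultimately show ?thesis using measure_F_pos by (simp add: measure_F field_simps)
qed

end

text \<open>If the domain has a point, it is open and has positive diameter, and this makes the
  radius positive. Otherwise all terms of the estimates vanish.\<close>

lemma mesh_regular_cases:
 assumes "mesh_regular \<rho> vs" "\<rho> > 0"
 obtains "domain vs = {}" | c r where "regular_polygon vs c r \<rho>"
proof (cases "domain vs = {}")
 case False
 obtain c r where cr: "polygon vs" "r \<ge> \<rho> * diameter (domain vs)" "star_shaped_wrt (domain vs) (ball c r)"
  "\<And>i. i < length vs ==> edge_length vs i \<ge> \<rho> * diameter (domain vs)"
  using assms(1) by (auto simp: mesh_regular_def)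
 obtain x e where xe: "e > 0" "ball x e \<subseteq> domain vs" using False open_domain[of vs] openE by blast
 have "2 * e \<le> diameter (domain vs)" using diameter_subset[OF xe(2) bounded_domain] xe(1) by simp
 then have "\<rho> * diameter (domain vs) > 0" using xe(1) assms(2) by simp
 then have "r > 0" using cr(2) by linarith
 then have "regular_polygon vs c r \<rho>" using cr assms(2) by unfold_locales auto
 then show ?thesis using that by blast
qed (use that in blast)

lemma empty_domain_trivial:
 fixes w :: "plane => plane"
 assumes "domain vs = {}"
 shows "L2_norm_on (domain vs) w = 0" "boundary_div_terms vs v = 0"
proof -
 show "L2_norm_on (domain vs) w = 0" by (simp add: L2_norm_on_def assms integral_restrict_space)
 show "boundary_div_terms vs v = 0" by (simp add: boundary_div_terms_def assms)
qed

context polygon_constants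
begin

text \<open>The degree \<open>k + 1\<close> makes the fields
  \<open>q x *\<^sub>R perp (x - b)\<close>, with \<open>q\<close> of degree \<open>k\<close>,
  admissible tests for the projection.\<close>

lemma projection_bounds:
 assumes v: "v \<in> face_space k vs"
 shows "(nrm (leb F) v)^2 \<le> (2 * LB^2) * (boundary_div_terms vs v + (nrm (leb F) (L2_projection (k + 1) F v))^2)"
 and "boundary_div_terms vs v + (nrm (leb F) (L2_projection (k + 1) F v))^2 \<le> (UB + 1) * (nrm (leb F) v)^2"
proof -
 let ?M = "leb F"
 note L = L2_projection[OF face_spaceD(1)[OF v], where m = "k + 1"]
 show "(nrm ?M v)^2 \<le> (2 * LB^2) * (boundary_div_terms vs v + (nrm ?M (L2_projection (k + 1) F v))^2)"
 proof (rule lower_bound[OF v barycenter_near L(4)])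
  fix q assume "q \<in> polys (int k)"
  then have "(\<lambda>x. q x *\<^sub>R perp (x - barycenter F)) \<in> vec_polys (int (k + 1))"
   using perp_field_vec_polys[of q "int k"] by (simp add: add.commute)
  then show "(LINT x|?M. v x \<bullet> (q x *\<^sub>R perp (x - barycenter F))) = (LINT x|?M. L2_projection (k + 1) F v x \<bullet> (q x *\<^sub>R perp (x - barycenter F)))"
   by (rule L(2))
 qed
 have "(nrm ?M (L2_projection (k + 1) F v))^2 \<le> (nrm ?M v)^2" by (rule power_mono[OF L(3) nrm_nonneg])
 with upper_bound[OF v] show "boundary_div_terms vs v + (nrm ?M (L2_projection (k + 1) F v))^2 \<le> (UB + 1) * (nrm ?M v)^2"
  unfolding distrib_right by linarith
qed

end

section \<open>Uniformly convex polygons\<close>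

text \<open>\<open>\<sigma>\<close> bounds the sine of each vertex angle from below; stated as an
  area, the condition can be used without trigonometry.\<close>

locale convex_polygon = regular_polygon +
 fixes \<sigma> :: real
 assumes convex_F: "convex (domain vs)" and sigma_pos: "\<sigma> > 0"
 and angle: "\<And>i. \<sigma> * (edge_length vs i * edge_length vs (Suc i)) \<le>
 \<bar>wedge (vertex vs i - vertex vs (Suc i)) (vertex vs (Suc (Suc i)) - vertex vs (Suc i))\<bar>"

lemma uniformly_convex_polygon:
 assumes reg: "regular_polygon vs c r \<rho>" and e: "\<epsilon> > 0" and u: "uniformly_convex \<epsilon> vs"
 shows "convex_polygon vs c r \<rho> (sin (min \<epsilon> (pi/2)))"
proof -
 interpret regular_polygon vs c r \<rho> by (rule reg)
 show ?thesis
 proof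
  show "convex F" using u by (simp add: uniformly_convex_def)
  \<comment> \<open>The minimum keeps the constant positive for every \<open>\<epsilon>\<close>;
    angles between the two bounds exist only for \<open>\<epsilon> \<le> pi/2\<close>.\<close>
  show "sin (min \<epsilon> (pi/2)) > 0" using e pi_gt_zero by (intro sin_gt_zero) (auto simp: min_less_iff_disj)
  fix i
  let ?a = "vertex vs i - vertex vs (Suc i)" and ?b = "vertex vs (Suc (Suc i)) - vertex vs (Suc i)"
  define th where "th = arccos ((?a \<bullet> ?b) / (norm ?a * norm ?b))"
  have pos: "norm ?a > 0" "norm ?b > 0" using vertex_Suc_neq[OF poly, of i] vertex_Suc_neq[OF poly, of "Suc i"] by auto
  have "i mod n < n" using vs_ne by simp
  moreover have "corner_angle vs (i mod n) = th"
  proof -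
   have "vertex vs (Suc (i mod n)) = vertex vs (Suc i)" "vertex vs (Suc (Suc (i mod n))) = vertex vs (Suc (Suc i))"
    by (simp_all add: vertex_def mod_Suc_eq mod_Suc_Suc_eq)
   then show ?thesis by (simp add: corner_angle_def th_def Let_def)
  qed
  ultimately have th: "\<epsilon> \<le> th" "th \<le> pi - \<epsilon>" using u by (auto simp: uniformly_convex_def)
  have "\<bar>?a \<bullet> ?b\<bar> \<le> norm ?a * norm ?b" by (rule Cauchy_Schwarz_ineq2)
  then have "\<bar>(?a \<bullet> ?b) / (norm ?a * norm ?b)\<bar> \<le> 1" using pos by (simp add: abs_mult)
  then have "cos th = (?a \<bullet> ?b) / (norm ?a * norm ?b)" unfolding th_def by (intro cos_arccos) linarith+
  then have ab: "?a \<bullet> ?b = norm ?a * norm ?b * cos th" using pos by simp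
  have "(wedge ?a ?b)^2 = (norm ?a)^2 * (norm ?b)^2 * (1 - (cos th)^2)"
   using lagrange_plane[of ?a ?b] unfolding ab by (simp add: algebra_simps power_mult_distrib)
  also have "\<dots> = (norm ?a * norm ?b * sin th)^2" unfolding sin_squared_eq[symmetric] by (simp add: power_mult_distrib)
  finally have w: "\<bar>wedge ?a ?b\<bar> = \<bar>norm ?a * norm ?b * sin th\<bar>" by (metis real_sqrt_abs)
  have "\<epsilon> \<le> pi/2" using th by linarith
  have "sin \<epsilon> \<le> sin th"
  proof (cases "th \<le> pi/2")
   case True then show ?thesis using th e by (intro sin_monotone_2pi_le) auto
  next
   case False
   then have "sin \<epsilon> \<le> sin (pi - th)" using th e \<open>\<epsilon> \<le> pi/2\<close> by (intro sin_monotone_2pi_le) auto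
   then show ?thesis by simp
  qed
  then have "sin (min \<epsilon> (pi/2)) \<le> \<bar>sin th\<bar>" using \<open>\<epsilon> \<le> pi/2\<close> by (simp add: min_absorb1)
  then have "sin (min \<epsilon> (pi/2)) * (norm ?a * norm ?b) \<le> \<bar>sin th\<bar> * (norm ?a * norm ?b)" by (intro mult_right_mono) auto
  then show "sin (min \<epsilon> (pi/2)) * (edge_length vs i * edge_length vs (Suc i)) \<le> \<bar>wedge ?a ?b\<bar>"
   unfolding w by (simp add: edge_length_norm norm_minus_commute abs_mult mult_ac)
 qed
qed

section \<open>Heights over the edges\<close>

context star_polygon
begin

lemma edge_parallel:
 assumes "wedge (vx (Suc i) - vx i) y = 0"
 shows "\<exists>t. y = t *\<^sub>R (vx (Suc i) - vx i)"
proof -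
 let ?e = "vx (Suc i) - vx i"
 have e: "norm ?e > 0" using edge_length_pos[of i] by (simp add: edge_length_norm)
 have w1: "wedge ?e (perp ?e) = (norm ?e)^2" by (simp only: wedge_def plane_norm_sq perp_nth) (simp add: power2_eq_square algebra_simps)
 define m where "m = wedge y (perp ?e)"
 have eq: "(norm ?e)^2 *\<^sub>R y = m *\<^sub>R ?e" using wedge_decomp[of ?e "perp ?e" y] unfolding w1 assms m_def by simp
 have "y = (1 / (norm ?e)^2) *\<^sub>R ((norm ?e)^2 *\<^sub>R y)" using e by simp
 also have "\<dots> = (m / (norm ?e)^2) *\<^sub>R ?e" unfolding eq by simp
 finally show ?thesis by blast
qed

text \<open>The signed distance from the line of edge \<open>i\<close>, positive on the side of
  \<open>c\<close>, in units of the diameter.\<close>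

definition ell :: "nat => plane => real" where "ell i x = (nv i \<bullet> (vx i - x)) / h"

lemma ell_edge: "ell i (edp i t) = 0"
proof -
 have "len i * (nv i \<bullet> (vx i - edp i t)) = 0" unfolding nv_inner by (simp add: linepath_def wedge_def algebra_simps)
 then show ?thesis using edge_length_pos[of i] by (simp add: ell_def)
qed

lemma ell_affine: "ell i x = ell i y + (nv i \<bullet> (y - x)) / h"
 by (simp add: ell_def inner_diff_right diff_divide_distrib)

lemma ell_lipschitz: "h * \<bar>ell i x - ell i y\<bar> \<le> norm (x - y)"
proof -
 have "h * \<bar>ell i x - ell i y\<bar> = \<bar>nv i \<bullet> (y - x)\<bar>" unfolding ell_affine[of i x y] using h_pos by (simp add: abs_mult)
 also have "\<dots> \<le> norm (nv i) * norm (y - x)" by (rule Cauchy_Schwarz_ineq2)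
 finally show ?thesis by (simp add: norm_nv norm_minus_commute)
qed

lemma ell_c: "ell i c \<ge> r / h" "ell i c > 0" "ell i c \<le> 1"
proof -
 have "len i * (nv i \<bullet> (vx i - c)) \<ge> r * len i" using D_nv[of i 0] D_ge[of i] by (simp add: linepath_def)
 then have "nv i \<bullet> (vx i - c) \<ge> r" using edge_length_pos[of i] by (simp add: mult.commute)
 then show 1: "ell i c \<ge> r / h" using h_pos by (simp add: ell_def divide_right_mono)
 then show "ell i c > 0" using divide_pos_pos[OF r_pos h_pos] by linarith
 have "nv i \<bullet> (vx i - c) \<le> norm (nv i) * norm (vx i - c)" by (rule norm_cauchy_schwarz)
 also have "\<dots> \<le> h" using norm_va(1)[of i] by (simp add: norm_nv)
 finally show "ell i c \<le> 1" using h_pos by (simp add: ell_def)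
qed

text \<open>An affine function vanishing on the edge line is a multiple of
  \<open>1 - al - be\<close>; the factor is read off at \<open>c\<close>.\<close>

lemma ell_cone: "ell i x = ell i c * (1 - al i x - be i x)"
proof -
 have "nv i \<bullet> vb i = nv i \<bullet> va i"
  using D_nv[of i 0] D_nv[of i 1] edge_length_pos[of i] by (simp add: linepath_def) (metis less_irrefl mult_left_cancel)
 then have 1: "nv i \<bullet> (x - c) = (al i x + be i x) * (nv i \<bullet> va i)"
  unfolding cone_coordinates[of x i] by (simp only: inner_add_right inner_scaleR_right distrib_right)
 have "vx i - x = va i - (x - c)" by simp
 then have "nv i \<bullet> (vx i - x) = nv i \<bullet> va i - nv i \<bullet> (x - c)" by (simp only: inner_diff_right)
 then have "nv i \<bullet> (vx i - x) = nv i \<bullet> va i * (1 - al i x - be i x)" unfolding 1 by (simp only: algebra_simps)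
 then show ?thesis by (simp add: ell_def)
qed

lemma continuous_ell: "continuous_on S (ell i)"
 unfolding ell_def[abs_def] by (intro continuous_intros) (use h_pos in auto)

end

context convex_polygon
begin

text \<open>Otherwise the segment from \<open>c\<close> to \<open>x\<close> meets the line of the
  edge in a point of \<open>F\<close>. A convex \<open>F\<close> is star-shaped about a small disc
  around that point, which contradicts \<open>line_misses_ball\<close>.\<close>

lemma ell_pos: assumes "x \<in> F" shows "ell i x > 0"
proof (rule ccontr)
 assume neg: "\<not> ell i x > 0"
 define u where "u = ell i c / (ell i c - ell i x)"
 have u: "0 \<le> u" "u \<le> 1" using neg ell_c(2)[of i] by (auto simp: u_def field_simps)
 let ?y = "c + u *\<^sub>R (x - c)"
 have "?y = (1 - u) *\<^sub>R c + u *\<^sub>R x" by (simp add: algebra_simps)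
 then have y: "?y \<in> F" using convexD[OF convex_F c_in assms, of "1 - u" u] u by simp
 have "ell i ?y = ell i c + u * (ell i x - ell i c)"
  unfolding ell_affine[of i ?y c] ell_affine[of i x c] by (simp add: inner_diff_right algebra_simps diff_divide_distrib)
 also have "\<dots> = 0" using neg ell_c(2)[of i] by (simp add: u_def field_simps)
 finally have z: "nv i \<bullet> (vx i - ?y) = 0" using h_pos by (simp add: ell_def)
 let ?e = "vx (Suc i) - vx i"
 have "wedge (vx i - ?y) ?e = 0" using nv_inner[of i "vx i - ?y"] z D_nz[of i] by (simp add: sgn_zero_iff)
 then have w3: "wedge ?e (?y - vx i) = 0" by (simp add: wedge_def algebra_simps)
 obtain t where "?y - vx i = t *\<^sub>R ?e" using edge_parallel[OF w3] by blast
 then have yy: "?y = vx i + t *\<^sub>R ?e" by (simp only: diff_eq_eq add.commute)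
 obtain d where d: "d > 0" "ball ?y d \<subseteq> F" using open_domain y openE by blast
 interpret y: star_polygon vs ?y d
 proof
  show "star_shaped_wrt F (ball ?y d)" unfolding star_shaped_wrt_def using d convex_F by (blast intro: closed_segment_subset[THEN subsetD])
 qed (use poly d in auto)
 have "?y \<in> ball ?y d" using d by simp
 then show False using y.line_misses_ball yy by blast
qed

lemma ell_nonneg: assumes "x \<in> closure F" shows "ell i x \<ge> 0"
proof -
 have "closed {x. 0 \<le> ell i x}" by (intro closed_Collect_le continuous_intros continuous_ell)
 moreover have "F \<subseteq> {x. 0 \<le> ell i x}" using ell_pos by (auto intro: less_imp_le)
 ultimately have "closure F \<subseteq> {x. 0 \<le> ell i x}" by (rule closure_minimal[rotated])
 then show ?thesis using assms by auto
qed

lemma boundary_closure: "x \<in> boundary vs ==> x \<in> closure F" by (simp add: closure_F)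

text \<open>The height of a neighbouring vertex over an edge is the length of the joining edge times
  the sine of the enclosed angle.\<close>

lemma ell_previous: "\<rho> * \<sigma> \<le> ell (Suc i) (vx i)"
 and ell_next: "\<rho> * \<sigma> \<le> ell i (vx (Suc (Suc i)))"
proof -
 let ?a = "vx i - vx (Suc i)" and ?b = "vx (Suc (Suc i)) - vx (Suc i)"
 have key: "\<rho> * \<sigma> \<le> ell j x"
  if x: "x \<in> boundary vs" and w: "\<bar>wedge (vx j - x) (vx (Suc j) - vx j)\<bar> = \<bar>wedge ?a ?b\<bar>"
  and l: "len i * len (Suc i) = len j * len l" for j l x
 proof -
  have "len j * (h * ell j x) = sgn (D j) * wedge (vx j - x) (vx (Suc j) - vx j)" using nv_inner[of j "vx j - x"] h_pos by (simp add: ell_def)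
  moreover have "len j * (h * ell j x) \<ge> 0" using edge_length_pos[of j] h_pos ell_nonneg[OF boundary_closure[OF x], of j] by simp
  ultimately have "len j * (h * ell j x) = \<bar>sgn (D j) * wedge (vx j - x) (vx (Suc j) - vx j)\<bar>" by linarith
  then have e: "len j * (h * ell j x) = \<bar>wedge ?a ?b\<bar>" using D_nz[of j] unfolding abs_mult w by (simp add: abs_sgn_eq)
  have "len j * (\<rho> * h * \<sigma>) \<le> len j * (len l * \<sigma>)"
   using edge_ge[of l] sigma_pos edge_length_pos[of j] by (intro mult_left_mono mult_right_mono) auto
  also have "\<dots> \<le> \<bar>wedge ?a ?b\<bar>" using angle[of i] unfolding l by (simp add: mult_ac)
  finally have "\<rho> * h * \<sigma> \<le> h * ell j x" using edge_length_pos[of j] unfolding e[symmetric] by (simp only: mult_le_cancel_left_pos)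
  then have "h * (\<rho> * \<sigma>) \<le> h * ell j x" by (simp only: mult_ac)
  then show ?thesis using h_pos by (simp only: mult_le_cancel_left_pos)
 qed
 show "\<rho> * \<sigma> \<le> ell (Suc i) (vx i)" by (rule key[OF vertex_in_boundary _ mult.commute]) (simp add: wedge_def algebra_simps)
 show "\<rho> * \<sigma> \<le> ell i (vx (Suc (Suc i)))" by (rule key[OF vertex_in_boundary _ refl]) (simp add: wedge_def algebra_simps)
qed

text \<open>In \<open>ell_boundary_lower\<close>, \<open>1 / \<rho>\<close> accounts for the
  displacement towards \<open>c\<close> and \<open>1 / (\<rho>^2 * \<sigma>)\<close> for the
  overshoot along the edge line.\<close>

definition KE :: real where "KE = 1 / \<rho> + 1 / (\<rho>^2 * \<sigma>)"

lemma KE_pos: "KE > 0" unfolding KE_def using rho(1) sigma_pos by (intro add_pos_pos) auto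

text \<open>A boundary point off the edge lies beyond one of its end points; nonnegativity of the
  height over the neighbouring edge there controls how far beyond.\<close>

lemma ell_boundary_lower:
 assumes ij: "i < n" "j < n" "i \<noteq> j" and t: "0 \<le> t" "t \<le> 1"
 shows "norm (edp j t - vx i) \<le> KE * (h * ell i (edp j t)) \<or>
 norm (edp j t - vx (Suc i)) \<le> KE * (h * ell i (edp j t))"
proof -
 define x where "x = edp j t"
 have x: "x \<in> boundary vs" unfolding x_def by (rule edge_pt_in_boundary[OF ij(2) t])
 \<comment> \<open>The barycentric coordinate belonging to \<open>c\<close>, which is the height
   relative to that of \<open>c\<close>.\<close>
 define m where "m = 1 - al i x - be i x"
 have rh: "\<rho> \<le> r / h" using r_ge h_pos by (simp add: field_simps)
 have e0: "ell l x \<ge> 0" for l by (rule ell_nonneg[OF boundary_closure[OF x]])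
 have em: "ell i x = ell i c * m" unfolding m_def by (rule ell_cone)
 then have m0: "m \<ge> 0" using e0[of i] ell_c(2)[of i] by (simp add: zero_le_mult_iff)
 have ml: "\<rho> * m \<le> ell i x" unfolding em using ell_c(1)[of i] rh m0 by (intro mult_right_mono) auto
 \<comment> \<open>\<open>w\<close> is the end point that \<open>x\<close> lies beyond and
   \<open>w'\<close> the other one; edge \<open>l\<close> is the neighbour at \<open>w\<close>, so
   its height vanishes at \<open>w\<close> and is bounded below at \<open>w'\<close>. Its
   nonnegativity at \<open>x\<close> limits the overshoot \<open>- a\<close>.\<close>
 have lem: "norm (x - w) \<le> KE * (h * ell i x)"
  if eq: "x - w = m *\<^sub>R (c - w) + a *\<^sub>R (w' - w)" and a: "a \<le> 0" and w: "w \<in> boundary vs" "w' \<in> boundary vs"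
  and l: "\<And>y. ell l y = (nv l \<bullet> (w - y)) / h" "\<rho> * \<sigma> \<le> ell l w'" for w w' a l
 proof -
  have "w - x = m *\<^sub>R (w - c) + a *\<^sub>R (w - w')" using eq by (simp add: algebra_simps)
  then have "ell l x = m * ell l c + a * ell l w'"
   unfolding l by (simp only: inner_add_right inner_scaleR_right add_divide_distrib times_divide_eq_right)
  moreover have "m * ell l c \<le> m * 1" by (intro mult_left_mono ell_c m0)
  moreover have "- a * (\<rho> * \<sigma>) \<le> - a * ell l w'" using a by (intro mult_left_mono l(2)) auto
  ultimately have "- a * (\<rho> * \<sigma>) \<le> m" using e0[of l] by linarith
  then have "\<rho> * (- a * (\<rho> * \<sigma>)) \<le> ell i x" using mult_left_mono[of "- a * (\<rho> * \<sigma>)" m \<rho>] ml rho(1) by linarith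
  then have a': "- a \<le> ell i x / (\<rho>^2 * \<sigma>)" using rho(1) sigma_pos by (simp add: field_simps power2_eq_square)
  have m': "m \<le> ell i x / \<rho>" using ml rho(1) by (simp add: field_simps)
  have "norm (x - w) \<le> norm (m *\<^sub>R (c - w)) + norm (a *\<^sub>R (w' - w))" unfolding eq by (rule norm_triangle_ineq)
  also have "\<dots> = m * norm (c - w) + (- a) * norm (w' - w)" using m0 a by simp
  also have "\<dots> \<le> m * h + (- a) * h" using m0 a dist_le_h[OF F_sub_closure[OF c_in] boundary_closure[OF w(1)]]
   dist_le_h[OF boundary_closure[OF w(2)] boundary_closure[OF w(1)]]
   by (intro add_mono mult_left_mono) auto
  also have "\<dots> \<le> (ell i x / \<rho>) * h + (ell i x / (\<rho>^2 * \<sigma>)) * h" using m' a' h_pos by (intro add_mono mult_right_mono) auto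
  finally show ?thesis by (simp add: KE_def algebra_simps)
 qed
 have xc: "x = c + (al i x *\<^sub>R va i + be i x *\<^sub>R vb i)" using cone_coordinates[of x i] by (simp add: diff_eq_eq add.commute)
 have "al i x \<le> 0 \<or> be i x \<le> 0" using cone_boundary[OF ij(1,2) t] ij(3) unfolding x_def by force
 then have "norm (x - vx i) \<le> KE * (h * ell i x) \<or> norm (x - vx (Suc i)) \<le> KE * (h * ell i x)"
 proof
  assume a: "al i x \<le> 0"
  have eq: "x - vx (Suc i) = m *\<^sub>R (c - vx (Suc i)) + al i x *\<^sub>R (vx i - vx (Suc i))" by (subst xc) (simp add: m_def algebra_simps)
  show ?thesis using lem[OF eq a vertex_in_boundary vertex_in_boundary ell_def ell_previous] by blast
 next
  assume b: "be i x \<le> 0"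
  \<comment> \<open>The predecessor of edge \<open>i\<close> is addressed as
    \<open>i + n - 1\<close>, which also works for \<open>i = 0\<close> since vertices are read
    modulo \<open>n\<close>.\<close>
  obtain k where k: "n = Suc k" using n_ge3 by (cases n) auto
  define i' where "i' = i + k"
  have i': "vx (Suc i') = vx i" "vx (Suc (Suc i')) = vx (Suc i)"
  proof -
   have "Suc i' = i + n" "Suc (Suc i') = Suc i + n" by (simp_all add: i'_def k)
   then show "vx (Suc i') = vx i" "vx (Suc (Suc i')) = vx (Suc i)" by (simp_all only: vertex_def mod_add_self2)
  qed
  have e: "ell i' y = (nv i' \<bullet> (vx i - y)) / h" for y using ell_affine[of i' y "vx i"] ell_edge[of i' 1] by (simp add: linepath_def i')
  have eq: "x - vx i = m *\<^sub>R (c - vx i) + be i x *\<^sub>R (vx (Suc i) - vx i)" by (subst xc) (simp add: m_def algebra_simps)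
  show ?thesis using lem[OF eq b vertex_in_boundary vertex_in_boundary e] ell_next[of i'] unfolding i' by blast
 qed
 then show ?thesis unfolding x_def .
qed

definition dE :: real where "dE = \<rho> / (4 * ((1 + KE) * KE))"

lemma dE_pos: "dE > 0" unfolding dE_def using rho(1) KE_pos by simp

text \<open>If a point \<open>x\<close> in the middle half of edge \<open>j\<close> were close to
  the line of edge \<open>i\<close>, it would by \<open>ell_boundary_lower\<close> be close to an
  end point \<open>w\<close> of edge \<open>i\<close>. Then \<open>w\<close> is close to the line of
  edge \<open>j\<close> and, with the edges exchanged, close to an end point of edge
  \<open>j\<close>, from which \<open>x\<close> is at least \<open>\<rho> * h / 4\<close> away. The
  two steps give the two factors in \<open>dE\<close>.\<close>

lemma ell_middle:
 assumes ij: "i < n" "j < n" "i \<noteq> j" and t: "1/4 \<le> t" "t \<le> 3/4"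
 shows "dE \<le> ell i (edp j t)"
proof -
 define x where "x = edp j t"
 have t01: "0 \<le> t" "t \<le> 1" using t by auto
 have far: "\<rho> * h / 4 \<le> (1 + KE) * norm (x - w)" if w: "w = edp i s" "0 \<le> s" "s \<le> 1" for w s
 proof -
  have e: "x - vx j = t *\<^sub>R (vx (Suc j) - vx j)"
   "x - vx (Suc j) = - ((1 - t) *\<^sub>R (vx (Suc j) - vx j))"
   by (simp_all add: x_def linepath_def algebra_simps)
  have g: "\<rho> * h / 4 \<le> s * len j" if "1/4 \<le> s" for s using mult_mono[OF that edge_ge[of j]] rho(1) h_pos that by simp
  have 1: "\<rho> * h / 4 \<le> norm (x - vx j)" "\<rho> * h / 4 \<le> norm (x - vx (Suc j))"
   unfolding e using g[of t] g[of "1 - t"] t by (simp_all add: edge_length_norm)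
  have "ell j x = 0" unfolding x_def by (rule ell_edge)
  then have "h * \<bar>ell j w\<bar> \<le> norm (x - w)" using ell_lipschitz[of j w x] by (simp add: norm_minus_commute)
  then have "h * ell j w \<le> norm (x - w)" using mult_left_mono[OF abs_ge_self[of "ell j w"], of h] h_pos by linarith
  then have 2: "KE * (h * ell j w) \<le> KE * norm (x - w)" using KE_pos by (intro mult_left_mono) auto
  have "norm (w - vx j) \<le> KE * (h * ell j w) \<or> norm (w - vx (Suc j)) \<le> KE * (h * ell j w)"
   unfolding w(1) using ij by (intro ell_boundary_lower w) auto
  moreover have "norm (x - y) \<le> norm (x - w) + norm (w - y)" for y using norm_triangle_ineq[of "x - w" "w - y"] by simp
  note this[of "vx j"] this[of "vx (Suc j)"]
  ultimately have "\<rho> * h / 4 \<le> norm (x - w) + KE * norm (x - w)" using 1 2 by linarith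
  then show ?thesis by (simp add: algebra_simps)
 qed
 have f: "\<rho> * h / 4 \<le> (1 + KE) * norm (x - vx i)" "\<rho> * h / 4 \<le> (1 + KE) * norm (x - vx (Suc i))"
  using far[of "vx i" 0] far[of "vx (Suc i)" 1] by (simp_all add: linepath_def)
 have "norm (x - w) \<le> KE * (h * ell i x) ==> (1 + KE) * norm (x - w) \<le> (1 + KE) * (KE * (h * ell i x))" for w
  using KE_pos by (intro mult_left_mono) auto
 then have "\<rho> * h / 4 \<le> (1 + KE) * (KE * (h * ell i x))" using ell_boundary_lower[OF ij t01] f unfolding x_def[symmetric] by fastforce
 then have "h * (\<rho> / 4) \<le> h * ((1 + KE) * KE * ell i x)" by (simp only: mult_ac times_divide_eq_right times_divide_eq_left)
 then have "\<rho> / 4 \<le> (1 + KE) * KE * ell i x" using h_pos by (simp only: mult_le_cancel_left_pos)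
 moreover have "(1 + KE) * KE > 0" using KE_pos by simp
 ultimately show ?thesis unfolding dE_def x_def[symmetric] by (simp add: field_simps)
qed

section \<open>Number of covering lines and outer normals\<close>

lemma is_line_unique:
 assumes L: "is_line L" and ab: "a \<in> L" "b \<in> L" "a \<noteq> b" shows "L = affine hull {a, b}"
proof -
 have "affine hull {a, b} \<subseteq> L" using L ab by (simp add: is_line_def hull_minimal)
 moreover have "aff_dim (affine hull {a, b}) = aff_dim L" using L ab(3) by (simp add: is_line_def aff_dim_affine_hull aff_dim_2)
 ultimately show ?thesis using L affine_dim_equal[of "affine hull {a, b}" L] by (simp add: is_line_def affine_affine_hull)
qed

lemma ell_line:
 assumes "x \<in> affine hull {a, b}" and z: "ell i a = 0" "ell i b = 0"
 shows "ell i x = 0"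
proof -
 from assms(1) obtain u v where x: "x = u *\<^sub>R a + v *\<^sub>R b" "u + v = 1" by (auto simp: affine_hull_2)
 have "nv i \<bullet> (vx i - a) = 0" "nv i \<bullet> (vx i - b) = 0" using z h_pos by (auto simp: ell_def)
 moreover have "vx i - x = u *\<^sub>R (vx i - a) + v *\<^sub>R (vx i - b)" using x(2) by (simp add: x(1) algebra_simps flip: scaleR_add_left)
 ultimately show ?thesis by (simp only: ell_def inner_add_right inner_scaleR_right) simp
qed

text \<open>Every edge has its own line in any cover, and by \<open>ell_middle\<close> different
  edges have different lines. The upper angle bound excludes hanging nodes, which would make
  \<open>eta\<close> smaller than the number of edges.\<close>

lemma eta_eq: "eta vs = n"
 unfolding eta_def
proof (rule Least_equality)
 let ?L = "\<lambda>i. affine hull {vx i, vx (Suc i)}"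
 have L: "is_line (?L i)" for i using vertex_Suc_neq[OF poly, of i] by (simp add: is_line_def affine_affine_hull aff_dim_affine_hull aff_dim_2)
 have lz: "x \<in> ?L i ==> ell i x = 0" for x i using ell_line[of x _ _ i] ell_edge[of i 0] ell_edge[of i 1] by (simp add: linepath_def)
 have lower: "n \<le> card \<L>" if fin: "finite \<L>" and li: "\<And>L. L \<in> \<L> ==> is_line L" and cov: "boundary vs \<subseteq> \<Union>\<L>" for \<L>
 proof -
  \<comment> \<open>Finitely many lines cover infinitely many points, so one of them contains two
    points of the middle half.\<close>
  have "\<exists>L\<in>\<L>. \<exists>s t. s \<noteq> t \<and> 1/4 \<le> s \<and> s \<le> 3/4 \<and> 1/4 \<le> t \<and> t \<le> 3/4 \<and> edp i s \<in> L \<and> edp i t \<in> L"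
   if i: "i < n" for i
  proof -
   have "\<forall>t\<in>{1/4..3/4::real}. \<exists>L\<in>\<L>. edp i t \<in> L"
   proof
    fix t :: real assume "t \<in> {1/4..3/4}"
    then have "edp i t \<in> boundary vs" by (intro edge_pt_in_boundary[OF i]) auto
    then show "\<exists>L\<in>\<L>. edp i t \<in> L" using cov by blast
   qed
   moreover have "infinite {1/4..3/4::real}" by simp
   ultimately obtain L where L: "L \<in> \<L>" "infinite {t \<in> {1/4..3/4}. edp i t \<in> L}"
    using pigeonhole_infinite_rel[of "{1/4..3/4::real}" \<L> "\<lambda>t L. edp i t \<in> L"] fin by auto
   define T where "T = {t \<in> {1/4..3/4}. edp i t \<in> L}"
   have T: "infinite T" using L(2) by (simp add: T_def)
   then have "T \<noteq> {}" by auto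
   then obtain s where s: "s \<in> T" by blast
   have "infinite (T - {s})" using T by simp
   then have "T - {s} \<noteq> {}" by (metis finite.emptyI)
   then obtain t where "t \<in> T" "t \<noteq> s" by blast
   then show ?thesis using s L(1) unfolding T_def by (intro bexI[of _ L] exI[of _ s] exI[of _ t]) auto
  qed
  then have "\<forall>i. \<exists>L s t. i < n --> L \<in> \<L> \<and> s \<noteq> t \<and> 1/4 \<le> s \<and> s \<le> 3/4 \<and> 1/4 \<le> t \<and> t \<le> 3/4 \<and> edp i s \<in> L \<and> edp i t \<in> L"
   by blast
  then obtain f s t where f: "\<And>i. i < n ==> f i \<in> \<L> \<and> s i \<noteq> t i \<and> 1/4 \<le> s i \<and> s i \<le> 3/4 \<and> 1/4 \<le> t i \<and> t i \<le> 3/4 \<and> edp i (s i) \<in> f i \<and> edp i (t i) \<in> (f i :: plane set)"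
   unfolding choice_iff by blast
  have "inj_on f {..<n}"
  proof (rule inj_onI, rule ccontr)
   fix i j assume ij: "i \<in> {..<n}" "j \<in> {..<n}" "f i = f j" "i \<noteq> j"
   have "edp i (s i) - edp i (t i) = (s i - t i) *\<^sub>R (vx (Suc i) - vx i)" by (simp add: linepath_def algebra_simps)
   then have "edp i (s i) \<noteq> edp i (t i)" using f[of i] ij(1) vertex_Suc_neq[OF poly, of i] by auto
   then have "f i = affine hull {edp i (s i), edp i (t i)}" using f[of i] ij(1) li by (intro is_line_unique) auto
   then have "ell i (edp j (s j)) = 0" using f[of j] ij(2) unfolding ij(3) by (intro ell_line[OF _ ell_edge ell_edge]) auto
   moreover have "dE \<le> ell i (edp j (s j))" using ij f[of j] by (intro ell_middle) auto
   ultimately show False using dE_pos by linarith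
  qed
  then have "card (f ` {..<n}) = n" by (simp add: card_image)
  moreover have "f ` {..<n} \<subseteq> \<L>" using f by blast
  ultimately show ?thesis using card_mono[OF fin, of "f ` {..<n}"] by simp
 qed
 show "\<exists>\<L>. finite \<L> \<and> card \<L> = n \<and> (\<forall>L\<in>\<L>. is_line L) \<and> boundary vs \<subseteq> \<Union>\<L>"
 proof (intro exI[of _ "?L ` {..<n}"] conjI)
  have sub: "boundary vs \<subseteq> \<Union>(?L ` {..<n})"
   unfolding boundary_def edge_def segment_convex_hull by (intro UN_mono convex_hull_subset_affine_hull order_refl)
  then show "boundary vs \<subseteq> \<Union>(?L ` {..<n})" .
  have "n \<le> card (?L ` {..<n})" using L sub by (intro lower) auto
  then show "card (?L ` {..<n}) = n" using card_image_le[of "{..<n}" ?L] by simp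
 qed (use L in auto)
 fix m assume "\<exists>\<L>. finite \<L> \<and> card \<L> = m \<and> (\<forall>L\<in>\<L>. is_line L) \<and> boundary vs \<subseteq> \<Union>\<L>"
 then show "n \<le> m" using lower by blast
qed

text \<open>Length and orthogonality leave two candidates. Stepping against \<open>nv i\<close> from
  the midpoint of the edge enters the sector, hence \<open>F\<close>, which rules out the opposite
  vector.\<close>

lemma outer_normal_eq: assumes i: "i < n" shows "outer_normal vs i = nv i"
 unfolding outer_normal_def
proof (rule the_equality)
 let ?e = "vx (Suc i) - vx i"
 have e: "norm ?e > 0" using edge_length_pos[of i] by (simp add: edge_length_norm)
 have ne: "nv i \<bullet> ?e = 0" using nv_inner[of i ?e] edge_length_pos[of i] by simp
 have seg: "ell i x = 0" if x: "x \<in> open_segment (vx i) (vx (Suc i))" for x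
 proof -
  obtain u where "x = edp i u" using x by (auto simp: in_segment linepath_def)
  then show ?thesis by (simp only: ell_edge)
 qed
 have "\<forall>\<^sub>F t in at_right 0. x + t *\<^sub>R nv i \<notin> F" if "x \<in> open_segment (vx i) (vx (Suc i))" for x
 proof (rule eventually_at_right_less[THEN eventually_mono])
  fix t :: real assume t: "0 < t"
  have "ell i (x + t *\<^sub>R nv i) = - t / h"
   unfolding ell_affine[of i "x + t *\<^sub>R nv i" x] seg[OF that] using norm_nv[of i] by (simp add: dot_square_norm)
  also have "\<dots> < 0" using t h_pos by simp
  finally show "x + t *\<^sub>R nv i \<notin> F" using ell_pos[of "x + t *\<^sub>R nv i" i] by auto
 qed
 then show "norm (nv i) = 1 \<and> nv i \<bullet> ?e = 0 \<and>
  (\<forall>x\<in>open_segment (vx i) (vx (Suc i)). \<forall>\<^sub>F t in at_right 0. x + t *\<^sub>R nv i \<notin> F)"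
  using norm_nv ne by blast
 fix m assume m: "norm m = 1 \<and> m \<bullet> ?e = 0 \<and>
  (\<forall>x\<in>open_segment (vx i) (vx (Suc i)). \<forall>\<^sub>F t in at_right 0. x + t *\<^sub>R m \<notin> F)"
 have w: "wedge (nv i) m = 0"
 proof -
  have "(wedge (nv i) m *\<^sub>R ?e) \<bullet> ?e = 0" unfolding wedge_decomp[of "nv i" m ?e] using m ne by (simp add: inner_add_left)
  then show ?thesis using e by auto
 qed
 have "(nv i \<bullet> m)^2 = 1" using lagrange_plane[of "nv i" m] w m norm_nv[of i] by simp
 then have d: "nv i \<bullet> m = 1 \<or> nv i \<bullet> m = -1" by (simp add: power2_eq_1_iff)
 have "nv i \<bullet> m \<noteq> -1"
 proof
  assume a: "nv i \<bullet> m = -1"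
  define x where "x = edp i (1/2)"
  have xs: "x \<in> open_segment (vx i) (vx (Suc i))"
   unfolding x_def in_segment linepath_def using vertex_Suc_neq[OF poly, of i] by (auto intro!: exI[of _ "1/2"])
  have "((\<lambda>t. al i (x + t *\<^sub>R m)) \<longlongrightarrow> al i (x + 0 *\<^sub>R m)) (at_right 0)" "((\<lambda>t. be i (x + t *\<^sub>R m)) \<longlongrightarrow> be i (x + 0 *\<^sub>R m)) (at_right 0)"
   unfolding al_def be_def by (intro tendsto_intros)+
  then have "\<forall>\<^sub>F t in at_right 0. 0 < al i (x + t *\<^sub>R m)" "\<forall>\<^sub>F t in at_right 0. 0 < be i (x + t *\<^sub>R m)"
   by (auto intro!: order_tendstoD(1) simp: x_def al_edge be_edge)
  moreover have "\<forall>\<^sub>F t in at_right 0. x + t *\<^sub>R m \<notin> F" using m xs by blast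
  ultimately have "\<forall>\<^sub>F t in at_right (0::real). False" using eventually_at_right_less[of 0]
  proof eventually_elim
   case (elim t)
   let ?y = "x + t *\<^sub>R m"
   have "ell i ?y = t / h" unfolding ell_affine[of i ?y x] seg[OF xs] using a by simp
   then have "ell i c * (1 - al i ?y - be i ?y) > 0" using elim h_pos by (simp flip: ell_cone)
   then have s: "al i ?y + be i ?y < 1" using ell_c(2)[of i] by (simp add: zero_less_mult_iff)
   define s where "s = al i ?y + be i ?y"
   have "edp i (be i ?y / s) \<in> closure F" using elim i by (intro boundary_closure edge_pt_in_boundary) (auto simp: s_def)
   then have "c + s *\<^sub>R (edp i (be i ?y / s) - c) \<in> F" using elim s by (intro ray_in) (auto simp: s_def)
   moreover have "?y = c + s *\<^sub>R (edp i (be i ?y / s) - c)" using cone_point[of i ?y] elim by (simp add: s_def diff_eq_eq add.commute)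
   ultimately show False using elim by simp
  qed
  then show False by simp
 qed
 then have "nv i \<bullet> m = 1" using d by simp
 then have "(norm (m - nv i))^2 = 0"
  using m norm_nv[of i] by (simp add: power2_norm_eq_inner inner_diff_left inner_diff_right inner_commute) (simp add: dot_square_norm)
 then show "m = nv i" by simp
qed

end

section \<open>Division by edge functions\<close>

text \<open>In coordinates whose second axis is \<open>\<nu>\<close>, the difference consists of the
  monomials containing the second variable, which therefore factors out.\<close>

lemma poly_division:
 assumes f: "f \<in> polys k" and nu: "norm \<nu> = 1"
 shows "\<exists>g\<in>polys (k - 1). \<forall>x. f x - f (x - ((x - a) \<bullet> \<nu>) *\<^sub>R \<nu>) = ((x - a) \<bullet> \<nu>) * g x"
proof -
 \<comment> \<open>\<open>R\<close> is the rigid motion from the adapted coordinates to the plane,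
   and \<open>Z\<close> below is its inverse.\<close>
 define R where "R z = mk (a $ 1 + (z $ 1 * (- \<nu> $ 2) + z $ 2 * \<nu> $ 1)) (a $ 2 + (z $ 1 * \<nu> $ 1 + z $ 2 * \<nu> $ 2))" for z :: plane
 have aff: "(\<lambda>z::plane. s + (z $ 1 * t + z $ 2 * u)) \<in> polys 1" for s t u
  using polys_add[OF polys_affine1[of s t 1] polys_affine1[of 0 u 2]] by (simp add: mult.commute add.assoc)
 have "(\<lambda>z. f (R z)) \<in> polys k" unfolding R_def by (rule polys_compose[OF f aff aff])
 then obtain cc where "(\<lambda>z. f (R z)) = (\<lambda>z. \<Sum>b\<in>idx k. cc b * mon b z)" by (rule polysE)
 then have fR: "f (R z) = (\<Sum>b\<in>idx k. cc b * mon b z)" for z by (rule fun_cong)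
 define G where "G z = (\<Sum>b\<in>idx k. if snd b = 0 then 0 else cc b * mon (fst b, snd b - 1) z)" for z
 have G: "G \<in> polys (k - 1)" unfolding G_def[abs_def]
 proof (rule polys_sum)
  fix b assume "b \<in> idx k"
  then show "(\<lambda>z. if snd b = 0 then 0 else cc b * mon (fst b, snd b - 1) z) \<in> polys (k - 1)"
   by (cases "snd b = 0") (auto simp: idx_def intro!: polys_zero polys_cmult polys_mon)
 qed
 have dif: "f (R z) - f (R (mk (z $ 1) 0)) = z $ 2 * G z" for z unfolding fR G_def sum_subtractf[symmetric] sum_distrib_left
 proof (rule sum.cong[OF refl])
  fix b
  show "cc b * mon b z - cc b * mon b (mk (z $ 1) 0) = z $ 2 * (if snd b = 0 then 0 else cc b * mon (fst b, snd b - 1) z)"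
   by (cases "snd b") (auto simp: mon_def)
 qed
 define Z where "Z x = mk ((x - a) \<bullet> perp \<nu>) ((x - a) \<bullet> \<nu>)" for x
 have nn: "\<nu> $ 1 * \<nu> $ 1 + \<nu> $ 2 * \<nu> $ 2 = 1" using nu plane_norm_sq[of \<nu>] by (simp add: power2_eq_square)
 have RZ: "R (mk ((x - a) \<bullet> perp \<nu>) s) = x - ((x - a) \<bullet> \<nu> - s) *\<^sub>R \<nu>" for x s
 proof -
  have "y = (y \<bullet> perp \<nu>) *\<^sub>R perp \<nu> + (y \<bullet> \<nu>) *\<^sub>R \<nu>" for y
  proof -
   have "(y \<bullet> perp \<nu>) * (- \<nu> $ 2) + (y \<bullet> \<nu>) * \<nu> $ 1 = y $ 1 * (\<nu> $ 1 * \<nu> $ 1 + \<nu> $ 2 * \<nu> $ 2)"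
    "(y \<bullet> perp \<nu>) * \<nu> $ 1 + (y \<bullet> \<nu>) * \<nu> $ 2 = y $ 2 * (\<nu> $ 1 * \<nu> $ 1 + \<nu> $ 2 * \<nu> $ 2)"
    by (simp_all add: plane_inner algebra_simps)
   then show ?thesis unfolding nn by (simp add: plane_eq_iff)
  qed
  note y = this[of "x - a"]
  have "x - ((x - a) \<bullet> \<nu> - s) *\<^sub>R \<nu> = a + (x - a) - ((x - a) \<bullet> \<nu> - s) *\<^sub>R \<nu>" by simp
  also have "\<dots> = a + (((x - a) \<bullet> perp \<nu>) *\<^sub>R perp \<nu> + ((x - a) \<bullet> \<nu>) *\<^sub>R \<nu>) - ((x - a) \<bullet> \<nu> - s) *\<^sub>R \<nu>"
   using y by (simp only:)
  also have "\<dots> = R (mk ((x - a) \<bullet> perp \<nu>) s)" by (simp add: R_def plane_eq_iff algebra_simps)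
  finally show ?thesis by (rule sym)
 qed
 have "(\<lambda>x. G (Z x)) \<in> polys (k - 1)"
  unfolding Z_def using polys_compose[OF G polys_inner[of 0 a "perp \<nu>"] polys_inner[of 0 a \<nu>]] by simp
 moreover have "f x - f (x - ((x - a) \<bullet> \<nu>) *\<^sub>R \<nu>) = ((x - a) \<bullet> \<nu>) * G (Z x)" for x
  using dif[of "Z x"] RZ[of x "(x - a) \<bullet> \<nu>"] RZ[of x 0] by (simp add: Z_def)
 ultimately show ?thesis by (intro bexI[of _ "\<lambda>x. G (Z x)"]) auto
qed

context star_polygon
begin

text \<open>The orthogonal projection onto the line of edge \<open>i\<close>.\<close>

definition pr :: "nat => plane => plane" where "pr i x = x - ((x - vx i) \<bullet> nv i) *\<^sub>R nv i"

lemma pr_edge: "\<exists>t. pr i x = edp i t \<and> \<bar>t\<bar> * len i \<le> norm (x - vx i)"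
proof -
 let ?e = "vx (Suc i) - vx i" and ?y = "pr i x - vx i"
 have yn: "?y = (x - vx i) - ((x - vx i) \<bullet> nv i) *\<^sub>R nv i" by (simp add: pr_def)
 have nn: "nv i \<bullet> nv i = 1" using norm_nv[of i] by (simp add: dot_square_norm)
 then have "nv i \<bullet> ?y = 0" unfolding yn by (simp add: inner_diff_right inner_commute)
 then have w: "wedge ?e ?y = 0" using nv_inner[of i ?y] D_nz[of i] wedge_swap[of ?e ?y] by (simp add: sgn_zero_iff)
 then obtain t where y: "?y = t *\<^sub>R ?e" using edge_parallel by blast
 then have "pr i x = edp i t" by (simp add: linepath_def algebra_simps)
 moreover have "(norm ?y)^2 \<le> (norm (x - vx i))^2" unfolding yn power2_norm_eq_inner using nn
  by (simp add: inner_diff_left inner_diff_right inner_commute)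
 then have "norm ?y \<le> norm (x - vx i)" by (rule power2_le_imp_le) simp
 then have "\<bar>t\<bar> * len i \<le> norm (x - vx i)" unfolding y by (simp add: edge_length_norm)
 ultimately show ?thesis by blast
qed

lemma pr_polys: assumes "s \<in> polys k" shows "(\<lambda>x. s (pr i x)) \<in> polys k"
proof -
 have "(\<lambda>x. pr i x $ j) \<in> polys 1" for j
 proof -
  have "(\<lambda>x. x $ j - nv i $ j * (0 + (x - vx i) \<bullet> nv i)) \<in> polys 1" by (intro polys_diff polys_coord polys_cmult polys_inner)
  then show ?thesis by (simp add: pr_def mult.commute)
 qed
 from polys_compose[OF assms this this, of 1 2] show ?thesis by simp
qed

lemma ell_division:
 assumes "s \<in> polys k" shows "\<exists>g\<in>polys (k - 1). \<forall>x. s x - s (pr i x) = ell i x * g x"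
proof -
 obtain g where g: "g \<in> polys (k - 1)" "\<And>x. s x - s (pr i x) = ((x - vx i) \<bullet> nv i) * g x"
  using poly_division[OF assms norm_nv] unfolding pr_def by blast
 have "(x - vx i) \<bullet> nv i = - h * ell i x" for x using h_pos by (simp add: ell_def inner_diff_right inner_diff_left inner_commute)
 then show ?thesis using g by (intro bexI[of _ "\<lambda>x. (- h) * g x"] polys_cmult) auto
qed

lemma ell_polys: "ell i \<in> polys 1"
proof -
 have "(\<lambda>x. (-1/h) * (0 + (x - vx i) \<bullet> nv i)) \<in> polys 1" by (intro polys_cmult polys_inner)
 moreover have "(\<lambda>x. (-1/h) * (0 + (x - vx i) \<bullet> nv i)) = ell i"
  by (auto simp: fun_eq_iff ell_def inner_diff_right inner_diff_left inner_commute diff_divide_distrib)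
 ultimately show ?thesis by simp
qed

lemma prod_ell_polys: "(\<lambda>x. \<Prod>i<m. ell i x) \<in> polys (int m)"
proof (induction m)
 case (Suc m)
 then show ?case using polys_mult[OF Suc ell_polys[of m]] by (simp add: mult.commute add.commute)
qed (simp add: polys_const)

lemma ell_abs_le: assumes "norm (x - c) \<le> 2 * h" shows "\<bar>ell i x\<bar> \<le> 3"
proof -
 have "h * \<bar>ell i x - ell i c\<bar> \<le> h * 2" using ell_lipschitz[of i x c] assms by linarith
 then have "\<bar>ell i x - ell i c\<bar> \<le> 2" using h_pos by (simp only: mult_le_cancel_left_pos)
 then show ?thesis using ell_c(2,3)[of i] by linarith
qed

lemma prod_ell_abs_le: assumes "norm (x - c) \<le> 2 * h" shows "\<bar>\<Prod>i<m. ell i x\<bar> \<le> 3 ^ m"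
proof -
 have "(\<Prod>i<m. \<bar>ell i x\<bar>) \<le> (\<Prod>i<m. 3)" by (intro prod_mono conjI abs_ge_zero ell_abs_le assms)
 then show ?thesis by (simp add: abs_prod)
qed

lemma edge_near: assumes "i < n" "0 \<le> t" "t \<le> 1" shows "norm (edp i t - c) \<le> h"
 using dist_le_h[OF _ F_sub_closure[OF c_in], of "edp i t"] edge_pt_in_boundary[OF assms] by (simp add: closure_F)

text \<open>The tangential derivative controls the oscillation along the boundary, which is closed
  under following the edges from the first vertex.\<close>

lemma boundary_walk:
 assumes C: "C1 p" and p0: "p (vx 0) = 0"
 and E: "\<And>i. i < n ==> nrm (leb {0..1}) (\<lambda>t. grad p (edp i t) \<bullet> (vx (Suc i) - vx i)) \<le> E"
 and i: "i < n" and t: "0 \<le> t" "t \<le> 1"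
 shows "\<bar>p (edp i t)\<bar> \<le> real n * E"
proof -
 have step: "\<bar>p (edp i t) - p (vx i)\<bar> \<le> E" if i: "i < n" and t: "0 \<le> t" "t \<le> 1" for i t
 proof -
  let ?M = "leb {0..1::real}"
  define e where "e = vx (Suc i) - vx i"
  define g where "g s = grad p (edp i s) \<bullet> e" for s
  have ep: "edp i s = vx i + s *\<^sub>R e" for s by (simp add: linepath_def e_def algebra_simps)
  have gc: "cont g" unfolding g_def ep by (intro continuous_intros continuous_on_compose2[OF C1_grad_continuous[OF C, of UNIV]]) auto
  have "(g has_integral (p (vx i + t *\<^sub>R e) - p (vx i + 0 *\<^sub>R e))) {0..t}"
  proof (rule fundamental_theorem_of_calculus[OF t(1)])
   fix s
   show "((\<lambda>s. p (vx i + s *\<^sub>R e)) has_vector_derivative g s) (at s within {0..t})"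
    using C1_ray_derivative[OF C] unfolding g_def ep has_real_derivative_iff_has_vector_derivative .
  qed
  then have "p (edp i t) - p (vx i) = integral {0..t} g" by (simp add: ep integral_unique)
  also have "\<bar>\<dots>\<bar> \<le> integral {0..t} (\<lambda>s. \<bar>g s\<bar>)"
   using integral_norm_bound_integral[of g "{0..t}" "\<lambda>s. \<bar>g s\<bar>"] gc
   by (auto intro!: integrable_continuous_real continuous_intros intro: continuous_on_subset)
  also have "\<dots> \<le> integral {0..1} (\<lambda>s. \<bar>g s\<bar>)"
   using t gc by (intro integral_subset_le integrable_continuous_real continuous_intros) (auto intro: continuous_on_subset)
  also have "\<dots> = (LINT s|?M. \<bar>g s\<bar> \<bullet> (1::real))"
   using gc by (subst LINT_01_eq_integral) (auto intro!: continuous_intros intro: continuous_on_subset)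
  also have "\<dots> \<le> nrm ?M (\<lambda>s. \<bar>g s\<bar>) * nrm ?M (\<lambda>s. 1::real)"
   by (rule order_trans[OF abs_ge_self nrm_Cauchy_Schwarz]; rule continuous_sqi_on) (use gc in \<open>auto intro!: continuous_intros\<close>)
  also have "\<dots> = nrm ?M g" by (simp add: nrm_def measure_restrict_space)
  also have "\<dots> \<le> E" unfolding g_def e_def by (rule E[OF i])
  finally show ?thesis .
 qed
 have v: "i \<le> n ==> \<bar>p (vx i)\<bar> \<le> real i * E" for i
 proof (induction i)
  case 0 then show ?case by (simp add: p0)
 next
  case (Suc i)
  have "\<bar>p (vx (Suc i)) - p (vx i)\<bar> \<le> E" using step[of i 1] Suc.prems by (simp add: linepath_def)
  then show ?case using Suc by (simp add: distrib_right)
 qed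
 have "E \<ge> 0" using order_trans[OF nrm_nonneg E[OF i]] .
 have "\<bar>p (edp i t)\<bar> \<le> real (Suc i) * E" using step[OF i t] v[of i] i by (simp add: distrib_right)
 also have "\<dots> \<le> real n * E" using i \<open>E \<ge> 0\<close> by (intro mult_right_mono) auto
 finally show ?thesis .
qed

end

locale serendipity_polygon = convex_polygon vs c r \<rho> \<sigma> + polygon_constants vs c r \<rho> k C G for vs c r \<rho> \<sigma> k C G
begin

text \<open>Successive division by the edge equations: the remainder is controlled by the boundary
  values since the quotients are evaluated where the earlier edge functions are bounded below.\<close>

lemma edge_division:
 assumes p: "p \<in> polys (int (Suc k))" and M: "0 \<le> M"
 and pM: "\<And>i t. i < n ==> 0 \<le> t ==> t \<le> 1 ==> \<bar>p (edp i t)\<bar> \<le> M"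
 and "m \<le> n"
 shows "\<exists>P\<in>polys (int (Suc k)). \<exists>s\<in>polys (int (Suc k) - int m). (\<forall>x. p x = P x + (\<Prod>i<m. ell i x) * s x) \<and>
 (\<forall>x. norm (x - c) \<le> 2 * h --> \<bar>P x\<bar> \<le> ((\<Prod>j<m. 1 + C * (3 / dE) ^ j) - 1) * M)"
 using \<open>m \<le> n\<close>
proof (induction m)
 case 0
 then show ?case using p by (intro bexI[of _ "\<lambda>x. 0"] bexI[of _ p]) (auto simp: polys_zero)
next
 case (Suc m)
 define Q where "Q = (\<Prod>j<m. 1 + C * (3 / dE) ^ j)"
 obtain P s where P: "P \<in> polys (int (Suc k))" and s: "s \<in> polys (int (Suc k) - int m)"
  and dec: "\<And>x. p x = P x + (\<Prod>i<m. ell i x) * s x"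
  and Pb: "\<And>x. norm (x - c) \<le> 2 * h ==> \<bar>P x\<bar> \<le> (Q - 1) * M"
  using Suc.IH Suc.prems unfolding Q_def by (meson Suc_leD)
 have m: "m < n" using Suc.prems by simp
 \<comment> \<open>Bounds the quotient on the middle half of edge \<open>m\<close>, where each of
   the \<open>m\<close> earlier heights is at least \<open>dE\<close>.\<close>
 define A where "A = Q * M / dE ^ m"
 have mid: "\<bar>s (edp m t)\<bar> \<le> A" if t: "1/4 \<le> t" "t \<le> 3/4" for t
 proof -
  let ?x = "edp m t"
  have x: "norm (?x - c) \<le> 2 * h" using edge_near[OF m, of t] t h_pos by auto
  have "dE ^ m = (\<Prod>i<m. dE)" by simp
  also have "\<dots> \<le> (\<Prod>i<m. ell i ?x)" using m t dE_pos by (intro prod_mono conjI ell_middle) auto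
  finally have l: "dE ^ m \<le> (\<Prod>i<m. ell i ?x)" .
  have pos: "dE ^ m > 0" using dE_pos by simp
  have "dE ^ m * \<bar>s ?x\<bar> \<le> \<bar>(\<Prod>i<m. ell i ?x) * s ?x\<bar>" unfolding abs_mult using l pos by (intro mult_right_mono) auto
  also have "\<dots> \<le> M + (Q - 1) * M" using dec[of ?x] Pb[OF x] pM[OF m, of t] t by auto
  finally show ?thesis using pos by (simp add: A_def field_simps)
 qed
 have A0: "0 \<le> A" using order_trans[OF abs_ge_zero mid[of "1/2"]] by simp
 \<comment> \<open>The projected point may lie beyond the end points of edge \<open>m\<close>, but
   its parameter is at most \<open>3 / \<rho>\<close>, within reach of the norm equivalence.\<close>
 have sb: "\<bar>s (pr m x)\<bar> \<le> C * A" if x: "norm (x - c) \<le> 2 * h" for x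
 proof -
  have "s \<in> polys (int (Suc k))" using s by (rule polys_mono) simp
  then obtain a where a: "\<And>t. s (vx m + t *\<^sub>R (vx (Suc m) - vx m)) = (\<Sum>i\<le>Suc k. a i * t ^ i)" using polys_edge by blast
  have ep: "edp m t = vx m + t *\<^sub>R (vx (Suc m) - vx m)" for t by (simp add: linepath_def algebra_simps)
  obtain t where t: "pr m x = edp m t" "\<bar>t\<bar> * len m \<le> norm (x - vx m)" using pr_edge by blast
  have "norm (x - vx m) \<le> norm (x - c) + norm (va m)" using norm_triangle_ineq4[of "x - c" "va m"] by simp
  then have "\<bar>t\<bar> * len m \<le> 3 * h" using t(2) x norm_va(1)[of m] by linarith
  moreover have "\<bar>t\<bar> * (\<rho> * h) \<le> \<bar>t\<bar> * len m" by (intro mult_left_mono edge_ge) auto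
  ultimately have "h * (\<bar>t\<bar> * \<rho>) \<le> h * 3" by (simp add: mult_ac)
  then have "\<bar>t\<bar> * \<rho> \<le> 3" using h_pos by (simp only: mult_le_cancel_left_pos)
  then have t3: "\<bar>t\<bar> \<le> 3 / \<rho>" using rho(1) by (simp add: field_simps)
  let ?I = "leb {1/4<..<3/4::real}" and ?f = "\<lambda>t. \<Sum>i\<le>Suc k. a i * t ^ i"
  have cont: "cont ?f" by (intro continuous_intros)
  have fin: "finite_measure ?I" by (rule finite_measure_lebesgue_on) auto
  have fA: "norm (?f t) \<le> A" if "t \<in> space ?I" for t using mid[of t] that unfolding ep a by (simp add: space_restrict_space)
  have "(nrm ?I ?f)^2 \<le> A^2 * measure ?I (space ?I)" by (rule nrm_le_sup(2)[OF cont_measurable[OF cont] fin A0 fA])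
  also have "measure ?I (space ?I) = 1/2" by (simp add: space_restrict_space measure_restrict_space)
  also have "A^2 * (1/2) \<le> A^2" by simp
  finally have "nrm ?I ?f \<le> A" using A0 by (rule power2_le_imp_le)
  then have "C * nrm ?I ?f \<le> C * A" using C_ge1 by (intro mult_left_mono) auto
  with conjunct1[OF C[OF t3, of a]] have "\<bar>?f t\<bar> \<le> C * A" by (rule order_trans)
  then show ?thesis unfolding t(1) ep a .
 qed
 obtain g where g: "g \<in> polys (int (Suc k) - int m - 1)" "\<And>x. s x - s (pr m x) = ell m x * g x" using ell_division[OF s, of m] by blast
 define P' where "P' x = P x + (\<Prod>i<m. ell i x) * s (pr m x)" for x
 have "(\<lambda>x. (\<Prod>i<m. ell i x) * s (pr m x)) \<in> polys (int (Suc k))"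
  using polys_mult[OF prod_ell_polys[of m] pr_polys[OF s, of m]] by simp
 with P have P': "P' \<in> polys (int (Suc k))" unfolding P'_def[abs_def] by (rule polys_add)
 moreover have "p x = P' x + (\<Prod>i<Suc m. ell i x) * g x" for x
 proof -
  have "s x = s (pr m x) + ell m x * g x" using g(2)[of x] by simp
  then show ?thesis unfolding dec[of x] P'_def by (simp add: distrib_left mult.assoc)
 qed
 moreover have "\<bar>P' x\<bar> \<le> ((\<Prod>j<Suc m. 1 + C * (3 / dE) ^ j) - 1) * M" if x: "norm (x - c) \<le> 2 * h" for x
 proof -
  have "\<bar>(\<Prod>i<m. ell i x) * s (pr m x)\<bar> \<le> 3 ^ m * (C * A)" unfolding abs_mult by (intro mult_mono prod_ell_abs_le x sb) auto
  also have "\<dots> = C * (3 / dE) ^ m * Q * M" by (simp add: A_def power_divide)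
  finally have "\<bar>P' x\<bar> \<le> (Q - 1) * M + C * (3 / dE) ^ m * Q * M" using Pb[OF x] unfolding P'_def by linarith
  \<comment> \<open>Each division contributes one factor: \<open>C\<close> extends the remainder
    from the middle half, \<open>3\<close> bounds the heights multiplied back in, and
    \<open>dE\<close> those divided out.\<close>
  also have "\<dots> = (Q * (1 + C * (3 / dE) ^ m) - 1) * M" by (simp add: algebra_simps)
  finally show ?thesis by (simp add: Q_def)
 qed
 ultimately show ?case using g(1) by (intro bexI[of _ P'] bexI[of _ g]) (auto simp: algebra_simps)
qed

end

section \<open>Stability of the stream function\<close>

context polygon_constants
begin

lemma near_disc: assumes "norm (x - c) \<le> 2 * h" shows "norm (x - c) \<le> (4/\<rho> + 1) * r"
proof -
 have "2 * h \<le> (2/\<rho>) * r" using r_ge rho(1) by (simp add: field_simps)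
 also have "\<dots> \<le> (4/\<rho> + 1) * r" using rho(1) r_pos by (intro mult_right_mono) (auto simp: field_simps)
 finally show ?thesis using assms by linarith
qed

text \<open>The sup norm on \<open>F\<close> bounds the norm on the half disc, from which norm
  equivalence recovers the gradient.\<close>

lemma grad_bound:
 assumes p: "p \<in> polys (int (Suc k))" and A: "0 \<le> A" "\<And>x. x \<in> F ==> \<bar>p x\<bar> \<le> A" and x: "norm (x - c) \<le> 2 * h"
 shows "norm (grad p x) \<le> 2 * G / \<rho>^2 * A / h"
proof -
 have cont: "cont p" by (intro C1_continuous polys_C1[OF p])
 have B: "ball c (r/2) \<subseteq> F" using ball_sub r_pos by (auto simp: subset_eq)
 have "nrm (leb (ball c (r/2))) p \<le> nrm (leb F) p"
  unfolding nrm_def by (intro real_sqrt_le_mono LINT_mono_subset continuous_intros cont B) (auto simp: F_ob)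
 also have "\<dots> \<le> 2 * h * A" using A by (intro nrm_le_sup_h(2) cont_measurable cont) auto
 finally have Z: "nrm (leb (ball c (r/2))) p \<le> 2 * h * A" .
 have "norm (grad p x) \<le> G / r^2 * nrm (leb (ball c (r/2))) p" using G[OF p r_pos near_disc[OF x]] by blast
 also have "\<dots> \<le> G / (\<rho> * h)^2 * (2 * h * A)" using Z G_pos r_ge rho(1) h_pos r_pos by (intro mult_mono divide_left_mono power_mono) auto
 also have "\<dots> = 2 * G / \<rho>^2 * A / h" using h_pos by (simp add: power2_eq_square mult_ac)
 finally show ?thesis .
qed

end

context serendipity_polygon
begin

text \<open>On the part of a stream function carried by the product of all edge functions, the moments
  against the rotated position field are, after integration by parts, weighted L2 products.\<close>

lemma interior_moment:
 assumes s: "s \<in> polys j" and u: "u \<in> polys j'" and su: "\<And>x. 2 * u x + grad u x \<bullet> (x - b) = w x" and w: "w \<in> polys j'"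
 shows "(LINT x|leb F. (curl (\<lambda>x. (\<Prod>i<n. ell i x) * s x) x \<bullet> perp (x - b)) * u x) =
 (LINT x|leb F. (\<Prod>i<n. ell i x) * s x * w x)"
proof -
 define f where "f x = (\<Prod>i<n. ell i x) * s x" for x
 have fC: "C1 f" unfolding f_def[abs_def] by (intro polys_C1[OF polys_mult[OF prod_ell_polys s]])
 have uC: "C1 u" by (rule polys_C1[OF u])
 have wC: "C1 w" by (rule polys_C1[OF w])
 note g = C1_mult[OF fC uC]
 have z: "(\<Prod>i<n. ell i (edp j t)) = 0" if "j < n" for j t using that by (intro prod_zero bexI[of _ j]) (auto simp: ell_edge)
 have "(LINT x|leb F. 2 * (f x * u x) + grad (\<lambda>x. f x * u x) x \<bullet> (x - b)) = 0"
  by (rule radial_divergence_center(2)[OF g(1)]) (simp add: f_def z)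
 moreover have "2 * (f x * u x) + grad (\<lambda>x. f x * u x) x \<bullet> (x - b) = f x * w x - (curl f x \<bullet> perp (x - b)) * u x" for x
 proof -
  have pc: "curl f x \<bullet> perp (x - b) = - (grad f x \<bullet> (x - b))" using perp_curl[of "x - b" f x] by (simp only: inner_commute)
  show ?thesis unfolding g(2) su[symmetric] pc inner_add_left inner_scaleR_left by (simp add: algebra_simps)
 qed
 moreover have "integrable (leb F) (\<lambda>x. f x * w x)" "integrable (leb F) (\<lambda>x. (curl f x \<bullet> perp (x - b)) * u x)"
  by (intro integrable_C1 continuous_intros C1_continuous C1_curl_continuous continuous_perp fC uC wC)+
 ultimately have "(LINT x|leb F. f x * w x) = (LINT x|leb F. (curl f x \<bullet> perp (x - b)) * u x)" by simp
 then show ?thesis by (simp add: f_def[abs_def])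
qed

text \<open>\<open>A\<close> bounds the remainder of the division by the edge functions, the inner
  bracket the quotient, and \<open>G'\<close> converts sup bounds into gradient bounds. The number
  of edges enters only through \<open>NN\<close>.\<close>

definition stab :: real where
 "stab = (let A = (\<Prod>j<NN. 1 + C * (3 / dE) ^ j) * real NN; G' = 2 * G / \<rho>^2
 in 2 * G' * (A + 3 ^ NN * (2 * G^2 / \<rho>^2 * ((2/\<rho>) ^ NN * (1 + 4 * G' * A)))))"

text \<open>Tangential derivatives on the boundary and moments determine a stream function up to a
  constant. \<open>P\<close> is controlled by the boundary alone. The part \<open>s\<close>,
  multiplied by all heights, is tested with the \<open>u\<close> whose radial image is
  \<open>s\<close>; this turns its moment into a weighted integral of the square of
  \<open>s\<close>.\<close>

lemma curl_bound:
 assumes b: "norm (b - c) \<le> h"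
 and p: "p \<in> polys (int (Suc k))"
 and E: "\<And>i. i < n ==> nrm (leb {0..1}) (\<lambda>t. grad p (edp i t) \<bullet> (vx (Suc i) - vx i)) \<le> E"
 and mom: "\<And>t. t \<in> polys (int (Suc k) - int n) ==> \<bar>LINT x|leb F. (curl p x \<bullet> perp (x - b)) * t x\<bar> \<le> E * h * nrm (leb F) t"
 shows "nrm (leb F) (curl p) \<le> stab * E"
proof -
 let ?M = "leb F"
 have E0: "0 \<le> E" using order_trans[OF nrm_nonneg E[of 0]] vs_ne by simp
 define G' where "G' = 2 * G / \<rho>^2"
 have G': "G' > 0" using G_pos rho(1) by (simp add: G'_def)
 define Q where "Q = (\<Prod>j<NN. 1 + C * (3 / dE) ^ j)"
 have dC: "1 \<le> 1 + C * (3 / dE) ^ j" for j using C_ge1 dE_pos by simp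
 have Qm: "(\<Prod>j<n. 1 + C * (3 / dE) ^ j) \<le> Q" unfolding Q_def
  using n_le_N by (intro prod_mono2) (use dC in \<open>auto intro: order_trans[OF zero_le_one]\<close>)
 have Q1: "1 \<le> Q" unfolding Q_def by (intro prod_ge_1 dC)
 define A where "A = Q * real NN * E"
 have A0: "0 \<le> A" using Q1 E0 by (simp add: A_def)
 \<comment> \<open>Normalised to vanish at the first vertex, where \<open>boundary_walk\<close>
   starts; the curl is unchanged.\<close>
 define p0 where "p0 x = p x + - p (vx 0)" for x
 have p0: "p0 \<in> polys (int (Suc k))" unfolding p0_def[abs_def] by (intro polys_add p polys_const) simp
 have gp: "grad p0 = grad p" using C1_add(2)[OF polys_C1[OF p] C1_const(1), of "- p (vx 0)"] by (simp add: p0_def[abs_def])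
 then have cp: "curl p0 = curl p" by (simp add: fun_eq_iff curl_mk)
 have bd: "\<bar>p0 (edp i t)\<bar> \<le> real NN * E" if "i < n" "0 \<le> t" "t \<le> 1" for i t
 proof -
  have "\<bar>p0 (edp i t)\<bar> \<le> real n * E" by (rule boundary_walk[OF polys_C1[OF p0] _ _ that]) (use E in \<open>auto simp: gp p0_def\<close>)
  also have "\<dots> \<le> real NN * E" using n_le_N E0 by (intro mult_right_mono) auto
  finally show ?thesis .
 qed
 have NE0: "0 \<le> real NN * E" using E0 by simp
 obtain P s where P: "P \<in> polys (int (Suc k))" and s: "s \<in> polys (int (Suc k) - int n)"
  and dec: "\<And>x. p0 x = P x + (\<Prod>i<n. ell i x) * s x"
  and Pb: "\<And>x. norm (x - c) \<le> 2 * h ==> \<bar>P x\<bar> \<le> ((\<Prod>j<n. 1 + C * (3 / dE) ^ j) - 1) * (real NN * E)"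
  using edge_division[OF p0 NE0 bd order_refl] by blast
 have PA: "\<bar>P x\<bar> \<le> A" if "norm (x - c) \<le> 2 * h" for x
 proof -
  have "((\<Prod>j<n. 1 + C * (3 / dE) ^ j) - 1) * (real NN * E) \<le> Q * (real NN * E)" using Qm NE0 by (intro mult_right_mono) auto
  then show ?thesis using Pb[OF that] by (simp add: A_def mult.assoc)
 qed
 have Fc2: "norm (x - c) \<le> 2 * h" if "x \<in> F" for x using near_c(2)[OF that] h_pos by linarith
 define \<beta> where "\<beta> x = (\<Prod>i<n. ell i x)" for x
 define Z where "Z = nrm (leb (ball c (r/2))) s"
 have sb: "\<bar>s x\<bar> \<le> G / (\<rho> * h) * Z" if "norm (x - c) \<le> 2 * h" for x
 proof -
  have "\<bar>s x\<bar> \<le> G / r * Z" using G[OF polys_mono[OF s] r_pos near_disc[OF that]] unfolding Z_def by simp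
  also have "\<dots> \<le> G / (\<rho> * h) * Z" using G_pos r_ge rho(1) h_pos r_pos by (intro mult_right_mono divide_left_mono) (auto simp: Z_def)
  finally show ?thesis .
 qed
 obtain u where u: "u \<in> polys (int (Suc k) - int n)" and us: "\<And>x. 2 * u x + grad u x \<bullet> (x - b) = s x"
  and ub: "\<And>x M. (\<And>t. 0 \<le> t ==> t \<le> 1 ==> \<bar>s (b + t *\<^sub>R (x - b))\<bar> \<le> M) ==> \<bar>u x\<bar> \<le> M"
  using radial_inverse[OF s, of b] by meson
 have uF: "\<bar>u x\<bar> \<le> G / (\<rho> * h) * Z" if "x \<in> F" for x by (rule ub, rule sb, rule near_segment(2)[OF b near_c(2)[OF that]])
 have uC: "continuous_on S u" and sC: "continuous_on S s" and PC: "C1 P" and bsC: "C1 (\<lambda>x. \<beta> x * s x)" and bC: "continuous_on S \<beta>" for S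
  unfolding \<beta>_def by (intro C1_continuous polys_C1[OF u] polys_C1[OF s] polys_C1[OF P] polys_C1[OF polys_mult[OF prod_ell_polys s]] polys_C1[OF prod_ell_polys])+
 have Z0: "0 \<le> Z" by (simp add: Z_def)
 have "nrm ?M u \<le> 2 * h * (G / (\<rho> * h) * Z)" using uF G_pos rho(1) h_pos Z0 by (intro nrm_le_sup_h(2) cont_measurable uC) auto
 also have "\<dots> = 2 * G / \<rho> * Z" using h_pos by simp
 finally have nu: "nrm ?M u \<le> 2 * G / \<rho> * Z" .
 \<comment> \<open>On the half disc every height is at least \<open>\<rho> / 2\<close>, which bounds
   the weight from below.\<close>
 have low: "(\<rho>/2) ^ NN * Z^2 \<le> (LINT x|?M. \<beta> x * s x * s x)"
 proof -
  have rh: "\<rho> \<le> r / h" using r_ge h_pos by (simp add: field_simps)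
  have "r / h \<le> 1" using r_le_h r_pos h_pos by (simp add: field_simps)
  then have r2: "\<rho> / 2 \<le> 1" using rh by linarith
  have bl: "(\<rho>/2) ^ NN \<le> \<beta> x" if "x \<in> ball c (r/2)" for x
  proof -
   have "\<rho>/2 \<le> ell i x" for i
   proof -
    define q where "q = r / h"
    have "h * \<bar>ell i x - ell i c\<bar> \<le> h * (q / 2)" using ell_lipschitz[of i x c] that h_pos by (simp add: q_def dist_norm norm_minus_commute)
    then have "\<bar>ell i x - ell i c\<bar> \<le> q / 2" using h_pos by (simp only: mult_le_cancel_left_pos)
    moreover have "q \<le> ell i c" "\<rho> \<le> q" using ell_c(1)[of i] rh by (simp_all add: q_def)
    ultimately show ?thesis by linarith
   qed
   then have "(\<Prod>i<n. \<rho>/2) \<le> \<beta> x" unfolding \<beta>_def using rho(1) by (intro prod_mono) auto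
   moreover have "(\<rho>/2) ^ NN \<le> (\<rho>/2) ^ n" using n_le_N r2 rho(1) by (intro power_decreasing) auto
   ultimately show ?thesis by simp
  qed
  have "(\<rho>/2) ^ NN * Z^2 = (LINT x|leb (ball c (r/2)). (\<rho>/2) ^ NN * (s x)^2)" by (simp add: Z_def nrm_sq)
  also have "\<dots> \<le> (LINT x|?M. \<beta> x * (s x)^2)"
  proof (rule LINT_mono_subset)
   show "ball c (r/2) \<subseteq> F" using ball_sub r_pos by (auto simp: subset_eq)
   show "(\<rho>/2) ^ NN * (s x)^2 \<le> \<beta> x * (s x)^2" if "x \<in> ball c (r/2)" for x using bl[OF that] by (intro mult_right_mono) auto
   show "0 \<le> \<beta> x * (s x)^2" if "x \<in> F" for x
    unfolding \<beta>_def using ell_pos[OF that] by (intro mult_nonneg_nonneg prod_nonneg) (auto intro: less_imp_le)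
  qed (auto intro!: continuous_intros bC sC simp: F_ob)
  finally show ?thesis by (simp add: power2_eq_square mult.assoc)
 qed
 have "(LINT x|?M. \<beta> x * s x * s x) = (LINT x|?M. (curl (\<lambda>x. \<beta> x * s x) x \<bullet> perp (x - b)) * u x)"
  unfolding \<beta>_def using interior_moment[OF s u us s] by simp
 also have "\<dots> = (LINT x|?M. (curl p x \<bullet> perp (x - b)) * u x - (curl P x \<bullet> perp (x - b)) * u x)"
 proof -
  have "p0 = (\<lambda>x. P x + \<beta> x * s x)" using dec by (simp add: fun_eq_iff \<beta>_def)
  then have "curl p x = curl P x + curl (\<lambda>x. \<beta> x * s x) x" for x
   unfolding cp[symmetric] curl_mk using C1_add(2)[OF PC bsC] by (simp add: plane_eq_iff)
  then show ?thesis by (simp add: inner_add_left distrib_right)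
 qed
 also have "\<dots> = (LINT x|?M. (curl p x \<bullet> perp (x - b)) * u x) - (LINT x|?M. (curl P x \<bullet> perp (x - b)) * u x)"
  by (intro LINT_diff integrable_C1 continuous_intros C1_curl_continuous polys_C1[OF p] PC continuous_perp uC)
 also have "\<dots> \<le> E * h * nrm ?M u + 4 * h * (G' * A) * nrm ?M u"
 proof -
  have cc: "cont (\<lambda>x. curl P x \<bullet> perp (x - b))" by (intro continuous_intros C1_curl_continuous PC continuous_perp)
  have "norm (curl P x \<bullet> perp (x - b)) \<le> 2 * (G' * A)" if "x \<in> F" for x
  proof -
   have "norm (curl P x) \<le> G' * A / h" unfolding norm_curl G'_def using PA Fc2 that by (intro grad_bound[OF P A0]) auto
   moreover have "norm (x - b) \<le> 2 * h" by (rule near_segment(1)[OF b near_c(2)[OF that]])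
   ultimately have "norm (curl P x) * norm (perp (x - b)) \<le> G' * A / h * (2 * h)" using G' A0 h_pos by (intro mult_mono) auto
   then show ?thesis using Cauchy_Schwarz_ineq2[of "curl P x" "perp (x - b)"] h_pos by simp
  qed
  then have "nrm ?M (\<lambda>x. curl P x \<bullet> perp (x - b)) \<le> 2 * h * (2 * (G' * A))"
   using G' A0 by (intro nrm_le_sup_h(2) cont_measurable cc) auto
  moreover have "\<bar>LINT x|?M. (curl P x \<bullet> perp (x - b)) * u x\<bar> \<le> nrm ?M (\<lambda>x. curl P x \<bullet> perp (x - b)) * nrm ?M u"
   using nrm_Cauchy_Schwarz[OF sqi_C1[OF cc] sqi_C1[OF uC]] by simp
  ultimately have "\<bar>LINT x|?M. (curl P x \<bullet> perp (x - b)) * u x\<bar> \<le> 2 * h * (2 * (G' * A)) * nrm ?M u"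
   by (meson mult_right_mono nrm_nonneg order_trans)
  then show ?thesis using mom[OF u] by simp
 qed
 also have "\<dots> = h * (E + 4 * (G' * A)) * nrm ?M u" by (simp add: algebra_simps)
 also have "\<dots> \<le> h * (E + 4 * (G' * A)) * (2 * G / \<rho> * Z)" using nu h_pos E0 G' A0 by (intro mult_left_mono) auto
 finally have "(\<rho>/2) ^ NN * Z^2 \<le> h * (E + 4 * (G' * A)) * (2 * G / \<rho>) * Z" using low by (simp add: mult_ac)
 then have "(\<rho>/2) ^ NN * Z * Z \<le> h * (E + 4 * (G' * A)) * (2 * G / \<rho>) * Z" by (simp add: power2_eq_square mult.assoc)
 then have "(\<rho>/2) ^ NN * Z \<le> h * (E + 4 * (G' * A)) * (2 * G / \<rho>)"
  using Z0 h_pos E0 G' A0 G_pos rho(1) by (cases "Z = 0") (auto intro: mult_right_le_imp_le[of _ Z] simp del: times_divide_eq_right)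
 then have Zb: "Z \<le> (2/\<rho>) ^ NN * (h * (E + 4 * (G' * A)) * (2 * G / \<rho>))" using rho(1) by (simp add: field_simps)
 define S where "S = 2 * G^2 / \<rho>^2 * ((2/\<rho>) ^ NN * (E + 4 * (G' * A)))"
 have S0: "0 \<le> S" using E0 G' A0 rho(1) by (simp add: S_def)
 have sS: "\<bar>s x\<bar> \<le> S" if "norm (x - c) \<le> 2 * h" for x
 proof -
  have "\<bar>s x\<bar> \<le> G / (\<rho> * h) * ((2/\<rho>) ^ NN * (h * (E + 4 * (G' * A)) * (2 * G / \<rho>)))"
   using G_pos rho(1) h_pos Zb by (intro order_trans[OF sb[OF that]] mult_left_mono) auto
  also have "\<dots> = S" using h_pos by (simp add: S_def power2_eq_square)
  finally show ?thesis .
 qed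
 have "\<bar>p0 x\<bar> \<le> A + 3 ^ NN * S" if "x \<in> F" for x
 proof -
  have "\<bar>(\<Prod>i<n. ell i x) * s x\<bar> \<le> 3 ^ n * S" unfolding abs_mult by (intro mult_mono prod_ell_abs_le sS Fc2 that) auto
  also have "\<dots> \<le> 3 ^ NN * S" using n_le_N S0 by (intro mult_right_mono power_increasing) auto
  finally show ?thesis using PA[OF Fc2[OF that]] unfolding dec[of x] by linarith
 qed
 then have "norm (curl p x) \<le> G' * (A + 3 ^ NN * S) / h" if "x \<in> F" for x
  unfolding norm_curl gp[symmetric] G'_def using A0 S0 that by (intro grad_bound[OF p0]) (auto intro: Fc2)
 then have "nrm ?M (curl p) \<le> 2 * h * (G' * (A + 3 ^ NN * S) / h)" using G' A0 S0 h_pos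
  by (intro nrm_le_sup_h(2) cont_measurable C1_curl_continuous polys_C1[OF p]) auto
 also have "\<dots> = 2 * G' * (A + 3 ^ NN * S)" using h_pos by simp
 also have "\<dots> = stab * E"
  unfolding stab_def Let_def A_def S_def Q_def[symmetric] G'_def[symmetric] by (simp only: algebra_simps times_divide_eq_right mult_1_left mult_1_right)
 finally show ?thesis .
qed

end

section \<open>The serendipity projection\<close>

lemma grad_mon_sum:
 "C1 (\<lambda>x. \<Sum>a\<in>A. c a * mon (f a) x)"
 "grad (\<lambda>x. \<Sum>a\<in>A. c a * mon (f a) x) = (\<lambda>x. \<Sum>a\<in>A. c a *\<^sub>R
 mk (real (fst (f a)) * mon (fst (f a) - 1, snd (f a)) x) (real (snd (f a)) * mon (fst (f a), snd (f a) - 1) x))"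
 using C1_sum[of A "\<lambda>a x. c a * mon (f a) x", OF C1_cmult(1)[OF C1_mon]] by (simp_all add: C1_cmult C1_mon grad_mon)

lemma grad_mon_sum_nth:
 "grad (\<lambda>x. \<Sum>a\<in>A. c a * mon (f a) x) x $ 1 = (\<Sum>a\<in>A. (c a * real (fst (f a))) * mon (fst (f a) - 1, snd (f a)) x)"
 "grad (\<lambda>x. \<Sum>a\<in>A. c a * mon (f a) x) x $ 2 = (\<Sum>a\<in>A. (c a * real (snd (f a))) * mon (fst (f a), snd (f a) - 1) x)"
 by (simp_all add: grad_mon_sum(2) mult.assoc)

lemma mixed_partials:
 assumes "p \<in> polys k"
 shows "grad (\<lambda>x. grad p x $ 2) x $ 1 = grad (\<lambda>x. grad p x $ 1) x $ 2"
proof -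
 obtain c where p: "p = (\<lambda>x. \<Sum>a\<in>idx k. c a * mon a x)" using assms by (rule polysE)
 show ?thesis unfolding p grad_mon_sum_nth(1)[where f="\<lambda>a. a"] grad_mon_sum_nth(2)[where f="\<lambda>a. a"]
  unfolding grad_mon_sum_nth(1)[where f="\<lambda>a. (fst a, snd a - 1)"] grad_mon_sum_nth(2)[where f="\<lambda>a. (fst a - 1, snd a)"]
  by (intro sum.cong) (auto simp: mult_ac)
qed

definition dv :: "(plane => plane) => plane => real" where
 "dv q x = grad (\<lambda>x. q x $ 1) x $ 1 + grad (\<lambda>x. q x $ 2) x $ 2"

lemma vec_polys_C1: "q \<in> vec_polys k ==> C1 (\<lambda>x. q x $ i)" by (rule polys_C1[OF vec_polysD])

lemma dv_polys: "q \<in> vec_polys k ==> dv q \<in> polys (k - 1)"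
 unfolding dv_def[abs_def] by (intro polys_add polys_grad vec_polysD)

lemma dv_add:
 assumes "q \<in> vec_polys k" "q' \<in> vec_polys k"
 shows "dv (\<lambda>x. q x + q' x) x = dv q x + dv q' x" "dv (\<lambda>x. q x - q' x) x = dv q x - dv q' x"
proof -
 note C = vec_polys_C1[OF assms(1)] vec_polys_C1[OF assms(2)]
 show "dv (\<lambda>x. q x + q' x) x = dv q x + dv q' x" by (simp add: dv_def C1_add[OF C])
 have "grad (\<lambda>x. q x $ i - q' x $ i) = (\<lambda>x. grad (\<lambda>x. q x $ i) x - grad (\<lambda>x. q' x $ i) x)" for i
  using C1_add(2)[OF C(1) C1_cmult(1)[OF C(2)], of i "-1" i] C1_cmult(2)[OF C(2), of "-1" i] by simp
 then show "dv (\<lambda>x. q x - q' x) x = dv q x - dv q' x" by (simp add: dv_def)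
qed

lemma curl_vec_polys: "p \<in> polys (k + 1) ==> curl p \<in> vec_polys k"
 using vec_polys_mk[of "\<lambda>x. grad p x $ 2" k "\<lambda>x. - grad p x $ 1"] polys_grad[of p "k + 1"] polys_uminus by (simp add: curl_mk[abs_def])

lemma dv_curl: assumes "p \<in> polys (k + 1)" shows "dv (curl p) x = 0"
proof -
 have "(\<lambda>x. grad p x $ 1) \<in> polys k" using polys_grad[OF assms] by simp
 from C1_cmult(2)[OF polys_C1[OF this], of "-1"]
 show ?thesis using mixed_partials[OF assms, of x] by (simp add: dv_def curl_mk)
qed

text \<open>The first component is integrated in the second variable. Vanishing divergence makes the
  remaining defect independent of the second variable, so it is integrated in the first. Working on
  coefficients keeps the degree under control.\<close>

lemma stream_function:
 assumes q: "q \<in> vec_polys k" and d: "\<And>x. dv q x = 0"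
 shows "\<exists>p\<in>polys (k + 1). curl p = q"
proof -
 obtain c where c: "(\<lambda>x. q x $ 1) = (\<lambda>x. \<Sum>a\<in>idx k. c a * mon a x)" using vec_polysD[OF q] by (rule polysE)
 define P where "P = (\<lambda>x. \<Sum>a\<in>idx k. (c a / real (snd a + 1)) * mon (fst a, snd a + 1) x)"
 have P: "P \<in> polys (k + 1)" unfolding P_def by (intro polys_sum polys_cmult polys_mon) (auto simp: idx_def)
 have P2: "grad P x $ 2 = q x $ 1" for x unfolding P_def grad_mon_sum_nth(2) using fun_cong[OF c, of x] by simp
 define f where "f x = - q x $ 2 - grad P x $ 1" for x
 have P1: "(\<lambda>x. grad P x $ 1) \<in> polys k" using polys_grad[OF P] by simp
 have f: "f \<in> polys k" unfolding f_def[abs_def] by (intro polys_diff polys_uminus vec_polysD q P1)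
 have f2: "grad f x $ 2 = 0" for x
 proof -
  have "f = (\<lambda>x. (-1) * q x $ 2 + (-1) * grad P x $ 1)" by (simp add: f_def fun_eq_iff)
  then have "grad f x = (-1) *\<^sub>R grad (\<lambda>x. q x $ 2) x + (-1) *\<^sub>R grad (\<lambda>x. grad P x $ 1) x"
   by (simp only: C1_add(2)[OF C1_cmult(1)[OF vec_polys_C1[OF q]] C1_cmult(1)[OF polys_C1[OF P1]]]
   C1_cmult(2)[OF vec_polys_C1[OF q]] C1_cmult(2)[OF polys_C1[OF P1]])
  then have "grad f x $ 2 = - (grad (\<lambda>x. q x $ 2) x $ 2 + grad (\<lambda>x. grad P x $ 1) x $ 2)" by simp
  also have "grad (\<lambda>x. grad P x $ 1) x $ 2 = grad (\<lambda>x. q x $ 1) x $ 1" unfolding mixed_partials[OF P, symmetric] P2 ..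
  finally show ?thesis using d[of x] by (simp add: dv_def)
 qed
 have fx: "f x = f (mk (x $ 1) 0)" for x
 proof -
  have "\<forall>s. ((\<lambda>s. f (mk (x $ 1) 0 + s *\<^sub>R mk 0 1)) has_real_derivative 0) (at s)"
   using C1_ray_derivative[OF polys_C1[OF f], of "mk (x $ 1) 0" "mk 0 1"] by (simp add: plane_inner f2)
  then have "f (mk (x $ 1) 0 + (x $ 2) *\<^sub>R mk 0 1) = f (mk (x $ 1) 0 + 0 *\<^sub>R mk 0 1)" by (rule DERIV_isconst_all)
  moreover have "mk (x $ 1) 0 + (x $ 2) *\<^sub>R mk 0 1 = x" by (simp add: plane_eq_iff)
  ultimately show ?thesis by simp
 qed
 obtain e where e: "f = (\<lambda>x. \<Sum>a\<in>idx k. e a * mon a x)" using f by (rule polysE)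
 define Q where "Q = (\<lambda>x. \<Sum>a\<in>idx k. (if snd a = 0 then e a / real (fst a + 1) else 0) * mon (fst a + 1, 0) x)"
 have Q: "Q \<in> polys (k + 1)" unfolding Q_def by (intro polys_sum polys_cmult polys_mon) (auto simp: idx_def)
 have Q2: "grad Q x $ 2 = 0" for x unfolding Q_def grad_mon_sum_nth(2) by simp
 have Q1: "grad Q x $ 1 = f x" for x unfolding fx[of x] unfolding Q_def grad_mon_sum_nth(1) e by (intro sum.cong) (auto simp: mon_def power_0_left)
 have "curl (\<lambda>x. P x + Q x) x = q x" for x
  unfolding curl_mk C1_add(2)[OF polys_C1[OF P] polys_C1[OF Q]] by (simp add: plane_eq_iff P2 Q1 Q2 f_def)
 then show ?thesis by (intro bexI[of _ "\<lambda>x. P x + Q x"] polys_add P Q) auto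
qed

text \<open>Along each ray from \<open>b\<close>, \<open>s^2 * t\<close> is constant and starts at
  zero.\<close>

lemma radial_injective:
 assumes C: "C1 t" and z: "\<And>x. 2 * t x + grad t x \<bullet> (x - b) = 0" shows "t x = 0"
proof -
 let ?f = "\<lambda>s. s^2 * t (b + s *\<^sub>R (x - b))"
 have "(?f has_real_derivative 0) (at s)" for s
 proof -
  have "(?f has_real_derivative s^2 * (grad t (b + s *\<^sub>R (x - b)) \<bullet> (x - b)) + 2 * s * t (b + s *\<^sub>R (x - b))) (at s)"
   by (rule DERIV_cong, rule DERIV_mult, rule derivative_eq_intros, rule DERIV_ident, rule refl, rule C1_ray_derivative[OF C]) simp
  moreover have "s^2 * (grad t (b + s *\<^sub>R (x - b)) \<bullet> (x - b)) + 2 * s * t (b + s *\<^sub>R (x - b)) = 0"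
   using arg_cong[OF z[of "b + s *\<^sub>R (x - b)"], of "\<lambda>u. s * u"] by (simp add: power2_eq_square algebra_simps)
  ultimately show ?thesis by simp
 qed
 then have "?f 1 = ?f 0" by (intro DERIV_isconst_all allI)
 then show ?thesis by simp
qed

section \<open>Prescribed divergence, boundary and moment conditions\<close>

context star_polygon
begin

text \<open>The normal component of a curl is the tangential derivative of the stream function, up
  to orientation.\<close>

lemma curl_nv: "len i * (curl p x \<bullet> nv i) = sgn (D i) * (grad p x \<bullet> (vx (Suc i) - vx i))"
 using nv_inner[of i "curl p x"] by (simp add: inner_commute curl_mk wedge_def plane_inner algebra_simps)

lemma curl_nv_zero:
 assumes C: "C1 p" and z: "\<And>t. p (edp i t) = 0" shows "curl p (edp i t) \<bullet> nv i = 0"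
proof -
 let ?e = "vx (Suc i) - vx i"
 have ep: "edp i t = vx i + t *\<^sub>R ?e" for t by (simp add: linepath_def algebra_simps)
 have "((\<lambda>s. p (vx i + s *\<^sub>R ?e)) has_real_derivative (grad p (vx i + t *\<^sub>R ?e) \<bullet> ?e)) (at t)"
  by (rule C1_ray_derivative[OF C])
 moreover have "(\<lambda>s. p (vx i + s *\<^sub>R ?e)) = (\<lambda>s. 0)" using z unfolding ep by simp
 ultimately have "grad p (vx i + t *\<^sub>R ?e) \<bullet> ?e = 0" using DERIV_unique[OF DERIV_const] by fastforce
 then show ?thesis using curl_nv[of i p "edp i t"] edge_length_pos[of i] unfolding ep by simp
qed

abbreviation "M01 \<equiv> leb {0..1::real}"

lemma edge_integral_LINT: "EI i f = len i * (LINT t|M01. f (edp i t))" by (simp add: edge_integral_def)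

lemma sqi_mult_int:
 fixes f g :: "real => real"
 shows "sqi M f ==> sqi M g ==> integrable M (\<lambda>x. f x * g x)" using sqi_inner[of M f g] by simp

lemma edge_integral_diff:
 assumes "sqi M01 (\<lambda>t. g (edp i t))" "sqi M01 (\<lambda>t. g' (edp i t))" "sqi M01 (\<lambda>t. f (edp i t))"
 shows "EI i (\<lambda>x. (g x - g' x) * f x) = EI i (\<lambda>x. g x * f x) - EI i (\<lambda>x. g' x * f x)"
 using sqi_mult_int[OF assms(1,3)] sqi_mult_int[OF assms(2,3)] by (simp add: edge_integral_LINT left_diff_distrib right_diff_distrib)

lemma field_green:
 assumes q: "q \<in> vec_polys k" and C: "C1 \<phi>"
 shows "(LINT x|leb F. q x \<bullet> grad \<phi> x) + (LINT x|leb F. dv q x * \<phi> x) =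
 (\<Sum>i<n. EI i (\<lambda>x. (q x \<bullet> nv i) * \<phi> x))"
proof -
 have qC: "C1 (\<lambda>x. q x $ j)" for j by (rule vec_polys_C1[OF q])
 note m = C1_mult[OF qC C]
 have 1: "(LINT x|leb F. q x $ j * grad \<phi> x $ j + grad (\<lambda>x. q x $ j) x $ j * \<phi> x) =
  (\<Sum>i<n. EI i (\<lambda>x. q x $ j * \<phi> x) * nv i $ j)" for j
  using divergence_theorem[OF m(1), of j "axis j 1"] unfolding m(2) by (simp add: inner_axis inner_add_left mult.commute)
 have gj: "cont (\<lambda>x. q x $ j)" "cont (\<lambda>x. grad \<phi> x $ j)" "cont (\<lambda>x. grad (\<lambda>x. q x $ j) x $ j)" "cont \<phi>" for j
  by (intro continuous_intros C1_continuous C1_grad_continuous qC C)+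
 have i: "integrable (leb F) (\<lambda>x. q x $ j * grad \<phi> x $ j)" "integrable (leb F) (\<lambda>x. grad (\<lambda>x. q x $ j) x $ j * \<phi> x)" for j
  by (intro integrable_C1 continuous_intros gj)+
 have ei: "integrable M01 (\<lambda>t. q (edp i t) $ j * \<phi> (edp i t))" for i j by (intro sqi_mult_int sqi_edge gj)
 have "(LINT x|leb F. q x \<bullet> grad \<phi> x) + (LINT x|leb F. dv q x * \<phi> x) =
  (\<Sum>i<n. EI i (\<lambda>x. q x $ 1 * \<phi> x) * nv i $ 1) + (\<Sum>i<n. EI i (\<lambda>x. q x $ 2 * \<phi> x) * nv i $ 2)"
  unfolding 1[symmetric] plane_inner dv_def distrib_right using i[of 1] i[of 2] by simp
 also have "\<dots> = (\<Sum>i<n. EI i (\<lambda>x. (q x \<bullet> nv i) * \<phi> x))" unfolding sum.distrib[symmetric]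
 proof (rule sum.cong[OF refl])
  fix i
  have "(LINT t|M01. (q (edp i t) \<bullet> nv i) * \<phi> (edp i t)) =
   (LINT t|M01. (q (edp i t) $ 1 * \<phi> (edp i t)) * nv i $ 1 + (q (edp i t) $ 2 * \<phi> (edp i t)) * nv i $ 2)"
   by (simp add: plane_inner algebra_simps)
  also have "\<dots> = (LINT t|M01. q (edp i t) $ 1 * \<phi> (edp i t)) * nv i $ 1 + (LINT t|M01. q (edp i t) $ 2 * \<phi> (edp i t)) * nv i $ 2"
   using ei[of i 1] ei[of i 2] by simp
  finally show "EI i (\<lambda>x. q x $ 1 * \<phi> x) * nv i $ 1 + EI i (\<lambda>x. q x $ 2 * \<phi> x) * nv i $ 2 =
   EI i (\<lambda>x. (q x \<bullet> nv i) * \<phi> x)"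
   by (simp add: edge_integral_LINT algebra_simps)
 qed
 finally show ?thesis .
qed

text \<open>The defining conditions of the serendipity projection in terms of prescribed data: moments
  of \<open>v\<close>, normal traces \<open>g\<close> and divergence \<open>d\<close>.\<close>

definition ser :: "nat => plane => (plane => plane) => (nat => plane => real) => (plane => real) => (plane => plane) => bool" where
 "ser k b v g d q \<longleftrightarrow> q \<in> vec_polys (int k) \<and> (\<forall>x. dv q x = d x) \<and>
 (\<forall>p\<in>polys (int k + 1). (\<Sum>i<n. EI i (\<lambda>x. (g i x - q x \<bullet> nv i) * (curl p x \<bullet> nv i))) = 0) \<and>
 (\<forall>p\<in>polys (int k + 1 - int n). (LINT x|leb F. ((v x - q x) \<bullet> perp (x - b)) * p x) = 0)"

lemma radial_field:
 assumes d: "d \<in> polys (int k - 1)" and dt: "dt \<in> polys (int k - 1)" "\<And>x. 2 * dt x + grad dt x \<bullet> (x - b) = d x"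
 shows "(\<lambda>x. dt x *\<^sub>R (x - b)) \<in> vec_polys (int k)" "dv (\<lambda>x. dt x *\<^sub>R (x - b)) x = d x"
proof -
 have a: "(\<lambda>x. (x - b) $ j) \<in> polys 1" for j using polys_affine1[of "- b $ j" 1 j] by simp
 have "(\<lambda>x. dt x * (x - b) $ j) \<in> polys (int k)" for j using polys_mult[OF dt(1) a[of j]] by simp
 then show "(\<lambda>x. dt x *\<^sub>R (x - b)) \<in> vec_polys (int k)" by (simp add: vec_polys_def)
 have g: "grad (\<lambda>x. (x - b) $ j) x = axis j 1" for j x using C1_linear(2)[of b "axis j 1"] by (simp add: inner_axis fun_eq_iff)
 have m: "grad (\<lambda>x. dt x * (x - b) $ j) x $ j = dt x + (x - b) $ j * grad dt x $ j" for j x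
  unfolding C1_mult(2)[OF polys_C1[OF dt(1)] polys_C1[OF a]] g by (simp add: axis_def)
 show "dv (\<lambda>x. dt x *\<^sub>R (x - b)) x = d x" using m[of 1 x] m[of 2 x] by (simp add: dv_def plane_inner mult.commute flip: dt(2))
qed

lemma sqi_normal: "q \<in> vec_polys k ==> sqi M01 (\<lambda>t. q (edp i t) \<bullet> nv i)"
 by (intro sqi_edge[of "\<lambda>x. q x \<bullet> nv i"] continuous_intros vec_polys_continuous)

text \<open>The residual is orthogonal to the normal trace of \<open>curl p\<close>, so by
  Pythagoras that trace is no larger than the data \<open>G\<close>. Passing to the derivative along
  the edge costs a factor \<open>len i\<close>, absorbed by \<open>h\<close>.\<close>

lemma edge_term_bound:
 assumes G: "\<And>i. i < n ==> sqi M01 (\<lambda>t. G i (edp i t))" and p: "p \<in> polys (k + 1)"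
 and o: "(\<Sum>i<n. EI i (\<lambda>x. (G i x - curl p x \<bullet> nv i) * (curl p x \<bullet> nv i))) = 0"
 and E: "0 \<le> E" "h * (\<Sum>i<n. EI i (\<lambda>x. (G i x)^2)) \<le> E^2" and i: "i < n"
 shows "nrm M01 (\<lambda>t. grad p (edp i t) \<bullet> (vx (Suc i) - vx i)) \<le> E"
proof -
 have f: "sqi M01 (\<lambda>t. curl p (edp i t) \<bullet> nv i)" for i by (rule sqi_normal[OF curl_vec_polys[OF p]])
 have sq: "EI i (\<lambda>x. (curl p x \<bullet> nv i)^2) \<le> EI i (\<lambda>x. (G i x)^2) - 2 * EI i (\<lambda>x. (G i x - curl p x \<bullet> nv i) * (curl p x \<bullet> nv i))"
  if "i < n" for i
 proof -
  let ?g = "\<lambda>t. G i (edp i t)" and ?f = "\<lambda>t. curl p (edp i t) \<bullet> nv i"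
  note I = sqi_mult_int[OF G[OF that] G[OF that]] sqi_mult_int[OF G[OF that] f[of i]] sqi_mult_int[OF f[of i] f[of i]]
  have "0 \<le> (LINT t|M01. (?g t - ?f t)^2)" by simp
  also have "(\<lambda>t. (?g t - ?f t)^2) = (\<lambda>t. (?g t * ?g t - 2 * (?g t * ?f t - ?f t * ?f t)) - ?f t * ?f t)"
   by (simp add: fun_eq_iff power2_eq_square algebra_simps)
  also have "(LINT t|M01. (?g t * ?g t - 2 * (?g t * ?f t - ?f t * ?f t)) - ?f t * ?f t) =
   (LINT t|M01. ?g t * ?g t) - 2 * (LINT t|M01. ?g t * ?f t - ?f t * ?f t) - (LINT t|M01. ?f t * ?f t)"
   using I by simp
  finally have "len i * (LINT t|M01. ?f t * ?f t) \<le>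
   len i * ((LINT t|M01. ?g t * ?g t) - 2 * (LINT t|M01. ?g t * ?f t - ?f t * ?f t))"
   using edge_length_pos[of i] by (intro mult_left_mono) auto
  then show ?thesis by (simp add: edge_integral_LINT power2_eq_square algebra_simps)
 qed
 let ?N = "nrm M01 (\<lambda>t. curl p (edp i t) \<bullet> nv i)"
 have "len i * ?N^2 = EI i (\<lambda>x. (curl p x \<bullet> nv i)^2)" by (simp add: edge_integral_abs_sq)
 also have "\<dots> \<le> (\<Sum>i<n. EI i (\<lambda>x. (curl p x \<bullet> nv i)^2))"
  using i edge_length_pos by (intro member_le_sum) (auto simp: edge_integral_abs_sq less_imp_le[OF edge_length_pos])
 also have "\<dots> \<le> (\<Sum>i<n. EI i (\<lambda>x. (G i x)^2) - 2 * EI i (\<lambda>x. (G i x - curl p x \<bullet> nv i) * (curl p x \<bullet> nv i)))"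
  by (intro sum_mono sq) auto
 also have "\<dots> = (\<Sum>i<n. EI i (\<lambda>x. (G i x)^2))" using o by (simp add: sum_subtractf flip: sum_distrib_left)
 finally have "len i * (len i * ?N^2) \<le> h * (\<Sum>i<n. EI i (\<lambda>x. (G i x)^2))"
  using edge_length_pos[of i] edge_length_le[of i] h_pos by (intro mult_mono) auto
 then have "(len i * ?N)^2 \<le> E^2" using E(2) by (simp add: power2_eq_square mult_ac)
 then have "len i * ?N \<le> E" using E(1) by (rule power2_le_imp_le)
 moreover have "grad p x \<bullet> (vx (Suc i) - vx i) = (sgn (D i) * len i) *\<^sub>R (curl p x \<bullet> nv i)" for x
 proof -
  have "sgn (D i) * sgn (D i) = 1" using D_nz[of i] by (simp add: sgn_if)
  then show ?thesis using arg_cong[OF curl_nv[of i p x], of "\<lambda>u. sgn (D i) * u"] by (simp add: mult.assoc[symmetric])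
 qed
 then have "nrm M01 (\<lambda>t. grad p (edp i t) \<bullet> (vx (Suc i) - vx i)) = \<bar>sgn (D i) * len i\<bar> * ?N" by (simp only: nrm_scale)
 moreover have "\<bar>sgn (D i) * len i\<bar> = len i" using D_nz[of i] edge_length_pos[of i] by (simp add: abs_mult abs_sgn_eq)
 ultimately show ?thesis by simp
qed

end

context serendipity_polygon
begin

lemma moment_integrable:
 assumes "sqi (leb F) w" "cont t"
 shows "integrable (leb F) (\<lambda>x. (w x \<bullet> perp (x - b)) * t x)"
 using sqi_inner[OF assms(1) sqi_C1[of "\<lambda>x. t x *\<^sub>R perp (x - b)"]] assms(2) continuous_perp
 by (simp add: continuous_intros mult.commute)

text \<open>\<open>q - q1\<close> has zero divergence and therefore a stream function, to which
  \<open>curl_bound\<close> applies. \<open>q1\<close> is any comparison field with the prescribed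
  divergence; \<open>E\<close> measures its misfit in the traces and in the interior.\<close>

lemma ser_bound:
 assumes v: "sqi (leb F) v" and g: "\<And>i. i < n ==> sqi M01 (\<lambda>t. g i (edp i t))"
 and q1: "q1 \<in> vec_polys (int k)" "\<And>x. dv q1 x = d x" and s: "ser k b v g d q" and b: "norm (b - c) \<le> h"
 and E: "0 \<le> E" "h * (\<Sum>i<n. EI i (\<lambda>x. (g i x - q1 x \<bullet> nv i)^2)) \<le> E^2" "2 * nrm (leb F) (\<lambda>x. v x - q1 x) \<le> E"
 shows "nrm (leb F) (\<lambda>x. q x - q1 x) \<le> stab * E"
proof -
 let ?M = "leb F"
 have q: "q \<in> vec_polys (int k)" "\<And>x. dv q x = d x"
  and sa: "\<And>p. p \<in> polys (int k + 1) ==> (\<Sum>i<n. EI i (\<lambda>x. (g i x - q x \<bullet> nv i) * (curl p x \<bullet> nv i))) = 0"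
  and sd: "\<And>p. p \<in> polys (int k + 1 - int n) ==> (LINT x|?M. ((v x - q x) \<bullet> perp (x - b)) * p x) = 0"
  using s by (auto simp: ser_def)
 obtain p where p: "p \<in> polys (int k + 1)" and cp: "curl p = (\<lambda>x. q x - q1 x)"
  using stream_function[OF vec_polys_diff[OF q(1) q1(1)]] by (auto simp: dv_add[OF q(1) q1(1)] q(2) q1(2))
 have p': "p \<in> polys (int (Suc k))" using p by (simp add: add.commute)
 have sq: "sqi ?M q" "sqi ?M q1" by (intro sqi_C1 vec_polys_continuous[OF q(1)] vec_polys_continuous[OF q1(1)])+
 have "nrm ?M (curl p) \<le> stab * E"
 proof (rule curl_bound[OF b p'])
  fix i assume i: "i < n"
  show "nrm M01 (\<lambda>t. grad p (edp i t) \<bullet> (vx (Suc i) - vx i)) \<le> E"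
  proof (rule edge_term_bound[OF _ p _ E(1,2) i])
   show "sqi M01 (\<lambda>t. g i (edp i t) - q1 (edp i t) \<bullet> nv i)" if "i < n" for i by (intro sqi_diff g that sqi_normal[OF q1(1)])
   show "(\<Sum>i<n. EI i (\<lambda>x. (g i x - q1 x \<bullet> nv i - curl p x \<bullet> nv i) * (curl p x \<bullet> nv i))) = 0"
    using sa[OF p] by (simp add: cp inner_diff_left)
  qed
 next
  fix t assume "t \<in> polys (int (Suc k) - int n)"
  then have t: "t \<in> polys (int k + 1 - int n)" by (simp add: add.commute)
  have tC: "continuous_on S t" for S by (intro C1_continuous polys_C1[OF t])
  note I = moment_integrable[OF sqi_diff[OF v sq(1)] tC, of b] moment_integrable[OF sqi_diff[OF v sq(2)] tC, of b]
  have "(LINT x|?M. (curl p x \<bullet> perp (x - b)) * t x) =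
   (LINT x|?M. ((v x - q1 x) \<bullet> perp (x - b)) * t x - ((v x - q x) \<bullet> perp (x - b)) * t x)"
   by (simp add: cp inner_diff_left algebra_simps)
  also have "\<dots> = (LINT x|?M. (v x - q1 x) \<bullet> (t x *\<^sub>R perp (x - b)))" using I sd[OF t] by (simp add: mult.commute)
  also have "\<bar>\<dots>\<bar> \<le> nrm ?M (\<lambda>x. v x - q1 x) * nrm ?M (\<lambda>x. t x *\<^sub>R perp (x - b))"
   by (intro nrm_Cauchy_Schwarz sqi_diff v sq sqi_C1 continuous_intros tC continuous_perp)
  also have "nrm ?M (\<lambda>x. t x *\<^sub>R perp (x - b)) \<le> nrm ?M (\<lambda>x. (2 * h) *\<^sub>R t x)" unfolding nrm_def
  proof (rule real_sqrt_le_mono, rule integral_mono)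
   fix x assume "x \<in> space ?M"
   then have "norm (x - b) \<le> 2 * h" using near_segment(1)[OF b near_c(2)] by (simp add: space_restrict_space)
   then have "\<bar>t x\<bar> * norm (x - b) \<le> \<bar>t x\<bar> * (2 * h)" by (intro mult_left_mono) auto
   then show "(norm (t x *\<^sub>R perp (x - b)))^2 \<le> (norm ((2 * h) *\<^sub>R t x))^2"
    using h_pos by (intro power_mono) (auto simp: abs_mult mult_ac)
  qed (intro integrable_C1 continuous_intros tC continuous_perp)+
  finally have "\<bar>LINT x|?M. (curl p x \<bullet> perp (x - b)) * t x\<bar> \<le> nrm ?M (\<lambda>x. v x - q1 x) * ((2 * h) * nrm ?M t)"
   using h_pos by (simp only: nrm_scale) (simp add: mult_left_mono)
  also have "\<dots> = (2 * nrm ?M (\<lambda>x. v x - q1 x)) * (h * nrm ?M t)" by simp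
  also have "\<dots> \<le> E * (h * nrm ?M t)" using h_pos by (intro mult_right_mono E(3)) auto
  finally show "\<bar>LINT x|?M. (curl p x \<bullet> perp (x - b)) * t x\<bar> \<le> E * h * nrm ?M t" by simp
 qed
 then show ?thesis by (simp add: cp)
qed

lemma ser_unique:
 assumes v: "sqi (leb F) v" and g: "\<And>i. i < n ==> sqi M01 (\<lambda>t. g i (edp i t))"
 and b: "norm (b - c) \<le> h" and s: "ser k b v g d q" "ser k b v g d q'"
 shows "q = q'"
proof -
 let ?M = "leb F"
 have q: "q \<in> vec_polys (int k)" "q' \<in> vec_polys (int k)" using s by (auto simp: ser_def)
 have sq: "sqi ?M q" "sqi ?M q'" by (intro sqi_C1 vec_polys_continuous[OF q(1)] vec_polys_continuous[OF q(2)])+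
 \<comment> \<open>By linearity \<open>q\<close> also solves the problem whose data are those of
   \<open>q'\<close>; for these data the comparison field \<open>q'\<close> has misfit zero.\<close>
 have "ser k b q' (\<lambda>i x. q' x \<bullet> nv i) d q" unfolding ser_def
 proof (intro conjI ballI)
  show "q \<in> vec_polys (int k)" by (rule q)
  show "\<forall>x. dv q x = d x" using s(1) by (simp add: ser_def)
 next
  fix p assume p: "p \<in> polys (int k + 1)"
  have f: "sqi M01 (\<lambda>t. curl p (edp i t) \<bullet> nv i)" for i by (rule sqi_normal[OF curl_vec_polys[OF p]])
  have "EI i (\<lambda>x. (q' x \<bullet> nv i - q x \<bullet> nv i) * (curl p x \<bullet> nv i)) =
   EI i (\<lambda>x. (g i x - q x \<bullet> nv i) * (curl p x \<bullet> nv i)) - EI i (\<lambda>x. (g i x - q' x \<bullet> nv i) * (curl p x \<bullet> nv i))"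
   if i: "i < n" for i
   by (simp add: edge_integral_diff[OF g[OF i] sqi_normal[OF q(1)] f] edge_integral_diff[OF g[OF i] sqi_normal[OF q(2)] f]
   edge_integral_diff[OF sqi_normal[OF q(2)] sqi_normal[OF q(1)] f])
  then show "(\<Sum>i<n. EI i (\<lambda>x. (q' x \<bullet> nv i - q x \<bullet> nv i) * (curl p x \<bullet> nv i))) = 0"
   using s p by (simp add: ser_def sum_subtractf)
 next
  fix p assume p: "p \<in> polys (int k + 1 - int n)"
  have pC: "cont p" by (intro C1_continuous polys_C1[OF p])
  note I = moment_integrable[OF sqi_diff[OF v sq(1)] pC, of b] moment_integrable[OF sqi_diff[OF v sq(2)] pC, of b]
  have "(LINT x|?M. ((q' x - q x) \<bullet> perp (x - b)) * p x) = (LINT x|?M. ((v x - q x) \<bullet> perp (x - b)) * p x - ((v x - q' x) \<bullet> perp (x - b)) * p x)"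
   by (simp add: inner_diff_left algebra_simps)
  then show "(LINT x|?M. ((q' x - q x) \<bullet> perp (x - b)) * p x) = 0" unfolding LINT_diff[OF I] using s p by (simp add: ser_def)
 qed
 from ser_bound[OF sq(2) sqi_normal[OF q(2)] q(2) _ this b, of 0]
 have "nrm ?M (\<lambda>x. q x - q' x) \<le> 0" using s(2) by (simp add: ser_def edge_integral_def nrm_def)
 then have "nrm ?M (\<lambda>x. q x - q' x) = 0" by (simp add: antisym)
 from vec_poly_nrm_zero[OF vec_polys_diff[OF q] this] show ?thesis by (simp add: fun_eq_iff)
qed

lemma curl_linear:
 assumes "p \<in> polys j" "p' \<in> polys j'"
 shows "curl (\<lambda>x. p x + p' x) x = curl p x + curl p' x" "curl (\<lambda>x. a * p x) x = a *\<^sub>R curl p x"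
 using C1_add(2)[OF polys_C1[OF assms(1)] polys_C1[OF assms(2)]] C1_cmult(2)[OF polys_C1[OF assms(1)], of a] by (simp_all add: curl_mk plane_eq_iff)

text \<open>Treats the boundary conditions alone. The form is degenerate, but the functional sees
  \<open>p\<close> only through the normal traces of \<open>curl p\<close>, so it vanishes on the
  kernel.\<close>

lemma boundary_least_squares:
 assumes g: "\<And>i. i < n ==> sqi M01 (\<lambda>t. g i (edp i t))"
 shows "\<exists>u\<in>polys (j + 1). \<forall>p\<in>polys (j + 1). (\<Sum>i<n. EI i (\<lambda>x. (curl u x \<bullet> nv i) * (curl p x \<bullet> nv i))) =
 (\<Sum>i<n. EI i (\<lambda>x. g i x * (curl p x \<bullet> nv i)))"
proof (rule riesz_polys)
 have f: "sqi M01 (\<lambda>t. curl p (edp i t) \<bullet> nv i)" if "p \<in> polys (j + 1)" for p i by (rule sqi_normal[OF curl_vec_polys[OF that]])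
 fix p q s :: "plane => real" and a :: real
 assume p: "p \<in> polys (j + 1)"
 show "(\<Sum>i<n. EI i (\<lambda>x. (curl (\<lambda>x. a * p x) x \<bullet> nv i) * (curl s x \<bullet> nv i))) = a * (\<Sum>i<n. EI i (\<lambda>x. (curl p x \<bullet> nv i) * (curl s x \<bullet> nv i)))"
  by (simp add: curl_linear(2)[OF p p] sum_distrib_left edge_integral_LINT mult.assoc mult.left_commute)
 show "(\<Sum>i<n. EI i (\<lambda>x. g i x * (curl (\<lambda>x. a * p x) x \<bullet> nv i))) = a * (\<Sum>i<n. EI i (\<lambda>x. g i x * (curl p x \<bullet> nv i)))"
  by (simp add: curl_linear(2)[OF p p] sum_distrib_left edge_integral_LINT mult.left_commute)
 show "(\<Sum>i<n. EI i (\<lambda>x. (curl p x \<bullet> nv i) * (curl q x \<bullet> nv i))) = (\<Sum>i<n. EI i (\<lambda>x. (curl q x \<bullet> nv i) * (curl p x \<bullet> nv i)))"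
  by (simp add: mult.commute)
 have e: "EI i (\<lambda>x. (curl p x \<bullet> nv i) * (curl p x \<bullet> nv i)) = len i * (nrm M01 (\<lambda>t. curl p (edp i t) \<bullet> nv i))^2" for i
  using edge_integral_abs_sq[of i "\<lambda>x. curl p x \<bullet> nv i"] by (simp add: power2_eq_square)
 have e0: "0 \<le> len i * (nrm M01 (\<lambda>t. curl p (edp i t) \<bullet> nv i))^2" for i using edge_length_pos[of i] by simp
 show "0 \<le> (\<Sum>i<n. EI i (\<lambda>x. (curl p x \<bullet> nv i) * (curl p x \<bullet> nv i)))" unfolding e by (intro sum_nonneg e0)
 show "(\<Sum>i<n. EI i (\<lambda>x. g i x * (curl p x \<bullet> nv i))) = 0" if z: "(\<Sum>i<n. EI i (\<lambda>x. (curl p x \<bullet> nv i) * (curl p x \<bullet> nv i))) = 0"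
 proof (rule sum.neutral, rule ballI)
  fix i assume i: "i \<in> {..<n}"
  have "len i * (nrm M01 (\<lambda>t. curl p (edp i t) \<bullet> nv i))^2 = 0" using z i e0 unfolding e by (subst (asm) sum_nonneg_eq_0_iff) auto
  then have "nrm M01 (\<lambda>t. curl p (edp i t) \<bullet> nv i) = 0" using edge_length_pos[of i] by simp
  then show "EI i (\<lambda>x. g i x * (curl p x \<bullet> nv i)) = 0"
   using nrm_Cauchy_Schwarz[OF g f[OF p], of i i] i by (simp add: edge_integral_LINT)
 qed
 assume q: "q \<in> polys (j + 1)"
 show "(\<Sum>i<n. EI i (\<lambda>x. g i x * (curl (\<lambda>x. p x + q x) x \<bullet> nv i))) =
  (\<Sum>i<n. EI i (\<lambda>x. g i x * (curl p x \<bullet> nv i))) + (\<Sum>i<n. EI i (\<lambda>x. g i x * (curl q x \<bullet> nv i)))"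
  unfolding sum.distrib[symmetric]
 proof (rule sum.cong[OF refl])
  fix i assume "i \<in> {..<n}"
  then show "EI i (\<lambda>x. g i x * (curl (\<lambda>x. p x + q x) x \<bullet> nv i)) = EI i (\<lambda>x. g i x * (curl p x \<bullet> nv i)) + EI i (\<lambda>x. g i x * (curl q x \<bullet> nv i))"
   using sqi_mult_int[OF g f[OF p], of i i] sqi_mult_int[OF g f[OF q], of i i]
   by (simp add: curl_linear(1)[OF p q] edge_integral_LINT inner_add_left distrib_left)
 qed
 assume s: "s \<in> polys (j + 1)"
 show "(\<Sum>i<n. EI i (\<lambda>x. (curl (\<lambda>x. p x + q x) x \<bullet> nv i) * (curl s x \<bullet> nv i))) =
  (\<Sum>i<n. EI i (\<lambda>x. (curl p x \<bullet> nv i) * (curl s x \<bullet> nv i))) + (\<Sum>i<n. EI i (\<lambda>x. (curl q x \<bullet> nv i) * (curl s x \<bullet> nv i)))"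
  using sqi_mult_int[OF f[OF p] f[OF s]] sqi_mult_int[OF f[OF q] f[OF s]]
  by (simp add: curl_linear(1)[OF p q] edge_integral_LINT inner_add_left distrib_right distrib_left sum.distrib)
qed

text \<open>Seeking the solution as \<open>s = L u\<close> makes the problem symmetric: by
  \<open>interior_moment\<close> the form becomes the weighted product of \<open>L u\<close> and
  \<open>L t\<close>. It is definite because the weight is positive in \<open>F\<close> and
  \<open>L\<close> is injective.\<close>

lemma interior_solve:
 assumes w: "sqi (leb F) w"
 shows "\<exists>s\<in>polys j. \<forall>t\<in>polys j. (LINT x|leb F. (curl (\<lambda>x. (\<Prod>i<n. ell i x) * s x) x \<bullet> perp (x - b)) * t x) =
 (LINT x|leb F. (w x \<bullet> perp (x - b)) * t x)"
proof -
 let ?M = "leb F"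
 define \<beta> where "\<beta> x = (\<Prod>i<n. ell i x)" for x
 define L where "L t x = 2 * t x + grad t x \<bullet> (x - b)" for t x
 have L: "L t \<in> polys j" if t: "t \<in> polys j" for t
 proof -
  have a: "(\<lambda>x. (x - b) $ i) \<in> polys 1" for i using polys_affine1[of "- b $ i" 1 i] by simp
  have "(\<lambda>x. grad t x $ i * (x - b) $ i) \<in> polys j" for i using polys_mult[OF polys_grad[OF t, of i] a[of i]] by simp
  then show ?thesis unfolding L_def[abs_def] plane_inner by (intro polys_add polys_cmult t)
 qed
 have Ladd: "L (\<lambda>x. p x + q x) = (\<lambda>x. L p x + L q x)" if "p \<in> polys j" "q \<in> polys j" for p q
  using C1_add(2)[OF polys_C1[OF that(1)] polys_C1[OF that(2)]] by (simp add: L_def fun_eq_iff inner_add_left)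
 have Lcm: "L (\<lambda>x. a * p x) = (\<lambda>x. a * L p x)" if "p \<in> polys j" for p a
  using C1_cmult(2)[OF polys_C1[OF that], of a] by (simp add: L_def fun_eq_iff distrib_left)
 have bC: "continuous_on S \<beta>" for S unfolding \<beta>_def[abs_def] by (intro C1_continuous polys_C1[OF prod_ell_polys])
 have LC: "continuous_on S (L t)" if "t \<in> polys j" for t S by (intro C1_continuous polys_C1[OF L[OF that]])
 have tC: "continuous_on S t" if "t \<in> polys j" for t S by (intro C1_continuous polys_C1[OF that])
 have I: "integrable ?M (\<lambda>x. \<beta> x * L s x * L t x)" if "s \<in> polys j" "t \<in> polys j" for s t
  by (intro integrable_C1 continuous_intros bC LC that)
 have bp: "\<beta> x > 0" if "x \<in> F" for x unfolding \<beta>_def by (intro prod_pos ell_pos that)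
 have "\<exists>u\<in>polys j. \<forall>t\<in>polys j. (LINT x|?M. \<beta> x * L u x * L t x) = (LINT x|?M. (w x \<bullet> perp (x - b)) * t x)"
 proof (rule riesz_polys)
  fix p q s :: "plane => real" and a :: real
  assume p: "p \<in> polys j"
  show "(LINT x|?M. \<beta> x * L (\<lambda>x. a * p x) x * L s x) = a * (LINT x|?M. \<beta> x * L p x * L s x)" by (simp add: Lcm[OF p] mult_ac)
  show "(LINT x|?M. (w x \<bullet> perp (x - b)) * (a * p x)) = a * (LINT x|?M. (w x \<bullet> perp (x - b)) * p x)" by (simp add: mult.left_commute)
  show "(LINT x|?M. \<beta> x * L p x * L q x) = (LINT x|?M. \<beta> x * L q x * L p x)" by (simp add: mult_ac)
  have nn: "0 \<le> \<beta> x * L p x * L p x" if "x \<in> F" for x using bp[OF that] by (simp add: mult.assoc)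
  show "0 \<le> (LINT x|?M. \<beta> x * L p x * L p x)" using nn by (intro LINT_nonneg) (auto simp: space_restrict_space)
  show "(LINT x|?M. (w x \<bullet> perp (x - b)) * p x) = 0" if z: "(LINT x|?M. \<beta> x * L p x * L p x) = 0"
  proof -
   have "AE x in ?M. 0 \<le> \<beta> x * L p x * L p x" using nn by (intro AE_I2) (simp add: space_restrict_space)
   then have ae: "AE x in ?M. \<beta> x * L p x * L p x = 0" using z integral_nonneg_eq_0_iff_AE[OF I[OF p p]] by simp
   have "\<beta> x * L p x * L p x = 0" if "x \<in> F" for x by (rule continuous_AE_zero[OF _ open_domain ae that]) (intro continuous_intros bC LC p)
   then have "L p x = 0" if "x \<in> F" for x using bp[OF that] that by fastforce
   then have "L p = (\<lambda>x. 0)" by (rule poly_zero_F[OF L[OF p]])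
   then have "2 * p x + grad p x \<bullet> (x - b) = 0" for x unfolding L_def by (rule fun_cong)
   then have "p x = 0" for x by (rule radial_injective[OF polys_C1[OF p]])
   then show ?thesis by simp
  qed
  assume q: "q \<in> polys j"
  show "(LINT x|?M. (w x \<bullet> perp (x - b)) * (p x + q x)) = (LINT x|?M. (w x \<bullet> perp (x - b)) * p x) + (LINT x|?M. (w x \<bullet> perp (x - b)) * q x)"
   using moment_integrable[OF w tC[OF p]] moment_integrable[OF w tC[OF q]] by (simp add: distrib_left)
  assume s: "s \<in> polys j"
  show "(LINT x|?M. \<beta> x * L (\<lambda>x. p x + q x) x * L s x) = (LINT x|?M. \<beta> x * L p x * L s x) + (LINT x|?M. \<beta> x * L q x * L s x)"
   using I[OF p s] I[OF q s] by (simp add: Ladd[OF p q] distrib_left distrib_right)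
 qed
 then obtain u where u: "u \<in> polys j" "\<And>t. t \<in> polys j ==> (LINT x|?M. \<beta> x * L u x * L t x) = (LINT x|?M. (w x \<bullet> perp (x - b)) * t x)"
  by blast
 show ?thesis
 proof (intro bexI[OF _ L[OF u(1)]] ballI)
  fix t assume t: "t \<in> polys j"
  show "(LINT x|?M. (curl (\<lambda>x. (\<Prod>i<n. ell i x) * L u x) x \<bullet> perp (x - b)) * t x) = (LINT x|?M. (w x \<bullet> perp (x - b)) * t x)"
   using interior_moment[OF L[OF u(1)] t _ L[OF t], of b] u(2)[OF t] by (simp add: L_def \<beta>_def)
 qed
qed

text \<open>Three parts that do not disturb each other: \<open>q1\<close> matches the divergence,
  \<open>curl p0\<close> the boundary conditions, \<open>curl f\<close> the interior moments. Curls
  have no divergence, and \<open>f\<close> vanishes on the boundary, so its curl has no normal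
  component there.\<close>

lemma ser_exists:
 assumes v: "sqi (leb F) v" and g: "\<And>i. i < n ==> sqi M01 (\<lambda>t. g i (edp i t))" and d: "d \<in> polys (int k - 1)"
 shows "\<exists>q. ser k b v g d q"
proof -
 let ?M = "leb F"
 obtain dt where dt: "dt \<in> polys (int k - 1)" "\<And>x. 2 * dt x + grad dt x \<bullet> (x - b) = d x" using radial_inverse[OF d, of b] by blast
 define q1 where "q1 x = dt x *\<^sub>R (x - b)" for x
 have q1: "q1 \<in> vec_polys (int k)" "\<And>x. dv q1 x = d x" unfolding q1_def[abs_def] by (rule radial_field[OF d dt])+
 have g1: "sqi M01 (\<lambda>t. g i (edp i t) - q1 (edp i t) \<bullet> nv i)" if "i < n" for i by (intro sqi_diff g that sqi_normal[OF q1(1)])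
 obtain p0 where p0: "p0 \<in> polys (int k + 1)" and ls: "\<And>p. p \<in> polys (int k + 1) ==>
  (\<Sum>i<n. EI i (\<lambda>x. (curl p0 x \<bullet> nv i) * (curl p x \<bullet> nv i))) = (\<Sum>i<n. EI i (\<lambda>x. (g i x - q1 x \<bullet> nv i) * (curl p x \<bullet> nv i)))"
  using boundary_least_squares[of "\<lambda>i x. g i x - q1 x \<bullet> nv i" "int k"] g1 by meson
 have c0: "curl p0 \<in> vec_polys (int k)" by (rule curl_vec_polys[OF p0])
 define w where "w x = v x - q1 x - curl p0 x" for x
 have w: "sqi ?M w" unfolding w_def[abs_def] by (intro sqi_diff v sqi_C1 vec_polys_continuous[OF q1(1)] vec_polys_continuous[OF c0])
 obtain s where s: "s \<in> polys (int k + 1 - int n)" and sm: "\<And>t. t \<in> polys (int k + 1 - int n) ==>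
  (LINT x|?M. (curl (\<lambda>x. (\<Prod>i<n. ell i x) * s x) x \<bullet> perp (x - b)) * t x) = (LINT x|?M. (w x \<bullet> perp (x - b)) * t x)"
  using interior_solve[OF w, of "int k + 1 - int n" b] by blast
 define f where "f x = (\<Prod>i<n. ell i x) * s x" for x
 have f: "f \<in> polys (int k + 1)" unfolding f_def[abs_def] using polys_mult[OF prod_ell_polys[of n] s] by simp
 have cf: "curl f \<in> vec_polys (int k)" by (rule curl_vec_polys[OF f])
 define q where "q x = q1 x + (curl p0 x + curl f x)" for x
 have q: "q \<in> vec_polys (int k)" unfolding q_def[abs_def] by (intro vec_polys_add q1 c0 cf)
 have fz: "f (edp i t) = 0" if "i < n" for i t unfolding f_def using that by (subst prod_zero) (auto intro!: bexI[of _ i] simp: ell_edge)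
 have fn: "curl f (edp i t) \<bullet> nv i = 0" if "i < n" for i t by (rule curl_nv_zero[OF polys_C1[OF f] fz[OF that]])
 have "ser k b v g d q" unfolding ser_def
 proof (intro conjI ballI allI)
  show "q \<in> vec_polys (int k)" by (rule q)
  show "dv q x = d x" for x
   unfolding q_def dv_add(1)[OF q1(1) vec_polys_add[OF c0 cf]] dv_add(1)[OF c0 cf] by (simp add: q1(2) dv_curl[OF p0] dv_curl[OF f])
 next
  fix p assume p: "p \<in> polys (int k + 1)"
  have e: "EI i (\<lambda>x. (g i x - q x \<bullet> nv i) * (curl p x \<bullet> nv i)) =
   EI i (\<lambda>x. (g i x - q1 x \<bullet> nv i) * (curl p x \<bullet> nv i)) - EI i (\<lambda>x. (curl p0 x \<bullet> nv i) * (curl p x \<bullet> nv i))"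
   if i: "i < n" for i
   using edge_integral_diff[OF g1[OF i] sqi_normal[OF c0] sqi_normal[OF curl_vec_polys[OF p]]]
   by (simp add: edge_integral_LINT q_def inner_add_left fn[OF i] diff_diff_eq)
  show "(\<Sum>i<n. EI i (\<lambda>x. (g i x - q x \<bullet> nv i) * (curl p x \<bullet> nv i))) = 0" using ls[OF p] by (simp add: e sum_subtractf)
 next
  fix t assume t: "t \<in> polys (int k + 1 - int n)"
  have tC: "cont t" by (intro C1_continuous polys_C1[OF t])
  note I = moment_integrable[OF w tC, of b] moment_integrable[OF sqi_C1[OF vec_polys_continuous[OF cf]] tC, of b]
  have "(LINT x|?M. ((v x - q x) \<bullet> perp (x - b)) * t x) = (LINT x|?M. (w x \<bullet> perp (x - b)) * t x - (curl f x \<bullet> perp (x - b)) * t x)"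
   by (simp add: q_def w_def inner_add_left inner_diff_left algebra_simps)
  then show "(LINT x|?M. ((v x - q x) \<bullet> perp (x - b)) * t x) = 0" unfolding LINT_diff[OF I] using sm[OF t] by (simp add: f_def[abs_def])
 qed
 then show ?thesis by blast
qed

end

section \<open>From the weak definition to conditions on polynomials\<close>

context convex_polygon
begin

lemma edge_integral_AE:
 assumes "sqi M01 (\<lambda>t. g (edp i t))" "sqi M01 (\<lambda>t. g' (edp i t))" "AE t in M01. g (edp i t) = g' (edp i t)"
 and f: "cont f"
 shows "EI i (\<lambda>x. g x * f x) = EI i (\<lambda>x. g' x * f x)"
proof -
 note I = sqi_mult_int[OF assms(1) sqi_edge[OF f, of i]] sqi_mult_int[OF assms(2) sqi_edge[OF f, of i]]
 have "(LINT t|M01. g (edp i t) * f (edp i t)) = (LINT t|M01. g' (edp i t) * f (edp i t))"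
  using assms(3) by (intro integral_cong_AE borel_measurable_integrable I) (auto elim: eventually_mono)
 then show ?thesis by (simp add: edge_integral_LINT)
qed

text \<open>\<open>weak_div\<close> and \<open>normal_trace\<close> of \<open>v - q\<close> are
  chosen anew and need not be differences of earlier choices. Uniqueness almost everywhere makes
  them interchangeable with \<open>d - dv q\<close> and \<open>g i - q \<bullet> nv i\<close> under
  integrals.\<close>

lemma residual_field:
 assumes v: "sqi (leb F) v" and d: "has_weak_div F v d" and g: "has_normal_trace vs v g" and q: "q \<in> vec_polys k"
 shows "AE x in leb F. weak_div F (\<lambda>x. v x - q x) x = d x - dv q x"
 and "sqi (leb F) (weak_div F (\<lambda>x. v x - q x))"
 and "\<And>i f. i < n ==> cont f ==>
 EI i (\<lambda>x. normal_trace vs (\<lambda>x. v x - q x) i x * f x) = EI i (\<lambda>x. (g i x - q x \<bullet> nv i) * f x)"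
 and "(\<Sum>i<n. EI i (\<lambda>x. g i x - q x \<bullet> nv i)) = (LINT x|leb F. d x - dv q x)"
proof -
 let ?M = "leb F" and ?w = "\<lambda>x. v x - q x" and ?g = "\<lambda>i x. g i x - q x \<bullet> nv i"
 have ds: "sqi ?M d" using d by (simp add: has_weak_div_def square_integrable_sqi)
 have qs: "sqi ?M q" by (intro sqi_C1 vec_polys_continuous[OF q])
 have dvC: "cont (dv q)" by (intro C1_continuous polys_C1[OF dv_polys[OF q]])
 have dvs: "sqi ?M (dv q)" by (rule sqi_C1[OF dvC])
 have es: "sqi ?M (\<lambda>x. d x - dv q x)" by (rule sqi_diff[OF ds dvs])
 have gs: "sqi M01 (\<lambda>t. g i (edp i t))" if "i < n" for i using g that by (simp add: has_normal_trace_def square_integrable_edge_sqi)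
 have split: "(LINT x|?M. ?w x \<bullet> grad \<phi> x) = (LINT x|?M. v x \<bullet> grad \<phi> x) - (LINT x|?M. q x \<bullet> grad \<phi> x)"
  "(LINT x|?M. (d x - dv q x) * \<phi> x) = (LINT x|?M. d x * \<phi> x) - (LINT x|?M. dv q x * \<phi> x)" if C: "C1 \<phi>" for \<phi>
 proof -
  have s: "sqi ?M (grad \<phi>)" "sqi ?M \<phi>" by (intro sqi_C1 C1_grad_continuous C1_continuous C)+
  show "(LINT x|?M. ?w x \<bullet> grad \<phi> x) = (LINT x|?M. v x \<bullet> grad \<phi> x) - (LINT x|?M. q x \<bullet> grad \<phi> x)"
   using sqi_inner[OF v s(1)] sqi_inner[OF qs s(1)] by (simp add: inner_diff_left)
  show "(LINT x|?M. (d x - dv q x) * \<phi> x) = (LINT x|?M. d x * \<phi> x) - (LINT x|?M. dv q x * \<phi> x)"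
   using sqi_inner[OF ds s(2)] sqi_inner[OF dvs s(2)] by (simp add: left_diff_distrib)
 qed
 have wd: "has_weak_div F ?w (\<lambda>x. d x - dv q x)" unfolding has_weak_div_def square_integrable_sqi
 proof (intro conjI allI impI es)
  fix \<phi> assume s: "C1_compact_support F \<phi>"
  then have C: "C1 \<phi>" by (simp add: C1_compact_support_def)
  have "(LINT x|?M. q x \<bullet> grad \<phi> x) + (LINT x|?M. dv q x * \<phi> x) = 0" unfolding field_green[OF q C]
  proof (rule sum.neutral, rule ballI)
   fix i assume "i \<in> {..<n}"
   then have "(LINT t|M01. (q (edp i t) \<bullet> nv i) * \<phi> (edp i t)) = (LINT t|M01. 0)"
    by (intro LINT_cong) (auto simp: space_restrict_space compact_support_boundary[OF s edge_pt_in_boundary])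
   then show "EI i (\<lambda>x. (q x \<bullet> nv i) * \<phi> x) = 0" by (simp add: edge_integral_LINT)
  qed
  then show "(LINT x|?M. (d x - dv q x) * \<phi> x) = - (LINT x|?M. ?w x \<bullet> grad \<phi> x)"
   using d s unfolding split[OF C] by (simp add: has_weak_div_def)
 qed
 note W = weak_div_AE[OF wd] and V = weak_div_AE[OF d]
 show "AE x in ?M. weak_div F ?w x = d x - dv q x" "sqi ?M (weak_div F ?w)" by (rule W)+
 have AEint: "(LINT x|?M. e x * \<phi> x) = (LINT x|?M. e' x * \<phi> x)"
  if "sqi ?M e" "sqi ?M e'" "AE x in ?M. e x = e' x" "C1 \<phi>" for e e' \<phi> :: "plane => real"
 proof -
  have s: "sqi ?M \<phi>" by (intro sqi_C1 C1_continuous that)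
  show ?thesis using that(3) sqi_inner[OF that(1) s] sqi_inner[OF that(2) s]
   by (intro integral_cong_AE) (auto elim: eventually_mono intro: borel_measurable_integrable)
 qed
 have green: "(LINT x|?M. v x \<bullet> grad \<phi> x) + (LINT x|?M. d x * \<phi> x) - ((LINT x|?M. q x \<bullet> grad \<phi> x) + (LINT x|?M. dv q x * \<phi> x))
  = (\<Sum>i<n. EI i (\<lambda>x. ?g i x * \<phi> x))" if C: "C1 \<phi>" for \<phi>
 proof -
  have e: "EI i (\<lambda>x. ?g i x * \<phi> x) = EI i (\<lambda>x. g i x * \<phi> x) - EI i (\<lambda>x. (q x \<bullet> nv i) * \<phi> x)" if "i < n" for i
   by (rule edge_integral_diff[OF gs[OF that] sqi_normal[OF q] sqi_edge[OF C1_continuous[OF C]]])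
  have "(LINT x|?M. v x \<bullet> grad \<phi> x) + (LINT x|?M. d x * \<phi> x) = (\<Sum>i<n. EI i (\<lambda>x. g i x * \<phi> x))"
   using has_normal_traceD[OF g C] AEint[OF V(2) ds V(3) C] by simp
  then show ?thesis unfolding field_green[OF q C] by (simp add: e sum_subtractf)
 qed
 have tr: "has_normal_trace vs ?w ?g" unfolding has_normal_trace_def
 proof (intro conjI allI impI)
  show "square_integrable_edge vs i (?g i)" if "i < n" for i unfolding square_integrable_edge_sqi by (intro sqi_diff gs that sqi_normal[OF q])
  fix \<phi> assume C: "C1 \<phi>"
  show "(LINT x|?M. ?w x \<bullet> grad \<phi> x) + (LINT x|?M. weak_div F ?w x * \<phi> x) = (\<Sum>i<n. EI i (\<lambda>x. ?g i x * \<phi> x))"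
   unfolding AEint[OF W(2) es W(3) C] split[OF C] green[OF C, symmetric] by simp
 qed
 have nt: "has_normal_trace vs ?w (normal_trace vs ?w)" unfolding normal_trace_def by (rule someI[where P="has_normal_trace vs ?w", OF tr])
 show "EI i (\<lambda>x. normal_trace vs ?w i x * f x) = EI i (\<lambda>x. ?g i x * f x)"
  if "i < n" "cont f" for i f
  using nt tr that normal_trace_unique[OF nt tr that(1)] by (intro edge_integral_AE) (auto simp: has_normal_trace_def square_integrable_edge_sqi)
 show "(\<Sum>i<n. EI i (?g i)) = (LINT x|?M. d x - dv q x)" using green[OF C1_const(1), of 1] split(2)[OF C1_const(1), of 1] C1_const(2)[of 1] by simp
qed

text \<open>For either normalisation \<open>e\<close> minus a constant is an admissible test
  polynomial, and the constant is harmless as \<open>e\<close> has zero mean over \<open>F\<close>.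
  For \<open>k = 1\<close> there are no tests, but then \<open>e\<close> is itself constant.\<close>

lemma mean_zero_residual:
 assumes e: "e \<in> polys (int k - 1)" and k: "k \<ge> 1" and m: "(LINT x|leb F. e x) = 0"
 and o: "\<And>p. k > 1 ==> p \<in> zero_mean_polys bd vs (int k - 1) ==> (LINT x|leb F. e x * p x) = 0"
 shows "e x = 0"
proof -
 let ?M = "leb F"
 have eC: "continuous_on S e" for S by (intro C1_continuous polys_C1[OF e])
 have ei: "integrable ?M e" by (rule integrable_C1[OF eC])
 have "(LINT x|?M. e x * e x) = 0"
 proof (cases "k > 1")
  case False
  then have "int k - 1 = 0" using k by simp
  with e have "e \<in> polys 0" by (simp only:)
  then obtain c where "e = (\<lambda>x. \<Sum>a\<in>idx 0. c a * mon a x)" by (rule polysE)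
  moreover have "idx 0 = {(0, 0)}" by (auto simp: idx_def)
  ultimately have ec: "e = (\<lambda>x. c (0, 0))" by (simp add: mon_def)
  then have "(LINT x|?M. e x * e x) = c (0, 0) * (LINT x|?M. e x)" by simp
  then show ?thesis by (simp only: m mult_zero_right)
 next
  case True
  define L where "L = (\<Sum>i<n. len i)"
  have "L > 0" unfolding L_def using vs_ne by (intro sum_pos edge_length_pos) auto
  define \<mu> where "\<mu> = (if bd then (\<Sum>i<n. EI i e) / L else 0)"
  have "EI i (\<lambda>x. e x - \<mu>) = EI i e - \<mu> * len i" for i
  proof -
   have "integrable M01 (\<lambda>t. e (edp i t))" by (rule continuous_integrable_on[OF continuous_edge[OF eC]]) auto
   then show ?thesis by (simp add: edge_integral_LINT measure_restrict_space right_diff_distrib)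
  qed
  then have "(\<Sum>i<n. EI i (\<lambda>x. e x - \<mu>)) = (\<Sum>i<n. EI i e) - \<mu> * L" by (simp add: sum_subtractf L_def sum_distrib_left)
  moreover have "(\<lambda>x. e x - \<mu>) \<in> polys (int k - 1)" using k by (intro polys_diff e polys_const) simp
  ultimately have "(\<lambda>x. e x - \<mu>) \<in> zero_mean_polys bd vs (int k - 1)"
   using \<open>L > 0\<close> m by (auto simp: zero_mean_polys_def \<mu>_def)
  from o[OF True this] have "(LINT x|?M. e x * e x - \<mu> * e x) = 0" by (simp add: algebra_simps)
  moreover have "integrable ?M (\<lambda>x. e x * e x)" by (intro integrable_C1 continuous_intros eC)
  ultimately show ?thesis using ei m by simp
 qed
 then have "nrm ?M e = 0" by (simp add: nrm_def power2_eq_square)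
 then have ae: "AE x in ?M. e x = 0" by (rule nrm_zero_AE[OF sqi_C1[OF eC]])
 have "e = (\<lambda>x. 0)" by (rule poly_zero_F[OF e continuous_AE_zero[OF eC open_domain ae]])
 then show ?thesis by simp
qed

text \<open>By Green's formula the total normal trace of \<open>v - q\<close> is the integral of its
  divergence; with the zero-mean tests this says that the divergences agree. The other conditions
  carry over term by term.\<close>

lemma serendipity_characterization:
 assumes v: "sqi (leb F) v" and d: "has_weak_div F v d" "d \<in> polys (int k - 1)" and g: "has_normal_trace vs v g" and k: "k \<ge> 1"
 shows "is_serendipity_projection k bd vs v q \<longleftrightarrow> ser k (barycenter F) v g d q"
proof (cases "q \<in> vec_polys (int k)")
 case q: True
 let ?M = "leb F" and ?w = "\<lambda>x. v x - q x"
 note R = residual_field[OF v d(1) g q]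
 have e: "(\<lambda>x. d x - dv q x) \<in> polys (int k - 1)" using d(2) dv_polys[OF q] by (rule polys_diff)
 have a: "(\<Sum>i<n. EI i (\<lambda>x. normal_trace vs ?w i x * (curl p x \<bullet> outer_normal vs i))) =
  (\<Sum>i<n. EI i (\<lambda>x. (g i x - q x \<bullet> nv i) * (curl p x \<bullet> nv i)))" if "p \<in> polys (int k + 1)" for p
  by (intro sum.cong refl) (simp add: outer_normal_eq R(3) continuous_intros C1_curl_continuous polys_C1[OF that])
 have b: "(\<Sum>i<n. EI i (normal_trace vs ?w i)) = (LINT x|?M. d x - dv q x)"
  unfolding R(4)[symmetric] using R(3)[of _ "\<lambda>x. 1"] by (intro sum.cong refl) simp
 have c: "(LINT x|?M. weak_div F ?w x * p x) = (LINT x|?M. (d x - dv q x) * p x)" if "p \<in> polys (int k - 1)" for p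
 proof -
  note s = polys_sqi[OF that] polys_sqi[OF e]
  show ?thesis using R(1) sqi_inner[OF R(2) s(1)] sqi_inner[OF s(2,1)]
   by (intro integral_cong_AE) (auto elim: eventually_mono intro: borel_measurable_integrable)
 qed
 have beta: "beta k vs = int k + 1 - int n" by (simp add: beta_def eta_eq)
 \<comment> \<open>For negative \<open>beta\<close> the quantifier on the right ranges over the zero
   polynomial only, so both sides hold.\<close>
 have dd: "(beta k vs \<ge> 0 --> (\<forall>p\<in>polys (beta k vs). (LINT x|?M. (?w x \<bullet> x_perp vs x) * p x) = 0)) \<longleftrightarrow>
  (\<forall>p\<in>polys (int k + 1 - int n). (LINT x|?M. ((v x - q x) \<bullet> perp (x - barycenter F)) * p x) = 0)"
  unfolding beta x_perp_def using polys_negative[of "int k + 1 - int n"] by (cases "int k + 1 - int n \<ge> 0") auto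
 have bc: "(LINT x|?M. d x - dv q x) = 0 \<and> (k > 1 --> (\<forall>p\<in>zero_mean_polys bd vs (int k - 1). (LINT x|?M. weak_div F ?w x * p x) = 0))
  \<longleftrightarrow> (\<forall>x. dv q x = d x)" (is "?l \<longleftrightarrow> ?r")
 proof
  assume l: ?l
  have "d x - dv q x = 0" for x
  proof (rule mean_zero_residual[OF e k, of bd])
   fix p assume "k > 1" "p \<in> zero_mean_polys bd vs (int k - 1)"
   then show "(LINT x|?M. (d x - dv q x) * p x) = 0" using l c[of p] by (simp add: zero_mean_polys_def)
  qed (use l in blast)
  then show ?r by simp
 next
  assume ?r
  then show ?l using c by (simp add: zero_mean_polys_def)
 qed
 show ?thesis unfolding is_serendipity_projection_def ser_def Let_def dd b using a bc q by auto
qed (simp add: is_serendipity_projection_def ser_def Let_def)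

end

context serendipity_polygon
begin

lemma serendipity_projection_ser:
 assumes v: "sqi (leb F) v" and d: "has_weak_div F v d" "d \<in> polys (int k - 1)" and g: "has_normal_trace vs v g" and k: "k \<ge> 1"
 shows "ser k (barycenter F) v g d (serendipity_projection k bd vs v)"
proof -
 have gs: "sqi M01 (\<lambda>t. g i (edp i t))" if "i < n" for i using g that by (simp add: has_normal_trace_def square_integrable_edge_sqi)
 have "\<exists>!q. ser k (barycenter F) v g d q" using ser_exists[OF v gs d(2), of "barycenter F"] ser_unique[OF v gs barycenter_near] by blast
 then show ?thesis unfolding serendipity_projection_def serendipity_characterization[OF v d g k] by (rule theI')
qed

text \<open>\<open>4 * IC\<close> bounds the radial comparison field. In the bracket,
  \<open>2 + 8 * IC\<close> is twice the bound for its L2 distance from \<open>v\<close>, and the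
  root bounds the distance in the normal traces.\<close>

definition SB :: real where "SB = 4 * IC + \<bar>stab\<bar> * (2 + 8 * IC + sqrt (2 * UB + 8 * real NN * IC^2))"

lemma UB_nonneg: "0 \<le> UB" using rho by (simp add: UB_def)

text \<open>The comparison field is the radial one with the divergence of \<open>v\<close>: the
  inverse estimate for the divergence controls its size, and \<open>upper_bound\<close> its misfit
  in the traces.\<close>

lemma serendipity_projection_bound:
 assumes v: "v \<in> face_space k vs" and k: "k \<ge> 1"
 shows "nrm (leb F) (serendipity_projection k bd vs v) \<le> SB * nrm (leb F) v"
proof -
 let ?M = "leb F" and ?q = "serendipity_projection k bd vs v"
 define V where "V = nrm ?M v"
 have V0: "0 \<le> V" by (simp add: V_def)
 note vs' = face_spaceD(1)[OF v]
 obtain d where d: "d \<in> polys (int k - 1)" "has_weak_div F v d" using v by (auto simp: face_space_def)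
 define g where "g = normal_trace vs v"
 have g: "has_normal_trace vs v g" unfolding g_def by (rule face_spaceD(2)[OF v])
 have gs: "sqi M01 (\<lambda>t. g i (edp i t))" if "i < n" for i using g that by (simp add: has_normal_trace_def square_integrable_edge_sqi)
 note ser = serendipity_projection_ser[OF vs' d(2,1) g k, of bd]
 let ?b = "barycenter F"
 obtain dt where dt: "dt \<in> polys (int k - 1)" "\<And>x. 2 * dt x + grad dt x \<bullet> (x - ?b) = d x"
  and db: "\<And>x M. (\<And>t. 0 \<le> t ==> t \<le> 1 ==> \<bar>d (?b + t *\<^sub>R (x - ?b))\<bar> \<le> M) ==> \<bar>dt x\<bar> \<le> M"
  using radial_inverse[OF d(1), of ?b] by meson
 define q1 where "q1 x = dt x *\<^sub>R (x - ?b)" for x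
 have q1: "q1 \<in> vec_polys (int k)" "\<And>x. dv q1 x = d x" unfolding q1_def[abs_def] by (rule radial_field[OF d(1) dt])+
 have q1s: "sqi ?M q1" by (intro sqi_C1 vec_polys_continuous[OF q1(1)])
 have q1b: "norm (q1 x) \<le> 2 * IC / h * V" if x: "x \<in> closure F" for x
 proof -
  have "\<bar>dt x\<bar> \<le> IC / h^2 * V" unfolding V_def
   by (rule db, rule div_upper_bound(1)[OF d(1) vs' d(2)], rule near_segment(2)[OF barycenter_near near_c(1)[OF x]])
  moreover have "norm (x - ?b) \<le> 2 * h" by (rule near_segment(1)[OF barycenter_near near_c(1)[OF x]])
  ultimately have "norm (q1 x) \<le> (IC / h^2 * V) * (2 * h)" unfolding q1_def norm_scaleR real_norm_def using IC_pos V0 by (intro mult_mono) auto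
  then show ?thesis using h_pos by (simp add: power2_eq_square mult_ac)
 qed
 have M0: "0 \<le> 2 * IC / h * V" using IC_pos h_pos V0 by simp
 have nq1: "nrm ?M q1 \<le> 4 * IC * V" using nrm_le_sup_h(2)[OF cont_measurable[OF vec_polys_continuous[OF q1(1)]] M0] q1b F_sub_closure h_pos by auto
 define E where "E = (2 + 8 * IC + sqrt (2 * UB + 8 * real NN * IC^2)) * V"
 have s0: "0 \<le> 2 * UB + 8 * real NN * IC^2" using UB_nonneg by simp
 have E0: "0 \<le> E" using IC_pos V0 s0 by (simp add: E_def)
 have E1: "2 * nrm ?M (\<lambda>x. v x - q1 x) \<le> E"
 proof -
  have "nrm ?M (\<lambda>x. v x - q1 x) \<le> V + 4 * IC * V" using nrm_diff_triangle[OF vs' q1s] nq1 by (simp add: V_def)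
  moreover have "0 \<le> sqrt (2 * UB + 8 * real NN * IC^2) * V" using s0 V0 by simp
  ultimately show ?thesis unfolding E_def distrib_right by linarith
 qed
 have E2: "h * (\<Sum>i<n. EI i (\<lambda>x. (g i x - q1 x \<bullet> nv i)^2)) \<le> E^2"
 proof -
  have t: "EI i (\<lambda>x. (g i x - q1 x \<bullet> nv i)^2) \<le> 2 * (L2_norm_edge vs i (g i))^2 + h * (2 * (2 * IC / h * V)^2)" if i: "i < n" for i
  proof -
   let ?g = "\<lambda>t. g i (edp i t)" and ?f = "\<lambda>t. q1 (edp i t) \<bullet> nv i"
   have fs: "sqi M01 ?f" by (rule sqi_normal[OF q1(1)])
   have "(LINT t|M01. (?g t - ?f t)^2) \<le> (LINT t|M01. 2 * (norm (?g t))^2 + 2 * (2 * IC / h * V)^2)"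
   proof (rule integral_mono)
    show "integrable M01 (\<lambda>t. (?g t - ?f t)^2)" using sqi_int[OF sqi_diff[OF gs[OF i] fs]] by simp
    have "integrable M01 (\<lambda>t. 2 * (2 * IC / h * V)^2)" by (rule continuous_integrable_on) auto
    then show "integrable M01 (\<lambda>t. 2 * (norm (?g t))^2 + 2 * (2 * IC / h * V)^2)"
     by (rule Bochner_Integration.integrable_add[OF integrable_mult_right[OF sqi_int[OF gs[OF i]]]])
    fix t assume "t \<in> space M01"
    then have "edp i t \<in> closure F" using edge_pt_in_boundary[OF i, of t] by (simp add: space_restrict_space closure_F)
    then have "norm (q1 (edp i t)) \<le> 2 * IC / h * V" by (rule q1b)
    moreover have "\<bar>?f t\<bar> \<le> norm (q1 (edp i t))" using Cauchy_Schwarz_ineq2[of "q1 (edp i t)" "nv i"] by (simp add: norm_nv)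
    ultimately have "(?f t)^2 \<le> (2 * IC / h * V)^2" by (intro abs_le_square_iff[THEN iffD1]) linarith
    moreover have "(?g t - ?f t)^2 + (?g t + ?f t)^2 = 2 * (?g t)^2 + 2 * (?f t)^2" by (simp add: power2_eq_square algebra_simps)
    moreover have "0 \<le> (?g t + ?f t)^2" by simp
    ultimately show "(?g t - ?f t)^2 \<le> 2 * (norm (?g t))^2 + 2 * (2 * IC / h * V)^2" by (simp only: real_norm_def power2_abs)
   qed
   also have "\<dots> = 2 * (nrm M01 ?g)^2 + 2 * (2 * IC / h * V)^2" using sqi_int[OF gs[OF i]] by (simp add: nrm_sq measure_restrict_space)
   finally have "EI i (\<lambda>x. (g i x - q1 x \<bullet> nv i)^2) \<le> len i * (2 * (nrm M01 ?g)^2 + 2 * (2 * IC / h * V)^2)"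
    unfolding edge_integral_LINT using edge_length_pos[of i] by (intro mult_left_mono) auto
   also have "\<dots> = 2 * (L2_norm_edge vs i (g i))^2 + len i * (2 * (2 * IC / h * V)^2)" by (simp add: L2_norm_edge_sq algebra_simps)
   also have "\<dots> \<le> 2 * (L2_norm_edge vs i (g i))^2 + h * (2 * (2 * IC / h * V)^2)"
    using edge_length_le[of i] by (intro add_left_mono mult_right_mono) auto
   finally show ?thesis .
  qed
  have "h * (\<Sum>i<n. EI i (\<lambda>x. (g i x - q1 x \<bullet> nv i)^2)) \<le>
   h * (\<Sum>i<n. 2 * (L2_norm_edge vs i (g i))^2 + h * (2 * (2 * IC / h * V)^2))"
   using h_pos by (intro mult_left_mono sum_mono t) auto
  also have "\<dots> = 2 * (h * (\<Sum>i<n. (L2_norm_edge vs i (g i))^2)) + real n * (8 * IC^2 * V^2)"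
  proof -
   have A: "h * (h * (2 * (2 * IC / h * V)^2)) = 8 * IC^2 * V^2" using h_pos by (simp add: power2_eq_square)
   show ?thesis unfolding A[symmetric] sum.distrib sum_distrib_left[symmetric] sum_constant card_lessThan distrib_left by (simp only: mult_ac)
  qed
  also have "\<dots> \<le> 2 * (UB * V^2) + real NN * (8 * IC^2 * V^2)"
  proof (intro add_mono mult_left_mono mult_right_mono)
   have "0 \<le> h^2 * (L2_norm_on F (weak_div F v))^2" by simp
   then show "h * (\<Sum>i<n. (L2_norm_edge vs i (g i))^2) \<le> UB * V^2"
    using upper_bound[OF v] unfolding boundary_div_terms_def g_def V_def h_def by linarith
  qed (use n_le_N in auto)
  also have "\<dots> = (sqrt (2 * UB + 8 * real NN * IC^2) * V)^2" using s0 by (simp add: power_mult_distrib algebra_simps)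
  also have "\<dots> \<le> E^2" unfolding E_def using IC_pos V0 s0 by (intro power_mono mult_right_mono) auto
  finally show ?thesis .
 qed
 have qv: "?q \<in> vec_polys (int k)" using ser by (simp add: ser_def)
 have qs: "sqi ?M ?q" by (intro sqi_C1 vec_polys_continuous[OF qv])
 have "nrm ?M (\<lambda>x. ?q x - q1 x) \<le> stab * E" by (rule ser_bound[OF vs' gs q1 ser barycenter_near E0 E2 E1])
 also have "\<dots> \<le> \<bar>stab\<bar> * E" using E0 by (intro mult_right_mono) auto
 finally have "nrm ?M ?q \<le> \<bar>stab\<bar> * E + 4 * IC * V" using nrm_triangle[OF sqi_diff[OF qs q1s] q1s] nq1 by simp
 then show ?thesis unfolding V_def[symmetric] by (simp add: E_def SB_def algebra_simps)
qed

text \<open>A polynomial of degree \<open>k\<close> splits along the complement \<open>W\<close>: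
  the definition of the projection handles the part of degree \<open>beta\<close>, membership in the
  serendipity space the part in \<open>W\<close>. So the projection has all the moments that
  \<open>lower_bound\<close> requires.\<close>

lemma serendipity_bounds:
 assumes k: "k \<ge> 1" and W: "linear_complement (polys (int k)) (polys (beta k vs)) W" and vW: "v \<in> serendipity_space k bd W vs"
 shows "(nrm (leb F) v)^2 \<le> (2 * LB^2) * (boundary_div_terms vs v + (nrm (leb F) (serendipity_projection k bd vs v))^2)"
 and "boundary_div_terms vs v + (nrm (leb F) (serendipity_projection k bd vs v))^2 \<le> (UB + SB^2) * (nrm (leb F) v)^2"
proof -
 let ?M = "leb F" and ?q = "serendipity_projection k bd vs v" and ?b = "barycenter F"
 have v: "v \<in> face_space k vs" using vW by (simp add: serendipity_space_def)
 note vs' = face_spaceD(1)[OF v]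
 obtain d g where d: "d \<in> polys (int k - 1)" "has_weak_div F v d" and g: "has_normal_trace vs v g" using v by (auto simp: face_space_def)
 note ser = serendipity_projection_ser[OF vs' d(2,1) g k, of bd]
 have qv: "?q \<in> vec_polys (int k)" using ser by (simp add: ser_def)
 have qs: "sqi ?M ?q" by (intro sqi_C1 vec_polys_continuous[OF qv])
 have zero: "(LINT x|?M. ((v x - ?q x) \<bullet> perp (x - ?b)) * p x) = 0" if p: "p \<in> polys (int k)" for p
 proof -
  have "\<forall>p\<in>polys (int k). \<exists>!(a, w). a \<in> polys (beta k vs) \<and> w \<in> W \<and> p = (\<lambda>x. a x + w x)"
   using W unfolding linear_complement_def by (elim conjE)
  from ex1_implies_ex[OF bspec[OF this p]] obtain a w where aw: "a \<in> polys (beta k vs)" "w \<in> W" "p = (\<lambda>x. a x + w x)" by (auto split: prod.splits)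
  have "W \<subseteq> polys (int k)" using W by (simp add: linear_complement_def)
  then have wp: "w \<in> polys (int k)" using aw(2) by blast
  have z: "(LINT x|?M. ((v x - ?q x) \<bullet> perp (x - ?b)) * a x) = 0" using ser aw(1) by (simp add: ser_def beta_def eta_eq)
  have z': "(LINT x|?M. ((v x - ?q x) \<bullet> perp (x - ?b)) * w x) = 0" using vW aw(2) by (simp add: serendipity_space_def x_perp_def)
  have I: "integrable ?M (\<lambda>x. ((v x - ?q x) \<bullet> perp (x - ?b)) * a x)" "integrable ?M (\<lambda>x. ((v x - ?q x) \<bullet> perp (x - ?b)) * w x)"
   by (intro moment_integrable sqi_diff vs' qs C1_continuous polys_C1[OF aw(1)] polys_C1[OF wp])+
  show ?thesis unfolding aw(3) distrib_left LINT_add[OF I] z z' by simp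
 qed
 show "(nrm ?M v)^2 \<le> (2 * LB^2) * (boundary_div_terms vs v + (nrm ?M ?q)^2)"
 proof (rule lower_bound[OF v barycenter_near qs])
  fix p assume p: "p \<in> polys (int k)"
  have s: "sqi ?M (\<lambda>x. p x *\<^sub>R perp (x - ?b))" by (intro sqi_C1 continuous_intros C1_continuous polys_C1[OF p] continuous_perp)
  have "(LINT x|?M. v x \<bullet> (p x *\<^sub>R perp (x - ?b))) - (LINT x|?M. ?q x \<bullet> (p x *\<^sub>R perp (x - ?b))) =
   (LINT x|?M. v x \<bullet> (p x *\<^sub>R perp (x - ?b)) - ?q x \<bullet> (p x *\<^sub>R perp (x - ?b)))"
   by (rule LINT_diff[OF sqi_inner[OF vs' s] sqi_inner[OF qs s], symmetric])
  also have "\<dots> = (LINT x|?M. ((v x - ?q x) \<bullet> perp (x - ?b)) * p x)" by (simp add: inner_diff_left algebra_simps)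
  finally show "(LINT x|?M. v x \<bullet> (p x *\<^sub>R perp (x - ?b))) = (LINT x|?M. ?q x \<bullet> (p x *\<^sub>R perp (x - ?b)))"
   using zero[OF p] by simp
 qed
 have "(nrm ?M ?q)^2 \<le> (SB * nrm ?M v)^2" by (rule power_mono[OF serendipity_projection_bound[OF v k] nrm_nonneg])
 with upper_bound[OF v] show "boundary_div_terms vs v + (nrm ?M ?q)^2 \<le> (UB + SB^2) * (nrm ?M v)^2"
  unfolding distrib_right power_mult_distrib by linarith
qed

end

text \<open>The maximum with 1 guarantees positive constants whatever the signs of \<open>K\<close>
  and \<open>K'\<close>.\<close>

lemma two_sided_bounds:
 fixes a b K K' :: real
 assumes "a \<le> K * b" "b \<le> K' * a" "0 \<le> a" "0 \<le> b"
 shows "1 / max 1 K * a \<le> b \<and> b \<le> max 1 K' * a"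
proof
 have "K * b \<le> max 1 K * b" "K' * a \<le> max 1 K' * a" using assms(3,4) by (intro mult_right_mono; simp)+
 with assms(1,2) have *: "a \<le> max 1 K * b" and "b \<le> max 1 K' * a" by linarith+
 then show "b \<le> max 1 K' * a" by simp
 have "1 / max 1 K * a \<le> 1 / max 1 K * (max 1 K * b)" by (rule mult_left_mono[OF *]) simp
 then show "1 / max 1 K * a \<le> b" by (simp add: max_def)
qed

lemma boundary_div_terms_nonneg: "0 \<le> boundary_div_terms vs v"
 by (auto simp: boundary_div_terms_def diameter_ge_0[OF bounded_domain] intro!: add_nonneg_nonneg mult_nonneg_nonneg sum_nonneg)

theorem mainTheorem10:
  fixes k :: nat and \<rho> \<epsilon>\<^sub>0 :: real
  assumes "k \<ge> 1" and "\<rho> > 0" and "\<epsilon>\<^sub>0 > 0"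
  shows
    "(\<exists>c\<^sub>1>0. \<exists>c\<^sub>2>0. \<forall>vs. mesh_regular \<rho> vs \<longrightarrow>
        (\<forall>v\<in>face_space k vs.
           let F = domain vs;
               N = boundary_div_terms vs v + (L2_norm_on F (L2_projection (k + 1) F v))\<^sup>2
           in c\<^sub>1 * (L2_norm_on F v)\<^sup>2 \<le> N \<and> N \<le> c\<^sub>2 * (L2_norm_on F v)\<^sup>2)) \<and>
     (\<exists>c\<^sub>1>0. \<exists>c\<^sub>2>0. \<forall>vs. mesh_regular \<rho> vs \<and> uniformly_convex \<epsilon>\<^sub>0 vs \<longrightarrow>
        (\<forall>bd W. linear_complement (polys (int k)) (polys (beta k vs)) W \<longrightarrow>
           (\<forall>v\<in>serendipity_space k bd W vs.
              let F = domain vs;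
                  N = boundary_div_terms vs v
                      + (L2_norm_on F (serendipity_projection k bd vs v))\<^sup>2
              in c\<^sub>1 * (L2_norm_on F v)\<^sup>2 \<le> N \<and> N \<le> c\<^sub>2 * (L2_norm_on F v)\<^sup>2)))"
proof -
 \<comment> \<open>Chosen before any polygon is considered; the locale constants below are functions
   of \<open>\<rho>\<close>, \<open>\<sigma>\<close>, \<open>C\<close> and \<open>G\<close>
   alone.\<close>
 obtain C G where CG: "\<And>vs c r. regular_polygon vs c r \<rho> ==> polygon_constants vs c r \<rho> k C G" using polygon_constants_exist by blast
 define \<sigma> where "\<sigma> = sin (min \<epsilon>\<^sub>0 (pi/2))"
 let ?L = "1 / max 1 (2 * (polygon_constants.LB \<rho> G)^2)" and ?U = "polygon_constants.UB \<rho> C G"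
 have i: "?L * (L2_norm_on (domain vs) v)^2 \<le> boundary_div_terms vs v + (L2_norm_on (domain vs) (L2_projection (k + 1) (domain vs) v))^2 \<and>
  boundary_div_terms vs v + (L2_norm_on (domain vs) (L2_projection (k + 1) (domain vs) v))^2 \<le> max 1 (?U + 1) * (L2_norm_on (domain vs) v)^2"
  if m: "mesh_regular \<rho> vs" and v: "v \<in> face_space k vs" for vs v
  using m assms(2)
 proof (cases rule: mesh_regular_cases)
  case 1
  then show ?thesis unfolding empty_domain_trivial[OF 1] by simp
 next
  case (2 c r)
  interpret polygon_constants vs c r \<rho> k C G by (rule CG[OF 2])
  show ?thesis unfolding L2_norm_on_nrm by (intro two_sided_bounds projection_bounds v add_nonneg_nonneg boundary_div_terms_nonneg zero_le_power2)
 qed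
 let ?S = "serendipity_polygon.SB \<rho> \<sigma> C G"
 have ii: "?L * (L2_norm_on (domain vs) v)^2 \<le> boundary_div_terms vs v + (L2_norm_on (domain vs) (serendipity_projection k bd vs v))^2 \<and>
  boundary_div_terms vs v + (L2_norm_on (domain vs) (serendipity_projection k bd vs v))^2 \<le> max 1 (?U + ?S^2) * (L2_norm_on (domain vs) v)^2"
  if m: "mesh_regular \<rho> vs" and u: "uniformly_convex \<epsilon>\<^sub>0 vs" and W: "linear_complement (polys (int k)) (polys (beta k vs)) W"
  and v: "v \<in> serendipity_space k bd W vs" for vs v bd W
  using m assms(2)
 proof (cases rule: mesh_regular_cases)
  case 1
  then show ?thesis unfolding empty_domain_trivial[OF 1] by simp
 next
  case (2 c r)
  interpret convex_polygon vs c r \<rho> \<sigma> unfolding \<sigma>_def by (rule uniformly_convex_polygon[OF 2 assms(3) u])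
  interpret polygon_constants vs c r \<rho> k C G by (rule CG[OF 2])
  interpret serendipity_polygon vs c r \<rho> \<sigma> k C G by unfold_locales
  show ?thesis unfolding L2_norm_on_nrm
   by (intro two_sided_bounds serendipity_bounds[OF assms(1) W v] add_nonneg_nonneg boundary_div_terms_nonneg zero_le_power2)
 qed
 show ?thesis unfolding Let_def using i ii by (intro conjI exI[of _ ?L] exI[of _ "max 1 (?U + 1)"] exI[of _ "max 1 (?U + ?S^2)"]) auto
qed

end
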